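(* Let $\hbar,c,m,\beta>0$ and $\gamma\geqslant 0$. If $$\gamma\leqslant\gamma_{\rm c}^{\mathcal S}:=\hbar c\beta ,$$ then the quadratic form $$\langle\psi,\boldsymbol{\mathcal B}_{\rm FW}\psi\rangle=\Bigl\langle\psi,\sqrt{-\hbar^2c^2\Delta+m^2c^4}\,\psi\Bigr\rangle-\gamma\,\langle\psi,K_0(\beta|\boldsymbol x|)\psi\rangle ,\qquad \psi\in H^{1/2}(\mathbb R^2;\mathbb C),$$ is bounded from below; more precisely, $\langle\psi,\boldsymbol{\mathcal B}_{\rm FW}\psi\rangle\geqslant 0$ for all $\psi\in H^{1/2}(\mathbb R^2;\mathbb C)$.
   Context: $K_0$ is the modified Bessel function of the second kind (Bessel-Macdonald function) of order $0$. The Fourier transform is $\widehat\psi(\boldsymbol p)=\int_{\mathbb R^2}e^{i\hbar^{-1}\boldsymbol p\cdot\boldsymbol x}\psi(\boldsymbol x)\,d\boldsymbol x$. The form of $\sqrt{-\hbar^2c^2\Delta+m^2c^4}$ is $\langle\psi,\sqrt{-\hbar^2c^2\Delta+m^2c^4}\,\psi\rangle=(2\pi\hbar)^{-2}\int_{\mathbb R^2}\sqrt{c^2|\boldsymbol p|^2+m^2c^4}\,|\widehat\psi(\boldsymbol p)|^2\,d\boldsymbol p$ on $H^{1/2}(\mathbb R^2;\mathbb C)$, and $\langle\psi,K_0(\beta|\boldsymbol x|)\psi\rangle=\int_{\mathbb R^2}K_0(\beta|\boldsymbol x|)|\psi(\boldsymbol x)|^2\,d\boldsymbol x$. *)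

theory Defs
  imports "HOL-Analysis.Analysis"
begin

text \<open>
  Elements of \<open>L\<^sup>2(\<real>\<^sup>2; \<complex>)\<close> are represented by Borel functions; every
  almost-everywhere class has such a representative.
\<close>

definition square_integrable :: "(real^2 \<Rightarrow> complex) \<Rightarrow> bool" where
  "square_integrable \<psi> \<longleftrightarrow>
     \<psi> \<in> borel_measurable lborel \<and> integrable lborel (\<lambda>x. (cmod (\<psi> x))\<^sup>2)"

definition L2_norm_sq :: "(real^2 \<Rightarrow> complex) \<Rightarrow> real" where
  "L2_norm_sq \<psi> = (\<integral>x. (cmod (\<psi> x))\<^sup>2 \<partial>lborel)"

text \<open>
  The Fourier integral itself, meaningful for integrable \<open>\<psi>\<close>.  Note the sign and the absence of a
  prefactor.
\<close>

definition fourier_integral :: "real \<Rightarrow> (real^2 \<Rightarrow> complex) \<Rightarrow> real^2 \<Rightarrow> complex" where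
  "fourier_integral hbar \<psi> p = (\<integral>x. exp (\<i> * of_real ((p \<bullet> x) / hbar)) * \<psi> x \<partial>lborel)"

text \<open>
  The Fourier-Plancherel transform on \<open>L\<^sup>2\<close>: the limit in mean, as \<open>R \<rightarrow> \<infinity>\<close>, of the Fourier
  integrals of \<open>\<psi>\<close> cut off to the ball of radius \<open>R\<close> (the cut-off function is integrable).
  The limit is unique only almost everywhere, hence a relation and a chosen representative.
\<close>

definition has_fourier_transform ::
    "real \<Rightarrow> (real^2 \<Rightarrow> complex) \<Rightarrow> (real^2 \<Rightarrow> complex) \<Rightarrow> bool" where
  "has_fourier_transform hbar \<psi> \<phi> \<longleftrightarrow>
     square_integrable \<phi> \<and>
     ((\<lambda>R::real. \<integral>\<^sup>+p. ennreal ((cmod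
          (fourier_integral hbar (\<lambda>x. indicator (cball 0 R) x * \<psi> x) p - \<phi> p))\<^sup>2) \<partial>lborel)
        \<longlongrightarrow> 0) at_top"

definition fourier :: "real \<Rightarrow> (real^2 \<Rightarrow> complex) \<Rightarrow> real^2 \<Rightarrow> complex" where
  "fourier hbar \<psi> = (SOME \<phi>. has_fourier_transform hbar \<psi> \<phi>)"

text \<open>
  The Sobolev space \<open>H\<^sup>1\<^sup>/\<^sup>2(\<real>\<^sup>2; \<complex>)\<close>.  It does not depend on \<open>hbar\<close>, so it is
  defined by the transform with \<open>hbar = 1\<close>.
\<close>

definition H_half :: "(real^2 \<Rightarrow> complex) set" where
  "H_half = {\<psi>. square_integrable \<psi> \<and>
     (\<exists>\<phi>. has_fourier_transform 1 \<psi> \<phi> \<and>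
        integrable lborel (\<lambda>p. sqrt (1 + (norm p)\<^sup>2) * (cmod (\<phi> p))\<^sup>2))}"

text \<open>
  The Bessel-Macdonald function of order \<open>0\<close>, by its standard integral representation for \<open>r > 0\<close>.
  The singular point \<open>r = 0\<close> gets the value \<open>0\<close>; it only matters on a null set below.
\<close>

definition bessel_K0 :: "real \<Rightarrow> real" where
  "bessel_K0 r = (LINT t:{0..}|lborel. exp (- r * cosh t))"

definition kinetic_density ::
    "real \<Rightarrow> real \<Rightarrow> real \<Rightarrow> (real^2 \<Rightarrow> complex) \<Rightarrow> real^2 \<Rightarrow> real" where
  "kinetic_density hbar c m \<psi> p =
     sqrt (c\<^sup>2 * (norm p)\<^sup>2 + m\<^sup>2 * c ^ 4) * (cmod (fourier hbar \<psi> p))\<^sup>2"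

definition potential_density :: "real \<Rightarrow> (real^2 \<Rightarrow> complex) \<Rightarrow> real^2 \<Rightarrow> real" where
  "potential_density \<beta> \<psi> x = bessel_K0 (\<beta> * norm x) * (cmod (\<psi> x))\<^sup>2"

definition kinetic_form :: "real \<Rightarrow> real \<Rightarrow> real \<Rightarrow> (real^2 \<Rightarrow> complex) \<Rightarrow> real" where
  "kinetic_form hbar c m \<psi> =
     1 / (2 * pi * hbar)\<^sup>2 * (\<integral>p. kinetic_density hbar c m \<psi> p \<partial>lborel)"

definition potential_form :: "real \<Rightarrow> (real^2 \<Rightarrow> complex) \<Rightarrow> real" where
  "potential_form \<beta> \<psi> = (\<integral>x. potential_density \<beta> \<psi> x \<partial>lborel)"

definition B_FW ::
    "real \<Rightarrow> real \<Rightarrow> real \<Rightarrow> real \<Rightarrow> real \<Rightarrow> (real^2 \<Rightarrow> complex) \<Rightarrow> real" where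
  "B_FW hbar c m \<beta> \<gamma> \<psi> = kinetic_form hbar c m \<psi> - \<gamma> * potential_form \<beta> \<psi>"

definition gamma_crit_S :: "real \<Rightarrow> real \<Rightarrow> real \<Rightarrow> real" where
  "gamma_crit_S hbar c \<beta> = hbar * c * \<beta>"

end

theory Submission
  imports Defs "HOL-Probability.Probability" "HOL-Real_Asymp.Real_Asymp"
begin

text \<open>
  In momentum space the potential has the kernel \<open>1 / (\<beta>\<^sup>2 + (norm (p - q))\<^sup>2)\<close>.  After rescaling and passing
  to angular means the claim becomes that the integral operator on \<open>L\<^sup>2(0, \<infinity>)\<close> with kernel
  \<open>1 / sqrt ((1 + (p - q)\<^sup>2) (1 + (p + q)\<^sup>2))\<close> has norm at most 1.  Its norm is about 0.99, and its
  Hilbert-Schmidt norm \<open>pi / sqrt 8\<close> exceeds 1, so one direction has to be split off.  Let \<open>e\<close> be the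
  normalized \<open>exp (- a p)\<close>, \<open>y\<close> its image and \<open>\<alpha>\<close> the inner product of the two, with \<open>a\<close> a stationary
  point of \<open>\<alpha>\<close>.  On the complement of \<open>e\<close> the Hilbert-Schmidt norm is at most \<open>sqrt (pi\<^sup>2 / 8 - \<alpha>\<^sup>2)\<close>.
  The off-diagonal part \<open>z = y - \<alpha> e\<close> is controlled by the Laguerre operator
  \<open>L z = - (p z')' + a\<^sup>2 p z\<close>, with eigenvalues \<open>a, 3 a, 5 a, \<dots>\<close>: stationarity makes \<open>z\<close> orthogonal
  to its first two eigenfunctions, whence \<open>5 a \<parallel>z\<parallel>\<^sup>2 \<le> \<langle>z, L z\<rangle>\<close>, while \<open>y\<close> is the Fourier transform of
  a multiple of \<open>K\<^sub>0 (norm x) / sqrt (a\<^sup>2 + (norm x)\<^sup>2)\<close>, and Plancherel gives \<open>\<langle>y, L y\<rangle> \<le> a\<close>.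
\<close>

section \<open>Gaussian integrals\<close>

text \<open>Splitting off one direction leaves a 2 by 2 matrix with diagonal \<alpha>, d and
  off-diagonal entry the norm of z. It is at most the identity when the squared norm of z is at most
  (1 - \<alpha>) (1 - d). The norm of z is never computed. Since \<open>exp (- a p)\<close> is the
  ground state of the Laguerre operator with eigenvalue a, the energy of z is that of y minus a
  \<alpha> squared, and dividing by the gap 5 a bounds the squared norm by (1 -
  \<open>\<alpha>\<^sup>2\<close>) / 5. This equals (1 - \<alpha>) (1 - d) for d = (4 - \<alpha>) /
  5, so everything comes down to the single numerical condition that pi squared over 8 minus
  \<open>\<alpha>\<^sup>2\<close> is at most \<open>d\<^sup>2\<close>; it holds for \<alpha> at
  least 93/100. The stationary point is indispensable here: orthogonality to the ground state alone
  would give the gap 3 a, which does not suffice for any \<alpha> \<le> 1. On the way to this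
  operator only the mass term, the phases of the transform and its angular dependence are given up,
  and no constant is lost: the kernel is positive and rotation invariant, and the kinetic weight is
  radial.\<close>

definition vec2 :: "real \<Rightarrow> real \<Rightarrow> real^2" where "vec2 x y = vector [x, y]"

lemma vec2_nth [simp]: "vec2 x y $ 1 = x" "vec2 x y $ 2 = y"
  by (simp_all add: vec2_def)

lemma inner_vec2: "(p::real^2) \<bullet> q = p $ 1 * q $ 1 + p $ 2 * q $ 2"
  by (simp add: inner_vec_def sum_2)

lemma norm_vec2_sq: "(norm (p::real^2))\<^sup>2 = (p $ 1)\<^sup>2 + (p $ 2)\<^sup>2"
  unfolding power2_norm_eq_inner inner_vec2 by (simp add: power2_eq_square)

lemma Basis_real2: "(Basis :: (real^2) set) = {axis 1 1, axis 2 1}"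
  by (auto simp: Basis_vec_def UNIV_2)

lemma axis12_neq: "axis 1 (1::real) \<noteq> (axis 2 1 :: real^2)"
  by (simp add: axis_eq_axis)

lemma vec2_measurable [measurable]: "(\<lambda>(x, y). vec2 x y) \<in> borel_measurable (borel \<Otimes>\<^sub>M borel)"
  unfolding borel_prod
  apply (rule borel_measurable_continuous_onI)
  apply (simp add: split_beta vec2_def)
  apply (rule continuous_on_vec_lambda[where f="\<lambda>i z. if i = 1 then fst z else snd z" for i, THEN continuous_on_eq])
  subgoal for i by (cases "i = 1") (auto intro!: continuous_intros)
  subgoal by (auto simp: vec_eq_iff forall_2)
  done

lemma vec2_measurable' [measurable (raw)]:
  "f \<in> borel_measurable M \<Longrightarrow> g \<in> borel_measurable M \<Longrightarrow> (\<lambda>x. vec2 (f x) (g x)) \<in> borel_measurable M"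
  using measurable_compose[OF measurable_Pair[of f M borel g borel] vec2_measurable] by simp

text \<open>Lebesgue measure is determined by its values on boxes, and a box in the plane is a
  product of intervals. This opens \<open>real^2\<close> to Fubini in the two coordinates, both for
  Gaussians and for polar coordinates.\<close>

lemma lborel_real2: "(lborel :: (real^2) measure) = distr (lborel \<Otimes>\<^sub>M lborel) borel (\<lambda>(x, y). vec2 x y)"
proof (rule lborel_eqI)
  fix l u :: "real^2"
  assume le: "\<And>b. b \<in> Basis \<Longrightarrow> l \<bullet> b \<le> u \<bullet> b"
  have le1: "l $ 1 \<le> u $ 1" "l $ 2 \<le> u $ 2"
    using le[of "axis 1 1"] le[of "axis 2 1"] by (auto simp: Basis_real2 inner_axis)
  have pre: "(\<lambda>(x, y). vec2 x y) -` box l u \<inter> space (lborel \<Otimes>\<^sub>M lborel)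
      = {l$1<..<u$1} \<times> {l$2<..<u$2}"
    by (auto simp: mem_box Basis_real2 inner_axis space_pair_measure)
  show "emeasure (distr (lborel \<Otimes>\<^sub>M lborel) borel (\<lambda>(x, y). vec2 x y)) (box l u)
      = (\<Prod>b\<in>Basis. (u - l) \<bullet> b)"
    using le1 axis12_neq
    by (subst emeasure_distr)
       (auto simp: pre lborel.emeasure_pair_measure_Times Basis_real2 inner_axis ennreal_mult)
qed simp

lemma nn_integral_real2:
  assumes [measurable]: "f \<in> borel_measurable borel"
  shows "(\<integral>\<^sup>+p. f p \<partial>(lborel :: (real^2) measure)) = (\<integral>\<^sup>+x. \<integral>\<^sup>+y. f (vec2 x y) \<partial>lborel \<partial>lborel)"
  by (subst lborel_real2) (simp add: nn_integral_distr lborel.nn_integral_fst[symmetric] split_beta')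

lemma integrable_real2_iff:
  fixes f :: "real^2 \<Rightarrow> 'b::{banach, second_countable_topology}"
  assumes [measurable]: "f \<in> borel_measurable borel"
  shows "integrable lborel f \<longleftrightarrow> integrable (lborel \<Otimes>\<^sub>M lborel) (\<lambda>(x, y). f (vec2 x y))"
  by (subst lborel_real2) (simp add: integrable_distr_eq split_beta')

lemma integral_real2:
  fixes f :: "real^2 \<Rightarrow> 'b::{banach, second_countable_topology}"
  assumes [measurable]: "integrable lborel f"
  shows "(\<integral>p. f p \<partial>lborel) = (\<integral>x. \<integral>y. f (vec2 x y) \<partial>lborel \<partial>lborel)"
proof -
  have [measurable]: "f \<in> borel_measurable borel" using borel_measurable_integrable[OF assms] by simp
  have "(\<integral>p. f p \<partial>lborel) = (\<integral>z. (\<lambda>(x, y). f (vec2 x y)) z \<partial>(lborel \<Otimes>\<^sub>M lborel))"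
    by (subst lborel_real2) (simp add: integral_distr split_beta')
  also have "\<dots> = (\<integral>x. \<integral>y. f (vec2 x y) \<partial>lborel \<partial>lborel)"
    using assms by (subst lborel_pair.integral_fst'[symmetric]) (simp_all add: integrable_real2_iff)
  finally show ?thesis .
qed

lemma integrable_prod_mult:
  fixes f :: "'a \<Rightarrow> 'c::{real_normed_field, banach, second_countable_topology}" and g :: "'b \<Rightarrow> 'c"
  assumes "sigma_finite_measure M" "sigma_finite_measure N" and f: "integrable M f" and g: "integrable N g"
  shows "integrable (M \<Otimes>\<^sub>M N) (\<lambda>(x, y). f x * g y)"
proof -
  interpret pair_sigma_finite M N by (simp add: pair_sigma_finite_def assms)
  have [measurable]: "f \<in> borel_measurable M" "g \<in> borel_measurable N" using f g by auto
  show ?thesis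
  proof (rule Fubini_integrable)
    show "integrable M (\<lambda>x. \<integral>y. norm (case (x, y) of (x, y) \<Rightarrow> f x * g y) \<partial>N)"
      using f g by (simp add: norm_mult)
    show "AE x in M. integrable N (\<lambda>y. case (x, y) of (x, y) \<Rightarrow> f x * g y)"
      using g by simp
  qed measurable
qed

text \<open>The characteristic function of the standard normal distribution, rescaled so that its
  density becomes a multiple of \<open>exp (- t * x\<^sup>2)\<close>.\<close>

lemma gauss_ft_real:
  fixes t p :: real
  assumes "t > 0"
  shows "integrable lborel (\<lambda>x. exp (\<i> * of_real (p * x)) * of_real (exp (- t * x\<^sup>2)))"
    and "(\<integral>x. exp (\<i> * of_real (p * x)) * of_real (exp (- t * x\<^sup>2)) \<partial>lborel) = of_real (sqrt (pi / t) * exp (- p\<^sup>2 / (4 * t)))"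
proof -
  \<comment> \<open>With \<open>c\<^sup>2 = 2 * t\<close> the exponent
    \<open>(c * x)\<^sup>2 / 2\<close> of the normal density becomes
    \<open>t * x\<^sup>2\<close>.\<close>
  define c where "c = sqrt (2 * t)"
  have c: "c > 0" and c2: "c\<^sup>2 = 2 * t" using assms by (simp_all add: c_def)
  define g where "g = (\<lambda>x::real. complex_of_real (std_normal_density x) * exp (\<i> * of_real (p / c * x)))"
  have int: "integrable lborel g"
    unfolding g_def
    by (rule Bochner_Integration.integrable_bound[where f=std_normal_density])
      (auto simp: norm_mult simp del: of_real_mult)
  have val: "(\<integral>x. g x \<partial>lborel) = of_real (exp (- (p/c)\<^sup>2 / 2))"
    using char_std_normal_distribution[THEN fun_cong, of "p/c"]
    unfolding char_def g_def
    by (subst (asm) integral_density) (auto simp: scaleR_conv_of_real)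
  have eq: "g (c * x) = of_real (1 / sqrt (2 * pi)) * (exp (\<i> * of_real (p * x)) * of_real (exp (- t * x\<^sup>2)))" for x
    using c by (simp add: g_def std_normal_density_def power_mult_distrib c2)
  have eq': "exp (\<i> * of_real (p * x)) * of_real (exp (- t * x\<^sup>2)) = of_real (sqrt (2 * pi)) * g (0 + c * x)" for x
    unfolding add_0 eq by simp
  have "integrable lborel (\<lambda>x. g (0 + c * x))"
    by (rule lborel_integrable_real_affine[OF int]) (use c in auto)
  then show *: "integrable lborel (\<lambda>x. exp (\<i> * of_real (p * x)) * of_real (exp (- t * x\<^sup>2)))"
    unfolding eq' by (rule integrable_mult_right)
  have "(\<integral>x. g x \<partial>lborel) = \<bar>c\<bar> *\<^sub>R (\<integral>x. g (0 + c * x) \<partial>lborel)"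
    by (rule lborel_integral_real_affine) (use c in auto)
  also have "\<dots> = of_real (c / sqrt (2 * pi)) * (\<integral>x. exp (\<i> * of_real (p * x)) * of_real (exp (- t * x\<^sup>2)) \<partial>lborel)"
    using c by (simp add: eq scaleR_conv_of_real)
  finally have "(\<integral>x. exp (\<i> * of_real (p * x)) * of_real (exp (- t * x\<^sup>2)) \<partial>lborel)
     = of_real (sqrt (2 * pi) / c) * of_real (exp (- (p/c)\<^sup>2 / 2))"
    using c unfolding val by (simp add: field_simps)
  also have "sqrt (2 * pi) / c = sqrt (pi / t)"
    using assms by (simp add: c_def real_sqrt_divide[symmetric])
  finally show "(\<integral>x. exp (\<i> * of_real (p * x)) * of_real (exp (- t * x\<^sup>2)) \<partial>lborel) = of_real (sqrt (pi / t) * exp (- p\<^sup>2 / (4 * t)))"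
    by (simp add: power_divide c2)
qed

text \<open>This transform has two uses: as a regularizer in the proof of Plancherel, and as the
  source of the momentum-space formulas for the Bessel function, which is a superposition of
  Gaussians.\<close>

lemma gauss_ft:
  fixes p :: "real^2"
  assumes t: "t > 0"
  shows "integrable lborel (\<lambda>x. exp (\<i> * of_real (p \<bullet> x)) * of_real (exp (- t * (norm x)\<^sup>2)))"
    and "(\<integral>x. exp (\<i> * of_real (p \<bullet> x)) * of_real (exp (- t * (norm x)\<^sup>2)) \<partial>lborel) = of_real (pi / t * exp (- (norm p)\<^sup>2 / (4 * t)))"
proof -
  let ?f = "\<lambda>x::real^2. exp (\<i> * of_real (p \<bullet> x)) * of_real (exp (- t * (norm x)\<^sup>2))"
  let ?g = "\<lambda>(q::real) x::real. exp (\<i> * of_real (q * x)) * of_real (exp (- t * x\<^sup>2))"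
  have eq: "?f (vec2 x y) = ?g (p$1) x * ?g (p$2) y" for x y
    by (simp add: inner_vec2 norm_vec2_sq exp_add[symmetric] exp_of_real[symmetric] algebra_simps)
  show int: "integrable lborel ?f"
  proof (subst integrable_real2_iff)
    have "(\<lambda>(x, y). ?f (vec2 x y)) = (\<lambda>(x, y). ?g (p$1) x * ?g (p$2) y)"
      by (simp only: eq)
    then show "integrable (lborel \<Otimes>\<^sub>M lborel) (\<lambda>(x, y). ?f (vec2 x y))"
      using integrable_prod_mult[OF lborel.sigma_finite_measure_axioms lborel.sigma_finite_measure_axioms
        gauss_ft_real(1)[OF t, of "p$1"] gauss_ft_real(1)[OF t, of "p$2"]]
      by (simp only:)
  qed measurable
  have "(\<integral>x. ?f x \<partial>lborel) = (\<integral>x. \<integral>y. ?g (p$1) x * ?g (p$2) y \<partial>lborel \<partial>lborel)"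
    by (simp only: integral_real2[OF int] eq)
  also have "\<dots> = of_real (sqrt (pi / t) * exp (- (p$1)\<^sup>2 / (4 * t))) * of_real (sqrt (pi / t) * exp (- (p$2)\<^sup>2 / (4 * t)))"
    by (simp only: integral_mult_right_zero integral_mult_left_zero gauss_ft_real(2)[OF t])
  also have "\<dots> = of_real (sqrt (pi/t) * sqrt (pi/t) * exp (- (p$1)\<^sup>2 / (4 * t) + - (p$2)\<^sup>2 / (4 * t)))"
    unfolding exp_add of_real_mult by (simp only: mult_ac)
  also have "\<dots> = of_real (pi / t * exp (- (norm p)\<^sup>2 / (4 * t)))"
    using t by (simp add: norm_vec2_sq add_divide_distrib diff_divide_distrib)
  finally show "(\<integral>x. ?f x \<partial>lborel) = of_real (pi / t * exp (- (norm p)\<^sup>2 / (4 * t)))" .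
qed

lemma gauss_integrable: "t > 0 \<Longrightarrow> integrable lborel (\<lambda>x::real^2. exp (- t * (norm x)\<^sup>2))"
  using integrable_norm[OF gauss_ft(1)[of t 0]] by simp

lemma nn_integral_gauss:
  "t > 0 \<Longrightarrow> (\<integral>\<^sup>+x. ennreal (exp (- t * (norm (x::real^2))\<^sup>2)) \<partial>lborel) = ennreal (pi / t)"
proof -
  assume t: "t > 0"
  have "complex_of_real (\<integral>x. exp (- t * (norm (x::real^2))\<^sup>2) \<partial>lborel) = of_real (pi / t)"
    using gauss_ft(2)[OF t, of 0] by (subst integral_complex_of_real[symmetric]) simp
  then have "(\<integral>x. exp (- t * (norm (x::real^2))\<^sup>2) \<partial>lborel) = pi / t" by (simp only: of_real_eq_iff)
  then show ?thesis using gauss_integrable[OF t] by (subst nn_integral_eq_integral) auto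
qed

section \<open>The Plancherel identity in the plane\<close>

lemma nn_integral_shift:
  fixes h :: "'a::euclidean_space"
  assumes [measurable]: "f \<in> borel_measurable borel"
  shows "(\<integral>\<^sup>+x. f (x + h) \<partial>lborel) = (\<integral>\<^sup>+x. f x \<partial>lborel)"
  by (subst (2) lborel_distr_plus[of h, symmetric]) (simp add: nn_integral_distr add.commute)

lemma nn_integral_scale:
  fixes f :: "'a::euclidean_space \<Rightarrow> ennreal"
  assumes [measurable]: "f \<in> borel_measurable borel" and c: "c > 0"
  shows "(\<integral>\<^sup>+x. f x \<partial>lborel) = ennreal (c ^ DIM('a)) * (\<integral>\<^sup>+x. f (c *\<^sub>R x) \<partial>lborel)"
  using c by (subst lborel_affine[of c 0]) (simp_all add: nn_integral_density nn_integral_distr nn_integral_cmult ennreal_power)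

lemma integrable_shift:
  fixes h :: "'a::euclidean_space" and f :: "'a \<Rightarrow> 'b::{banach, second_countable_topology}"
  assumes f: "integrable lborel f"
  shows "integrable lborel (\<lambda>x. f (x + h))"
proof -
  have "integrable (distr lborel borel ((+) h)) f" using f by (simp add: lborel_distr_plus)
  then have "integrable lborel (\<lambda>x. f (h + x))" 
    using borel_measurable_integrable[OF f] by (subst (asm) integrable_distr_eq) auto
  then show ?thesis by (simp add: add.commute)
qed

lemma integral_shift:
  fixes h :: "'a::euclidean_space" and f :: "'a \<Rightarrow> 'b::{banach, second_countable_topology}"
  assumes [measurable]: "f \<in> borel_measurable borel"
  shows "(\<integral>x. f (x + h) \<partial>lborel) = (\<integral>x. f x \<partial>lborel)"
  by (subst (2) lborel_distr_plus[of h, symmetric]) (simp add: integral_distr add.commute)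

lemma borel_measurable_cnj [measurable (raw)]:
  "f \<in> borel_measurable M \<Longrightarrow> (\<lambda>x. cnj (f x)) \<in> borel_measurable M"
  by (rule measurable_compose[of f M borel cnj])
     (auto intro!: borel_measurable_continuous_onI continuous_intros)

text \<open>The functions with continuous translations are closed in L1: a translation preserves the
  distance between \<open>f\<close> and its approximant \<open>g\<close>, so the error is counted
  twice, once shifted and once not. The base case and the limit case of the induction below both end
  in this argument.\<close>

lemma L1_translation_approx:
  fixes f :: "'a::euclidean_space \<Rightarrow> 'b::{banach, second_countable_topology}"
  assumes f: "integrable lborel f"
    and approx: "\<And>e. e > 0 \<Longrightarrow> \<exists>g. integrable lborel g \<and> (\<integral>x. norm (f x - g x) \<partial>lborel) \<le> e \<and>
        (\<lambda>n. \<integral>x. norm (g (x + X n) - g x) \<partial>lborel) \<longlonglongrightarrow> 0"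
  shows "(\<lambda>n. \<integral>x. norm (f (x + X n) - f x) \<partial>lborel) \<longlonglongrightarrow> 0"
proof (rule LIMSEQ_I)
  fix e :: real assume e: "e > 0"
  then have "e / 4 > 0" by simp
  from approx[OF this] obtain g where g: "integrable lborel g" "(\<integral>x. norm (f x - g x) \<partial>lborel) \<le> e / 4"
    "(\<lambda>n. \<integral>x. norm (g (x + X n) - g x) \<partial>lborel) \<longlonglongrightarrow> 0" by auto
  from LIMSEQ_D[OF g(3), of "e/4"] e obtain N where
    N: "\<And>n. n \<ge> N \<Longrightarrow> (\<integral>x. norm (g (x + X n) - g x) \<partial>lborel) < e / 4" by auto
  show "\<exists>N. \<forall>n\<ge>N. norm ((\<integral>x. norm (f (x + X n) - f x) \<partial>lborel) - 0) < e"
  proof (intro exI allI impI)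
    fix n assume n: "n \<ge> N"
    let ?h = "X n"
    have d: "integrable lborel (\<lambda>x. norm (f x - g x))" using f g by auto
    have "(\<integral>x. norm (f (x + ?h) - f x) \<partial>lborel)
        \<le> (\<integral>x. norm (f (x + ?h) - g (x + ?h)) + (norm (g (x + ?h) - g x) + norm (f x - g x)) \<partial>lborel)"
    proof (rule integral_mono)
      fix x
      have "f (x + ?h) - f x = (f (x + ?h) - g (x + ?h)) + ((g (x + ?h) - g x) - (f x - g x))" by simp
      then show "norm (f (x + ?h) - f x) \<le> norm (f (x + ?h) - g (x + ?h)) + (norm (g (x + ?h) - g x) + norm (f x - g x))"
        by (smt (verit) norm_triangle_ineq norm_triangle_ineq4)
    qed (use integrable_shift[OF f, of ?h] integrable_shift[OF g(1), of ?h] integrable_shift[OF d, of ?h] d f g in auto)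
    also have "\<dots> = (\<integral>x. norm (f (x + ?h) - g (x + ?h)) \<partial>lborel) + ((\<integral>x. norm (g (x + ?h) - g x) \<partial>lborel) + (\<integral>x. norm (f x - g x) \<partial>lborel))"
      using integrable_shift[OF g(1), of ?h] integrable_shift[OF d, of ?h] d g by simp
    also have "(\<integral>x. norm (f (x + ?h) - g (x + ?h)) \<partial>lborel) = (\<integral>x. norm (f x - g x) \<partial>lborel)"
      using integral_shift[of "\<lambda>x. norm (f x - g x)" ?h] borel_measurable_integrable[OF d] by simp
    finally show "norm ((\<integral>x. norm (f (x + ?h) - f x) \<partial>lborel) - 0) < e"
      using g(2) N[OF n] e by (simp add: abs_of_nonneg)
  qed
qed

text \<open>An open set contains a neighbourhood of each of its points, so the part of
  \<open>U\<close> lost under a small shift, \<open>F\<close>, tends to 0 pointwise and is dominated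
  by the indicator of \<open>U\<close>. The part gained has the same measure as the part lost,
  because the shifted set has the measure of \<open>U\<close>; hence the factor 2.\<close>

lemma L1_translation_open:
  fixes U :: "'a::euclidean_space set"
  assumes U: "open U" "emeasure lborel U < \<infinity>" and X: "X \<longlonglongrightarrow> 0"
  shows "(\<lambda>n. \<integral>x. \<bar>indicator U (x + X n) - indicator U x :: real\<bar> \<partial>lborel) \<longlonglongrightarrow> 0"
proof -
  have [measurable]: "U \<in> sets borel" using U by auto
  have iU: "integrable lborel (indicator U :: _ \<Rightarrow> real)" using U by (simp add: integrable_indicator_iff)
  define F where "F n x = (indicator U x - indicator U x * indicator U (x + X n) :: real)" for n x
  have [measurable]: "F n \<in> borel_measurable borel" for n
    unfolding F_def by measurable
  have lim: "(\<lambda>n. \<integral>x. F n x \<partial>lborel) \<longlonglongrightarrow> integral\<^sup>L lborel (\<lambda>x::'a. 0)"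
  proof (rule integral_dominated_convergence[where w="indicator U" and s=F and f="\<lambda>_. 0"])
    show "AE x in lborel. (\<lambda>n. F n x) \<longlonglongrightarrow> 0"
    proof (rule AE_I2)
      fix x :: 'a
      show "(\<lambda>n. F n x) \<longlonglongrightarrow> 0"
      proof (cases "x \<in> U")
        case True
        have "(\<lambda>n. x + X n) \<longlonglongrightarrow> x" using tendsto_add[OF tendsto_const X, of x] by simp
        from topological_tendstoD[OF this U(1) True]
        have "eventually (\<lambda>n. F n x = 0) sequentially" 
          by (rule eventually_mono) (use True in \<open>simp add: F_def\<close>)
        then show ?thesis by (rule tendsto_eventually)
      qed (simp add: F_def)
    qed
    show "AE x in lborel. norm (F n x) \<le> indicator U x" for n
      by (rule AE_I2) (auto simp: F_def split: split_indicator)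
  qed (use iU in auto)
  have "(\<integral>x. \<bar>indicator U (x + X n) - indicator U x :: real\<bar> \<partial>lborel) = 2 * (\<integral>x. F n x \<partial>lborel)" for n
  proof -
    have i2: "integrable lborel (\<lambda>x. indicator U (x + X n) :: real)" by (rule integrable_shift[OF iU])
    have i3: "integrable lborel (F n)"
      unfolding F_def using iU
      by (rule Bochner_Integration.integrable_bound) (auto split: split_indicator)
    have "(\<integral>x. \<bar>indicator U (x + X n) - indicator U x :: real\<bar> \<partial>lborel)
      = (\<integral>x. 2 * F n x + (indicator U (x + X n) - indicator U x) \<partial>lborel)"
      by (rule Bochner_Integration.integral_cong) (auto simp: F_def split: split_indicator)
    also have "\<dots> = 2 * (\<integral>x. F n x \<partial>lborel) + ((\<integral>x. indicator U (x + X n) \<partial>lborel) - (\<integral>x. indicator U x \<partial>lborel))"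
      using i2 i3 iU by simp
    also have "(\<integral>x. indicator U (x + X n) \<partial>lborel) = (\<integral>x. (indicator U x :: real) \<partial>lborel)"
      by (rule integral_shift) simp
    finally show ?thesis by simp
  qed
  then show ?thesis using tendsto_mult[OF tendsto_const lim, of 2] by simp
qed

text \<open>Induction along simple functions. An indicator is first replaced by that of an open
  superset of nearly the same measure, where pointwise continuity is available.\<close>

lemma L1_translation_continuous:
  fixes f :: "'a::euclidean_space \<Rightarrow> 'b::{banach, second_countable_topology}"
  assumes f: "integrable lborel f" and X: "X \<longlonglongrightarrow> 0"
  shows "(\<lambda>n. \<integral>x. norm (f (x + X n) - f x) \<partial>lborel) \<longlonglongrightarrow> 0"
  using f
proof (induction rule: integrable_induct)
  case (base A c)
  have A[measurable]: "A \<in> sets borel" using base by simp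
  have iA: "integrable lborel (indicator A :: _ \<Rightarrow> real)" using base by (simp add: integrable_indicator_iff)
  show ?case
  proof (rule L1_translation_approx)
    show "integrable lborel (\<lambda>x. indicator A x *\<^sub>R c)" using iA by simp
    fix e :: real assume e: "e > 0"
    \<comment> \<open>Dividing by \<open>norm c + 1\<close> rather than \<open>norm c\<close> keeps
      the tolerance positive also for \<open>c = 0\<close>.\<close>
    define e' where "e' = e / (norm c + 1)"
    have e': "e' > 0" using e by (simp add: e'_def add_nonneg_pos)
    obtain U where U: "open U" "A \<subseteq> U" "emeasure lborel (U - A) < ennreal e'"
      by (rule outer_regular_lborel[OF A e'])
    have [measurable]: "U \<in> sets borel" using U by auto
    have "emeasure lborel U \<le> emeasure lborel (U - A) + emeasure lborel A"
      using U(2) emeasure_subadditive[of "U - A" lborel A] by (simp add: Un_absorb2)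
    also have "\<dots> < \<infinity>" using U(3) base by (auto simp: ennreal_add_less_top less_top[symmetric] top_unique dest: less_imp_le)
    finally have Uf: "emeasure lborel U < \<infinity>" .
    have iU: "integrable lborel (indicator U :: _ \<Rightarrow> real)" using Uf by (simp add: integrable_indicator_iff)
    have "(\<integral>x. norm (indicator A x *\<^sub>R c - indicator U x *\<^sub>R c) \<partial>lborel) = (\<integral>x. indicator (U - A) x * norm c \<partial>lborel)"
      by (rule Bochner_Integration.integral_cong) (use U(2) in \<open>auto split: split_indicator\<close>)
    also have "\<dots> = measure lborel (U - A) * norm c" by simp
    also have "\<dots> \<le> e' * norm c"
      using U(3) e' by (intro mult_right_mono) (auto simp: measure_def enn2real_leI)
    also have "\<dots> \<le> e"
      using e mult_left_mono[of "norm c / (norm c + 1)" 1 e]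
      by (simp add: e'_def divide_le_eq_1 add_nonneg_pos)
    finally have 1: "(\<integral>x. norm (indicator A x *\<^sub>R c - indicator U x *\<^sub>R c) \<partial>lborel) \<le> e" .
    have 2: "(\<lambda>n. \<integral>x. norm (indicator U (x + X n) *\<^sub>R c - indicator U x *\<^sub>R c) \<partial>lborel) \<longlonglongrightarrow> 0"
      using tendsto_mult[OF L1_translation_open[OF U(1) Uf X] tendsto_const, of "norm c"]
      by (simp add: scaleR_left_diff_distrib[symmetric])
    show "\<exists>g. integrable lborel g \<and> (\<integral>x. norm (indicator A x *\<^sub>R c - g x) \<partial>lborel) \<le> e \<and>
        (\<lambda>n. \<integral>x. norm (g (x + X n) - g x) \<partial>lborel) \<longlonglongrightarrow> 0"
      using 1 2 iU by (intro exI[of _ "\<lambda>x. indicator U x *\<^sub>R c"]) auto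
  qed
next
  case (add f g)
  have lim: "(\<lambda>n. (\<integral>x. norm (f (x + X n) - f x) \<partial>lborel) + (\<integral>x. norm (g (x + X n) - g x) \<partial>lborel)) \<longlonglongrightarrow> 0"
    using tendsto_add[OF add(3,4)] by simp
  show ?case
  proof (rule tendsto_sandwich[OF _ _ tendsto_const lim])
    show "\<forall>\<^sub>F n in sequentially. (\<integral>x. norm (f (x + X n) + g (x + X n) - (f x + g x)) \<partial>lborel)
      \<le> (\<integral>x. norm (f (x + X n) - f x) \<partial>lborel) + (\<integral>x. norm (g (x + X n) - g x) \<partial>lborel)"
    proof (rule always_eventually, rule allI)
      fix n
      note i = add(1,2) integrable_shift[OF add(1), of "X n"] integrable_shift[OF add(2), of "X n"]
      have "(\<integral>x. norm (f (x + X n) + g (x + X n) - (f x + g x)) \<partial>lborel)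
        \<le> (\<integral>x. norm (f (x + X n) - f x) + norm (g (x + X n) - g x) \<partial>lborel)"
      proof (rule integral_mono)
        fix x show "norm (f (x + X n) + g (x + X n) - (f x + g x)) \<le> norm (f (x + X n) - f x) + norm (g (x + X n) - g x)"
          using norm_triangle_ineq[of "f (x + X n) - f x" "g (x + X n) - g x"] by (simp add: algebra_simps)
      qed (use i in auto)
      also have "\<dots> = (\<integral>x. norm (f (x + X n) - f x) \<partial>lborel) + (\<integral>x. norm (g (x + X n) - g x) \<partial>lborel)"
        using i by (intro Bochner_Integration.integral_add) auto
      finally show "(\<integral>x. norm (f (x + X n) + g (x + X n) - (f x + g x)) \<partial>lborel) \<le> \<dots>" .
    qed
  qed simp
next
  case (lim f s)
  show ?case
  proof (rule L1_translation_approx[OF lim(4)])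
    fix e :: real assume e: "e > 0"
    have "(\<lambda>i. \<integral>x. norm (f x - s i x) \<partial>lborel) \<longlonglongrightarrow> integral\<^sup>L lborel (\<lambda>x::'a. 0)"
    proof (rule integral_dominated_convergence[where w="\<lambda>x. 3 * norm (f x)"])
      show "AE x in lborel. (\<lambda>i. norm (f x - s i x)) \<longlonglongrightarrow> 0"
      proof (rule AE_I2)
        fix x :: 'a
        have "(\<lambda>i. norm (f x - s i x)) \<longlonglongrightarrow> norm (f x - f x)"
          by (intro tendsto_intros lim(2)) simp
        then show "(\<lambda>i. norm (f x - s i x)) \<longlonglongrightarrow> 0" by simp
      qed
      \<comment> \<open>The induction rule supplies approximants with
        \<open>norm (s i x) \<le> 2 * norm (f x)\<close>, hence the factor 3.\<close>
      show "AE x in lborel. norm (norm (f x - s i x)) \<le> 3 * norm (f x)" for i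
        by (rule AE_I2) (smt (verit) lim(3) norm_ge_zero norm_triangle_ineq4 real_norm_def space_lborel UNIV_I)
    qed (use lim in auto)
    then have "eventually (\<lambda>i. (\<integral>x. norm (f x - s i x) \<partial>lborel) < e) sequentially"
      using e by (intro order_tendstoD(2)) auto
    then obtain i where "(\<integral>x. norm (f x - s i x) \<partial>lborel) < e" by (auto simp: eventually_sequentially)
    then show "\<exists>g. integrable lborel g \<and> (\<integral>x. norm (f x - g x) \<partial>lborel) \<le> e \<and>
        (\<lambda>n. \<integral>x. norm (g (x + X n) - g x) \<partial>lborel) \<longlonglongrightarrow> 0"
      using lim by (intro exI[of _ "s i"]) auto
  qed
qed

text \<open>
  The \<open>L\<^sup>2\<close> case reduces to the \<open>L\<^sup>1\<close> one because \<open>(a - b)\<^sup>2 \<le> \<bar>a\<^sup>2 - b\<^sup>2\<bar>\<close> for nonnegative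
  \<open>a\<close> and \<open>b\<close>.
\<close>

lemma L2_translation_continuous:
  fixes f :: "'a::euclidean_space \<Rightarrow> complex"
  assumes [measurable]: "f \<in> borel_measurable borel"
    and f: "integrable lborel (\<lambda>x. (cmod (f x))\<^sup>2)" and X: "X \<longlonglongrightarrow> 0"
  shows "(\<lambda>n. \<integral>x. (cmod (f (x + X n) - f x))\<^sup>2 \<partial>lborel) \<longlonglongrightarrow> 0"
proof -
  \<comment> \<open>Positive and negative parts of the real and the imaginary part: four nonnegative
    functions, as the elementary inequality requires, whose squares are integrable and therefore
    have continuous translations in mean.\<close>
  define G :: "nat \<Rightarrow> 'a \<Rightarrow> real" where "G i x = (if i = 0 then max (Re (f x)) 0 else if i = 1 then max (- Re (f x)) 0
     else if i = 2 then max (Im (f x)) 0 else max (- Im (f x)) 0)" for i x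
  have [measurable]: "G i \<in> borel_measurable borel" for i
    unfolding G_def by measurable
  have iG: "integrable lborel (\<lambda>x. (G i x)\<^sup>2)" for i
  proof (rule Bochner_Integration.integrable_bound[OF f])
    have "\<bar>G i x\<bar> \<le> cmod (f x)" for x
      unfolding G_def using abs_Re_le_cmod[of "f x"] abs_Im_le_cmod[of "f x"] by auto
    then show "AE x in lborel. norm ((G i x)\<^sup>2) \<le> norm ((cmod (f x))\<^sup>2)"
      by (intro AE_I2) (auto simp: abs_le_square_iff[symmetric])
  qed measurable
  have bd: "(cmod (f y - f x))\<^sup>2 \<le> 2 * (\<Sum>i<4. \<bar>(G i y)\<^sup>2 - (G i x)\<^sup>2\<bar>)" for x y
  proof -
    have four: "{..<4} = {0, 1, 2, 3::nat}" by auto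
    have key: "(a - b)\<^sup>2 \<le> 2 * (\<bar>(max a 0)\<^sup>2 - (max b 0)\<^sup>2\<bar> + \<bar>(max (-a) 0)\<^sup>2 - (max (-b) 0)\<^sup>2\<bar>)" for a b :: real
    proof -
      have sq: "(u - v)\<^sup>2 \<le> \<bar>u\<^sup>2 - v\<^sup>2\<bar>" if "u \<ge> 0" "v \<ge> 0" for u v :: real
      proof -
        have "(u - v)\<^sup>2 = \<bar>u - v\<bar> * \<bar>u - v\<bar>" by (simp add: power2_eq_square)
        also have "\<dots> \<le> \<bar>u - v\<bar> * \<bar>u + v\<bar>" using that by (intro mult_left_mono) auto
        also have "\<dots> = \<bar>u\<^sup>2 - v\<^sup>2\<bar>" by (simp add: abs_mult[symmetric] power2_eq_square algebra_simps)
        finally show ?thesis .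
      qed
      have "(a - b)\<^sup>2 = ((max a 0 - max b 0) - (max (-a) 0 - max (-b) 0))\<^sup>2" by (auto simp: max_def)
      also have "\<dots> \<le> 2 * ((max a 0 - max b 0)\<^sup>2 + (max (-a) 0 - max (-b) 0)\<^sup>2)"
      proof -
        have "(u - v)\<^sup>2 \<le> 2 * (u\<^sup>2 + v\<^sup>2)" for u v :: real
          using zero_le_power2[of "u + v"] by (simp add: power2_eq_square algebra_simps)
        then show ?thesis .
      qed
      also have "\<dots> \<le> 2 * (\<bar>(max a 0)\<^sup>2 - (max b 0)\<^sup>2\<bar> + \<bar>(max (-a) 0)\<^sup>2 - (max (-b) 0)\<^sup>2\<bar>)"
        by (intro mult_left_mono add_mono sq) auto
      finally show ?thesis .
    qed
    have "(\<Sum>i<4. \<bar>(G i y)\<^sup>2 - (G i x)\<^sup>2\<bar>)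
        = (\<bar>(max (Re (f y)) 0)\<^sup>2 - (max (Re (f x)) 0)\<^sup>2\<bar> + \<bar>(max (- Re (f y)) 0)\<^sup>2 - (max (- Re (f x)) 0)\<^sup>2\<bar>)
          + (\<bar>(max (Im (f y)) 0)\<^sup>2 - (max (Im (f x)) 0)\<^sup>2\<bar> + \<bar>(max (- Im (f y)) 0)\<^sup>2 - (max (- Im (f x)) 0)\<^sup>2\<bar>)"
      unfolding four by (simp add: G_def)
    note sum4 = this
    have add2: "u + v \<le> 2 * w" if "w = p + q" "u \<le> 2 * p" "v \<le> 2 * q" for u v w p q :: real
      using that by simp
    show ?thesis
      unfolding cmod_power2 minus_complex.sel by (rule add2[OF sum4 key key])
  qed
  have lim: "(\<lambda>n. 2 * (\<Sum>i<4. \<integral>x. norm ((G i (x + X n))\<^sup>2 - (G i x)\<^sup>2) \<partial>lborel)) \<longlonglongrightarrow> 2 * (\<Sum>i<(4::nat). 0)"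
    by (intro tendsto_intros L1_translation_continuous[OF iG X])
  show ?thesis
  proof (rule tendsto_sandwich[OF _ _ tendsto_const])
    show "(\<lambda>n. 2 * (\<Sum>i<4. \<integral>x. norm ((G i (x + X n))\<^sup>2 - (G i x)\<^sup>2) \<partial>lborel)) \<longlonglongrightarrow> 0"
      using lim by simp
    show "\<forall>\<^sub>F n in sequentially. (\<integral>x. (cmod (f (x + X n) - f x))\<^sup>2 \<partial>lborel)
      \<le> 2 * (\<Sum>i<4. \<integral>x. norm ((G i (x + X n))\<^sup>2 - (G i x)\<^sup>2) \<partial>lborel)"
    proof (rule always_eventually, rule allI)
      fix n
      have ii: "integrable lborel (\<lambda>x. norm ((G i (x + X n))\<^sup>2 - (G i x)\<^sup>2))" for i
        using iG[of i] integrable_shift[OF iG, of i "X n"] by auto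
      have i2: "integrable lborel (\<lambda>x. 2 * (\<Sum>i<4. \<bar>(G i (x + X n))\<^sup>2 - (G i x)\<^sup>2\<bar>))"
        using ii by (intro integrable_mult_right Bochner_Integration.integrable_sum) auto
      have "(\<integral>x. (cmod (f (x + X n) - f x))\<^sup>2 \<partial>lborel) \<le> (\<integral>x. 2 * (\<Sum>i<4. \<bar>(G i (x + X n))\<^sup>2 - (G i x)\<^sup>2\<bar>) \<partial>lborel)"
      proof (rule integral_mono[OF _ i2])
        show "integrable lborel (\<lambda>x. (cmod (f (x + X n) - f x))\<^sup>2)"
          by (rule Bochner_Integration.integrable_bound[OF i2])
             (measurable, use bd in \<open>auto intro!: AE_I2 intro: order_trans abs_ge_self\<close>)
      qed (rule bd)
      also have "\<dots> = 2 * (\<Sum>i<4. \<integral>x. norm ((G i (x + X n))\<^sup>2 - (G i x)\<^sup>2) \<partial>lborel)"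
        using ii by (subst integral_mult_right_zero, subst Bochner_Integration.integral_sum) auto
      finally show "(\<integral>x. (cmod (f (x + X n) - f x))\<^sup>2 \<partial>lborel) \<le> \<dots>" .
    qed
  qed simp
qed

section \<open>Plancherel for functions that are both integrable and square integrable\<close>

lemma fourier_integral_measurable [measurable]:
  assumes [measurable]: "f \<in> borel_measurable borel"
  shows "fourier_integral h f \<in> borel_measurable borel"
  unfolding fourier_integral_def by measurable

lemma norm_fourier_integral_le:
  assumes "integrable lborel f"
  shows "cmod (fourier_integral h f p) \<le> (\<integral>x. cmod (f x) \<partial>lborel)"
  unfolding fourier_integral_def
  by (rule order_trans[OF integral_norm_bound]) (simp add: norm_mult)

lemma integrable_fourier_kernel:
  assumes "integrable lborel f"
  shows "integrable lborel (\<lambda>x. exp (\<i> * of_real (p \<bullet> x)) * f x)"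
  using borel_measurable_integrable[OF assms]
  by (intro Bochner_Integration.integrable_bound[OF assms]) (auto simp: norm_mult)

lemma Re_mult_cnj_le: "\<bar>Re (a * cnj b)\<bar> \<le> ((cmod a)\<^sup>2 + (cmod b)\<^sup>2) / 2"
proof -
  have "\<bar>Re (a * cnj b)\<bar> \<le> cmod a * cmod b"
    using abs_Re_le_cmod[of "a * cnj b"] by (simp add: norm_mult)
  also have "\<dots> \<le> ((cmod a)\<^sup>2 + (cmod b)\<^sup>2) / 2"
    using sum_squares_bound[of "cmod a" "cmod b"] by simp
  finally show ?thesis .
qed

locale L12 =
  fixes f :: "real^2 \<Rightarrow> complex"
  assumes meas [measurable]: "f \<in> borel_measurable borel"
    and L1: "integrable lborel f" and L2: "integrable lborel (\<lambda>x. (cmod (f x))\<^sup>2)"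
begin

abbreviation "N2 \<equiv> (\<integral>x. (cmod (f x))\<^sup>2 \<partial>lborel)"

text \<open>Real part of the autocorrelation of \<open>f\<close>; the Gaussian-weighted norm with
  which it is compared is real, so only the real part enters.\<close>

definition A :: "real^2 \<Rightarrow> real" where "A h = (\<integral>x. Re (f x * cnj (f (x + h))) \<partial>lborel)"

lemma A_measurable [measurable]: "A \<in> borel_measurable borel"
  unfolding A_def by measurable

lemma integrable_A: "integrable lborel (\<lambda>x. Re (f x * cnj (f (x + h))))"
proof (rule Bochner_Integration.integrable_bound)
  show "integrable lborel (\<lambda>x. ((cmod (f x))\<^sup>2 + (cmod (f (x + h)))\<^sup>2) / 2)"
    using L2 integrable_shift[OF L2, of h] by auto
  show "AE x in lborel. norm (Re (f x * cnj (f (x + h)))) \<le> norm (((cmod (f x))\<^sup>2 + (cmod (f (x + h)))\<^sup>2) / 2)"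
    by (rule AE_I2) (unfold real_norm_def, rule order_trans[OF Re_mult_cnj_le abs_ge_self])
qed measurable

lemma A_bound: "\<bar>A h\<bar> \<le> N2"
proof -
  have "\<bar>A h\<bar> \<le> (\<integral>x. \<bar>Re (f x * cnj (f (x + h)))\<bar> \<partial>lborel)" unfolding A_def by (rule integral_abs_bound)
  also have "\<dots> \<le> (\<integral>x. ((cmod (f x))\<^sup>2 + (cmod (f (x + h)))\<^sup>2) / 2 \<partial>lborel)"
    using L2 integrable_shift[OF L2, of h] integrable_A[of h]
    by (intro integral_mono Re_mult_cnj_le) auto
  also have "\<dots> = N2"
    using L2 integrable_shift[OF L2, of h] integral_shift[of "\<lambda>x. (cmod (f x))\<^sup>2" h] by simp
  finally show ?thesis .
qed

text \<open>Polarization: continuity of the autocorrelation at 0 becomes continuity of translations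
  in L2.\<close>

lemma A_eq: "A h = N2 - (\<integral>x. (cmod (f (x + h) - f x))\<^sup>2 \<partial>lborel) / 2"
proof -
  have eq: "Re (a * cnj b) = ((cmod a)\<^sup>2 + (cmod b)\<^sup>2 - (cmod (b - a))\<^sup>2) / 2" for a b
    unfolding cmod_power2 by (simp add: power2_eq_square algebra_simps)
  have eq2: "(cmod (b - a))\<^sup>2 = (cmod a)\<^sup>2 + (cmod b)\<^sup>2 - 2 * Re (a * cnj b)" for a b
    unfolding eq by (simp add: field_simps)
  have i: "integrable lborel (\<lambda>x. (cmod (f (x + h)))\<^sup>2)" using integrable_shift[OF L2] .
  have "integrable lborel (\<lambda>x. (cmod (f x))\<^sup>2 + (cmod (f (x + h)))\<^sup>2 - 2 * Re (f x * cnj (f (x + h))))"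
    by (intro Bochner_Integration.integrable_diff Bochner_Integration.integrable_add L2 i
        integrable_mult_right integrable_A)
  then have i2: "integrable lborel (\<lambda>x. (cmod (f (x + h) - f x))\<^sup>2)"
    unfolding eq2 .
  have "A h = (\<integral>x. ((cmod (f x))\<^sup>2 + (cmod (f (x + h)))\<^sup>2 - (cmod (f (x + h) - f x))\<^sup>2) / 2 \<partial>lborel)"
    unfolding A_def eq ..
  also have "\<dots> = N2 - (\<integral>x. (cmod (f (x + h) - f x))\<^sup>2 \<partial>lborel) / 2"
    using L2 i i2 integral_shift[of "\<lambda>x. (cmod (f x))\<^sup>2" h] by simp
  finally show ?thesis .
qed

lemma A_tendsto: "X \<longlonglongrightarrow> 0 \<Longrightarrow> (\<lambda>n. A (X n)) \<longlonglongrightarrow> N2"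
  unfolding A_eq using tendsto_diff[OF tendsto_const tendsto_divide[OF L2_translation_continuous[OF meas L2] tendsto_const]]
  by fastforce

text \<open>Expanding the squared modulus gives a triple integral, made absolutely convergent by the
  Gaussian factor. Integrating over \<open>p\<close> leaves a Gaussian in \<open>y - x\<close>, and
  \<open>y = x + h\<close> turns the rest into the autocorrelation averaged near 0.\<close>

lemma gauss_plancherel:
  assumes t: "t > 0"
  shows "integrable lborel (\<lambda>p. exp (- t * (norm p)\<^sup>2) * (cmod (fourier_integral 1 f p))\<^sup>2)"
    and "(\<integral>p. exp (- t * (norm p)\<^sup>2) * (cmod (fourier_integral 1 f p))\<^sup>2 \<partial>lborel)
      = (\<integral>h. pi / t * exp (- (norm h)\<^sup>2 / (4 * t)) * A h \<partial>lborel)"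
proof -
  let ?F = "fourier_integral 1 f"
  let ?C = "(\<integral>x. cmod (f x) \<partial>lborel)"
  let ?L = "lborel :: (real^2) measure"
  interpret P: pair_sigma_finite ?L "?L \<Otimes>\<^sub>M ?L"
    by (intro pair_sigma_finite.intro lborel.sigma_finite_measure_axioms) 
       (simp add: lborel_prod lborel.sigma_finite_measure_axioms)
  define K where "K p z = complex_of_real (exp (- t * (norm p)\<^sup>2)) * (exp (\<i> * of_real (p \<bullet> (fst z - snd z))) * (f (fst z) * cnj (f (snd z))))" for p z
  define g where "g h = pi / t * exp (- (norm h)\<^sup>2 / (4 * t))" for h :: "real^2"
  have [measurable]: "g \<in> borel_measurable borel" unfolding g_def by measurable
  have g_nn: "0 \<le> g h" "g h \<le> pi / t" for h using t by (auto simp: g_def field_simps)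
  have cn: "integrable lborel (\<lambda>x. cnj (f x))" using L1 by simp
  have ff: "integrable (?L \<Otimes>\<^sub>M ?L) (\<lambda>z. f (fst z) * cnj (f (snd z)))"
    using integrable_prod_mult[OF lborel.sigma_finite_measure_axioms lborel.sigma_finite_measure_axioms L1 cn] by (simp add: split_beta')
  have Kint: "integrable (?L \<Otimes>\<^sub>M (?L \<Otimes>\<^sub>M ?L)) (\<lambda>(p, z). K p z)"
  proof (rule Bochner_Integration.integrable_bound)
    have "integrable lborel (\<lambda>p::real^2. complex_of_real (exp (- t * (norm p)\<^sup>2)))"
      using gauss_integrable[OF t] by simp
    from integrable_prod_mult[OF lborel.sigma_finite_measure_axioms _ this ff]
    show "integrable (?L \<Otimes>\<^sub>M (?L \<Otimes>\<^sub>M ?L)) (\<lambda>(p, z). complex_of_real (exp (- t * (norm p)\<^sup>2)) * (f (fst z) * cnj (f (snd z))))"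
      by (simp add: lborel_prod lborel.sigma_finite_measure_axioms)
    show "(\<lambda>(p, z). K p z) \<in> borel_measurable (?L \<Otimes>\<^sub>M (?L \<Otimes>\<^sub>M ?L))"
      unfolding K_def by measurable
  qed (auto intro!: AE_I2 simp: K_def norm_mult)
  have inner1: "complex_of_real (exp (- t * (norm p)\<^sup>2) * (cmod (?F p))\<^sup>2) = (\<integral>z. K p z \<partial>(?L \<Otimes>\<^sub>M ?L))" for p
  proof -
    have c: "cnj (?F p) = (\<integral>y. exp (- (\<i> * of_real (p \<bullet> y))) * cnj (f y) \<partial>lborel)"
      using integral_bounded_linear[OF bounded_linear_cnj integrable_fourier_kernel[OF L1, of p]]
      by (simp add: fourier_integral_def exp_cnj)
    have i1: "integrable lborel (\<lambda>x. exp (\<i> * of_real (p \<bullet> x)) * f x)" by (rule integrable_fourier_kernel[OF L1])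
    have i2: "integrable lborel (\<lambda>y. exp (- (\<i> * of_real (p \<bullet> y))) * cnj (f y))"
      using integrable_fourier_kernel[OF cn, of "-p"] by simp
    have "complex_of_real ((cmod (?F p))\<^sup>2) = ?F p * cnj (?F p)" by (simp only: complex_norm_square)
    also have "\<dots> = (\<integral>x. \<integral>y. (exp (\<i> * of_real (p \<bullet> x)) * f x) * (exp (- (\<i> * of_real (p \<bullet> y))) * cnj (f y)) \<partial>lborel \<partial>lborel)"
      unfolding c by (simp add: fourier_integral_def)
    also have "\<dots> = (\<integral>z. exp (\<i> * of_real (p \<bullet> (fst z - snd z))) * (f (fst z) * cnj (f (snd z))) \<partial>(?L \<Otimes>\<^sub>M ?L))"
    proof -
      have e3: "(exp (\<i> * of_real (p \<bullet> x)) * f x) * (exp (- (\<i> * of_real (p \<bullet> y))) * cnj (f y))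
          = exp (\<i> * of_real (p \<bullet> (x - y))) * (f x * cnj (f y))" for x y
        by (simp add: inner_diff_right right_diff_distrib exp_diff exp_minus field_simps)
      have "integrable (?L \<Otimes>\<^sub>M ?L) (\<lambda>z. exp (\<i> * of_real (p \<bullet> (fst z - snd z))) * (f (fst z) * cnj (f (snd z))))"
        using integrable_prod_mult[OF lborel.sigma_finite_measure_axioms lborel.sigma_finite_measure_axioms i1 i2]
        unfolding e3 by (simp only: split_beta')
      from lborel_pair.integral_fst'[OF this] show ?thesis
        unfolding e3 by simp
    qed
    finally show ?thesis by (simp add: K_def)
  qed
  have inner2: "(\<integral>p. K p z \<partial>lborel) = f (fst z) * cnj (f (snd z)) * of_real (g (snd z - fst z))" for z
  proof -
    have "(\<integral>p. K p z \<partial>lborel) = (\<integral>p. (f (fst z) * cnj (f (snd z))) * (exp (\<i> * of_real ((fst z - snd z) \<bullet> p)) * of_real (exp (- t * (norm p)\<^sup>2))) \<partial>lborel)"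
      by (rule Bochner_Integration.integral_cong) (simp_all add: K_def inner_commute)
    also have "\<dots> = f (fst z) * cnj (f (snd z)) * of_real (g (snd z - fst z))"
      by (simp only: integral_mult_right_zero gauss_ft(2)[OF t] g_def norm_minus_commute)
    finally show ?thesis .
  qed
  have bF: "(cmod (?F p))\<^sup>2 \<le> ?C\<^sup>2" for p
    by (intro power_mono norm_fourier_integral_le[OF L1]) simp
  show int: "integrable lborel (\<lambda>p. exp (- t * (norm p)\<^sup>2) * (cmod (?F p))\<^sup>2)"
  proof (rule Bochner_Integration.integrable_bound)
    show "integrable lborel (\<lambda>p::real^2. exp (- t * (norm p)\<^sup>2) * ?C\<^sup>2)" using gauss_integrable[OF t] by simp
  qed (use bF in \<open>auto intro!: AE_I2 mult_left_mono\<close>)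
  define H where "H x h = f x * cnj (f (x + h)) * of_real (g h)" for x h
  have Hb: "cmod (H x h) \<le> (cmod (f x) * (pi / t)) * cmod (f (h + x))" for x h
  proof -
    have "cmod (H x h) = cmod (f x) * cmod (f (h + x)) * g h"
      using g_nn by (simp add: H_def norm_mult add.commute)
    also have "\<dots> \<le> cmod (f x) * cmod (f (h + x)) * (pi / t)"
      using g_nn by (intro mult_left_mono) auto
    finally show ?thesis by (simp only: mult_ac)
  qed
  \<comment> \<open>Bounding \<open>g\<close> by \<open>pi / t\<close> leaves the product of
    \<open>f\<close> and a translate of \<open>f\<close>, so integrability of \<open>f\<close>
    suffices.\<close>
  have Hint: "integrable (?L \<Otimes>\<^sub>M ?L) (\<lambda>(x, h). H x h)"
  proof (rule lborel_pair.Fubini_integrable)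
    show "(\<lambda>(x, h). H x h) \<in> borel_measurable (?L \<Otimes>\<^sub>M ?L)" unfolding H_def by measurable
    have i: "integrable lborel (\<lambda>h. H x h)" for x
    proof (rule Bochner_Integration.integrable_bound)
      show "integrable lborel (\<lambda>h. (cmod (f x) * (pi / t)) * cmod (f (h + x)))"
        using integrable_shift[OF L1, of x] by simp
      show "AE h in lborel. norm (H x h) \<le> norm ((cmod (f x) * (pi / t)) * cmod (f (h + x)))"
        using Hb by (intro AE_I2) (metis abs_ge_self order_trans real_norm_def)
    qed (simp add: H_def)
    then show "AE x in lborel. integrable lborel (\<lambda>h. case (x, h) of (x, h) \<Rightarrow> H x h)" by simp
    show "integrable lborel (\<lambda>x. \<integral>h. norm (case (x, h) of (x, h) \<Rightarrow> H x h) \<partial>lborel)"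
    proof (rule Bochner_Integration.integrable_bound)
      show "integrable lborel (\<lambda>x. cmod (f x) * (pi / t * ?C))" using L1 by simp
      show "AE x in lborel. norm (\<integral>h. norm (case (x, h) of (x, h) \<Rightarrow> H x h) \<partial>lborel) \<le> norm (cmod (f x) * (pi / t * ?C))"
      proof (rule AE_I2)
        fix x
        have "(\<integral>h. norm (H x h) \<partial>lborel) \<le> (\<integral>h. (cmod (f x) * (pi / t)) * cmod (f (h + x)) \<partial>lborel)"
          using integrable_shift[OF L1, of x] i[of x] by (intro integral_mono Hb) auto
        also have "\<dots> = cmod (f x) * (pi / t * ?C)"
          using integral_shift[of "\<lambda>h. cmod (f h)" x] by simp
        finally show "norm (\<integral>h. norm (case (x, h) of (x, h) \<Rightarrow> H x h) \<partial>lborel) \<le> norm (cmod (f x) * (pi / t * ?C))"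
          using t by (simp add: abs_of_nonneg)
      qed
    qed (unfold H_def, measurable)
  qed
  have "complex_of_real (\<integral>p. exp (- t * (norm p)\<^sup>2) * (cmod (?F p))\<^sup>2 \<partial>lborel) = (\<integral>p. \<integral>z. K p z \<partial>(?L \<Otimes>\<^sub>M ?L) \<partial>lborel)"
    by (simp only: integral_complex_of_real[symmetric] inner1)
  also have "\<dots> = (\<integral>z. \<integral>p. K p z \<partial>lborel \<partial>(?L \<Otimes>\<^sub>M ?L))"
    by (rule P.Fubini_integral[OF Kint, symmetric])
  also have "\<dots> = (\<integral>z. f (fst z) * cnj (f (snd z)) * of_real (g (snd z - fst z)) \<partial>(?L \<Otimes>\<^sub>M ?L))"
    by (simp only: inner2)
  also have "\<dots> = (\<integral>x. \<integral>y. f x * cnj (f y) * of_real (g (y - x)) \<partial>lborel \<partial>lborel)"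
  proof (subst lborel_pair.integral_fst'[symmetric])
    show "integrable (?L \<Otimes>\<^sub>M ?L) (\<lambda>z. f (fst z) * cnj (f (snd z)) * of_real (g (snd z - fst z)))"
    proof (rule Bochner_Integration.integrable_bound)
      show "integrable (?L \<Otimes>\<^sub>M ?L) (\<lambda>z. complex_of_real (pi / t) * (f (fst z) * cnj (f (snd z))))"
        by (rule integrable_mult_right[OF ff])
      have "cmod (u * of_real (g h)) \<le> cmod (of_real (pi / t) * u)" for u h
      proof -
        have "cmod (u * of_real (g h)) = g h * cmod u" using g_nn by (simp add: norm_mult)
        also have "\<dots> \<le> pi / t * cmod u" using g_nn by (intro mult_right_mono) auto
        also have "\<dots> = cmod (of_real (pi / t) * u)"
          unfolding norm_mult norm_of_real using t by simp
        finally show ?thesis .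
      qed
      then show "AE z in ?L \<Otimes>\<^sub>M ?L. norm (f (fst z) * cnj (f (snd z)) * of_real (g (snd z - fst z)))
          \<le> norm (complex_of_real (pi / t) * (f (fst z) * cnj (f (snd z))))"
        by (intro AE_I2)
    qed measurable
  qed simp
  also have "\<dots> = (\<integral>x. \<integral>h. H x h \<partial>lborel \<partial>lborel)"
  proof (rule Bochner_Integration.integral_cong[OF refl])
    fix x
    show "(\<integral>y. f x * cnj (f y) * of_real (g (y - x)) \<partial>lborel) = (\<integral>h. H x h \<partial>lborel)"
      using integral_shift[of "\<lambda>y. f x * cnj (f y) * of_real (g (y - x))" x]
      unfolding H_def by (simp add: add.commute)
  qed
  also have "\<dots> = (\<integral>h. \<integral>x. H x h \<partial>lborel \<partial>lborel)"
    by (rule lborel_pair.Fubini_integral[OF Hint, symmetric])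
  finally have eq: "complex_of_real (\<integral>p. exp (- t * (norm p)\<^sup>2) * (cmod (?F p))\<^sup>2 \<partial>lborel) = (\<integral>h. \<integral>x. H x h \<partial>lborel \<partial>lborel)" .
  have i3: "integrable lborel (\<lambda>h. \<integral>x. H x h \<partial>lborel)"
    using lborel_pair.integrable_snd[OF Hint] .
  have i4: "integrable lborel (\<lambda>x. H x h)" for h
  proof (rule Bochner_Integration.integrable_bound)
    show "integrable lborel (\<lambda>x. pi / t * (((cmod (f x))\<^sup>2 + (cmod (f (x + h)))\<^sup>2) / 2))"
      using L2 integrable_shift[OF L2, of h] by auto
    have "cmod (H x h) \<le> pi / t * (((cmod (f x))\<^sup>2 + (cmod (f (x + h)))\<^sup>2) / 2)" for x
    proof -
      have "cmod (H x h) = g h * (cmod (f x) * cmod (f (x + h)))" using g_nn by (simp add: H_def norm_mult)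
      also have "\<dots> \<le> pi / t * (((cmod (f x))\<^sup>2 + (cmod (f (x + h)))\<^sup>2) / 2)"
        using g_nn t sum_squares_bound[of "cmod (f x)" "cmod (f (x + h))"] by (intro mult_mono) auto
      finally show ?thesis .
    qed
    then show "AE x in lborel. norm (H x h) \<le> norm (pi / t * (((cmod (f x))\<^sup>2 + (cmod (f (x + h)))\<^sup>2) / 2))"
      by (intro AE_I2) (metis abs_ge_self order_trans real_norm_def)
  qed (simp add: H_def)
  \<comment> \<open>The left side of \<open>eq\<close> is real, so nothing is lost by taking real
    parts, and this is what produces \<open>A\<close>.\<close>
  have "(\<integral>p. exp (- t * (norm p)\<^sup>2) * (cmod (?F p))\<^sup>2 \<partial>lborel) = Re (\<integral>h. \<integral>x. H x h \<partial>lborel \<partial>lborel)"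
    by (simp add: eq[symmetric])
  also have "\<dots> = (\<integral>h. \<integral>x. Re (H x h) \<partial>lborel \<partial>lborel)"
    using i3 i4 by simp
  also have "\<dots> = (\<integral>h. g h * A h \<partial>lborel)"
  proof (rule Bochner_Integration.integral_cong[OF refl])
    fix h
    have "Re (H x h) = g h * Re (f x * cnj (f (x + h)))" for x by (simp add: H_def algebra_simps)
    then show "(\<integral>x. Re (H x h) \<partial>lborel) = g h * A h" by (simp add: A_def)
  qed
  finally show "(\<integral>p. exp (- t * (norm p)\<^sup>2) * (cmod (?F p))\<^sup>2 \<partial>lborel) = (\<integral>h. pi / t * exp (- (norm h)\<^sup>2 / (4 * t)) * A h \<partial>lborel)"
    by (simp add: g_def)
qed

end

context L12 begin

text \<open>As \<open>t\<close> tends to 0, the right side of the regularized identity averages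
  \<open>A\<close> against a Gaussian shrinking to the origin and tends to
  \<open>(2 * pi)\<^sup>2\<close> times \<open>A 0\<close>. The left side increases, so monotone
  convergence proves at the same time that the transform is square integrable.\<close>

lemma plancherel: "(\<integral>\<^sup>+p. ennreal ((cmod (fourier_integral 1 f p))\<^sup>2) \<partial>lborel) = ennreal ((2 * pi)\<^sup>2 * N2)"
proof -
  let ?F = "fourier_integral 1 f"
  \<comment> \<open>A decreasing null sequence with explicit square roots:
    \<open>c n = 2 * sqrt (t n)\<close> is the width by which \<open>h\<close> is rescaled, and its
    square cancels the denominator of \<open>pi / t n\<close>.\<close>
  define t where "t n = 1 / (real (Suc n))\<^sup>2" for n
  define c where "c n = 2 / real (Suc n)" for n
  have t: "t n > 0" for n by (simp add: t_def)
  have c: "c n > 0" for n by (simp add: c_def)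
  have t_c: "4 * t n = (c n)\<^sup>2" for n by (simp add: t_def c_def power_divide)
  have int_eq: "(\<integral>h. pi / t n * exp (- (norm h)\<^sup>2 / (4 * t n)) * A h \<partial>lborel)
      = (\<integral>h. 4 * pi * exp (- (norm h)\<^sup>2) * A (c n *\<^sub>R h) \<partial>lborel)" for n
  proof -
    have "(\<integral>h. pi / t n * exp (- (norm h)\<^sup>2 / (4 * t n)) * A h \<partial>(lborel :: (real^2) measure))
      = (\<integral>h. pi / t n * exp (- (norm h)\<^sup>2 / (4 * t n)) * A h \<partial>density (distr lborel borel (\<lambda>x::real^2. 0 + c n *\<^sub>R x)) (\<lambda>_. ennreal (\<bar>c n\<bar> ^ DIM(real^2))))"
      using lborel_affine[of "c n" "0::real^2"] c[of n] by simp
    also have "\<dots> = (\<integral>h. (c n)\<^sup>2 * (pi / t n * exp (- (norm (c n *\<^sub>R h))\<^sup>2 / (4 * t n)) * A (c n *\<^sub>R h)) \<partial>lborel)"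
      using c[of n] by (subst integral_density) (simp_all add: integral_distr)
    also have "\<dots> = (\<integral>h. 4 * pi * exp (- (norm h)\<^sup>2) * A (c n *\<^sub>R h) \<partial>lborel)"
      using c[of n] t[of n] by (intro Bochner_Integration.integral_cong refl) (simp add: power_mult_distrib t_c[symmetric])
    finally show ?thesis .
  qed
  have g1: "integrable lborel (\<lambda>h::real^2. exp (- (norm h)\<^sup>2))"
    using gauss_integrable[of 1] by simp
  have g2: "(\<integral>h. exp (- (norm h)\<^sup>2) \<partial>(lborel :: (real^2) measure)) = pi"
  proof -
    have "ennreal (\<integral>h. exp (- (norm h)\<^sup>2) \<partial>(lborel :: (real^2) measure)) = ennreal pi"
      using nn_integral_gauss[of 1] nn_integral_eq_integral[OF g1] by simp
    then show ?thesis by simp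
  qed
  have "(\<lambda>n. \<integral>h. 4 * pi * exp (- (norm h)\<^sup>2) * A (c n *\<^sub>R h) \<partial>lborel)
      \<longlonglongrightarrow> (\<integral>h. 4 * pi * exp (- (norm h)\<^sup>2) * N2 \<partial>(lborel :: (real^2) measure))"
  proof (rule integral_dominated_convergence[where w="\<lambda>h. 4 * pi * exp (- (norm h)\<^sup>2) * N2"])
    show "integrable lborel (\<lambda>h::real^2. 4 * pi * exp (- (norm h)\<^sup>2) * N2)" using g1 by simp
    have c0: "c \<longlonglongrightarrow> 0"
      unfolding c_def by (rule lim_const_over_n[THEN LIMSEQ_Suc])
    show "AE h in lborel. (\<lambda>n. 4 * pi * exp (- (norm h)\<^sup>2) * A (c n *\<^sub>R h)) \<longlonglongrightarrow> 4 * pi * exp (- (norm h)\<^sup>2) * N2"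
    proof (rule AE_I2)
      fix h :: "real^2"
      have "(\<lambda>n. c n *\<^sub>R h) \<longlonglongrightarrow> 0" using tendsto_scaleR[OF c0 tendsto_const, of h] by simp
      from A_tendsto[OF this] show "(\<lambda>n. 4 * pi * exp (- (norm h)\<^sup>2) * A (c n *\<^sub>R h)) \<longlonglongrightarrow> 4 * pi * exp (- (norm h)\<^sup>2) * N2"
        by (intro tendsto_intros)
    qed
    show "AE h in lborel. norm (4 * pi * exp (- (norm h)\<^sup>2) * A (c n *\<^sub>R h)) \<le> 4 * pi * exp (- (norm h)\<^sup>2) * N2" for n
      using A_bound by (intro AE_I2) (simp add: abs_mult)
  qed measurable
  moreover have "(\<integral>h. 4 * pi * exp (- (norm h)\<^sup>2) * N2 \<partial>(lborel :: (real^2) measure)) = (2 * pi)\<^sup>2 * N2"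
    using g2 by (simp add: power2_eq_square)
  ultimately have lim1: "(\<lambda>n. \<integral>p. exp (- t n * (norm p)\<^sup>2) * (cmod (?F p))\<^sup>2 \<partial>lborel) \<longlonglongrightarrow> (2 * pi)\<^sup>2 * N2"
    by (simp only: gauss_plancherel(2)[OF t] int_eq)
  have lim2: "(\<lambda>n. \<integral>\<^sup>+p. ennreal (exp (- t n * (norm p)\<^sup>2) * (cmod (?F p))\<^sup>2) \<partial>lborel)
     \<longlonglongrightarrow> (\<integral>\<^sup>+p. ennreal ((cmod (?F p))\<^sup>2) \<partial>lborel)"
  proof (rule nn_integral_LIMSEQ)
    have dec: "t n \<le> t m" if "m \<le> n" for m n
      unfolding t_def using that by (intro divide_left_mono power_mono mult_pos_pos) auto
    show "incseq (\<lambda>n p. ennreal (exp (- t n * (norm p)\<^sup>2) * (cmod (?F p))\<^sup>2))"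
      by (intro incseq_SucI le_funI ennreal_leI mult_right_mono) (use dec in \<open>auto intro!: mult_right_mono\<close>)
    have t0: "t \<longlonglongrightarrow> 0"
    proof -
      have "(\<lambda>n. 1 / real (Suc n) * (1 / real (Suc n))) \<longlonglongrightarrow> 0 * 0"
        by (intro tendsto_mult lim_const_over_n[THEN LIMSEQ_Suc])
      then show ?thesis by (simp add: t_def[abs_def] power2_eq_square)
    qed
    show "(\<lambda>n. ennreal (exp (- t n * (norm p)\<^sup>2) * (cmod (?F p))\<^sup>2)) \<longlonglongrightarrow> ennreal ((cmod (?F p))\<^sup>2)" for p
    proof -
      have "(\<lambda>n. exp (- t n * (norm p)\<^sup>2) * (cmod (?F p))\<^sup>2) \<longlonglongrightarrow> exp (- 0 * (norm p)\<^sup>2) * (cmod (?F p))\<^sup>2"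
        by (intro tendsto_intros t0)
      then show ?thesis by (intro tendsto_ennrealI) simp
    qed
  qed measurable
  have "(\<integral>\<^sup>+p. ennreal (exp (- t n * (norm p)\<^sup>2) * (cmod (?F p))\<^sup>2) \<partial>lborel)
     = ennreal (\<integral>p. exp (- t n * (norm p)\<^sup>2) * (cmod (?F p))\<^sup>2 \<partial>lborel)" for n
    by (rule nn_integral_eq_integral[OF gauss_plancherel(1)[OF t]]) simp
  with lim2 tendsto_ennrealI[OF lim1] show ?thesis
    by (simp only: LIMSEQ_unique)
qed

end

section \<open>Plancherel for transforms defined as limits in mean\<close>

lemma ennreal_cmod_add_sq_le:
  assumes "t > 0"
  shows "ennreal ((cmod (a + b))\<^sup>2) \<le> ennreal (1 + t) * ennreal ((cmod a)\<^sup>2) + ennreal (1 + 1 / t) * ennreal ((cmod b)\<^sup>2)"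
proof -
  have "(cmod (a + b))\<^sup>2 \<le> (cmod a + cmod b)\<^sup>2" by (intro power_mono norm_triangle_ineq) simp
  also have "\<dots> \<le> (1 + t) * (cmod a)\<^sup>2 + (1 + 1 / t) * (cmod b)\<^sup>2"
  proof -
    have "0 \<le> (sqrt t * cmod a - cmod b / sqrt t)\<^sup>2" by simp
    also have "\<dots> = t * (cmod a)\<^sup>2 + (cmod b)\<^sup>2 / t - 2 * (cmod a * cmod b)"
      using assms by (simp add: power2_diff power_mult_distrib power_divide)
    finally show ?thesis by (simp add: power2_sum algebra_simps)
  qed
  finally show ?thesis
    using assms by (simp add: ennreal_mult[symmetric] ennreal_plus[symmetric] ennreal_leI del: ennreal_plus)
qed

text \<open>Limits in mean preserve the norm. In place of the triangle inequality for square roots,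
  the bound with weights \<open>1 + t\<close> and \<open>1 + 1 / t\<close> is used in both
  directions: \<open>R\<close> goes to infinity at fixed \<open>t\<close>, and then \<open>t\<close>
  goes to 0.\<close>

lemma nn_integral_L2_limit:
  fixes F :: "real \<Rightarrow> 'a::euclidean_space \<Rightarrow> complex"
  assumes [measurable]: "\<And>R. F R \<in> borel_measurable borel" "\<phi> \<in> borel_measurable borel"
    and lim: "((\<lambda>R. \<integral>\<^sup>+p. ennreal ((cmod (F R p - \<phi> p))\<^sup>2) \<partial>lborel) \<longlongrightarrow> 0) at_top"
    and limN: "((\<lambda>R. \<integral>\<^sup>+p. ennreal ((cmod (F R p))\<^sup>2) \<partial>lborel) \<longlongrightarrow> ennreal c) at_top"
    and c: "c \<ge> 0"
  shows "(\<integral>\<^sup>+p. ennreal ((cmod (\<phi> p))\<^sup>2) \<partial>lborel) = ennreal c"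
proof -
  let ?n = "\<lambda>f. \<integral>\<^sup>+p. ennreal ((cmod (f p))\<^sup>2) \<partial>(lborel :: 'a measure)"
  have tri: "?n (\<lambda>p. f p + g p) \<le> ennreal (1 + t) * ?n f + ennreal (1 + 1 / t) * ?n g"
    if [measurable]: "f \<in> borel_measurable borel" "g \<in> borel_measurable borel" and "t > 0" for f g t
    using ennreal_cmod_add_sq_le[OF \<open>t > 0\<close>]
    by (subst (1 2) nn_integral_cmult[symmetric], simp, simp, subst nn_integral_add[symmetric])
       (auto intro!: nn_integral_mono)
  have up: "?n \<phi> \<le> ennreal (1 + t) * ennreal c" and lo: "ennreal c \<le> ennreal (1 + t) * ?n \<phi>" if "t > 0" for t :: real
  proof -
    have l: "((\<lambda>R. ennreal (1 + t) * ?n (F R) + ennreal (1 + 1 / t) * ?n (\<lambda>p. F R p - \<phi> p)) \<longlongrightarrow> ennreal (1 + t) * ennreal c + ennreal (1 + 1 / t) * 0) at_top"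
      by (intro tendsto_intros ennreal_tendsto_cmult limN lim) auto
    show "?n \<phi> \<le> ennreal (1 + t) * ennreal c"
    proof (rule tendsto_le[OF _ _ tendsto_const])
      show "((\<lambda>R. ennreal (1 + t) * ?n (F R) + ennreal (1 + 1 / t) * ?n (\<lambda>p. F R p - \<phi> p)) \<longlongrightarrow> ennreal (1 + t) * ennreal c) at_top"
        using l by simp
      show "\<forall>\<^sub>F R in at_top. ?n \<phi> \<le> ennreal (1 + t) * ?n (F R) + ennreal (1 + 1 / t) * ?n (\<lambda>p. F R p - \<phi> p)"
        using tri[of "F R" "\<lambda>p. \<phi> p - F R p" t for R] \<open>t > 0\<close> by (intro always_eventually allI) (simp add: norm_minus_commute)
    qed simp
    have l2: "((\<lambda>R. ennreal (1 + t) * ?n \<phi> + ennreal (1 + 1 / t) * ?n (\<lambda>p. F R p - \<phi> p)) \<longlongrightarrow> ennreal (1 + t) * ?n \<phi> + ennreal (1 + 1 / t) * 0) at_top"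
      by (intro tendsto_intros ennreal_tendsto_cmult lim) auto
    show "ennreal c \<le> ennreal (1 + t) * ?n \<phi>"
    proof (rule tendsto_le[OF _ _ limN])
      show "((\<lambda>R. ennreal (1 + t) * ?n \<phi> + ennreal (1 + 1 / t) * ?n (\<lambda>p. F R p - \<phi> p)) \<longlongrightarrow> ennreal (1 + t) * ?n \<phi>) at_top"
        using l2 by simp
      show "\<forall>\<^sub>F R in at_top. ?n (F R) \<le> ennreal (1 + t) * ?n \<phi> + ennreal (1 + 1 / t) * ?n (\<lambda>p. F R p - \<phi> p)"
        using tri[of "\<phi>" "\<lambda>p. F R p - \<phi> p" t for R] \<open>t > 0\<close> by (intro always_eventually allI) simp
    qed simp
  qed
  have "?n \<phi> < \<infinity>" 
  proof -
    have "?n \<phi> \<le> ennreal (2 * c)" using up[of 1] c by (simp add: ennreal_mult'')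
    then show ?thesis by (rule le_less_trans) simp
  qed
  then obtain d where d: "?n \<phi> = ennreal d" "d \<ge> 0" by (cases "?n \<phi>") auto
  have "d \<le> (1 + t) * c" "c \<le> (1 + t) * d" if "t > 0" for t
    using up[OF that] lo[OF that] that c d by (simp_all add: ennreal_mult[symmetric] del: ennreal_plus)
  note b = this
  have "d \<le> c"
  proof (rule field_le_epsilon)
    fix e :: real assume e: "e > 0"
    have "(1 + e / (c + 1)) * c \<le> c + e"
      using e c mult_left_mono[of "c / (c + 1)" 1 e] by (simp add: algebra_simps divide_le_eq_1)
    with b(1)[of "e / (c + 1)"] e c show "d \<le> c + e" by simp
  qed
  moreover have "c \<le> d"
  proof (rule field_le_epsilon)
    fix e :: real assume e: "e > 0"
    have "(1 + e / (d + 1)) * d \<le> d + e"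
      using e d mult_left_mono[of "d / (d + 1)" 1 e] by (simp add: algebra_simps divide_le_eq_1)
    with b(2)[of "e / (d + 1)"] e d show "c \<le> d + e" by simp
  qed
  ultimately show ?thesis using d by simp
qed

text \<open>A function cut off to a ball is integrable as well as square integrable, so the identity
  holds for it. Both sides then pass to the limit in \<open>R\<close>, the transform side by the
  definition of \<open>has_fourier_transform\<close>.\<close>

lemma plancherel_L2:
  assumes sq: "square_integrable \<psi>" and ft: "has_fourier_transform 1 \<psi> \<phi>"
  shows "(\<integral>\<^sup>+p. ennreal ((cmod (\<phi> p))\<^sup>2) \<partial>lborel) = ennreal ((2 * pi)\<^sup>2 * (\<integral>x. (cmod (\<psi> x))\<^sup>2 \<partial>lborel))"
proof -
  have [measurable]: "\<psi> \<in> borel_measurable borel" and L2: "integrable lborel (\<lambda>x. (cmod (\<psi> x))\<^sup>2)"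
    using sq by (simp_all add: square_integrable_def)
  have [measurable]: "\<phi> \<in> borel_measurable borel" using ft by (simp add: has_fourier_transform_def square_integrable_def)
  define g where "g R x = indicator (cball 0 R) x * \<psi> x" for R x
  have [measurable]: "cball (0::real^2) R \<in> sets borel" for R by simp
  have [measurable]: "g R \<in> borel_measurable borel" for R unfolding g_def by measurable
  have cm: "cmod (g R x) = indicator (cball 0 R) x * cmod (\<psi> x)" for R x
    by (simp add: g_def norm_mult indicator_def)
  have gL2: "integrable lborel (\<lambda>x. (cmod (g R x))\<^sup>2)" for R
    by (rule Bochner_Integration.integrable_bound[OF L2])
       (auto intro!: AE_I2 simp: cm power_mult_distrib split: split_indicator)
  have gL1: "integrable lborel (g R)" for R
  proof (rule Bochner_Integration.integrable_bound)
    have "integrable lborel (indicator (cball 0 R) :: real^2 \<Rightarrow> real)"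
      using emeasure_lborel_cball_finite[of 0 R] by (simp add: integrable_indicator_iff)
    then show "integrable lborel (\<lambda>x. indicator (cball 0 R) x + (cmod (\<psi> x))\<^sup>2)" using L2 by simp
    \<comment> \<open>This elementary bound puts square integrable functions into L1 on sets of
      finite measure.\<close>
    have "u \<le> 1 + u\<^sup>2" for u :: real
      using zero_le_power2[of "u - 1/2"] by (simp add: power2_eq_square algebra_simps)
    then show "AE x in lborel. norm (g R x) \<le> norm (indicator (cball 0 R) x + (cmod (\<psi> x))\<^sup>2)"
      by (intro AE_I2) (auto simp: cm split: split_indicator)
  qed measurable
  have pl: "(\<integral>\<^sup>+p. ennreal ((cmod (fourier_integral 1 (g R) p))\<^sup>2) \<partial>lborel) = ennreal ((2 * pi)\<^sup>2 * (\<integral>x. (cmod (g R x))\<^sup>2 \<partial>lborel))" for R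
    using L12.plancherel[OF L12.intro[OF _ gL1 gL2]] by simp
  have "((\<lambda>R. \<integral>x. (cmod (g R x))\<^sup>2 \<partial>lborel) \<longlongrightarrow> (\<integral>x. (cmod (\<psi> x))\<^sup>2 \<partial>lborel)) at_top"
  proof (rule integral_dominated_convergence_at_top[where w="\<lambda>x. (cmod (\<psi> x))\<^sup>2"])
    show "\<forall>\<^sub>F R in at_top. AE x in lborel. norm ((cmod (g R x))\<^sup>2) \<le> (cmod (\<psi> x))\<^sup>2"
      by (intro always_eventually allI AE_I2) (auto simp: cm split: split_indicator)
    show "AE x in lborel. ((\<lambda>R. (cmod (g R x))\<^sup>2) \<longlongrightarrow> (cmod (\<psi> x))\<^sup>2) at_top"
    proof (rule AE_I2, rule tendsto_eventually)
      fix x :: "real^2"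
      show "\<forall>\<^sub>F R in at_top. (cmod (g R x))\<^sup>2 = (cmod (\<psi> x))\<^sup>2"
        using eventually_ge_at_top[of "norm x"] by eventually_elim (simp add: cm)
    qed
  qed (use L2 in auto)
  then have "((\<lambda>R. ennreal ((2 * pi)\<^sup>2 * (\<integral>x. (cmod (g R x))\<^sup>2 \<partial>lborel))) \<longlongrightarrow> ennreal ((2 * pi)\<^sup>2 * (\<integral>x. (cmod (\<psi> x))\<^sup>2 \<partial>lborel))) at_top"
    by (intro tendsto_intros)
  then have limN: "((\<lambda>R. \<integral>\<^sup>+p. ennreal ((cmod (fourier_integral 1 (g R) p))\<^sup>2) \<partial>lborel) \<longlongrightarrow> ennreal ((2 * pi)\<^sup>2 * (\<integral>x. (cmod (\<psi> x))\<^sup>2 \<partial>lborel))) at_top"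
    by (simp only: pl)
  show ?thesis
  proof (rule nn_integral_L2_limit[OF _ _ _ limN])
    show "((\<lambda>R. \<integral>\<^sup>+p. ennreal ((cmod (fourier_integral 1 (g R) p - \<phi> p))\<^sup>2) \<partial>lborel) \<longlongrightarrow> 0) at_top"
      using ft by (simp add: has_fourier_transform_def g_def[abs_def])
  qed simp_all
qed

section \<open>The potential in momentum space\<close>

text \<open>The substitution \<open>s = exp u\<close> is made on compact intervals, and monotone
  convergence exhausts the half-line on one side and the line on the other; the integral may be
  infinite.\<close>

lemma nn_integral_lborel_exp:
  fixes f :: "real \<Rightarrow> ennreal"
  assumes [measurable]: "f \<in> borel_measurable borel"
  shows "(\<integral>\<^sup>+s. f s * indicator {0<..} s \<partial>lborel) = (\<integral>\<^sup>+u. f (exp u) * ennreal (exp u) \<partial>lborel)"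
proof -
  define I where "I n = {exp (- real (Suc n))..exp (real (Suc n))}" for n
  have "(\<lambda>n. \<integral>\<^sup>+s. f s * indicator (I n) s \<partial>lborel) \<longlonglongrightarrow> (\<integral>\<^sup>+s. f s * indicator {0<..} s \<partial>lborel)"
  proof (rule nn_integral_LIMSEQ)
    show "incseq (\<lambda>n s. f s * indicator (I n) s)"
    proof (intro incseq_SucI le_funI mult_left_mono)
      fix n and s :: real
      have "I n \<subseteq> I (Suc n)" unfolding I_def by (intro atLeastatMost_subset_iff[THEN iffD2]) simp
      then show "indicator (I n) s \<le> (indicator (I (Suc n)) s :: ennreal)"
        by (auto split: split_indicator)
    qed simp
    fix s :: real
    show "(\<lambda>n. f s * indicator (I n) s) \<longlonglongrightarrow> f s * indicator {0<..} s"
    proof (cases "s > 0")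
      case True
      obtain N :: nat where N: "\<bar>ln s\<bar> \<le> real N" using real_arch_simple by blast
      have "s \<in> I n" if "n \<ge> N" for n
      proof -
        have "- real (Suc n) \<le> ln s" "ln s \<le> real (Suc n)" using N that by auto
        then have "exp (- real (Suc n)) \<le> exp (ln s)" "exp (ln s) \<le> exp (real (Suc n))" by (simp_all only: exp_le_cancel_iff)
        then show ?thesis using True by (simp add: I_def)
      qed
      then show ?thesis using True
        by (intro tendsto_eventually eventually_sequentiallyI[of N]) simp
    next
      case False
      then have "s \<notin> I n" for n using less_le_trans[OF exp_gt_zero, of "- real (Suc n)" s] by (auto simp: I_def)
      then show ?thesis using False by simp
    qed
  qed (simp add: I_def)
  moreover have "(\<lambda>n. \<integral>\<^sup>+u. f (exp u) * ennreal (exp u) * indicator {- real (Suc n)..real (Suc n)} u \<partial>lborel) \<longlonglongrightarrow> (\<integral>\<^sup>+u. f (exp u) * ennreal (exp u) \<partial>lborel)"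
  proof (rule nn_integral_LIMSEQ)
    show "incseq (\<lambda>n u. f (exp u) * ennreal (exp u) * indicator {- real (Suc n)..real (Suc n)} u)"
      by (intro incseq_SucI le_funI mult_left_mono) (auto split: split_indicator)
    fix u :: real
    obtain N :: nat where N: "\<bar>u\<bar> \<le> real N" using real_arch_simple by blast
    have "u \<in> {- real (Suc n)..real (Suc n)}" if "n \<ge> N" for n using N that by auto
    then show "(\<lambda>n. f (exp u) * ennreal (exp u) * indicator {- real (Suc n)..real (Suc n)} u) \<longlonglongrightarrow> f (exp u) * ennreal (exp u)"
      by (intro tendsto_eventually eventually_sequentiallyI[of N]) (simp only: indicator_simps mult_1_right)
  qed simp
  moreover have "(\<integral>\<^sup>+s. f s * indicator (I n) s \<partial>lborel) = (\<integral>\<^sup>+u. f (exp u) * ennreal (exp u) * indicator {- real (Suc n)..real (Suc n)} u \<partial>lborel)" for n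
    unfolding I_def
    by (rule nn_integral_substitution_aux) (auto intro!: derivative_eq_intros continuous_intros)
  ultimately show ?thesis by (simp only: LIMSEQ_unique)
qed

lemma borel_measurable_cosh [measurable (raw)]:
  fixes f :: "'a \<Rightarrow> real"
  assumes [measurable]: "f \<in> borel_measurable M"
  shows "(\<lambda>x. cosh (f x)) \<in> borel_measurable M"
  unfolding cosh_def by measurable

text \<open>The substitution \<open>s = r * exp t / 2\<close> in the integral for \<open>K\<^sub>0 r\<close>.\<close>

definition heat_K0 :: "real \<Rightarrow> ennreal" where
  "heat_K0 r = (\<integral>\<^sup>+s. ennreal (exp (- s - r\<^sup>2 / (4 * s)) / (2 * s)) * indicator {0<..} s \<partial>lborel)"

lemma heat_K0_measurable [measurable]: "heat_K0 \<in> borel_measurable borel"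
  unfolding heat_K0_def by measurable

lemma bessel_K0_measurable [measurable]: "bessel_K0 \<in> borel_measurable borel"
  unfolding bessel_K0_def set_lebesgue_integral_def by measurable

lemma bessel_K0_nonneg: "bessel_K0 r \<ge> 0"
  unfolding bessel_K0_def set_lebesgue_integral_def by (rule integral_nonneg_AE) auto

text \<open>The substitution is carried out in \<open>ennreal\<close>, where convergence is no
  issue, and \<open>bessel_K0 r\<close> is the real value of the result. An infinite integral would
  have real value 0, so the statement is an inequality, which is the direction that an upper bound
  for the potential needs.\<close>

lemma bessel_K0_le_heat:
  assumes r: "r > 0"
  shows "ennreal (bessel_K0 r) \<le> heat_K0 r"
proof -
  define G where "G u = ennreal (exp (- r * cosh u))" for u
  have [measurable]: "G \<in> borel_measurable borel" unfolding G_def cosh_def by measurable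
  \<comment> \<open>Shifting \<open>u\<close> by \<open>l\<close> turns \<open>exp u\<close> into
    \<open>r * exp u / 2\<close>, which makes the exponent \<open>- r * cosh u\<close>. Evenness of
    \<open>cosh\<close> then compensates the factor 1/2 when the integral is restricted to
    \<open>u > 0\<close>.\<close>
  define l where "l = ln (r / 2)"
  have l: "exp l = r / 2" using r by (simp add: l_def)
  have half: "(\<integral>\<^sup>+u. G u * indicator {..<0} u \<partial>lborel) = (\<integral>\<^sup>+u. G u * indicator {0<..} u \<partial>lborel)"
    by (subst nn_integral_real_affine[of _ "-1" 0]) (auto intro!: nn_integral_cong simp: G_def split: split_indicator)
  have "heat_K0 r = (\<integral>\<^sup>+u. ennreal (exp (- exp u - r\<^sup>2 / (4 * exp u)) / (2 * exp u)) * ennreal (exp u) \<partial>lborel)"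
    unfolding heat_K0_def by (rule nn_integral_lborel_exp) measurable
  also have "\<dots> = (\<integral>\<^sup>+u. ennreal (exp (- exp u - r\<^sup>2 / (4 * exp u)) / 2) \<partial>lborel)"
    by (intro nn_integral_cong) (simp add: ennreal_mult[symmetric])
  also have "\<dots> = (\<integral>\<^sup>+u. ennreal (exp (- exp (u + l) - r\<^sup>2 / (4 * exp (u + l))) / 2) \<partial>lborel)"
    by (rule nn_integral_shift[symmetric]) measurable
  also have "\<dots> = (\<integral>\<^sup>+u. ennreal (1 / 2) * G u \<partial>lborel)"
  proof (intro nn_integral_cong)
    fix u :: real
    have "- exp (u + l) - r\<^sup>2 / (4 * exp (u + l)) = - r * cosh u"
      using r by (simp add: exp_add l cosh_def exp_minus field_simps power2_eq_square)
    then show "ennreal (exp (- exp (u + l) - r\<^sup>2 / (4 * exp (u + l))) / 2) = ennreal (1 / 2) * G u"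
      unfolding G_def by (subst ennreal_mult[symmetric]) simp_all
  qed
  also have "\<dots> = ennreal (1 / 2) * (\<integral>\<^sup>+u. G u \<partial>lborel)" by (rule nn_integral_cmult) measurable
  also have "(\<integral>\<^sup>+u. G u \<partial>lborel) = (\<integral>\<^sup>+u. G u * indicator {..<0} u + G u * indicator {0<..} u \<partial>lborel)"
    by (intro nn_integral_cong_AE AE_I[where N="{0}"]) (auto split: split_indicator)
  also have "\<dots> = (\<integral>\<^sup>+u. G u * indicator {..<0} u \<partial>lborel) + (\<integral>\<^sup>+u. G u * indicator {0<..} u \<partial>lborel)"
    by (rule nn_integral_add) measurable
  also have "ennreal (1 / 2) * \<dots> = (\<integral>\<^sup>+u. G u * indicator {0<..} u \<partial>lborel)"
  proof -
    have "ennreal (1/2) * (x + x) = x" for x :: ennreal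
    proof -
      have "ennreal (1/2) * (x + x) = (ennreal (1/2) + ennreal (1/2)) * x" by (simp only: distrib_left distrib_right)
      also have "ennreal (1/2) + ennreal (1/2) = 1" by (subst ennreal_plus[symmetric]) simp_all
      finally show ?thesis by simp
    qed
    then show ?thesis unfolding half .
  qed
  also have "\<dots> = (\<integral>\<^sup>+u. ennreal (indicator {0..} u *\<^sub>R exp (- r * cosh u)) \<partial>lborel)"
    by (intro nn_integral_cong_AE AE_I[where N="{0}"]) (auto simp: G_def split: split_indicator)
  finally have eq: "heat_K0 r = (\<integral>\<^sup>+u. ennreal (indicator {0..} u *\<^sub>R exp (- r * cosh u)) \<partial>lborel)" .
  have "bessel_K0 r = enn2real (heat_K0 r)"
    unfolding bessel_K0_def set_lebesgue_integral_def eq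
    by (rule integral_eq_nn_integral) (auto simp: cosh_def)
  then show ?thesis by (cases "heat_K0 r") simp_all
qed

text \<open>Multiplication by a cosine becomes a sum of two translates in momentum space. This real
  modulation is chosen because its square is \<open>2 + 2 * cos\<close> of the double angle, which
  brings a single cosine into the density.\<close>

lemma has_fourier_transform_cos:
  assumes ft: "has_fourier_transform 1 \<psi> \<phi>" and sq: "square_integrable \<psi>"
  shows "has_fourier_transform 1 (\<lambda>x. of_real (2 * cos (k \<bullet> x)) * \<psi> x) (\<lambda>p. \<phi> (p + k) + \<phi> (p - k))"
proof -
  have [measurable]: "\<psi> \<in> borel_measurable borel" and L2: "integrable lborel (\<lambda>x. (cmod (\<psi> x))\<^sup>2)"
    using sq by (simp_all add: square_integrable_def)
  have [measurable]: "\<phi> \<in> borel_measurable borel" and L2p: "integrable lborel (\<lambda>x. (cmod (\<phi> x))\<^sup>2)"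
    using ft by (simp_all add: has_fourier_transform_def square_integrable_def)
  have bd: "(cmod (a + b))\<^sup>2 \<le> 2 * (cmod a)\<^sup>2 + 2 * (cmod b)\<^sup>2" for a b
  proof -
    have "(cmod (a + b))\<^sup>2 \<le> (cmod a + cmod b)\<^sup>2" by (intro power_mono norm_triangle_ineq) simp
    also have "\<dots> \<le> 2 * (cmod a)\<^sup>2 + 2 * (cmod b)\<^sup>2"
      using zero_le_power2[of "cmod a - cmod b"] by (simp add: power2_eq_square algebra_simps)
    finally show ?thesis .
  qed
  have "integrable lborel (\<lambda>p. (cmod (\<phi> (p + k) + \<phi> (p - k)))\<^sup>2)"
  proof (rule Bochner_Integration.integrable_bound)
    show "integrable lborel (\<lambda>p. 2 * (cmod (\<phi> (p + k)))\<^sup>2 + 2 * (cmod (\<phi> (p - k)))\<^sup>2)"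
      using integrable_shift[OF L2p, of k] integrable_shift[OF L2p, of "-k"] by simp
  qed (use bd in \<open>auto intro!: AE_I2\<close>)
  then have sq': "square_integrable (\<lambda>p. \<phi> (p + k) + \<phi> (p - k))"
    unfolding square_integrable_def by simp
  let ?g = "\<lambda>R x. indicator (cball 0 R) x * \<psi> x"
  have [measurable]: "cball (0::real^2) R \<in> sets borel" for R by simp
  have cm: "cmod (?g R x) = indicator (cball 0 R) x * cmod (\<psi> x)" for R x
    by (simp add: norm_mult indicator_def)
  have gL1: "integrable lborel (?g R)" for R
  proof (rule Bochner_Integration.integrable_bound)
    have "integrable lborel (indicator (cball 0 R) :: real^2 \<Rightarrow> real)"
      using emeasure_lborel_cball_finite[of 0 R] by (simp add: integrable_indicator_iff)
    then show "integrable lborel (\<lambda>x. indicator (cball 0 R) x + (cmod (\<psi> x))\<^sup>2)" using L2 by simp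
    have "u \<le> 1 + u\<^sup>2" for u :: real
      using zero_le_power2[of "u - 1/2"] by (simp add: power2_eq_square algebra_simps)
    then show "AE x in lborel. norm (?g R x) \<le> norm (indicator (cball 0 R) x + (cmod (\<psi> x))\<^sup>2)"
      by (intro AE_I2) (auto simp: cm split: split_indicator)
  qed measurable
  let ?F = "\<lambda>R. fourier_integral 1 (?g R)"
  have F_eq: "fourier_integral 1 (\<lambda>x. indicator (cball 0 R) x * (of_real (2 * cos (k \<bullet> x)) * \<psi> x)) p = ?F R (p + k) + ?F R (p - k)" for R p
  proof -
    have "?F R (p + k) + ?F R (p - k) = (\<integral>x. exp (\<i> * of_real ((p + k) \<bullet> x)) * ?g R x + exp (\<i> * of_real ((p - k) \<bullet> x)) * ?g R x \<partial>lborel)"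
      unfolding fourier_integral_def
      using integrable_fourier_kernel[OF gL1, of "p + k" R] integrable_fourier_kernel[OF gL1, of "p - k" R] by simp
    also have "\<dots> = (\<integral>x. exp (\<i> * of_real (p \<bullet> x)) * (indicator (cball 0 R) x * (of_real (2 * cos (k \<bullet> x)) * \<psi> x)) \<partial>lborel)"
    proof (rule Bochner_Integration.integral_cong[OF refl])
      fix x
      have "complex_of_real (2 * cos (k \<bullet> x)) = exp (\<i> * of_real (k \<bullet> x)) + exp (- (\<i> * of_real (k \<bullet> x)))"
        by (simp add: cos_of_real[symmetric] cos_exp_eq)
      then show "exp (\<i> * of_real ((p + k) \<bullet> x)) * ?g R x + exp (\<i> * of_real ((p - k) \<bullet> x)) * ?g R x
        = exp (\<i> * of_real (p \<bullet> x)) * (indicator (cball 0 R) x * (of_real (2 * cos (k \<bullet> x)) * \<psi> x))"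
        by (simp add: inner_add_left inner_diff_left distrib_left right_diff_distrib exp_add exp_diff exp_minus divide_inverse) (simp add: algebra_simps)
    qed
    finally show ?thesis by (simp add: fourier_integral_def)
  qed
  let ?n = "\<lambda>f. \<integral>\<^sup>+p. ennreal ((cmod (f p))\<^sup>2) \<partial>(lborel :: (real^2) measure)"
  have lim: "((\<lambda>R. ?n (\<lambda>p. ?F R p - \<phi> p)) \<longlongrightarrow> 0) at_top" using ft by (simp add: has_fourier_transform_def)
  have "((\<lambda>R. ?n (\<lambda>p. (?F R (p + k) + ?F R (p - k)) - (\<phi> (p + k) + \<phi> (p - k)))) \<longlongrightarrow> 0) at_top"
  proof (rule tendsto_sandwich[OF _ _ tendsto_const])
    show "((\<lambda>R. 4 * ?n (\<lambda>p. ?F R p - \<phi> p)) \<longlongrightarrow> 0) at_top"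
      using ennreal_tendsto_cmult[OF _ lim, of 4] by simp
    show "\<forall>\<^sub>F R in at_top. ?n (\<lambda>p. (?F R (p + k) + ?F R (p - k)) - (\<phi> (p + k) + \<phi> (p - k))) \<le> 4 * ?n (\<lambda>p. ?F R p - \<phi> p)"
    proof (intro always_eventually allI)
      fix R :: real
      let ?D = "\<lambda>p. ennreal ((cmod (?F R p - \<phi> p))\<^sup>2)"
      have "?n (\<lambda>p. (?F R (p + k) + ?F R (p - k)) - (\<phi> (p + k) + \<phi> (p - k))) \<le> (\<integral>\<^sup>+p. 2 * ?D (p + k) + 2 * ?D (p + (- k)) \<partial>lborel)"
      proof (intro nn_integral_mono)
        fix p
        have "(cmod ((?F R (p + k) + ?F R (p - k)) - (\<phi> (p + k) + \<phi> (p - k))))\<^sup>2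
          \<le> 2 * (cmod (?F R (p + k) - \<phi> (p + k)))\<^sup>2 + 2 * (cmod (?F R (p - k) - \<phi> (p - k)))\<^sup>2"
          using bd[of "?F R (p + k) - \<phi> (p + k)" "?F R (p - k) - \<phi> (p - k)"] by (simp add: algebra_simps)
        from ennreal_leI[OF this]
        show "ennreal ((cmod ((?F R (p + k) + ?F R (p - k)) - (\<phi> (p + k) + \<phi> (p - k))))\<^sup>2) \<le> 2 * ?D (p + k) + 2 * ?D (p + (- k))"
          by (simp add: ennreal_mult)
      qed
      also have "\<dots> = 2 * (\<integral>\<^sup>+p. ?D (p + k) \<partial>lborel) + 2 * (\<integral>\<^sup>+p. ?D (p + (- k)) \<partial>lborel)"
        by (simp add: nn_integral_add nn_integral_cmult)
      also have "\<dots> = 4 * ?n (\<lambda>p. ?F R p - \<phi> p)"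
      proof -
        have m: "?D \<in> borel_measurable borel" by measurable
        show ?thesis
          unfolding nn_integral_shift[OF m] by (simp add: distrib_right[symmetric])
      qed
      finally show "?n (\<lambda>p. (?F R (p + k) + ?F R (p - k)) - (\<phi> (p + k) + \<phi> (p - k))) \<le> 4 * ?n (\<lambda>p. ?F R p - \<phi> p)" .
    qed
  qed simp
  then show ?thesis
    using sq' unfolding has_fourier_transform_def F_eq by simp
qed

text \<open>Plancherel as proved above concerns norms, so it is applied to \<psi> times
  \<open>2 * cos (j \<bullet> x)\<close>, with \<open>j\<close> half of \<open>k\<close>; the
  squared modulus contains the cosine at \<open>k\<close>. The cross term on the momentum side is
  bounded by the product of moduli, and this is where the phases of \<phi> are discarded.\<close>

lemma cos_density_le:
  assumes ft: "has_fourier_transform 1 \<psi> \<phi>" and sq: "square_integrable \<psi>"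
  shows "integrable lborel (\<lambda>p. cmod (\<phi> (p + k)) * cmod (\<phi> p))"
    and "(\<integral>x. cos (k \<bullet> x) * (cmod (\<psi> x))\<^sup>2 \<partial>lborel) \<le> (\<integral>p. cmod (\<phi> (p + k)) * cmod (\<phi> p) \<partial>lborel) / (2 * pi)\<^sup>2"
proof -
  have [measurable]: "\<psi> \<in> borel_measurable borel" and L2: "integrable lborel (\<lambda>x. (cmod (\<psi> x))\<^sup>2)"
    using sq by (simp_all add: square_integrable_def)
  have [measurable]: "\<phi> \<in> borel_measurable borel" and L2p: "integrable lborel (\<lambda>x. (cmod (\<phi> x))\<^sup>2)"
    using ft by (simp_all add: has_fourier_transform_def square_integrable_def)
  define j where "j = (1/2) *\<^sub>R k"
  have jk: "j + j = k" by (simp add: j_def scaleR_2[symmetric] del: scaleR_2)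
  note L2j = integrable_shift[OF L2p, of j] integrable_shift[OF L2p, of "-j"]
  have am: "2 * (u * v) \<le> u\<^sup>2 + v\<^sup>2" for u v :: real using sum_squares_bound[of u v] by simp
  have ij: "integrable lborel (\<lambda>p. cmod (\<phi> (p + j)) * cmod (\<phi> (p - j)))"
  proof (rule Bochner_Integration.integrable_bound)
    show "integrable lborel (\<lambda>p. (cmod (\<phi> (p + j)))\<^sup>2 + (cmod (\<phi> (p + -j)))\<^sup>2)" using L2j by auto
    have "\<bar>u * v\<bar> \<le> \<bar>u\<^sup>2 + v\<^sup>2\<bar>" if "u \<ge> 0" "v \<ge> 0" for u v :: real
    proof -
      have "u * v \<le> u\<^sup>2 + v\<^sup>2" using am[of u v] mult_nonneg_nonneg[OF that] by linarith
      then show ?thesis using that by simp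
    qed
    then show "AE p in lborel. norm (cmod (\<phi> (p + j)) * cmod (\<phi> (p - j))) \<le> norm ((cmod (\<phi> (p + j)))\<^sup>2 + (cmod (\<phi> (p + -j)))\<^sup>2)"
      by (intro AE_I2) simp
  qed measurable
  have sh: "(p + j) + j = p + k" "(p + j) - j = p" for p using jk by (simp_all add: add.assoc)
  show "integrable lborel (\<lambda>p. cmod (\<phi> (p + k)) * cmod (\<phi> p))"
    using integrable_shift[OF ij, of j] by (simp only: sh)
  have ij_eq: "(\<integral>p. cmod (\<phi> (p + j)) * cmod (\<phi> (p - j)) \<partial>lborel) = (\<integral>p. cmod (\<phi> (p + k)) * cmod (\<phi> p) \<partial>lborel)"
    using integral_shift[of "\<lambda>p. cmod (\<phi> (p + j)) * cmod (\<phi> (p - j))" j] by (simp add: sh)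
  let ?\<psi> = "\<lambda>x. of_real (2 * cos (j \<bullet> x)) * \<psi> x"
  have cj: "(cmod (?\<psi> x))\<^sup>2 = 2 * (cmod (\<psi> x))\<^sup>2 + 2 * (cos (k \<bullet> x) * (cmod (\<psi> x))\<^sup>2)" for x
  proof -
    have "cos (k \<bullet> x) = 2 * (cos (j \<bullet> x))\<^sup>2 - 1"
      using cos_double_cos[of "j \<bullet> x"] unfolding jk[symmetric] inner_add_left by simp
    then have c2: "4 * (cos (j \<bullet> x))\<^sup>2 = 2 + 2 * cos (k \<bullet> x)" by simp
    have "(cmod (?\<psi> x))\<^sup>2 = 4 * (cos (j \<bullet> x))\<^sup>2 * (cmod (\<psi> x))\<^sup>2"
      by (simp add: norm_mult power_mult_distrib)
    then show ?thesis unfolding c2 by (simp add: algebra_simps)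
  qed
  have ic: "integrable lborel (\<lambda>x. cos (k \<bullet> x) * (cmod (\<psi> x))\<^sup>2)"
    by (rule Bochner_Integration.integrable_bound[OF L2]) (auto intro!: AE_I2 simp: abs_mult mult_left_le_one_le)
  have sq': "square_integrable ?\<psi>"
    unfolding square_integrable_def cj using L2 ic by simp
  have iphi: "integrable lborel (\<lambda>p. (cmod (\<phi> (p + j) + \<phi> (p - j)))\<^sup>2)"
    using has_fourier_transform_cos[OF ft sq, of j] by (simp add: has_fourier_transform_def square_integrable_def)
  have "ennreal (\<integral>p. (cmod (\<phi> (p + j) + \<phi> (p - j)))\<^sup>2 \<partial>lborel) = ennreal ((2 * pi)\<^sup>2 * (\<integral>x. (cmod (?\<psi> x))\<^sup>2 \<partial>lborel))"
    using plancherel_L2[OF sq' has_fourier_transform_cos[OF ft sq, of j]] nn_integral_eq_integral[OF iphi] by simp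
  then have P1: "(\<integral>p. (cmod (\<phi> (p + j) + \<phi> (p - j)))\<^sup>2 \<partial>lborel) = (2 * pi)\<^sup>2 * (\<integral>x. (cmod (?\<psi> x))\<^sup>2 \<partial>lborel)"
    by (subst (asm) ennreal_inj) auto
  have "ennreal (\<integral>p. (cmod (\<phi> p))\<^sup>2 \<partial>lborel) = ennreal ((2 * pi)\<^sup>2 * (\<integral>x. (cmod (\<psi> x))\<^sup>2 \<partial>lborel))"
    using plancherel_L2[OF sq ft] nn_integral_eq_integral[OF L2p] by simp
  then have P2: "(\<integral>p. (cmod (\<phi> p))\<^sup>2 \<partial>lborel) = (2 * pi)\<^sup>2 * (\<integral>x. (cmod (\<psi> x))\<^sup>2 \<partial>lborel)"
    by (subst (asm) ennreal_inj) auto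
  have "(\<integral>p. (cmod (\<phi> (p + j) + \<phi> (p - j)))\<^sup>2 \<partial>lborel)
    \<le> (\<integral>p. (cmod (\<phi> (p + j)))\<^sup>2 + (cmod (\<phi> (p + -j)))\<^sup>2 + 2 * (cmod (\<phi> (p + j)) * cmod (\<phi> (p - j))) \<partial>lborel)"
  proof (rule integral_mono[OF iphi])
    fix p
    have "(cmod (\<phi> (p + j) + \<phi> (p - j)))\<^sup>2 \<le> (cmod (\<phi> (p + j)) + cmod (\<phi> (p - j)))\<^sup>2"
      by (intro power_mono norm_triangle_ineq) simp
    then show "(cmod (\<phi> (p + j) + \<phi> (p - j)))\<^sup>2 \<le> (cmod (\<phi> (p + j)))\<^sup>2 + (cmod (\<phi> (p + -j)))\<^sup>2 + 2 * (cmod (\<phi> (p + j)) * cmod (\<phi> (p - j)))"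
      by (simp add: power2_sum)
  qed (use L2j ij in auto)
  also have "\<dots> = 2 * (\<integral>p. (cmod (\<phi> p))\<^sup>2 \<partial>lborel) + 2 * (\<integral>p. cmod (\<phi> (p + k)) * cmod (\<phi> p) \<partial>lborel)"
    using L2j ij integral_shift[of "\<lambda>p. (cmod (\<phi> p))\<^sup>2" j] integral_shift[of "\<lambda>p. (cmod (\<phi> p))\<^sup>2" "-j"]
    by (simp add: ij_eq)
  finally have le: "(2 * pi)\<^sup>2 * (\<integral>x. (cmod (?\<psi> x))\<^sup>2 \<partial>lborel)
      \<le> 2 * ((2 * pi)\<^sup>2 * (\<integral>x. (cmod (\<psi> x))\<^sup>2 \<partial>lborel)) + 2 * (\<integral>p. cmod (\<phi> (p + k)) * cmod (\<phi> p) \<partial>lborel)"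
    unfolding P1 P2 .
  have "(\<integral>x. (cmod (?\<psi> x))\<^sup>2 \<partial>lborel) = 2 * (\<integral>x. (cmod (\<psi> x))\<^sup>2 \<partial>lborel) + 2 * (\<integral>x. cos (k \<bullet> x) * (cmod (\<psi> x))\<^sup>2 \<partial>lborel)"
    unfolding cj using L2 ic by simp
  from le[unfolded this]
  show "(\<integral>x. cos (k \<bullet> x) * (cmod (\<psi> x))\<^sup>2 \<partial>lborel) \<le> (\<integral>p. cmod (\<phi> (p + k)) * cmod (\<phi> p) \<partial>lborel) / (2 * pi)\<^sup>2"
    by (simp add: pos_le_divide_eq algebra_simps)
qed

text \<open>A Gaussian is a superposition of cosines with positive weights, so the bound for a
  single cosine may be integrated over \<open>k\<close>. The constant is \<open>t / pi\<close> from
  the Gaussian transform divided by \<open>(2 * pi)\<^sup>2\<close> from Plancherel.\<close>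

lemma gauss_density_le:
  assumes ft: "has_fourier_transform 1 \<psi> \<phi>" and sq: "square_integrable \<psi>" and t: "t > 0"
  shows "(\<integral>\<^sup>+x. ennreal (exp (- (norm x)\<^sup>2 / (4 * t)) * (cmod (\<psi> x))\<^sup>2) \<partial>lborel)
    \<le> ennreal (t / (4 * pi ^ 3)) * (\<integral>\<^sup>+k. ennreal (exp (- t * (norm k)\<^sup>2)) * (\<integral>\<^sup>+p. ennreal (cmod (\<phi> (p + k)) * cmod (\<phi> p)) \<partial>lborel) \<partial>lborel)"
proof -
  have [measurable]: "\<psi> \<in> borel_measurable borel" and L2: "integrable lborel (\<lambda>x. (cmod (\<psi> x))\<^sup>2)"
    using sq by (simp_all add: square_integrable_def)
  have [measurable]: "\<phi> \<in> borel_measurable borel" and L2p: "integrable lborel (\<lambda>x. (cmod (\<phi> x))\<^sup>2)"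
    using ft by (simp_all add: has_fourier_transform_def square_integrable_def)
  let ?L = "lborel :: (real^2) measure"
  let ?G = "\<lambda>k::real^2. exp (- t * (norm k)\<^sup>2)"
  define C where "C k = (\<integral>p. cmod (\<phi> (p + k)) * cmod (\<phi> p) \<partial>lborel)" for k
  have [measurable]: "C \<in> borel_measurable borel" unfolding C_def by measurable
  have C_nn: "C k \<ge> 0" for k unfolding C_def by simp
  have C_eq: "(\<integral>\<^sup>+p. ennreal (cmod (\<phi> (p + k)) * cmod (\<phi> p)) \<partial>lborel) = ennreal (C k)" for k
    unfolding C_def by (rule nn_integral_eq_integral[OF cos_density_le(1)[OF ft sq]]) simp
  have am: "u * v * 2 \<le> u\<^sup>2 + v\<^sup>2" for u v :: real using sum_squares_bound[of u v] by simp
  have C_le: "C k \<le> (\<integral>p. (cmod (\<phi> p))\<^sup>2 \<partial>lborel)" for k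
  proof -
    have "C k \<le> (\<integral>p. ((cmod (\<phi> (p + k)))\<^sup>2 + (cmod (\<phi> p))\<^sup>2) / 2 \<partial>lborel)"
      unfolding C_def using integrable_shift[OF L2p, of k] L2p cos_density_le(1)[OF ft sq, of k]
      by (intro integral_mono) (use am in auto)
    also have "\<dots> = (\<integral>p. (cmod (\<phi> p))\<^sup>2 \<partial>lborel)"
      using integrable_shift[OF L2p, of k] L2p integral_shift[of "\<lambda>p. (cmod (\<phi> p))\<^sup>2" k] by simp
    finally show ?thesis .
  qed
  have iG: "integrable lborel ?G" by (rule gauss_integrable[OF t])
  have cosG: "(\<integral>k. ?G k * cos (k \<bullet> x) \<partial>lborel) = pi / t * exp (- (norm x)\<^sup>2 / (4 * t))" for x
  proof -
    have "(\<integral>k. ?G k * cos (k \<bullet> x) \<partial>lborel) = (\<integral>k. Re (exp (\<i> * of_real (x \<bullet> k)) * of_real (?G k)) \<partial>lborel)"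
      by (rule Bochner_Integration.integral_cong[OF refl]) (simp add: inner_commute exp_Euler[symmetric] Re_exp)
    also have "\<dots> = Re (\<integral>k. exp (\<i> * of_real (x \<bullet> k)) * of_real (?G k) \<partial>lborel)"
      by (rule integral_Re[OF gauss_ft(1)[OF t]])
    also have "\<dots> = pi / t * exp (- (norm x)\<^sup>2 / (4 * t))"
      by (simp only: gauss_ft(2)[OF t] Re_complex_of_real)
    finally show ?thesis .
  qed
  have int2: "integrable (?L \<Otimes>\<^sub>M ?L) (\<lambda>(x, k). (cmod (\<psi> x))\<^sup>2 * (?G k * cos (k \<bullet> x)))"
  proof (rule Bochner_Integration.integrable_bound)
    show "integrable (?L \<Otimes>\<^sub>M ?L) (\<lambda>(x, k). (cmod (\<psi> x))\<^sup>2 * ?G k)"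
      by (rule integrable_prod_mult[OF lborel.sigma_finite_measure_axioms lborel.sigma_finite_measure_axioms L2 iG])
  qed (auto intro!: AE_I2 mult_left_mono mult_left_le simp: abs_mult)
  have iC: "integrable lborel (\<lambda>k. ?G k * C k)"
  proof (rule Bochner_Integration.integrable_bound)
    show "integrable lborel (\<lambda>k. ?G k * (\<integral>p. (cmod (\<phi> p))\<^sup>2 \<partial>lborel))" using iG by simp
  qed (use C_nn C_le in \<open>auto intro!: AE_I2 mult_left_mono simp: abs_mult\<close>)
  have ie: "integrable lborel (\<lambda>x. exp (- (norm x)\<^sup>2 / (4 * t)) * (cmod (\<psi> x))\<^sup>2)"
    by (rule Bochner_Integration.integrable_bound[OF L2]) (use t in \<open>auto intro!: AE_I2 mult_left_le_one_le\<close>)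
  have "pi / t * (\<integral>x. exp (- (norm x)\<^sup>2 / (4 * t)) * (cmod (\<psi> x))\<^sup>2 \<partial>lborel) = (\<integral>x. \<integral>k. (cmod (\<psi> x))\<^sup>2 * (?G k * cos (k \<bullet> x)) \<partial>lborel \<partial>lborel)"
    by (subst integral_mult_right_zero[symmetric], rule Bochner_Integration.integral_cong[OF refl])
       (simp only: integral_mult_right_zero cosG, simp)
  also have "\<dots> = (\<integral>k. \<integral>x. (cmod (\<psi> x))\<^sup>2 * (?G k * cos (k \<bullet> x)) \<partial>lborel \<partial>lborel)"
    using lborel_pair.Fubini_integral[OF int2] by simp
  also have "\<dots> \<le> (\<integral>k. ?G k * C k / (2 * pi)\<^sup>2 \<partial>lborel)"
  proof (rule integral_mono)
    show "integrable lborel (\<lambda>k. \<integral>x. (cmod (\<psi> x))\<^sup>2 * (?G k * cos (k \<bullet> x)) \<partial>lborel)"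
      using lborel_pair.integrable_snd[OF int2] by simp
    fix k
    have "(\<integral>x. (cmod (\<psi> x))\<^sup>2 * (?G k * cos (k \<bullet> x)) \<partial>lborel) = ?G k * (\<integral>x. cos (k \<bullet> x) * (cmod (\<psi> x))\<^sup>2 \<partial>lborel)"
      by (subst integral_mult_right_zero[symmetric]) (simp only: mult_ac)
    also have "\<dots> \<le> ?G k * (C k / (2 * pi)\<^sup>2)"
      unfolding C_def by (intro mult_left_mono cos_density_le[OF ft sq]) simp
    finally show "(\<integral>x. (cmod (\<psi> x))\<^sup>2 * (?G k * cos (k \<bullet> x)) \<partial>lborel) \<le> ?G k * C k / (2 * pi)\<^sup>2" by simp
  qed (use iC in simp)
  also have "\<dots> = (\<integral>k. ?G k * C k \<partial>lborel) / (2 * pi)\<^sup>2" by simp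
  finally have le: "(\<integral>x. exp (- (norm x)\<^sup>2 / (4 * t)) * (cmod (\<psi> x))\<^sup>2 \<partial>lborel) \<le> t / (4 * pi ^ 3) * (\<integral>k. ?G k * C k \<partial>lborel)"
    using t pi_gt_zero by (simp add: field_simps power2_eq_square power3_eq_cube)
  have "(\<integral>\<^sup>+x. ennreal (exp (- (norm x)\<^sup>2 / (4 * t)) * (cmod (\<psi> x))\<^sup>2) \<partial>lborel) = ennreal (\<integral>x. exp (- (norm x)\<^sup>2 / (4 * t)) * (cmod (\<psi> x))\<^sup>2 \<partial>lborel)"
    by (rule nn_integral_eq_integral[OF ie]) simp
  also have "\<dots> \<le> ennreal (t / (4 * pi ^ 3)) * ennreal (\<integral>k. ?G k * C k \<partial>lborel)"
    using ennreal_leI[OF le] t C_nn by (subst ennreal_mult[symmetric]) auto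
  also have "ennreal (\<integral>k. ?G k * C k \<partial>lborel) = (\<integral>\<^sup>+k. ennreal (?G k * C k) \<partial>lborel)"
    using C_nn by (intro nn_integral_eq_integral[OF iC, symmetric]) simp
  also have "\<dots> = (\<integral>\<^sup>+k. ennreal (?G k) * (\<integral>\<^sup>+p. ennreal (cmod (\<phi> (p + k)) * cmod (\<phi> p)) \<partial>lborel) \<partial>lborel)"
    unfolding C_eq using C_nn by (simp add: ennreal_mult)
  finally show ?thesis .
qed

lemma nn_integral_exp_Ioi:
  assumes a: "a > 0"
  shows "(\<integral>\<^sup>+s. ennreal (exp (- a * s)) * indicator {0<..} s \<partial>lborel) = ennreal (1 / a)"
proof -
  have "(\<integral>\<^sup>+s. ennreal (exp (- a * s)) * indicator {0<..} s \<partial>lborel) = (\<integral>\<^sup>+s. ennreal (exp (- a * s)) * indicator {0..} s \<partial>lborel)"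
    by (intro nn_integral_cong_AE AE_I[where N="{0}"]) (auto split: split_indicator)
  also have "\<dots> = ennreal (0 - (- exp (- a * 0) / a))"
  proof (rule nn_integral_FTC_atLeast[where F="\<lambda>s. - exp (- a * s) / a"])
    show "((\<lambda>s. - exp (- a * s) / a) \<longlongrightarrow> 0) at_top"
      using a by real_asymp
  qed (use a in \<open>auto intro!: derivative_eq_intros\<close>)
  finally show ?thesis by simp
qed

text \<open>The Bessel function is a superposition of Gaussians with
  \<open>t = s / \<beta>\<^sup>2\<close>. The factor \<open>t\<close> from the Gaussian bound
  cancels the \<open>1 / s\<close> of the heat weight, so the remaining integral over
  \<open>s\<close> is a plain exponential and yields the resolvent kernel
  \<open>1 / (\<beta>\<^sup>2 + (norm k)\<^sup>2)\<close>.\<close>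

lemma potential_le_momentum:
  assumes ft: "has_fourier_transform 1 \<psi> \<phi>" and sq: "square_integrable \<psi>" and b: "\<beta> > 0"
  shows "(\<integral>\<^sup>+x. ennreal (potential_density \<beta> \<psi> x) \<partial>lborel)
    \<le> ennreal (1 / (2 * pi) ^ 3) * (\<integral>\<^sup>+k. \<integral>\<^sup>+p. ennreal (cmod (\<phi> (p + k)) * cmod (\<phi> p) / (\<beta>\<^sup>2 + (norm k)\<^sup>2)) \<partial>lborel \<partial>lborel)"
proof -
  have [measurable]: "\<psi> \<in> borel_measurable borel" and L2: "integrable lborel (\<lambda>x. (cmod (\<psi> x))\<^sup>2)"
    using sq by (simp_all add: square_integrable_def)
  have [measurable]: "\<phi> \<in> borel_measurable borel" and L2p: "integrable lborel (\<lambda>x. (cmod (\<phi> x))\<^sup>2)"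
    using ft by (simp_all add: has_fourier_transform_def square_integrable_def)
  define w where "w s = ennreal (exp (- s) / (2 * s)) * indicator {0<..} s" for s :: real
  have [measurable]: "w \<in> borel_measurable borel" unfolding w_def by measurable
  define C where "C k = (\<integral>\<^sup>+p. ennreal (cmod (\<phi> (p + k)) * cmod (\<phi> p)) \<partial>lborel)" for k
  have [measurable]: "C \<in> borel_measurable borel" unfolding C_def by measurable
  have split: "ennreal (exp (- s - (\<beta> * norm x)\<^sup>2 / (4 * s)) / (2 * s)) * indicator {0<..} s * ennreal ((cmod (\<psi> x))\<^sup>2)
      = w s * ennreal (exp (- (norm x)\<^sup>2 / (4 * (s / \<beta>\<^sup>2))) * (cmod (\<psi> x))\<^sup>2)" for s x
  proof (cases "s > 0")
    case s: True
    have "- s - (\<beta> * norm x)\<^sup>2 / (4 * s) = - s + - (norm x)\<^sup>2 / (4 * (s / \<beta>\<^sup>2))"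
      by (simp add: power_mult_distrib)
    then have "exp (- s - (\<beta> * norm x)\<^sup>2 / (4 * s)) = exp (- s) * exp (- (norm x)\<^sup>2 / (4 * (s / \<beta>\<^sup>2)))"
      by (simp only: exp_add)
    then show ?thesis using s by (simp add: w_def ennreal_mult[symmetric])
  qed (simp add: w_def)
  have "(\<integral>\<^sup>+x. ennreal (potential_density \<beta> \<psi> x) \<partial>lborel) \<le> (\<integral>\<^sup>+x. heat_K0 (\<beta> * norm x) * ennreal ((cmod (\<psi> x))\<^sup>2) \<partial>lborel)"
  \<comment> \<open>The comparison with the heat integral is available for positive radius; the
    origin is a null set.\<close>
  proof (intro nn_integral_mono_AE AE_I[where N="{0}"])
    have "ennreal (potential_density \<beta> \<psi> x) \<le> heat_K0 (\<beta> * norm x) * ennreal ((cmod (\<psi> x))\<^sup>2)" if "x \<noteq> 0" for x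
      using bessel_K0_le_heat[of "\<beta> * norm x"] b that bessel_K0_nonneg[of "\<beta> * norm x"]
      unfolding potential_density_def by (subst ennreal_mult) (auto intro: mult_right_mono)
    then show "{x \<in> space lborel. \<not> ennreal (potential_density \<beta> \<psi> x) \<le> heat_K0 (\<beta> * norm x) * ennreal ((cmod (\<psi> x))\<^sup>2)} \<subseteq> {0}"
      by auto
  qed auto
  also have "\<dots> = (\<integral>\<^sup>+x. \<integral>\<^sup>+s. w s * ennreal (exp (- (norm x)\<^sup>2 / (4 * (s / \<beta>\<^sup>2))) * (cmod (\<psi> x))\<^sup>2) \<partial>lborel \<partial>lborel)"
    unfolding heat_K0_def by (subst nn_integral_multc[symmetric]) (simp_all add: split)
  also have "\<dots> = (\<integral>\<^sup>+s. \<integral>\<^sup>+x. w s * ennreal (exp (- (norm x)\<^sup>2 / (4 * (s / \<beta>\<^sup>2))) * (cmod (\<psi> x))\<^sup>2) \<partial>lborel \<partial>lborel)"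
    by (rule lborel_pair.Fubini') measurable
  also have "\<dots> = (\<integral>\<^sup>+s. w s * (\<integral>\<^sup>+x. ennreal (exp (- (norm x)\<^sup>2 / (4 * (s / \<beta>\<^sup>2))) * (cmod (\<psi> x))\<^sup>2) \<partial>lborel) \<partial>lborel)"
    by (simp add: nn_integral_cmult)
  also have "\<dots> \<le> (\<integral>\<^sup>+s. \<integral>\<^sup>+k. ennreal (1 / (8 * pi ^ 3 * \<beta>\<^sup>2)) * (ennreal (exp (- (1 + (norm k)\<^sup>2 / \<beta>\<^sup>2) * s)) * indicator {0<..} s * C k) \<partial>lborel \<partial>lborel)"
  proof (rule nn_integral_mono)
    fix s :: real
    show "w s * (\<integral>\<^sup>+x. ennreal (exp (- (norm x)\<^sup>2 / (4 * (s / \<beta>\<^sup>2))) * (cmod (\<psi> x))\<^sup>2) \<partial>lborel)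
      \<le> (\<integral>\<^sup>+k. ennreal (1 / (8 * pi ^ 3 * \<beta>\<^sup>2)) * (ennreal (exp (- (1 + (norm k)\<^sup>2 / \<beta>\<^sup>2) * s)) * indicator {0<..} s * C k) \<partial>lborel)"
    proof (cases "s > 0")
      case s: True
      have "w s * (\<integral>\<^sup>+x. ennreal (exp (- (norm x)\<^sup>2 / (4 * (s / \<beta>\<^sup>2))) * (cmod (\<psi> x))\<^sup>2) \<partial>lborel)
        \<le> w s * (ennreal (s / \<beta>\<^sup>2 / (4 * pi ^ 3)) * (\<integral>\<^sup>+k. ennreal (exp (- (s / \<beta>\<^sup>2) * (norm k)\<^sup>2)) * C k \<partial>lborel))"
        unfolding C_def using s b by (intro mult_left_mono gauss_density_le[OF ft sq]) auto
      also have "\<dots> = (\<integral>\<^sup>+k. w s * ennreal (s / \<beta>\<^sup>2 / (4 * pi ^ 3)) * (ennreal (exp (- (s / \<beta>\<^sup>2) * (norm k)\<^sup>2)) * C k) \<partial>lborel)"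
        unfolding mult.assoc[of "w s", symmetric] by (rule nn_integral_cmult[symmetric]) measurable
      also have "\<dots> = (\<integral>\<^sup>+k. ennreal (1 / (8 * pi ^ 3 * \<beta>\<^sup>2)) * (ennreal (exp (- (1 + (norm k)\<^sup>2 / \<beta>\<^sup>2) * s)) * indicator {0<..} s * C k) \<partial>lborel)"
      proof (rule nn_integral_cong)
        fix k :: "real^2"
        have "w s * ennreal (s / \<beta>\<^sup>2 / (4 * pi ^ 3)) * ennreal (exp (- (s / \<beta>\<^sup>2) * (norm k)\<^sup>2)) = ennreal (1 / (8 * pi ^ 3 * \<beta>\<^sup>2)) * ennreal (exp (- (1 + (norm k)\<^sup>2 / \<beta>\<^sup>2) * s))"
        proof -
          have "exp (- (1 + (norm k)\<^sup>2 / \<beta>\<^sup>2) * s) = exp (- s) * exp (- (s / \<beta>\<^sup>2) * (norm k)\<^sup>2)"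
            by (simp add: exp_add[symmetric] algebra_simps)
          then show ?thesis using s b by (simp add: w_def ennreal_mult[symmetric])
        qed
        then show "w s * ennreal (s / \<beta>\<^sup>2 / (4 * pi ^ 3)) * (ennreal (exp (- (s / \<beta>\<^sup>2) * (norm k)\<^sup>2)) * C k)
          = ennreal (1 / (8 * pi ^ 3 * \<beta>\<^sup>2)) * (ennreal (exp (- (1 + (norm k)\<^sup>2 / \<beta>\<^sup>2) * s)) * indicator {0<..} s * C k)"
          using s by (simp add: mult.assoc[symmetric])
      qed
      finally show ?thesis .
    qed (simp add: w_def)
  qed
  also have "\<dots> = (\<integral>\<^sup>+k. \<integral>\<^sup>+s. ennreal (1 / (8 * pi ^ 3 * \<beta>\<^sup>2)) * (ennreal (exp (- (1 + (norm k)\<^sup>2 / \<beta>\<^sup>2) * s)) * indicator {0<..} s * C k) \<partial>lborel \<partial>lborel)"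
    by (rule lborel_pair.Fubini') measurable
  also have "\<dots> = (\<integral>\<^sup>+k. ennreal (1 / (8 * pi ^ 3 * \<beta>\<^sup>2)) * (ennreal (1 / (1 + (norm k)\<^sup>2 / \<beta>\<^sup>2)) * C k) \<partial>lborel)"
    using nn_integral_exp_Ioi[of "1 + (norm (k::real^2))\<^sup>2 / \<beta>\<^sup>2" for k]
    by (simp add: nn_integral_cmult nn_integral_multc add_pos_nonneg)
  also have "\<dots> = (\<integral>\<^sup>+k. ennreal (1 / (2 * pi) ^ 3) * (\<integral>\<^sup>+p. ennreal (cmod (\<phi> (p + k)) * cmod (\<phi> p) / (\<beta>\<^sup>2 + (norm k)\<^sup>2)) \<partial>lborel) \<partial>lborel)"
  proof (rule nn_integral_cong)
    fix k :: "real^2"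
    have pos: "\<beta>\<^sup>2 + (norm k)\<^sup>2 > 0" using b by (simp add: add_pos_nonneg)
    have e1: "ennreal (1 / (8 * pi ^ 3 * \<beta>\<^sup>2)) * ennreal (1 / (1 + (norm k)\<^sup>2 / \<beta>\<^sup>2)) = ennreal (1 / (2 * pi) ^ 3) * ennreal (1 / (\<beta>\<^sup>2 + (norm k)\<^sup>2))"
    proof -
      have "1 + (norm k)\<^sup>2 / \<beta>\<^sup>2 = (\<beta>\<^sup>2 + (norm k)\<^sup>2) / \<beta>\<^sup>2"
        using b by (simp add: add_divide_distrib)
      then show ?thesis
        using b pos by (simp add: ennreal_mult[symmetric] power_mult_distrib)
    qed
    have e2: "ennreal (1 / (\<beta>\<^sup>2 + (norm k)\<^sup>2)) * C k = (\<integral>\<^sup>+p. ennreal (cmod (\<phi> (p + k)) * cmod (\<phi> p) / (\<beta>\<^sup>2 + (norm k)\<^sup>2)) \<partial>lborel)"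
      unfolding C_def using pos
      by (subst nn_integral_cmult[symmetric]) (auto intro!: nn_integral_cong simp: ennreal_mult[symmetric])
    show "ennreal (1 / (8 * pi ^ 3 * \<beta>\<^sup>2)) * (ennreal (1 / (1 + (norm k)\<^sup>2 / \<beta>\<^sup>2)) * C k) = ennreal (1 / (2 * pi) ^ 3) * (\<integral>\<^sup>+p. ennreal (cmod (\<phi> (p + k)) * cmod (\<phi> p) / (\<beta>\<^sup>2 + (norm k)\<^sup>2)) \<partial>lborel)"
      unfolding e2[symmetric] mult.assoc[symmetric] e1 ..
  qed
  also have "\<dots> = ennreal (1 / (2 * pi) ^ 3) * (\<integral>\<^sup>+k. \<integral>\<^sup>+p. ennreal (cmod (\<phi> (p + k)) * cmod (\<phi> p) / (\<beta>\<^sup>2 + (norm k)\<^sup>2)) \<partial>lborel \<partial>lborel)"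
    by (rule nn_integral_cmult) measurable
  finally show ?thesis .
qed

section \<open>Radial reduction\<close>

text \<open>Unit vector of slope \<open>t\<close>. Together with their negatives these vectors cover
  the circle except for the two vertical directions.\<close>

definition dir :: "real \<Rightarrow> real^2" where "dir t = (1 / sqrt (1 + t\<^sup>2)) *\<^sub>R vec2 1 t"

lemma dir_measurable [measurable]: "dir \<in> borel_measurable borel"
  unfolding dir_def by measurable

lemma norm_dir [simp]: "norm (dir t) = 1"
proof -
  have "(norm (dir t))\<^sup>2 = 1"
    unfolding dir_def norm_vec2_sq by (simp add: power_divide add_nonneg_eq_0_iff add_divide_distrib[symmetric])
  then show ?thesis using norm_ge_zero[of "dir t"] by (auto simp: power2_eq_1_iff)
qed

text \<open>Integral over the circle of radius \<open>r\<close> with respect to the angle: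
  \<open>1 / (1 + t\<^sup>2)\<close> is the derivative of \<open>arctan t\<close>, and antipodal
  points are taken together.\<close>

definition circ :: "(real^2 \<Rightarrow> ennreal) \<Rightarrow> real \<Rightarrow> ennreal" where
  "circ f r = (\<integral>\<^sup>+t. (f (r *\<^sub>R dir t) + f (- r *\<^sub>R dir t)) * ennreal (1 / (1 + t\<^sup>2)) \<partial>lborel)"

lemma circ_measurable [measurable]:
  assumes [measurable]: "f \<in> borel_measurable borel"
  shows "circ f \<in> borel_measurable borel"
  unfolding circ_def by measurable

text \<open>
  Polar coordinates with the slope \<open>t\<close> in place of the angle, so that only affine substitutions
  in one variable are needed.
\<close>

lemma nn_integral_polar:
  assumes [measurable]: "f \<in> borel_measurable borel"
  shows "(\<integral>\<^sup>+p. f p \<partial>lborel) = (\<integral>\<^sup>+r. ennreal r * circ f r * indicator {0<..} r \<partial>lborel)"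
proof -
  have "(\<integral>\<^sup>+p. f p \<partial>lborel) = (\<integral>\<^sup>+x. \<integral>\<^sup>+y. f (vec2 x y) \<partial>lborel \<partial>lborel)"
    by (rule nn_integral_real2) measurable
  \<comment> \<open>On the vertical line with abscissa \<open>x \<noteq> 0\<close> the substitution
    \<open>y = x * t\<close> makes the slope the variable.\<close>
  also have "\<dots> = (\<integral>\<^sup>+x. \<integral>\<^sup>+t. ennreal \<bar>x\<bar> * f (x *\<^sub>R vec2 1 t) \<partial>lborel \<partial>lborel)"
  proof (intro nn_integral_cong_AE AE_I[where N="{0}"])
    have "(\<integral>\<^sup>+y. f (vec2 x y) \<partial>lborel) = (\<integral>\<^sup>+t. ennreal \<bar>x\<bar> * f (x *\<^sub>R vec2 1 t) \<partial>lborel)" if "x \<noteq> 0" for x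
    proof -
      have "x *\<^sub>R vec2 1 t = vec2 x (0 + x * t)" for t by (simp add: vec_eq_iff forall_2)
      then show ?thesis
        using nn_integral_real_affine[of "\<lambda>y. f (vec2 x y)" x 0] that by (simp add: nn_integral_cmult)
    qed
    then show "{x \<in> space lborel. (\<integral>\<^sup>+y. f (vec2 x y) \<partial>lborel) \<noteq> (\<integral>\<^sup>+t. ennreal \<bar>x\<bar> * f (x *\<^sub>R vec2 1 t) \<partial>lborel)} \<subseteq> {0}"
      by auto
  qed auto
  also have "\<dots> = (\<integral>\<^sup>+t. \<integral>\<^sup>+x. ennreal \<bar>x\<bar> * f (x *\<^sub>R vec2 1 t) \<partial>lborel \<partial>lborel)"
    by (rule lborel_pair.Fubini') measurable
  also have "\<dots> = (\<integral>\<^sup>+t. \<integral>\<^sup>+r. ennreal r * ((f (r *\<^sub>R dir t) + f (- r *\<^sub>R dir t)) * ennreal (1 / (1 + t\<^sup>2))) * indicator {0<..} r \<partial>lborel \<partial>lborel)"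
  proof (rule nn_integral_cong)
    fix t :: real
    \<comment> \<open>On the line of slope \<open>t\<close> the abscissa is \<open>c\<close> times
      the signed distance \<open>r\<close> from the origin. The Jacobian and the factor in front
      together give \<open>c * c\<close>, which is the angular weight.\<close>
    define c where "c = 1 / sqrt (1 + t\<^sup>2)"
    have c: "c > 0" and c2: "c * c = 1 / (1 + t\<^sup>2)"
      by (simp_all add: c_def add_pos_nonneg)
    define h where "h r = ennreal \<bar>r\<bar> * f (r *\<^sub>R dir t) * ennreal (1 / (1 + t\<^sup>2))" for r
    have [measurable]: "h \<in> borel_measurable borel" unfolding h_def by measurable
    have "(\<integral>\<^sup>+x. ennreal \<bar>x\<bar> * f (x *\<^sub>R vec2 1 t) \<partial>lborel) = ennreal c * (\<integral>\<^sup>+r. ennreal \<bar>c * r\<bar> * f ((c * r) *\<^sub>R vec2 1 t) \<partial>lborel)"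
      using nn_integral_real_affine[of "\<lambda>x. ennreal \<bar>x\<bar> * f (x *\<^sub>R vec2 1 t)" c 0] c by simp
    also have "\<dots> = (\<integral>\<^sup>+r. h r \<partial>lborel)"
    proof (subst nn_integral_cmult[symmetric], measurable, rule nn_integral_cong)
      fix r
      have "ennreal c * ennreal \<bar>c * r\<bar> = ennreal \<bar>r\<bar> * ennreal (1 / (1 + t\<^sup>2))"
        using c by (simp add: ennreal_mult[symmetric] abs_mult c2[symmetric] mult_ac)
      moreover have "(c * r) *\<^sub>R vec2 1 t = r *\<^sub>R dir t" by (simp add: dir_def c_def)
      ultimately show "ennreal c * (ennreal \<bar>c * r\<bar> * f ((c * r) *\<^sub>R vec2 1 t)) = h r"
        by (simp add: h_def mult.assoc[symmetric]) (simp add: mult_ac)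
    qed
    also have "\<dots> = (\<integral>\<^sup>+r. h r * indicator {0<..} r + h r * indicator {..<0} r \<partial>lborel)"
      by (intro nn_integral_cong_AE AE_I[where N="{0}"]) (auto split: split_indicator)
    also have "\<dots> = (\<integral>\<^sup>+r. h r * indicator {0<..} r \<partial>lborel) + (\<integral>\<^sup>+r. h r * indicator {..<0} r \<partial>lborel)"
      by (rule nn_integral_add) measurable
    also have "(\<integral>\<^sup>+r. h r * indicator {..<0} r \<partial>lborel) = (\<integral>\<^sup>+r. h (- r) * indicator {0<..} r \<partial>lborel)"
      by (subst nn_integral_real_affine[of _ "-1" 0]) (auto intro!: nn_integral_cong split: split_indicator)
    also have "(\<integral>\<^sup>+r. h r * indicator {0<..} r \<partial>lborel) + (\<integral>\<^sup>+r. h (- r) * indicator {0<..} r \<partial>lborel)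
      = (\<integral>\<^sup>+r. h r * indicator {0<..} r + h (- r) * indicator {0<..} r \<partial>lborel)"
      by (rule nn_integral_add[symmetric]) measurable
    also have "\<dots> = (\<integral>\<^sup>+r. ennreal r * ((f (r *\<^sub>R dir t) + f (- r *\<^sub>R dir t)) * ennreal (1 / (1 + t\<^sup>2))) * indicator {0<..} r \<partial>lborel)"
      by (intro nn_integral_cong) (auto simp: h_def distrib_left distrib_right mult.assoc split: split_indicator)
    finally show "(\<integral>\<^sup>+x. ennreal \<bar>x\<bar> * f (x *\<^sub>R vec2 1 t) \<partial>lborel) = \<dots>" .
  qed
  also have "\<dots> = (\<integral>\<^sup>+r. \<integral>\<^sup>+t. ennreal r * ((f (r *\<^sub>R dir t) + f (- r *\<^sub>R dir t)) * ennreal (1 / (1 + t\<^sup>2))) * indicator {0<..} r \<partial>lborel \<partial>lborel)"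
    by (rule lborel_pair.Fubini') measurable
  also have "\<dots> = (\<integral>\<^sup>+r. ennreal r * circ f r * indicator {0<..} r \<partial>lborel)"
    unfolding circ_def by (simp add: nn_integral_multc nn_integral_cmult)
  finally show ?thesis .
qed

section \<open>Angular integrals\<close>

lemma nn_integral_FTC_real_line:
  fixes F f :: "real \<Rightarrow> real"
  assumes [measurable]: "f \<in> borel_measurable borel"
    and d: "\<And>x. (F has_real_derivative f x) (at x)" and nn: "\<And>x. f x \<ge> 0"
    and top: "(F \<longlongrightarrow> T) at_top" and bot: "(F \<longlongrightarrow> B) at_bot"
  shows "(\<integral>\<^sup>+x. ennreal (f x) \<partial>lborel) = ennreal (T - B)"
proof -
  have mono: "F x \<le> F y" if "x \<le> y" for x y
    using DERIV_nonneg_imp_nondecreasing[OF that] d nn by blast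
  have FT: "F 0 \<le> T"
    by (rule tendsto_lowerbound[OF top]) (auto intro!: eventually_mono[OF eventually_ge_at_top[of 0]] mono)
  have BF: "B \<le> F 0"
    by (rule tendsto_upperbound[OF bot]) (auto intro!: eventually_mono[OF eventually_le_at_bot[of 0]] mono)
  have "(\<integral>\<^sup>+x. ennreal (f x) \<partial>lborel) = (\<integral>\<^sup>+x. ennreal (f x) * indicator {0..} x + ennreal (f x) * indicator {..0} x \<partial>lborel)"
    by (intro nn_integral_cong_AE AE_I[where N="{0}"]) (auto split: split_indicator)
  also have "\<dots> = (\<integral>\<^sup>+x. ennreal (f x) * indicator {0..} x \<partial>lborel) + (\<integral>\<^sup>+x. ennreal (f x) * indicator {..0} x \<partial>lborel)"
    by (rule nn_integral_add) measurable
  also have "(\<integral>\<^sup>+x. ennreal (f x) * indicator {0..} x \<partial>lborel) = ennreal (T - F 0)"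
    by (rule nn_integral_FTC_atLeast) (use d nn top in auto)
  also have "(\<integral>\<^sup>+x. ennreal (f x) * indicator {..0} x \<partial>lborel) = (\<integral>\<^sup>+x. ennreal (f (- x)) * indicator {0..} x \<partial>lborel)"
    by (subst nn_integral_real_affine[of _ "-1" 0]) (auto intro!: nn_integral_cong split: split_indicator)
  also have "\<dots> = ennreal (- B - (- F (- 0)))"
  proof (rule nn_integral_FTC_atLeast[where F="\<lambda>x. - F (- x)"])
    show "((\<lambda>x. - F (- x)) \<longlongrightarrow> - B) at_top"
      using bot by (intro tendsto_minus) (simp add: filterlim_at_top_mirror)
    show "((\<lambda>x. - F (- x)) has_real_derivative f (- x)) (at x)" for x
      using DERIV_minus[OF DERIV_chain2[OF d DERIV_minus[OF DERIV_ident], of x]] by simp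
  qed (use nn in auto)
  also have "ennreal (T - F 0) + ennreal (- B - (- F (- 0))) = ennreal (T - B)"
    using FT BF by (simp add: ennreal_plus[symmetric] del: ennreal_plus)
  finally show ?thesis .
qed

text \<open>The angular integrals evaluated below all reduce to this rational form, because the
  slope replaces the angle; completing the square gives an \<open>arctan\<close>.\<close>

lemma nn_integral_inverse_quadratic:
  fixes A B C :: real
  assumes A: "A > 0" and D: "A * C - B\<^sup>2 > 0"
  shows "(\<integral>\<^sup>+t. ennreal (1 / (A * t\<^sup>2 + 2 * B * t + C)) \<partial>lborel) = ennreal (pi / sqrt (A * C - B\<^sup>2))"
proof -
  define d where "d = sqrt (A * C - B\<^sup>2)"
  have d: "d > 0" and d2: "d\<^sup>2 = A * C - B\<^sup>2" using D by (simp_all add: d_def)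
  have pos: "A * t\<^sup>2 + 2 * B * t + C > 0" for t
  proof -
    have "A * (A * t\<^sup>2 + 2 * B * t + C) = (A * t + B)\<^sup>2 + d\<^sup>2"
      unfolding d2 by (simp add: power2_eq_square algebra_simps)
    also have "\<dots> > 0" using d by (simp add: add_nonneg_pos)
    finally show ?thesis using A by (simp add: zero_less_mult_iff)
  qed
  have "(\<integral>\<^sup>+t. ennreal (1 / (A * t\<^sup>2 + 2 * B * t + C)) \<partial>lborel) = ennreal (pi / 2 / d - (- (pi / 2)) / d)"
  proof (rule nn_integral_FTC_real_line[where F="\<lambda>t. arctan ((A * t + B) / d) / d"])
    fix t
    have e: "(A * t + B)\<^sup>2 = A * (A * t\<^sup>2 + 2 * B * t + C) - d\<^sup>2"
      unfolding d2 by (simp add: power2_eq_square algebra_simps)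
    have "((\<lambda>t. arctan ((A * t + B) / d) / d) has_real_derivative inverse (1 + ((A * t + B) / d)\<^sup>2) * (A / d) / d) (at t)"
      using d by (auto intro!: derivative_eq_intros)
    also have "inverse (1 + ((A * t + B) / d)\<^sup>2) * (A / d) / d = 1 / (A * t\<^sup>2 + 2 * B * t + C)"
    proof -
      have "1 + (A * Q - d\<^sup>2) / d\<^sup>2 = A * Q / d\<^sup>2" for Q
        using d by (simp add: field_simps)
      then show ?thesis
        unfolding power_divide e using d A by (simp add: power2_eq_square)
    qed
    finally show "((\<lambda>t. arctan ((A * t + B) / d) / d) has_real_derivative 1 / (A * t\<^sup>2 + 2 * B * t + C)) (at t)" .
    show "0 \<le> 1 / (A * t\<^sup>2 + 2 * B * t + C)" using pos[of t] by simp
  next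
    have 1: "filterlim (\<lambda>t. (A * t + B) / d) at_top at_top" using A d by real_asymp
    have 2: "filterlim (\<lambda>t. (A * t + B) / d) at_bot at_bot" using A d by real_asymp
    show "((\<lambda>t. arctan ((A * t + B) / d) / d) \<longlongrightarrow> pi / 2 / d) at_top"
      using d by (intro tendsto_divide tendsto_const filterlim_compose[OF tendsto_arctan_at_top 1]) auto
    show "((\<lambda>t. arctan ((A * t + B) / d) / d) \<longlongrightarrow> - (pi / 2) / d) at_bot"
      using d by (intro tendsto_divide tendsto_const filterlim_compose[OF tendsto_arctan_at_bot 2]) auto
  qed measurable
  then show ?thesis by (simp add: d_def)
qed

text \<open>Up to the factor \<open>2 * pi\<close>, what remains of the propagator
  \<open>1 / (1 + (norm (p - q))\<^sup>2)\<close> of the planar Yukawa potential after integration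
  over the angle.\<close>

definition yuk :: "real \<Rightarrow> real \<Rightarrow> real" where
  "yuk p q = 1 / sqrt ((1 + (p - q)\<^sup>2) * (1 + (p + q)\<^sup>2))"

lemma yuk_pos: "yuk p q > 0"
  unfolding yuk_def by (simp add: add_pos_nonneg)

lemma yuk_measurable [measurable]: "(\<lambda>(p, q). yuk p q) \<in> borel_measurable (borel \<Otimes>\<^sub>M borel)"
  unfolding yuk_def by measurable

text \<open>At antipodal points the denominators are \<open>S - w\<close> and \<open>S + w\<close>,
  so the reciprocals add up to \<open>2 * S / (S\<^sup>2 - w\<^sup>2)\<close>. Multiplied by
  \<open>1 + t\<^sup>2\<close>, that denominator is a quadratic polynomial in the slope whose
  determinant is \<open>S\<^sup>2\<close> times the product under the root in
  \<open>yuk\<close>.\<close>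

lemma circ_yukawa:
  assumes "s \<ge> 0"
  shows "circ (\<lambda>q. ennreal (1 / (1 + (norm (p - q))\<^sup>2))) s = ennreal (2 * pi * yuk (norm p) s)"
proof -
  define S where "S = 1 + (norm p)\<^sup>2 + s\<^sup>2"
  define e1 where "e1 = p $ 1"
  define e2 where "e2 = p $ 2"
  have np: "(norm p)\<^sup>2 = e1\<^sup>2 + e2\<^sup>2" by (simp add: norm_vec2_sq e1_def e2_def)
  define A where "A = S\<^sup>2 - 4 * s\<^sup>2 * e2\<^sup>2"
  define B where "B = - 4 * s\<^sup>2 * e1 * e2"
  define C where "C = S\<^sup>2 - 4 * s\<^sup>2 * e1\<^sup>2"
  have S: "S > 0" unfolding S_def by (simp add: add_pos_nonneg)
  have q: "S\<^sup>2 - 4 * s\<^sup>2 * (norm p)\<^sup>2 = (1 + (norm p - s)\<^sup>2) * (1 + (norm p + s)\<^sup>2)"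
    by (simp add: S_def power2_eq_square algebra_simps)
  have q_pos: "S\<^sup>2 - 4 * s\<^sup>2 * (norm p)\<^sup>2 > 0" unfolding q by (intro mult_pos_pos) (auto simp: add_pos_nonneg)
  have D: "A * C - B\<^sup>2 = S\<^sup>2 * (S\<^sup>2 - 4 * s\<^sup>2 * (norm p)\<^sup>2)"
    unfolding A_def B_def C_def np by (simp add: power2_eq_square algebra_simps)
  have A: "A > 0"
  proof -
    have "4 * s\<^sup>2 * e2\<^sup>2 \<le> 4 * s\<^sup>2 * (norm p)\<^sup>2" unfolding np by (intro mult_left_mono) auto
    then show ?thesis using q_pos unfolding A_def by linarith
  qed
  have summand: "(ennreal (1 / (1 + (norm (p - s *\<^sub>R dir t))\<^sup>2)) + ennreal (1 / (1 + (norm (p - - s *\<^sub>R dir t))\<^sup>2))) * ennreal (1 / (1 + t\<^sup>2))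
      = ennreal (2 * S) * ennreal (1 / (A * t\<^sup>2 + 2 * B * t + C))" for t
  proof -
    define w where "w = 2 * s * (p \<bullet> dir t)"
    have dd: "dir t \<bullet> dir t = 1" using norm_dir[of t] by (simp add: norm_eq_sqrt_inner)
    have n1: "1 + (norm (p - s *\<^sub>R dir t))\<^sup>2 = S - w" and n2: "1 + (norm (p - - s *\<^sub>R dir t))\<^sup>2 = S + w"
      unfolding S_def w_def power2_norm_eq_inner by (simp_all add: inner_diff inner_add inner_commute dd algebra_simps power2_eq_square)
    have pd: "p \<bullet> dir t = (e1 + e2 * t) / sqrt (1 + t\<^sup>2)"
      by (simp add: dir_def inner_vec2 e1_def e2_def add_divide_distrib)
    have t1: "1 + t\<^sup>2 > 0" by (simp add: add_pos_nonneg)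
    have w2: "w\<^sup>2 = 4 * s\<^sup>2 * (e1 + e2 * t)\<^sup>2 / (1 + t\<^sup>2)"
      unfolding w_def pd using t1 by (simp add: power_mult_distrib power_divide)
    have p1: "S - w > 0" "S + w > 0" unfolding n1[symmetric] n2[symmetric] by (simp_all add: add_pos_nonneg)
    have eq: "(S\<^sup>2 - w\<^sup>2) * (1 + t\<^sup>2) = A * t\<^sup>2 + 2 * B * t + C"
      unfolding w2 A_def B_def C_def using t1 by (simp add: field_simps power2_eq_square)
    have "S\<^sup>2 - w\<^sup>2 = (S - w) * (S + w)" by (simp add: power2_eq_square algebra_simps)
    then have "1 / (S - w) + 1 / (S + w) = 2 * S / (S\<^sup>2 - w\<^sup>2)"
      using p1 by (simp add: field_simps)
    then have "(1 / (S - w) + 1 / (S + w)) * (1 / (1 + t\<^sup>2)) = 2 * S * (1 / (A * t\<^sup>2 + 2 * B * t + C))"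
      unfolding eq[symmetric] by simp
    moreover have "A * t\<^sup>2 + 2 * B * t + C > 0"
      unfolding eq[symmetric] using p1 t1 by (simp add: power2_eq_square square_diff_square_factored zero_less_mult_iff)
    ultimately show ?thesis
      unfolding n1 n2 using p1 t1 S
      by (simp only: ennreal_plus[symmetric] ennreal_mult[symmetric] less_imp_le zero_le_divide_1_iff add_nonneg_nonneg mult_nonneg_nonneg)
  qed
  have "circ (\<lambda>q. ennreal (1 / (1 + (norm (p - q))\<^sup>2))) s = (\<integral>\<^sup>+t. ennreal (2 * S) * ennreal (1 / (A * t\<^sup>2 + 2 * B * t + C)) \<partial>lborel)"
    unfolding circ_def summand ..
  also have "\<dots> = ennreal (2 * S) * ennreal (pi / sqrt (A * C - B\<^sup>2))"
    using nn_integral_inverse_quadratic[OF A, of C B] D q_pos S by (simp add: nn_integral_cmult)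
  also have "\<dots> = ennreal (2 * pi * yuk (norm p) s)"
    unfolding D q yuk_def using S by (simp add: real_sqrt_mult ennreal_mult[symmetric])
  finally show ?thesis .
qed

lemma circ_radial_mult:
  assumes [measurable]: "f \<in> borel_measurable borel" and "r \<ge> 0"
  shows "circ (\<lambda>p. h (norm p) * f p) r = h r * circ f r"
  unfolding circ_def using assms
  by (subst nn_integral_cmult[symmetric]) (auto intro!: nn_integral_cong simp: distrib_left mult_ac)

section \<open>Comparison of a function with its means over circles\<close>

locale radial_reduction =
  fixes u :: "real^2 \<Rightarrow> real"
  assumes u_meas [measurable]: "u \<in> borel_measurable borel" and u_nn: "\<And>p. u p \<ge> 0"
    and u_fin: "(\<integral>\<^sup>+p. ennreal ((u p)\<^sup>2) \<partial>lborel) < \<infinity>"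
begin

definition mass :: "real \<Rightarrow> ennreal" where "mass = circ (\<lambda>p. ennreal ((u p)\<^sup>2))"

text \<open>The L2 norm of \<open>u\<close> over the circle of radius \<open>r\<close>. A circle of
  infinite mass gets the value 0; this concerns only a null set of radii.\<close>

definition prof :: "real \<Rightarrow> real" where "prof r = sqrt (enn2real (mass r))"

lemma mass_measurable [measurable]: "mass \<in> borel_measurable borel"
  unfolding mass_def by measurable

lemma prof_measurable [measurable]: "prof \<in> borel_measurable borel"
  unfolding prof_def by measurable

lemma prof_nn: "prof r \<ge> 0" unfolding prof_def by simp

lemma mass_finite: "AE r in lborel. r > 0 \<longrightarrow> mass r = ennreal ((prof r)\<^sup>2)"
proof -
  have "(\<integral>\<^sup>+r. ennreal r * mass r * indicator {0<..} r \<partial>lborel) \<noteq> \<infinity>"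
    using u_fin nn_integral_polar[of "\<lambda>p. ennreal ((u p)\<^sup>2)"] by (simp add: mass_def)
  then have "AE r in lborel. ennreal r * mass r * indicator {0<..} r \<noteq> \<infinity>"
    by (intro nn_integral_PInf_AE) auto
  then show ?thesis
  proof eventually_elim
    case (elim r)
    show ?case
    proof
      assume r: "r > 0"
      with elim have "mass r \<noteq> \<infinity>" by (auto simp: ennreal_mult_eq_top_iff)
      then show "mass r = ennreal ((prof r)\<^sup>2)" by (simp add: prof_def less_top)
    qed
  qed
qed

lemma nn_integral_radial_weight:
  assumes [measurable]: "h \<in> borel_measurable borel"
  shows "(\<integral>\<^sup>+p. h (norm p) * ennreal ((u p)\<^sup>2) \<partial>lborel) = (\<integral>\<^sup>+r. ennreal r * h r * ennreal ((prof r)\<^sup>2) * indicator {0<..} r \<partial>lborel)"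
proof -
  have c: "circ (\<lambda>p. h (norm p) * ennreal ((u p)\<^sup>2)) r = h r * mass r" if "r \<ge> 0" for r
    unfolding mass_def by (rule circ_radial_mult) (use that in auto)
  have "(\<integral>\<^sup>+p. h (norm p) * ennreal ((u p)\<^sup>2) \<partial>lborel) = (\<integral>\<^sup>+r. ennreal r * circ (\<lambda>p. h (norm p) * ennreal ((u p)\<^sup>2)) r * indicator {0<..} r \<partial>lborel)"
    by (rule nn_integral_polar) measurable
  also have "\<dots> = (\<integral>\<^sup>+r. ennreal r * h r * ennreal ((prof r)\<^sup>2) * indicator {0<..} r \<partial>lborel)"
    by (rule nn_integral_cong_AE, rule AE_mp[OF mass_finite], rule AE_I2)
       (auto simp: c mult.assoc split: split_indicator)
  finally show ?thesis .
qed

text \<open>\<open>u\<close> vanishes almost everywhere on the circles where its mean vanishes,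
  which permits the division by \<open>prof\<close> in the comparison with the radial form.\<close>

lemma prof_pos_AE: "AE p in lborel. u p = 0 \<or> prof (norm p) > 0"
proof -
  have "(\<integral>\<^sup>+p. indicator {r. prof r = 0} (norm p) * ennreal ((u p)\<^sup>2) \<partial>lborel) = 0"
  proof (subst nn_integral_radial_weight)
    show "(indicator {r. prof r = 0} :: real \<Rightarrow> ennreal) \<in> borel_measurable borel" by measurable
    have "(\<integral>\<^sup>+r. ennreal r * indicator {r. prof r = 0} r * ennreal ((prof r)\<^sup>2) * indicator {0<..} r \<partial>lborel) = (\<integral>\<^sup>+(r::real). 0 \<partial>lborel)"
      by (intro nn_integral_cong) (auto split: split_indicator)
    then show "(\<integral>\<^sup>+r. ennreal r * indicator {r. prof r = 0} r * ennreal ((prof r)\<^sup>2) * indicator {0<..} r \<partial>lborel) = 0"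
      by simp
  qed
  then have "AE p in lborel. indicator {r. prof r = 0} (norm p) * ennreal ((u p)\<^sup>2) = 0"
    by (subst (asm) nn_integral_0_iff_AE) auto
  then show ?thesis
    by eventually_elim (use prof_nn in \<open>auto simp: indicator_def less_le split: if_splits\<close>)
qed

text \<open>
  By \<open>2 x y \<le> \<lambda> x\<^sup>2 + y\<^sup>2 / \<lambda>\<close> with \<open>\<lambda>\<close> the quotient of the angular means, a rotation invariant
  positive form is dominated by its value on the angular means.
\<close>

lemma form_le_radial_form:
  "(\<integral>\<^sup>+p. \<integral>\<^sup>+q. ennreal (u p * u q / (1 + (norm (p - q))\<^sup>2)) \<partial>lborel \<partial>lborel)
   \<le> ennreal (2 * pi) * (\<integral>\<^sup>+r. \<integral>\<^sup>+s. ennreal (yuk r s * (r * prof r) * (s * prof s)) * indicator {0<..} s * indicator {0<..} r \<partial>lborel \<partial>lborel)"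
proof -
  define M where "M p q = 1 / (1 + (norm (p - q))\<^sup>2)" for p q :: "real^2"
  have M_nn: "M p q \<ge> 0" and M_sym: "M p q = M q p" for p q
    by (simp_all add: M_def norm_minus_commute)
  have [measurable]: "(\<lambda>(p, q). M p q) \<in> borel_measurable (borel \<Otimes>\<^sub>M borel)" unfolding M_def by measurable
  \<comment> \<open>One half of the weighted bound: the square of \<open>u p\<close>, weighted with
    the ratio of the profiles at \<open>q\<close> and at \<open>p\<close>. As the kernel is
    symmetric, the other half has the same integral.\<close>
  define W where "W p q = ennreal (M p q) * (ennreal ((u p)\<^sup>2) * ennreal (prof (norm q) / prof (norm p)))" for p q
  have [measurable]: "(\<lambda>(p, q). W p q) \<in> borel_measurable (borel \<Otimes>\<^sub>M borel)" unfolding W_def by measurable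
  define X where "X r = (\<integral>\<^sup>+s. ennreal (2 * pi * yuk r s * (s * prof s)) * indicator {0<..} s \<partial>lborel)" for r
  have [measurable]: "X \<in> borel_measurable borel" unfolding X_def by measurable
  have inner: "(\<integral>\<^sup>+q. ennreal (M p q) * ennreal (prof (norm q)) \<partial>lborel) = X (norm p)" for p
  proof -
    have "(\<integral>\<^sup>+q. ennreal (prof (norm q)) * ennreal (M p q) \<partial>lborel)
      = (\<integral>\<^sup>+s. ennreal s * circ (\<lambda>q. ennreal (prof (norm q)) * ennreal (M p q)) s * indicator {0<..} s \<partial>lborel)"
      by (rule nn_integral_polar) measurable
    also have "\<dots> = X (norm p)"
      unfolding X_def
    proof (rule nn_integral_cong)
      fix s :: real
      show "ennreal s * circ (\<lambda>q. ennreal (prof (norm q)) * ennreal (M p q)) s * indicator {0<..} s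
        = ennreal (2 * pi * yuk (norm p) s * (s * prof s)) * indicator {0<..} s"
      proof (cases "s > 0")
        case True
        have "circ (\<lambda>q. ennreal (prof (norm q)) * ennreal (M p q)) s = ennreal (prof s) * circ (\<lambda>q. ennreal (M p q)) s"
          by (rule circ_radial_mult[where h="\<lambda>r. ennreal (prof r)"]) (use True in auto)
        also have "circ (\<lambda>q. ennreal (M p q)) s = ennreal (2 * pi * yuk (norm p) s)"
          unfolding M_def using True by (intro circ_yukawa) simp
        finally show ?thesis
          using True prof_nn[of s] yuk_pos[of "norm p" s] by (simp add: ennreal_mult[symmetric] mult_ac)
      qed simp
    qed
    finally show ?thesis by (simp only: mult.commute)
  qed
  have "(\<integral>\<^sup>+p. \<integral>\<^sup>+q. ennreal (u p * u q / (1 + (norm (p - q))\<^sup>2)) \<partial>lborel \<partial>lborel)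
    \<le> (\<integral>\<^sup>+p. \<integral>\<^sup>+q. ennreal (1/2) * W p q + ennreal (1/2) * W q p \<partial>lborel \<partial>lborel)"
  proof (rule nn_integral_mono_AE, rule AE_mp[OF prof_pos_AE], rule AE_I2, rule impI)
    fix p assume p: "u p = 0 \<or> prof (norm p) > 0"
    show "(\<integral>\<^sup>+q. ennreal (u p * u q / (1 + (norm (p - q))\<^sup>2)) \<partial>lborel) \<le> (\<integral>\<^sup>+q. ennreal (1/2) * W p q + ennreal (1/2) * W q p \<partial>lborel)"
    proof (rule nn_integral_mono_AE, rule AE_mp[OF prof_pos_AE], rule AE_I2, rule impI)
      fix q assume q: "u q = 0 \<or> prof (norm q) > 0"
      show "ennreal (u p * u q / (1 + (norm (p - q))\<^sup>2)) \<le> ennreal (1/2) * W p q + ennreal (1/2) * W q p"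
      proof (cases "u p = 0 \<or> u q = 0")
        case False
        define x where "x = prof (norm p)"
        define y where "y = prof (norm q)"
        have xy: "x > 0" "y > 0" using p q False by (simp_all add: x_def y_def)
        have "0 \<le> (u p * y - u q * x)\<^sup>2 / (x * y)" using xy by simp
        also have "\<dots> = (u p)\<^sup>2 * (y / x) + (u q)\<^sup>2 * (x / y) - 2 * (u p * u q)"
          using xy by (simp add: field_simps power2_eq_square)
        finally have "u p * u q \<le> 1/2 * ((u p)\<^sup>2 * (y / x)) + 1/2 * ((u q)\<^sup>2 * (x / y))" by simp
        from mult_left_mono[OF this M_nn[of p q]]
        have "u p * u q / (1 + (norm (p - q))\<^sup>2) \<le> 1/2 * (M p q * ((u p)\<^sup>2 * (y / x))) + 1/2 * (M q p * ((u q)\<^sup>2 * (x / y)))"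
          unfolding M_sym[of q p] by (simp add: M_def distrib_left mult_ac)
        from ennreal_leI[OF this] show ?thesis
          unfolding W_def x_def[symmetric] y_def[symmetric] using xy M_nn
          by (subst (asm) ennreal_plus) (simp_all only: ennreal_mult[symmetric] mult_nonneg_nonneg divide_nonneg_nonneg less_imp_le zero_le_power2 zero_le_divide_1_iff zero_le_numeral)
      qed auto
    qed
  qed
  also have "\<dots> = (\<integral>\<^sup>+p. \<integral>\<^sup>+q. ennreal (1/2) * W p q \<partial>lborel \<partial>lborel) + (\<integral>\<^sup>+p. \<integral>\<^sup>+q. ennreal (1/2) * W q p \<partial>lborel \<partial>lborel)"
    by (subst nn_integral_add[symmetric]) (auto intro!: nn_integral_cong nn_integral_add)
  also have "(\<integral>\<^sup>+p. \<integral>\<^sup>+q. ennreal (1/2) * W q p \<partial>lborel \<partial>lborel) = (\<integral>\<^sup>+q. \<integral>\<^sup>+p. ennreal (1/2) * W q p \<partial>lborel \<partial>lborel)"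
    by (rule lborel_pair.Fubini') measurable
  also have "(\<integral>\<^sup>+p. \<integral>\<^sup>+q. ennreal (1/2) * W p q \<partial>lborel \<partial>lborel) + \<dots> = (\<integral>\<^sup>+p. \<integral>\<^sup>+q. W p q \<partial>lborel \<partial>lborel)"
  proof -
    have h: "ennreal (1/2) * (x :: ennreal) + ennreal (1/2) * x = x" for x
    proof -
      have "ennreal (1/2) * x + ennreal (1/2) * x = (ennreal (1/2) + ennreal (1/2)) * x" by (simp only: distrib_right)
      also have "ennreal (1/2) + ennreal (1/2) = 1" by (subst ennreal_plus[symmetric]) simp_all
      finally show ?thesis by simp
    qed
    have "(\<integral>\<^sup>+p. \<integral>\<^sup>+q. ennreal (1/2) * W p q \<partial>lborel \<partial>lborel) = ennreal (1/2) * (\<integral>\<^sup>+p. \<integral>\<^sup>+q. W p q \<partial>lborel \<partial>lborel)"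
      by (subst nn_integral_cmult[symmetric]) (auto intro!: nn_integral_cong nn_integral_cmult)
    then show ?thesis by (simp only: h)
  qed
  also have "\<dots> = (\<integral>\<^sup>+p. (X (norm p) * ennreal (1 / prof (norm p))) * ennreal ((u p)\<^sup>2) \<partial>lborel)"
  proof (rule nn_integral_cong)
    fix p
    have "W p q = (ennreal (M p q) * ennreal (prof (norm q))) * (ennreal (1 / prof (norm p)) * ennreal ((u p)\<^sup>2))" for q
    proof -
      have "ennreal (prof (norm q) / prof (norm p)) = ennreal (prof (norm q)) * ennreal (1 / prof (norm p))"
        using prof_nn by (subst ennreal_mult[symmetric]) auto
      then show ?thesis by (simp add: W_def mult_ac)
    qed
    then have "(\<integral>\<^sup>+q. W p q \<partial>lborel) = (\<integral>\<^sup>+q. (ennreal (M p q) * ennreal (prof (norm q))) * (ennreal (1 / prof (norm p)) * ennreal ((u p)\<^sup>2)) \<partial>lborel)"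
      by simp
    also have "\<dots> = X (norm p) * (ennreal (1 / prof (norm p)) * ennreal ((u p)\<^sup>2))"
      unfolding inner[symmetric] by (rule nn_integral_multc) measurable
    finally show "(\<integral>\<^sup>+q. W p q \<partial>lborel) = (X (norm p) * ennreal (1 / prof (norm p))) * ennreal ((u p)\<^sup>2)"
      by (simp only: mult.assoc)
  qed
  also have "\<dots> = (\<integral>\<^sup>+r. ennreal r * (X r * ennreal (1 / prof r)) * ennreal ((prof r)\<^sup>2) * indicator {0<..} r \<partial>lborel)"
    by (rule nn_integral_radial_weight[where h="\<lambda>r. X r * ennreal (1 / prof r)"]) measurable
  also have "\<dots> = (\<integral>\<^sup>+r. ennreal (2 * pi) * (\<integral>\<^sup>+s. ennreal (yuk r s * (r * prof r) * (s * prof s)) * indicator {0<..} s * indicator {0<..} r \<partial>lborel) \<partial>lborel)"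
  proof (rule nn_integral_cong)
    fix r :: real
    show "ennreal r * (X r * ennreal (1 / prof r)) * ennreal ((prof r)\<^sup>2) * indicator {0<..} r
      = ennreal (2 * pi) * (\<integral>\<^sup>+s. ennreal (yuk r s * (r * prof r) * (s * prof s)) * indicator {0<..} s * indicator {0<..} r \<partial>lborel)"
    proof (cases "r > 0")
      case True
      have "ennreal r * (X r * ennreal (1 / prof r)) * ennreal ((prof r)\<^sup>2) = X r * ennreal (r * prof r)"
      proof -
        \<comment> \<open>This covers \<open>prof r = 0\<close> as well, since
          \<open>1 / prof r\<close> is then 0 and both sides vanish.\<close>
        have "ennreal r * ennreal (1 / prof r) * ennreal ((prof r)\<^sup>2) = ennreal (r * prof r)"
          using True prof_nn[of r] by (simp add: ennreal_mult[symmetric] power2_eq_square)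
        moreover have "ennreal r * (X r * ennreal (1 / prof r)) * ennreal ((prof r)\<^sup>2)
            = X r * (ennreal r * ennreal (1 / prof r) * ennreal ((prof r)\<^sup>2))"
          by (simp only: mult_ac)
        ultimately show ?thesis by simp
      qed
      also have "\<dots> = (\<integral>\<^sup>+s. ennreal (2 * pi * yuk r s * (s * prof s)) * indicator {0<..} s * ennreal (r * prof r) \<partial>lborel)"
        unfolding X_def by (rule nn_integral_multc[symmetric]) measurable
      also have "\<dots> = (\<integral>\<^sup>+s. ennreal (2 * pi) * (ennreal (yuk r s * (r * prof r) * (s * prof s)) * indicator {0<..} s * indicator {0<..} r) \<partial>lborel)"
        using True prof_nn yuk_pos[of r]
        by (intro nn_integral_cong) (auto simp: ennreal_mult[symmetric] less_imp_le mult_ac split: split_indicator)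
      also have "\<dots> = ennreal (2 * pi) * (\<integral>\<^sup>+s. ennreal (yuk r s * (r * prof r) * (s * prof s)) * indicator {0<..} s * indicator {0<..} r \<partial>lborel)"
        by (rule nn_integral_cmult) measurable
      finally show ?thesis using True by simp
    qed simp
  qed
  also have "\<dots> = ennreal (2 * pi) * (\<integral>\<^sup>+r. \<integral>\<^sup>+s. ennreal (yuk r s * (r * prof r) * (s * prof s)) * indicator {0<..} s * indicator {0<..} r \<partial>lborel \<partial>lborel)"
    by (rule nn_integral_cmult) measurable
  finally show ?thesis .
qed

end

section \<open>The Laguerre gap\<close>

text \<open>
  On the orthogonal complement of \<open>exp (- a p)\<close> and \<open>p exp (- a p)\<close> the Laguerre operator
  \<open>- (p z')' + a\<^sup>2 p z\<close> is bounded from below by \<open>5 a\<close>, its third eigenvalue.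
  The difference of the quadratic forms is written as a sum of three squares plus a total
  derivative; the squares come from applying \<open>A\<^sup>* A\<close> versus \<open>A A\<^sup>*\<close> twice, and \<open>H\<close> and \<open>S\<close> below
  are iterated antiderivatives of \<open>exp (- a p) z\<close>.
\<close>

locale laguerre_gap =
  fixes a :: real and z z' H S :: "real \<Rightarrow> real"
  assumes a: "a > 0"
    and z': "\<And>p. p > 0 \<Longrightarrow> (z has_real_derivative z' p) (at p)"
    and H': "\<And>p. p > 0 \<Longrightarrow> (H has_real_derivative exp (- a * p) * z p) (at p)"
    and S': "\<And>p. p > 0 \<Longrightarrow> (S has_real_derivative H p) (at p)"
begin

text \<open>The boundary terms produced by completing the squares. The functions
  \<open>h = H * exp (a * p)\<close> and \<open>s = S * exp (a * p)\<close> satisfy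
  \<open>h' = z + a * h\<close> and \<open>s' = h + a * s\<close>, so the derivative of
  \<open>Q\<close> is again quadratic in \<open>z\<close>, \<open>z'\<close>, \<open>h\<close> and
  \<open>s\<close>, with coefficients rational in \<open>p\<close>.\<close>

definition Q :: "real \<Rightarrow> real" where
  "Q p = - 8 * a * z p * (H p * exp (a * p)) + 4 * a * (1 - 2 * a * p) / p * (H p * exp (a * p))\<^sup>2
    - 16 * a\<^sup>2 / p * ((H p * exp (a * p)) * (S p * exp (a * p)))
    + 16 * a\<^sup>2 * (1 - a * p) / p\<^sup>2 * (S p * exp (a * p))\<^sup>2 - a * p * (z p)\<^sup>2"

definition Q' :: "real \<Rightarrow> real" where
  "Q' p = - 8 * a * (z' p * (H p * exp (a * p)) + z p * (z p + a * (H p * exp (a * p))))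
    - 4 * a / p\<^sup>2 * (H p * exp (a * p))\<^sup>2
    + 8 * a * (1 - 2 * a * p) / p * (H p * exp (a * p)) * (z p + a * (H p * exp (a * p)))
    + 16 * a\<^sup>2 / p\<^sup>2 * ((H p * exp (a * p)) * (S p * exp (a * p)))
    - 16 * a\<^sup>2 / p * ((z p + a * (H p * exp (a * p))) * (S p * exp (a * p))
        + (H p * exp (a * p)) * (H p * exp (a * p) + a * (S p * exp (a * p))))
    + 16 * a\<^sup>2 * (a * p - 2) / p ^ 3 * (S p * exp (a * p))\<^sup>2
    + 32 * a\<^sup>2 * (1 - a * p) / p\<^sup>2 * (S p * exp (a * p)) * (H p * exp (a * p) + a * (S p * exp (a * p)))
    - a * (z p)\<^sup>2 - 2 * a * p * z p * z' p"

lemma Q_deriv: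
  assumes p: "p > 0"
  shows "(Q has_real_derivative Q' p) (at p)"
proof -
  have e: "((\<lambda>p. exp (a * p)) has_real_derivative a * exp (a * p)) (at p)"
    by (auto intro!: derivative_eq_intros)
  have "((\<lambda>p. H p * exp (a * p)) has_real_derivative (exp (- a * p) * z p) * exp (a * p) + (a * exp (a * p)) * H p) (at p)"
    using DERIV_mult[OF H'[OF p] e] .
  moreover have "(exp (- a * p) * z p) * exp (a * p) + (a * exp (a * p)) * H p = z p + a * (H p * exp (a * p))"
    by (simp add: exp_minus)
  ultimately have h: "((\<lambda>p. H p * exp (a * p)) has_real_derivative z p + a * (H p * exp (a * p))) (at p)"
    by (simp only:)
  have s: "((\<lambda>p. S p * exp (a * p)) has_real_derivative H p * exp (a * p) + a * (S p * exp (a * p))) (at p)"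
    using DERIV_mult[OF S'[OF p] e] by (simp add: algebra_simps)
  \<comment> \<open>The product rule is carried out for arbitrary \<open>h\<close> and
    \<open>s\<close> with given derivatives, which keeps the exponentials out of the
    algebra.\<close>
  have "((\<lambda>p. - 8 * a * z p * h p + 4 * a * (1 - 2 * a * p) / p * (h p)\<^sup>2
    - 16 * a\<^sup>2 / p * (h p * s p) + 16 * a\<^sup>2 * (1 - a * p) / p\<^sup>2 * (s p)\<^sup>2 - a * p * (z p)\<^sup>2)
    has_real_derivative
     - 8 * a * (z' p * h p + z p * hd) - 4 * a / p\<^sup>2 * (h p)\<^sup>2
    + 8 * a * (1 - 2 * a * p) / p * h p * hd
    + 16 * a\<^sup>2 / p\<^sup>2 * (h p * s p) - 16 * a\<^sup>2 / p * (hd * s p + h p * sd)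
    + 16 * a\<^sup>2 * (a * p - 2) / p ^ 3 * (s p)\<^sup>2
    + 32 * a\<^sup>2 * (1 - a * p) / p\<^sup>2 * s p * sd
    - a * (z p)\<^sup>2 - 2 * a * p * z p * z' p) (at p)"
    if h: "(h has_real_derivative hd) (at p)" and s: "(s has_real_derivative sd) (at p)" for h s hd sd
  proof -
    have c2: "((\<lambda>p. 4 * a * (1 - 2 * a * p) / p) has_real_derivative - 4 * a / p\<^sup>2) (at p)"
      using p by (auto intro!: derivative_eq_intros simp: field_simps power2_eq_square)
    have c3: "((\<lambda>p. 16 * a\<^sup>2 / p) has_real_derivative - 16 * a\<^sup>2 / p\<^sup>2) (at p)"
      using p by (auto intro!: derivative_eq_intros simp: field_simps power2_eq_square)
    have c4: "((\<lambda>p. 16 * a\<^sup>2 * (1 - a * p) / p\<^sup>2) has_real_derivative 16 * a\<^sup>2 * (a * p - 2) / p ^ 3) (at p)"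
      using p by (auto intro!: derivative_eq_intros simp: field_simps power2_eq_square power3_eq_cube)
    have h2: "((\<lambda>p. (h p)\<^sup>2) has_real_derivative 2 * h p * hd) (at p)"
      using DERIV_power[OF h, of 2] by (simp add: mult_ac)
    have s2: "((\<lambda>p. (s p)\<^sup>2) has_real_derivative 2 * s p * sd) (at p)"
      using DERIV_power[OF s, of 2] by (simp add: mult_ac)
    have z2: "((\<lambda>p. (z p)\<^sup>2) has_real_derivative 2 * z p * z' p) (at p)"
      using DERIV_power[OF z'[OF p], of 2] by (simp add: mult_ac)
    have c1: "((\<lambda>p. - 8 * a * z p) has_real_derivative - 8 * a * z' p) (at p)"
      using DERIV_cmult[OF z'[OF p], of "- 8 * a"] by simp
    have c5: "((\<lambda>p. a * p) has_real_derivative a) (at p)"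
      using DERIV_cmult[OF DERIV_ident, of a] by simp
    show ?thesis
      by (rule DERIV_cong[OF DERIV_diff[OF DERIV_add[OF DERIV_diff[OF DERIV_add[OF DERIV_mult[OF c1 h]
          DERIV_mult[OF c2 h2]] DERIV_mult[OF c3 DERIV_mult[OF h s]]] DERIV_mult[OF c4 s2]] DERIV_mult[OF c5 z2]]])
        (simp add: algebra_simps)
  qed
  from this[OF h s] show ?thesis unfolding Q_def[abs_def] Q'_def .
qed

text \<open>The difference of the two sides is a sum of three squares. With antiderivatives that
  vanish at 0, all three are zero on the third Laguerre function, a multiple of
  \<open>(x\<^sup>2 - 4 * x + 2) * exp (- x / 2)\<close> with \<open>x = 2 * a * p\<close>, so
  nothing is lost in the constant \<open>5 * a\<close>.\<close>

lemma Q'_le: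
  assumes p: "p > 0"
  shows "Q' p \<le> p * (z' p)\<^sup>2 + a\<^sup>2 * p * (z p)\<^sup>2 - 5 * a * (z p)\<^sup>2"
proof -
  define h where "h = H p * exp (a * p)"
  define s where "s = S p * exp (a * p)"
  have "p * (z' p)\<^sup>2 + a\<^sup>2 * p * (z p)\<^sup>2 - 5 * a * (z p)\<^sup>2 - Q' p
    = p * (z' p + a * z p + 4 * a * h / p)\<^sup>2
     + 4 * a * (z p - h / p + 2 * a * h + 2 * a * s / p)\<^sup>2
     + 8 * a\<^sup>2 * p ^ 3 * (h / p\<^sup>2 - 2 * s / p ^ 3 + 2 * a * s / p\<^sup>2)\<^sup>2"
    unfolding Q'_def h_def[symmetric] s_def[symmetric] using p
    by (simp add: field_simps power2_eq_square power3_eq_cube)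
  moreover have "\<dots> \<ge> 0" using p a by (intro add_nonneg_nonneg mult_nonneg_nonneg) auto
  ultimately show ?thesis by linarith
qed

end

section \<open>The overlap of the trial function with its image\<close>

text \<open>
  A quadratic minorant of \<open>arsinh\<^sup>2\<close>.  In the variable \<open>t = arsinh s\<close> the difference is convex,
  concave and convex on three consecutive intervals; on the outer ones a tangent line decides.
\<close>

lemma sinh_quadratic_bound:
  fixes t :: real
  assumes t0: "t \<ge> 0"
  shows "t\<^sup>2 + 3/5 - 7/5 * sinh t + 23/500 * (sinh t)\<^sup>2 \<ge> 0"
proof -
  define G where "G t = t\<^sup>2 + 3/5 - 7/5 * sinh t + 23/500 * (sinh t)\<^sup>2" for t :: real
  define G1 where "G1 t = 2 * t - 7/5 * cosh t + 23/250 * (sinh t * cosh t)" for t :: real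
  \<comment> \<open>The second derivative of \<open>G\<close>, as a polynomial in
    \<open>sinh t\<close>; its two roots give the inflection points.\<close>
  define q where "q S = 2 + 23/250 - 7/5 * S + 23/125 * S\<^sup>2" for S :: real
  have d1: "(G has_real_derivative G1 t) (at t)" for t
    unfolding G_def[abs_def] G1_def by (auto intro!: derivative_eq_intros)
  have d2: "(G1 has_real_derivative q (sinh t)) (at t)" for t
  proof -
    have "(G1 has_real_derivative 2 - 7/5 * sinh t + 23/250 * (cosh t * cosh t + sinh t * sinh t)) (at t)"
      unfolding G1_def[abs_def] by (auto intro!: derivative_eq_intros)
    moreover have "2 - 7/5 * sinh t + 23/250 * (cosh t * cosh t + sinh t * sinh t) = q (sinh t)"
    proof -
      have "cosh t * cosh t = sinh t * sinh t + 1"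
        using cosh_square_eq[of t] by (simp add: power2_eq_square)
      then show ?thesis unfolding q_def power2_eq_square by (simp add: field_simps)
    qed
    ultimately show ?thesis by simp
  qed
  \<comment> \<open>Square root of the discriminant of \<open>q\<close>, whose coefficients are
    0.184, - 1.4 and 2.092.\<close>
  define D where "D = sqrt (1.96 - 0.736 * 2.092 :: real)"
  have D2: "D\<^sup>2 = 1.96 - 0.736 * 2.092" unfolding D_def by simp
  have D: "0.648 \<le> D" "D \<le> 0.649"
    unfolding D_def by (rule real_le_rsqrt, simp add: power2_eq_square)
      (rule real_le_lsqrt, auto simp: power2_eq_square)
  define SA where "SA = (1.4 - D) / 0.368"
  define SB where "SB = (1.4 + D) / 0.368"
  have q_eq: "q S = 0.184 * ((S - SA) * (S - SB))" for S
  proof -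
    have "0.184 * ((S - SA) * (S - SB)) = (0.184 * S\<^sup>2 - 1.4 * S + (1.96 - D\<^sup>2) / 0.736)"
      unfolding SA_def SB_def by (simp add: power2_eq_square field_simps)
    then show ?thesis unfolding D2 q_def by simp
  qed
  have SAB: "2.04 \<le> SA" "SA \<le> 2.044" "5.56 \<le> SB" "SB \<le> 5.57"
    unfolding SA_def SB_def using D by auto
  define tA where "tA = arsinh SA"
  define tB where "tB = arsinh SB"
  have sA: "sinh tA = SA" and sB: "sinh tB = SB" by (simp_all add: tA_def tB_def)
  have mono: "sinh x \<le> sinh y \<longleftrightarrow> x \<le> y" for x y :: real by simp
  have sinh_ln: "sinh (ln x) = (x - 1 / x) / 2" "cosh (ln x) = (x + 1 / x) / 2" if "x > 0" for x :: real
    using that by (simp_all add: sinh_ln_real cosh_ln_real inverse_eq_divide)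
  \<comment> \<open>The comparison points are logarithms of rational numbers, because
    \<open>sinh\<close> and \<open>cosh\<close> are rational there; only the points themselves need
    numerical bounds.\<close>
  have l83: "0.980 \<le> ln (8/3 :: real)" "ln (8/3 :: real) \<le> 0.9815"
    using ln_approx_bounds[of "8/3" 4] by (simp_all add: eval_nat_numeral field_simps)
  have l2: "0.693 \<le> ln (2 :: real)" "ln (2 :: real) \<le> 0.6935"
    using ln_approx_bounds[of 2 3] by (simp_all add: eval_nat_numeral field_simps)
  have ln8: "ln (x :: real) = ln (x / 8) + 3 * ln 2" if "x > 0" for x
  proof -
    have "ln x = ln (x / 8 * 2^3)" by simp
    also have "\<dots> = ln (x / 8) + ln (2^3)" by (rule ln_mult_pos) (use that in auto)
    also have "ln (2^3 :: real) = real 3 * ln 2" by (rule ln_realpow)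
    finally show ?thesis by simp
  qed
  have l15: "2.707 \<le> ln (15 :: real)" "ln (15 :: real) \<le> 2.7095"
  proof -
    have "0.628 \<le> ln (15/8 :: real)" "ln (15/8 :: real) \<le> 0.629"
      using ln_approx_bounds[of "15/8" 3] by (simp_all add: eval_nat_numeral field_simps)
    then show "2.707 \<le> ln (15 :: real)" "ln (15 :: real) \<le> 2.7095"
      using l2 ln8[of 15] by simp_all
  qed
  have l11: "2.3 \<le> ln (11 :: real)"
  proof -
    have "0.3 \<le> ln (11/8 :: real)"
      using ln_approx_bounds[of "11/8" 2] by (simp_all add: eval_nat_numeral field_simps)
    then show ?thesis using l2 ln8[of 11] by simp
  qed
  have l44: "ln (22/5 :: real) \<le> 1.5"
  proof -
    have "ln (22/5 :: real) = ln (11/10 * 2^2)" by simp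
    also have "\<dots> = ln (11/10) + ln (2^2)" by (rule ln_mult_pos) auto
    also have "ln (2^2 :: real) = real 2 * ln 2" by (rule ln_realpow)
    also have "ln (11/10 :: real) \<le> 11/10 - 1" by (rule ln_le_minus_one) simp
    finally show ?thesis using l2 by simp
  qed
  \<comment> \<open>Points near the local minima of \<open>G\<close> on the two outer intervals. The
    slopes there are small and of known sign, so the tangent lines stay above 0 up to the inflection
    points.\<close>
  define t1 where "t1 = ln (8/3 :: real)"
  define t2 where "t2 = ln (15 :: real)"
  have S1: "sinh t1 = 55/48" "cosh t1 = 73/48" using sinh_ln[of "8/3"] by (simp_all add: t1_def)
  have S2: "sinh t2 = 112/15" "cosh t2 = 113/15" using sinh_ln[of "15"] by (simp_all add: t2_def)
  have t1A: "t1 \<le> tA" by (rule iffD1[OF mono]) (use SAB in \<open>simp add: sA S1\<close>)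
  have tB2: "tB \<le> t2" by (rule iffD1[OF mono]) (use SAB in \<open>simp add: sB S2\<close>)
  have tAB: "tA \<le> tB" by (rule iffD1[OF mono]) (use SAB in \<open>simp add: sA sB\<close>)
  have G1t1: "G1 t1 \<le> 0" "G1 t1 \<ge> -0.0095" and Gt1: "G t1 \<ge> 0.0165"
  proof -
    have "t1\<^sup>2 \<ge> 0.98\<^sup>2" using l83 unfolding t1_def by (intro power_mono) auto
    then show "G t1 \<ge> 0.0165" unfolding G_def S1 by (simp add: power2_eq_square)
    show "G1 t1 \<le> 0" "G1 t1 \<ge> -0.0095" unfolding G1_def S1 using l83 by (simp_all add: t1_def)
  qed
  have G1t2: "G1 t2 \<ge> 0" "G1 t2 \<le> 0.06" and Gt2: "G t2 \<ge> 0.038"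
  proof -
    have "t2\<^sup>2 \<ge> 2.707\<^sup>2" using l15 unfolding t2_def by (intro power_mono) auto
    then show "G t2 \<ge> 0.038" unfolding G_def S2 by (simp add: power2_eq_square)
    show "G1 t2 \<ge> 0" "G1 t2 \<le> 0.06" unfolding G1_def S2 using l15 by (simp_all add: t2_def)
  qed
  \<comment> \<open>Crude positions of the inflection points, here and in \<open>tB_ge\<close>,
    limit how far each tangent line has to be followed.\<close>
  have tA_le: "tA \<le> 1.5"
  proof -
    have "tA \<le> ln (22/5)" by (rule iffD1[OF mono]) (use sinh_ln[of "22/5"] SAB in \<open>simp add: sA\<close>)
    then show ?thesis using l44 by simp
  qed
  have tB_ge: "tB \<ge> 2.3"
  proof -
    have "ln 11 \<le> tB" by (rule iffD1[OF mono]) (use sinh_ln[of 11] SAB in \<open>simp add: sB\<close>)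
    then show ?thesis using l11 by simp
  qed
  have G_left: "G t \<ge> 0" if "0 \<le> t" "t \<le> tA" for t
  proof -
    have "G1 t1 * (t - t1) \<le> G t - G t1"
    proof (rule f''_imp_f'[where C="{..tA}" and f''="\<lambda>t. q (sinh t)"])
      fix x assume "x \<in> {..tA}"
      then have "sinh x \<le> SA" using mono[of x tA] by (simp add: sA)
      then show "0 \<le> q (sinh x)" unfolding q_eq using SAB by (intro mult_nonneg_nonneg mult_nonpos_nonpos) auto
    qed (use d1 d2 that t1A in auto)
    moreover have "G1 t1 * (t - t1) \<ge> -0.0165"
    proof (cases "t \<le> t1")
      case True
      then have "G1 t1 * (t - t1) \<ge> 0" using G1t1 by (intro mult_nonpos_nonpos) auto
      then show ?thesis by simp
    next
      case False
      have "- G1 t1 * (t - t1) \<le> 0.0095 * (1.5 - 0.98)"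
        using False G1t1 that tA_le l83 by (intro mult_mono) (auto simp: t1_def)
      then show ?thesis by simp
    qed
    ultimately show ?thesis using Gt1 by linarith
  qed
  have G_right: "G t \<ge> 0" if "tB \<le> t" for t
  proof -
    have "G1 t2 * (t - t2) \<le> G t - G t2"
    proof (rule f''_imp_f'[where C="{tB..}" and f''="\<lambda>t. q (sinh t)"])
      fix x assume "x \<in> {tB..}"
      then have "SB \<le> sinh x" using mono[of tB x] by (simp add: sB)
      then show "0 \<le> q (sinh x)" unfolding q_eq using SAB by (intro mult_nonneg_nonneg) auto
    qed (use d1 d2 that tB2 in auto)
    moreover have "G1 t2 * (t2 - t) \<le> 0.06 * (2.7095 - 2.3)"
    proof (cases "t \<le> t2")
      case True
      then show ?thesis using G1t2 that tB_ge l15 by (intro mult_mono) (auto simp: t2_def)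
    next
      case False
      then have "G1 t2 * (t2 - t) \<le> 0" using G1t2 by (intro mult_nonneg_nonpos) auto
      then show ?thesis by simp
    qed
    ultimately show ?thesis using Gt2 by (simp add: algebra_simps)
  qed
  have "G t \<ge> 0"
  proof (cases "t \<le> tA \<or> t \<ge> tB")
    case True
    then show ?thesis using G_left G_right t0 by blast
  next
    case False
    \<comment> \<open>Between the inflection points \<open>G\<close> lies below its tangent at
      \<open>t\<close>. Following the tangent towards the end where it does not rise bounds the
      nonnegative value of \<open>G\<close> at that end by \<open>G t\<close>.\<close>
    define F where "F t = - G t" for t
    have tang: "- G1 t * (y - t) \<le> F y - F t" if "y \<in> {tA..tB}" for y
    proof (rule f''_imp_f'[where C="{tA..tB}" and f''="\<lambda>t. - q (sinh t)"])
      fix x assume x: "x \<in> {tA..tB}"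
      show "(F has_real_derivative - G1 x) (at x)" unfolding F_def[abs_def] by (intro derivative_intros d1)
      show "((\<lambda>t. - G1 t) has_real_derivative - q (sinh x)) (at x)" by (intro derivative_intros d2)
      have "SA \<le> sinh x" "sinh x \<le> SB" using x mono[of tA x] mono[of x tB] by (simp_all add: sA sB)
      then show "0 \<le> - q (sinh x)" unfolding q_eq by (simp add: mult_nonneg_nonpos)
    qed (use that False in auto)
    have ends: "G tA \<ge> 0" "G tB \<ge> 0" using G_left[of tA] G_right[of tB] t1A l83 by (auto simp: t1_def)
    show ?thesis
    proof (cases "G1 t \<ge> 0")
      case True
      have "- G1 t * (tA - t) \<ge> 0" using True False by (simp add: mult_nonneg_nonpos)
      then show ?thesis using tang[of tA] tAB ends unfolding F_def by auto
    next
      case G1: False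
      have "- G1 t * (tB - t) \<ge> 0" using G1 False by (intro mult_nonneg_nonneg) auto
      then show ?thesis using tang[of tB] tAB ends unfolding F_def by auto
    qed
  qed
  then show ?thesis by (simp add: G_def)
qed

section \<open>Gamma integrals and integrals of the radial kernel over the quadrant\<close>

lemma nn_integral_power_exp:
  assumes a: "a > 0"
  shows "(\<integral>\<^sup>+s. ennreal (s ^ k * exp (- a * s)) * indicator {0<..} s \<partial>lborel) = ennreal (fact k / a ^ Suc k)"
proof -
  have "ennreal (fact k) = (\<integral>\<^sup>+s. ennreal (s ^ k * exp (- s)) * indicator {0..} s \<partial>lborel)"
    using nn_intergal_power_times_exp_Ici[of k] by simp
  also have "\<dots> = ennreal a * (\<integral>\<^sup>+s. ennreal ((a * s) ^ k * exp (- (a * s))) * indicator {0..} (a * s) \<partial>lborel)"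
    using a nn_integral_real_affine[of "\<lambda>s. ennreal (s ^ k * exp (- s)) * indicator {0..} s" a 0] by simp
  also have "(\<integral>\<^sup>+s. ennreal ((a * s) ^ k * exp (- (a * s))) * indicator {0..} (a * s) \<partial>lborel)
      = (\<integral>\<^sup>+s. ennreal (a ^ k) * (ennreal (s ^ k * exp (- a * s)) * indicator {0<..} s) \<partial>lborel)"
    using a by (intro nn_integral_cong_AE AE_I[where N="{0}"])
       (auto simp: power_mult_distrib ennreal_mult zero_le_mult_iff mult_ac split: split_indicator)
  also have "\<dots> = ennreal (a ^ k) * (\<integral>\<^sup>+s. ennreal (s ^ k * exp (- a * s)) * indicator {0<..} s \<partial>lborel)"
    by (rule nn_integral_cmult) measurable
  finally have eq: "ennreal (fact k) = ennreal (a ^ Suc k) * (\<integral>\<^sup>+s. ennreal (s ^ k * exp (- a * s)) * indicator {0<..} s \<partial>lborel)"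
    using a by (simp add: ennreal_mult mult.assoc)
  define X where "X = (\<integral>\<^sup>+s. ennreal (s ^ k * exp (- a * s)) * indicator {0<..} s \<partial>lborel)"
  have "ennreal (1 / a ^ Suc k) * ennreal (fact k) = (ennreal (1 / a ^ Suc k) * ennreal (a ^ Suc k)) * X"
    unfolding eq X_def by (simp only: mult.assoc)
  also have "ennreal (1 / a ^ Suc k) * ennreal (a ^ Suc k) = 1"
    using a by (subst ennreal_mult[symmetric]) auto
  finally have "X = ennreal (1 / a ^ Suc k) * ennreal (fact k)" by simp
  also have "\<dots> = ennreal (fact k / a ^ Suc k)" using a by (subst ennreal_mult[symmetric]) auto
  finally show ?thesis by (simp add: X_def)
qed

lemma integrable_power_exp:
  assumes a: "a > 0"
  shows "integrable lborel (\<lambda>s. s ^ k * exp (- a * s) * indicator {0<..} s :: real)"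
proof (rule integrableI_nonneg)
  have "(\<integral>\<^sup>+s. ennreal (s ^ k * exp (- a * s) * indicator {0<..} s) \<partial>lborel) = (\<integral>\<^sup>+s. ennreal (s ^ k * exp (- a * s)) * indicator {0<..} s \<partial>lborel)"
    by (intro nn_integral_cong) (auto split: split_indicator)
  then show "(\<integral>\<^sup>+s. ennreal (s ^ k * exp (- a * s) * indicator {0<..} s) \<partial>lborel) < \<infinity>"
    unfolding nn_integral_power_exp[OF a] by simp
qed (auto split: split_indicator)

lemma integral_power_exp:
  assumes a: "a > 0"
  shows "(\<integral>s. s ^ k * exp (- a * s) * indicator {0<..} s \<partial>lborel) = (fact k / a ^ Suc k :: real)"
proof -
  have "ennreal (\<integral>s. s ^ k * exp (- a * s) * indicator {0<..} s \<partial>lborel) = (\<integral>\<^sup>+s. ennreal (s ^ k * exp (- a * s) * indicator {0<..} s) \<partial>lborel)"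
    by (rule nn_integral_eq_integral[OF integrable_power_exp[OF a], symmetric]) (auto split: split_indicator)
  also have "\<dots> = (\<integral>\<^sup>+s. ennreal (s ^ k * exp (- a * s)) * indicator {0<..} s \<partial>lborel)"
    by (intro nn_integral_cong) (auto split: split_indicator)
  finally have "ennreal (\<integral>s. s ^ k * exp (- a * s) * indicator {0<..} s \<partial>lborel) = ennreal (fact k / a ^ Suc k)"
    unfolding nn_integral_power_exp[OF a] .
  then show ?thesis
    using a by (subst (asm) ennreal_inj) (auto intro!: integral_nonneg_AE AE_I2 split: split_indicator)
qed

text \<open>In the coordinates \<open>s = p + q\<close> and \<open>p\<close> the quadrant becomes
  \<open>0 < p < s\<close>, and \<open>p - q\<close> becomes \<open>2 * p - s\<close>. Both
  \<open>yuk\<close> and its square factor into a function of the sum and a function of the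
  difference.\<close>

lemma nn_integral_quadrant:
  fixes F G :: "real \<Rightarrow> ennreal"
  assumes [measurable]: "F \<in> borel_measurable borel" "G \<in> borel_measurable borel"
  shows "(\<integral>\<^sup>+p. \<integral>\<^sup>+q. F (p + q) * G (p - q) * indicator {0<..} q * indicator {0<..} p \<partial>lborel \<partial>lborel)
    = (\<integral>\<^sup>+s. F s * (\<integral>\<^sup>+p. G (2 * p - s) * indicator {0..s} p \<partial>lborel) * indicator {0<..} s \<partial>lborel)"
proof -
  have "(\<integral>\<^sup>+p. \<integral>\<^sup>+q. F (p + q) * G (p - q) * indicator {0<..} q * indicator {0<..} p \<partial>lborel \<partial>lborel)
    = (\<integral>\<^sup>+p. \<integral>\<^sup>+s. F s * G (2 * p - s) * indicator {0<..} (s - p) * indicator {0<..} p \<partial>lborel \<partial>lborel)"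
  proof (rule nn_integral_cong)
    fix p :: real
    show "(\<integral>\<^sup>+q. F (p + q) * G (p - q) * indicator {0<..} q * indicator {0<..} p \<partial>lborel)
      = (\<integral>\<^sup>+s. F s * G (2 * p - s) * indicator {0<..} (s - p) * indicator {0<..} p \<partial>lborel)"
      using nn_integral_shift[of "\<lambda>s. F s * G (2 * p - s) * indicator {0<..} (s - p) * indicator {0<..} p" p]
      by (simp add: add.commute)
  qed
  also have "\<dots> = (\<integral>\<^sup>+s. \<integral>\<^sup>+p. F s * G (2 * p - s) * indicator {0<..} (s - p) * indicator {0<..} p \<partial>lborel \<partial>lborel)"
    by (rule lborel_pair.Fubini') measurable
  also have "\<dots> = (\<integral>\<^sup>+s. F s * (\<integral>\<^sup>+p. G (2 * p - s) * indicator {0..s} p \<partial>lborel) * indicator {0<..} s \<partial>lborel)"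
  proof (rule nn_integral_cong)
    fix s :: real
    show "(\<integral>\<^sup>+p. F s * G (2 * p - s) * indicator {0<..} (s - p) * indicator {0<..} p \<partial>lborel)
      = F s * (\<integral>\<^sup>+p. G (2 * p - s) * indicator {0..s} p \<partial>lborel) * indicator {0<..} s"
    proof (cases "s > 0")
      case True
      have "(\<integral>\<^sup>+p. F s * G (2 * p - s) * indicator {0<..} (s - p) * indicator {0<..} p \<partial>lborel)
        = (\<integral>\<^sup>+p. F s * (G (2 * p - s) * indicator {0..s} p) \<partial>lborel)"
        by (intro nn_integral_cong_AE AE_I[where N="{0, s}"])
             (auto split: split_indicator simp: emeasure_lborel_countable)
      then show ?thesis using True by (simp add: nn_integral_cmult)
    next
      case False
      have "(\<integral>\<^sup>+p. F s * G (2 * p - s) * indicator {0<..} (s - p) * indicator {0<..} p \<partial>lborel) = (\<integral>\<^sup>+(p::real). 0 \<partial>lborel)"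
        by (rule nn_integral_cong) (use False in \<open>auto split: split_indicator\<close>)
      then show ?thesis using False by simp
    qed
  qed
  finally show ?thesis .
qed

lemma yuk_factor: "yuk p q = 1 / sqrt (1 + (p + q)\<^sup>2) * (1 / sqrt (1 + (p - q)\<^sup>2))"
  by (simp add: yuk_def real_sqrt_mult)

lemma arsinh_deriv: "(arsinh has_real_derivative 1 / sqrt (1 + x\<^sup>2)) (at x)"
  by (auto intro!: derivative_eq_intros simp: add.commute)

lemma arsinh_nonneg: "s \<ge> 0 \<Longrightarrow> arsinh s \<ge> (0::real)"
  using arsinh_less_iff_real[of s 0] by (cases "s = 0") (auto simp: arsinh_0 not_less[symmetric])

text \<open>The inner integral of \<open>1 / sqrt (1 + d\<^sup>2)\<close> over
  \<open>- s < d < s\<close>, with \<open>d = 2 * p - s\<close>, is \<open>arsinh s\<close> after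
  the Jacobian 1/2. A weight in the sum is what the product of two equal exponentials
  provides.\<close>

lemma nn_integral_yuk_sum:
  assumes [measurable]: "h \<in> borel_measurable borel"
  shows "(\<integral>\<^sup>+p. \<integral>\<^sup>+q. h (p + q) * ennreal (yuk p q) * indicator {0<..} q * indicator {0<..} p \<partial>lborel \<partial>lborel)
    = (\<integral>\<^sup>+s. h s * ennreal (arsinh s / sqrt (1 + s\<^sup>2)) * indicator {0<..} s \<partial>lborel)"
proof -
  have "h (p + q) * ennreal (yuk p q) = (h (p + q) * ennreal (1 / sqrt (1 + (p + q)\<^sup>2))) * ennreal (1 / sqrt (1 + (p - q)\<^sup>2))" for p q
  proof -
    have "ennreal (yuk p q) = ennreal (1 / sqrt (1 + (p + q)\<^sup>2)) * ennreal (1 / sqrt (1 + (p - q)\<^sup>2))"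
      unfolding yuk_factor by (rule ennreal_mult) auto
    then show ?thesis by (simp only: mult.assoc)
  qed
  then have "(\<integral>\<^sup>+p. \<integral>\<^sup>+q. h (p + q) * ennreal (yuk p q) * indicator {0<..} q * indicator {0<..} p \<partial>lborel \<partial>lborel)
    = (\<integral>\<^sup>+s. (h s * ennreal (1 / sqrt (1 + s\<^sup>2))) * (\<integral>\<^sup>+p. ennreal (1 / sqrt (1 + (2 * p - s)\<^sup>2)) * indicator {0..s} p \<partial>lborel) * indicator {0<..} s \<partial>lborel)"
    using nn_integral_quadrant[of "\<lambda>s. h s * ennreal (1 / sqrt (1 + s\<^sup>2))" "\<lambda>d. ennreal (1 / sqrt (1 + d\<^sup>2))"] by simp
  also have "\<dots> = (\<integral>\<^sup>+s. h s * ennreal (arsinh s / sqrt (1 + s\<^sup>2)) * indicator {0<..} s \<partial>lborel)"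
  proof (rule nn_integral_cong)
    fix s :: real
    show "(h s * ennreal (1 / sqrt (1 + s\<^sup>2))) * (\<integral>\<^sup>+p. ennreal (1 / sqrt (1 + (2 * p - s)\<^sup>2)) * indicator {0..s} p \<partial>lborel) * indicator {0<..} s
      = h s * ennreal (arsinh s / sqrt (1 + s\<^sup>2)) * indicator {0<..} s"
    proof (cases "s > 0")
      case True
      have "(\<integral>\<^sup>+p. ennreal (1 / sqrt (1 + (2 * p - s)\<^sup>2)) * indicator {0..s} p \<partial>lborel) = ennreal (arsinh (2 * s - s) / 2 - arsinh (2 * 0 - s) / 2)"
      proof (rule nn_integral_FTC_Icc[where F="\<lambda>p. arsinh (2 * p - s) / 2"])
        show "((\<lambda>p. arsinh (2 * p - s) / 2) has_real_derivative 1 / sqrt (1 + (2 * x - s)\<^sup>2)) (at x)" for x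
        proof -
          have "((\<lambda>p. arsinh (2 * p - s) / 2) has_real_derivative 1 / sqrt (1 + (2 * x - s)\<^sup>2) * 2 / 2) (at x)"
            by (intro DERIV_cdivide DERIV_chain2[OF arsinh_deriv]) (auto intro!: derivative_eq_intros)
          then show ?thesis by simp
        qed
      qed (use True in auto)
      also have "\<dots> = ennreal (arsinh s)" by (simp add: arsinh_minus_real)
      finally show ?thesis using True arsinh_nonneg[of s]
        by (simp add: mult.assoc ennreal_mult[symmetric])
    qed simp
  qed
  finally show ?thesis .
qed

text \<open>The squared Hilbert-Schmidt norm. The inner integral is \<open>arctan s\<close>, and
  \<open>arctan s / (1 + s\<^sup>2)\<close> is the derivative of half of its square.\<close>

lemma nn_integral_yuk_sq:
  "(\<integral>\<^sup>+p. \<integral>\<^sup>+q. ennreal ((yuk p q)\<^sup>2) * indicator {0<..} q * indicator {0<..} p \<partial>lborel \<partial>lborel) = ennreal (pi\<^sup>2 / 8)"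
proof -
  have "ennreal ((yuk p q)\<^sup>2) = ennreal (1 / (1 + (p + q)\<^sup>2)) * ennreal (1 / (1 + (p - q)\<^sup>2))" for p q
    unfolding yuk_factor by (simp add: ennreal_mult[symmetric] power_mult_distrib power_divide)
  then have "(\<integral>\<^sup>+p. \<integral>\<^sup>+q. ennreal ((yuk p q)\<^sup>2) * indicator {0<..} q * indicator {0<..} p \<partial>lborel \<partial>lborel)
    = (\<integral>\<^sup>+s. ennreal (1 / (1 + s\<^sup>2)) * (\<integral>\<^sup>+p. ennreal (1 / (1 + (2 * p - s)\<^sup>2)) * indicator {0..s} p \<partial>lborel) * indicator {0<..} s \<partial>lborel)"
    using nn_integral_quadrant[of "\<lambda>s. ennreal (1 / (1 + s\<^sup>2))" "\<lambda>d. ennreal (1 / (1 + d\<^sup>2))"] by simp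
  also have "\<dots> = (\<integral>\<^sup>+s. ennreal (arctan s / (1 + s\<^sup>2)) * indicator {0..} s \<partial>lborel)"
  proof (rule nn_integral_cong_AE, rule AE_I[where N="{0}"], rule subsetI)
    fix s :: real
    have "ennreal (1 / (1 + s\<^sup>2)) * (\<integral>\<^sup>+p. ennreal (1 / (1 + (2 * p - s)\<^sup>2)) * indicator {0..s} p \<partial>lborel) * indicator {0<..} s
      = ennreal (arctan s / (1 + s\<^sup>2)) * indicator {0..} s" if "s \<noteq> 0"
    proof (cases "s > 0")
      case True
      have "(\<integral>\<^sup>+p. ennreal (1 / (1 + (2 * p - s)\<^sup>2)) * indicator {0..s} p \<partial>lborel) = ennreal (arctan (2 * s - s) / 2 - arctan (2 * 0 - s) / 2)"
      proof (rule nn_integral_FTC_Icc[where F="\<lambda>p. arctan (2 * p - s) / 2"])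
        show "((\<lambda>p. arctan (2 * p - s) / 2) has_real_derivative 1 / (1 + (2 * x - s)\<^sup>2)) (at x)" for x
        proof -
          have "((\<lambda>p. arctan (2 * p - s) / 2) has_real_derivative inverse (1 + (2 * x - s)\<^sup>2) * 2 / 2) (at x)"
            by (intro DERIV_cdivide DERIV_chain2[OF DERIV_arctan]) (auto intro!: derivative_eq_intros)
          moreover have "inverse X * 2 / 2 = 1 / X" for X :: real by (simp add: inverse_eq_divide)
          ultimately show ?thesis by (simp only:)
        qed
      qed (use True in auto)
      also have "\<dots> = ennreal (arctan s)" by (simp add: arctan_minus)
      finally show ?thesis using True
        by (simp add: ennreal_mult[symmetric])
    qed (use that in simp)
    moreover assume "s \<in> {x \<in> space lborel. ennreal (1 / (1 + x\<^sup>2)) * (\<integral>\<^sup>+p. ennreal (1 / (1 + (2 * p - x)\<^sup>2)) * indicator {0..x} p \<partial>lborel) * indicator {0<..} x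
      \<noteq> ennreal (arctan x / (1 + x\<^sup>2)) * indicator {0..} x}"
    ultimately show "s \<in> {0}" by auto
  qed auto
  also have "\<dots> = ennreal ((pi / 2)\<^sup>2 / 2 - (arctan 0)\<^sup>2 / 2)"
  proof (rule nn_integral_FTC_atLeast[where F="\<lambda>s. (arctan s)\<^sup>2 / 2"])
    show "((\<lambda>s. (arctan s)\<^sup>2 / 2) has_real_derivative arctan x / (1 + x\<^sup>2)) (at x)" for x
    proof -
      have "((\<lambda>s. (arctan s)\<^sup>2 / 2) has_real_derivative 2 * arctan x * inverse (1 + x\<^sup>2) / 2) (at x)"
        by (auto intro!: derivative_eq_intros)
      moreover have "2 * y * inverse X / 2 = y / X" for y X :: real by (simp add: field_simps)
      ultimately show ?thesis by (simp only:)
    qed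
    show "((\<lambda>s. (arctan s)\<^sup>2 / 2) \<longlongrightarrow> (pi / 2)\<^sup>2 / 2) at_top"
      by (rule tendsto_divide[OF tendsto_power[OF tendsto_arctan_at_top] tendsto_const]) simp
  qed auto
  finally show ?thesis by (simp add: power2_eq_square)
qed

section \<open>The Laplace transform that gives the overlap\<close>

definition ashk :: "real \<Rightarrow> real" where "ashk s = arsinh s / sqrt (1 + s\<^sup>2) * indicator {0<..} s"

text \<open>On the half-line \<open>ashk\<close> is half the derivative of the square of
  \<open>arsinh\<close>. Hence \<open>lapI a\<close> is \<open>a / 2\<close> times the Laplace
  transform of that square, and a minorant of the square bounds it from below.\<close>

definition lapI :: "real \<Rightarrow> real" where "lapI a = (\<integral>s. exp (- a * s) * ashk s \<partial>lborel)"

definition lapJ :: "real \<Rightarrow> real" where "lapJ a = (\<integral>s. s * exp (- a * s) * ashk s \<partial>lborel)"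

lemma arsinh_measurable [measurable]: "(arsinh :: real \<Rightarrow> real) \<in> borel_measurable borel"
  by (intro borel_measurable_continuous_onI continuous_at_imp_continuous_on ballI DERIV_isCont[OF arsinh_deriv])

lemma ashk_measurable [measurable]: "ashk \<in> borel_measurable borel"
  unfolding ashk_def by measurable

lemma ashk_nonneg: "0 \<le> ashk s"
  using arsinh_nonneg[of s] by (auto simp: ashk_def split: split_indicator)

lemma arsinh_le: "s \<ge> 0 \<Longrightarrow> arsinh s \<le> (s::real)"
proof -
  assume s: "s \<ge> 0"
  have "(\<lambda>s. s - arsinh s) 0 \<le> (\<lambda>s. s - arsinh s) s"
  proof (rule DERIV_nonneg_imp_nondecreasing[OF s])
    fix x :: real
    have "1 / sqrt (1 + x\<^sup>2) \<le> 1" by (simp add: divide_le_eq_1 add_pos_nonneg)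
    then show "\<exists>y. ((\<lambda>s. s - arsinh s) has_real_derivative y) (at x) \<and> 0 \<le> y"
      by (intro exI[of _ "1 - 1 / sqrt (1 + x\<^sup>2)"] conjI DERIV_diff DERIV_ident arsinh_deriv) simp
  qed
  then show ?thesis by simp
qed

lemma ashk_le: "ashk s \<le> indicator {0<..} s" "ashk s \<le> s * indicator {0<..} s"
proof -
  have "arsinh s / sqrt (1 + s\<^sup>2) \<le> 1" "arsinh s / sqrt (1 + s\<^sup>2) \<le> s" if "s > 0"
  proof -
    have "s \<le> sqrt (1 + s\<^sup>2)" by (rule real_le_rsqrt) simp
    moreover have "0 < sqrt (1 + s\<^sup>2)" by (simp add: add_pos_nonneg)
    ultimately show "arsinh s / sqrt (1 + s\<^sup>2) \<le> 1" using arsinh_le[of s] that by (simp add: divide_le_eq_1)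
    have "arsinh s / sqrt (1 + s\<^sup>2) \<le> arsinh s / 1"
      using arsinh_nonneg[of s] that by (intro divide_left_mono) (auto simp: add_pos_nonneg)
    then show "arsinh s / sqrt (1 + s\<^sup>2) \<le> s" using arsinh_le[of s] that by simp
  qed
  then show "ashk s \<le> indicator {0<..} s" "ashk s \<le> s * indicator {0<..} s"
    by (auto simp: ashk_def split: split_indicator)
qed

lemma integrable_power_ashk:
  assumes a: "a > 0"
  shows "integrable lborel (\<lambda>s. s ^ k * exp (- a * s) * ashk s)"
proof (rule Bochner_Integration.integrable_bound[OF integrable_power_exp[OF a, of k]])
  have "\<bar>s ^ k * exp (- a * s) * ashk s\<bar> \<le> \<bar>s ^ k * exp (- a * s) * indicator {0<..} s\<bar>" for s
    unfolding abs_mult using ashk_nonneg[of s] ashk_le(1)[of s] by (intro mult_left_mono) auto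
  then show "AE s in lborel. norm (s ^ k * exp (- a * s) * ashk s) \<le> norm (s ^ k * exp (- a * s) * indicator {0<..} s)"
    by simp
qed measurable

lemma integrable_ashk: "a > 0 \<Longrightarrow> integrable lborel (\<lambda>s. exp (- a * s) * ashk s)"
  using integrable_power_ashk[of a 0] by simp

lemma integrable_ashk1: "a > 0 \<Longrightarrow> integrable lborel (\<lambda>s. s * exp (- a * s) * ashk s)"
  using integrable_power_ashk[of a 1] by simp

lemma exp_taylor_bound: "\<bar>exp x - 1 - x\<bar> \<le> exp \<bar>x\<bar> * x\<^sup>2 / (2::real)"
proof -
  obtain t where t: "\<bar>t\<bar> \<le> \<bar>x\<bar>" "exp x = (\<Sum>m<2. x ^ m / fact m) + exp t / fact 2 * x ^ 2"
    using Maclaurin_exp_le[of x 2] by blast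
  have "exp x - 1 - x = exp t * x\<^sup>2 / 2" unfolding t(2) by (simp add: numeral_2_eq_2)
  then have "\<bar>exp x - 1 - x\<bar> = exp t * x\<^sup>2 / 2" by (simp only: abs_mult abs_divide) simp
  also have "\<dots> \<le> exp \<bar>x\<bar> * x\<^sup>2 / 2" using t(1) by (intro divide_right_mono mult_right_mono) auto
  finally show ?thesis .
qed

text \<open>Differentiation under the integral by a second-order Taylor estimate. For
  \<open>\<bar>b - a\<bar> < a / 2\<close> the growth of the remainder is absorbed by giving up half
  of the decay rate, whence the rate \<open>a / 2\<close> in \<open>C\<close>.\<close>

lemma lapI_deriv:
  assumes a: "a > 0"
  shows "(lapI has_real_derivative - lapJ a) (at a)"
proof -
  define C where "C = (\<integral>s. s ^ 2 * exp (- (a / 2) * s) * ashk s \<partial>lborel)"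
  have C0: "C \<ge> 0" unfolding C_def using ashk_nonneg by (intro integral_nonneg_AE AE_I2 mult_nonneg_nonneg) auto
  have bound: "\<bar>lapI b - lapI a + (b - a) * lapJ a\<bar> \<le> (b - a)\<^sup>2 * C" if b: "\<bar>b - a\<bar> < a / 2" for b
  proof -
    have b0: "b > 0" using b a by linarith
    have pw: "\<bar>exp (- b * s) * ashk s - exp (- a * s) * ashk s + (b - a) * (s * exp (- a * s) * ashk s)\<bar>
       \<le> (b - a)\<^sup>2 * (s ^ 2 * exp (- (a / 2) * s) * ashk s)" for s
    proof (cases "s > 0")
      case True
      define x where "x = - (b - a) * s"
      have "\<bar>x\<bar> \<le> a / 2 * s" using b True by (simp add: x_def abs_mult abs_minus_commute[of a b])
      then have e: "exp (- a * s) * exp \<bar>x\<bar> \<le> exp (- (a / 2) * s)"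
        by (simp add: exp_add[symmetric] algebra_simps)
      have "exp (- b * s) = exp (- a * s) * exp x" by (simp add: x_def exp_add[symmetric] algebra_simps)
      then have "exp (- b * s) * ashk s - exp (- a * s) * ashk s + (b - a) * (s * exp (- a * s) * ashk s)
          = exp (- a * s) * (exp x - 1 - x) * ashk s"
        by (simp add: x_def algebra_simps)
      then have "\<bar>exp (- b * s) * ashk s - exp (- a * s) * ashk s + (b - a) * (s * exp (- a * s) * ashk s)\<bar>
          = exp (- a * s) * \<bar>exp x - 1 - x\<bar> * ashk s"
        using ashk_nonneg[of s] by (simp add: abs_mult)
      also have "\<dots> \<le> exp (- a * s) * (exp \<bar>x\<bar> * x\<^sup>2 / 2) * ashk s"
        using ashk_nonneg[of s] by (intro mult_right_mono mult_left_mono exp_taylor_bound) auto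
      also have "\<dots> = (exp (- a * s) * exp \<bar>x\<bar>) * (x\<^sup>2 / 2 * ashk s)" by simp
      also have "\<dots> \<le> exp (- (a / 2) * s) * (x\<^sup>2 * ashk s)"
        using e ashk_nonneg[of s] by (intro mult_mono) auto
      also have "\<dots> = (b - a)\<^sup>2 * (s ^ 2 * exp (- (a / 2) * s) * ashk s)"
        by (simp add: x_def power_mult_distrib power2_commute[of b a])
      finally show ?thesis .
    qed (simp add: ashk_def)
    have a2: "a / 2 > 0" using a by simp
    have eq: "lapI b - lapI a + (b - a) * lapJ a = (\<integral>s. exp (- b * s) * ashk s - exp (- a * s) * ashk s + (b - a) * (s * exp (- a * s) * ashk s) \<partial>lborel)"
      unfolding lapI_def lapJ_def using integrable_ashk[OF a] integrable_ashk[OF b0] integrable_ashk1[OF a] by simp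
    have "\<bar>lapI b - lapI a + (b - a) * lapJ a\<bar> \<le> (\<integral>s. \<bar>exp (- b * s) * ashk s - exp (- a * s) * ashk s + (b - a) * (s * exp (- a * s) * ashk s)\<bar> \<partial>lborel)"
      unfolding eq by (rule integral_abs_bound)
    also have "\<dots> \<le> (\<integral>s. (b - a)\<^sup>2 * (s ^ 2 * exp (- (a / 2) * s) * ashk s) \<partial>lborel)"
      by (intro integral_mono[OF _ _ pw] integrable_abs Bochner_Integration.integrable_add
          Bochner_Integration.integrable_diff integrable_mult_right
          integrable_ashk[OF a] integrable_ashk[OF b0] integrable_ashk1[OF a] integrable_power_ashk[OF a2])
    also have "\<dots> = (b - a)\<^sup>2 * C" unfolding C_def by simp
    finally show ?thesis .
  qed
  show ?thesis
    unfolding has_field_derivative_def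
  proof (rule has_derivativeI_sandwich[of "a / 2" _ _ _ _ "\<lambda>b. \<bar>b - a\<bar> * C"])
    show "bounded_linear ((*) (- lapJ a))" by (rule bounded_linear_mult_right)
    fix b assume "b \<in> UNIV" "b \<noteq> a" "dist b a < a / 2"
    then have "\<bar>lapI b - lapI a + (b - a) * lapJ a\<bar> \<le> (b - a)\<^sup>2 * C" by (intro bound) (simp add: dist_real_def)
    then have "\<bar>lapI b - lapI a + (b - a) * lapJ a\<bar> / \<bar>b - a\<bar> \<le> (b - a)\<^sup>2 * C / \<bar>b - a\<bar>"
      by (rule divide_right_mono) simp
    also have "(b - a)\<^sup>2 * C / \<bar>b - a\<bar> = \<bar>b - a\<bar> * C"
    proof -
      have "(b - a)\<^sup>2 = \<bar>b - a\<bar> * \<bar>b - a\<bar>" by (simp add: power2_eq_square)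
      then have "(b - a)\<^sup>2 * C / \<bar>b - a\<bar> = \<bar>b - a\<bar> * (\<bar>b - a\<bar> * C) / \<bar>b - a\<bar>"
        by (simp only: mult.assoc)
      also have "\<dots> = \<bar>b - a\<bar> * C"
        using \<open>b \<noteq> a\<close> by (intro nonzero_mult_div_cancel_left) simp
      finally show ?thesis .
    qed
    finally show "norm (lapI b - lapI a - - lapJ a * (b - a)) / norm (b - a) \<le> \<bar>b - a\<bar> * C"
      by (simp add: algebra_simps)
  next
    have "((\<lambda>b. \<bar>b - a\<bar> * C) \<longlongrightarrow> \<bar>a - a\<bar> * C) (at a)" by (intro tendsto_intros)
    then show "((\<lambda>b. \<bar>b - a\<bar> * C) \<longlongrightarrow> 0) (at a within UNIV)" by simp
  qed (use a in simp)
qed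

text \<open>From \<open>ashk s \<le> s\<close>. It makes \<open>a * lapI a\<close> small for large
  \<open>a\<close>, so the maximum of the overlap cannot escape to infinity.\<close>

lemma lapI_le_inverse: "a > 0 \<Longrightarrow> lapI a \<le> 1 / a\<^sup>2"
proof -
  assume a: "a > 0"
  have "lapI a \<le> (\<integral>s. s ^ 1 * exp (- a * s) * indicator {0<..} s \<partial>lborel)"
    unfolding lapI_def
  proof (rule integral_mono[OF integrable_ashk[OF a] integrable_power_exp[OF a]])
    fix s show "exp (- a * s) * ashk s \<le> s ^ 1 * exp (- a * s) * indicator {0<..} s"
      using mult_left_mono[OF ashk_le(2)[of s], of "exp (- a * s)"] by (simp add: mult_ac)
  qed
  also have "\<dots> = 1 / a\<^sup>2" unfolding integral_power_exp[OF a] by (simp add: power2_eq_square)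
  finally show ?thesis .
qed

text \<open>\<open>ashk\<close> tends to 0 at infinity, and the part up to \<open>S\<close>
  contributes at most \<open>S\<close>. Hence \<open>a * lapI a\<close> is small for small
  \<open>a\<close>, which keeps the maximum of the overlap away from 0.\<close>

lemma lapI_small:
  assumes e: "e > 0"
  shows "\<exists>S>0. \<forall>a>0. lapI a \<le> S + e / a"
proof -
  have "((\<lambda>s. arsinh s / sqrt (1 + s\<^sup>2)) \<longlongrightarrow> 0) at_top"
    unfolding arsinh_real_def by real_asymp
  then have "eventually (\<lambda>s. arsinh s / sqrt (1 + s\<^sup>2) < e) at_top" using e by (intro order_tendstoD(2)) auto
  then obtain S0 where S0: "\<And>s. s \<ge> S0 \<Longrightarrow> arsinh s / sqrt (1 + s\<^sup>2) < e" by (auto simp: eventually_at_top_linorder)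
  define S where "S = max S0 1"
  have S: "S > 0" "S \<ge> S0" by (auto simp: S_def)
  have "lapI a \<le> S + e / a" if a: "a > 0" for a
  proof -
    have iS: "integrable lborel (indicator {0..S} :: real \<Rightarrow> real)" using S by (simp add: integrable_indicator_iff)
    have "lapI a \<le> (\<integral>s. indicator {0..S} s + e * (s ^ 0 * exp (- a * s) * indicator {0<..} s) \<partial>lborel)"
      unfolding lapI_def
    proof (rule integral_mono[OF integrable_ashk[OF a]])
      show "integrable lborel (\<lambda>s. indicator {0..S} s + e * (s ^ 0 * exp (- a * s) * indicator {0<..} s))"
        using iS integrable_power_exp[OF a, of 0] by auto
      fix s :: real
      show "exp (- a * s) * ashk s \<le> indicator {0..S} s + e * (s ^ 0 * exp (- a * s) * indicator {0<..} s)"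
      proof (cases "s > 0")
        case s: True
        show ?thesis
        proof (cases "s \<le> S")
          case True
          have "exp (- a * s) * ashk s \<le> 1 * 1"
            using s a ashk_le(1)[of s] ashk_nonneg[of s] by (intro mult_mono) (auto split: split_indicator)
          moreover have "0 \<le> e * (s ^ 0 * exp (- a * s) * indicator {0<..} s)" using e by simp
          ultimately show ?thesis using s True by simp
        next
          case False
          then have "ashk s \<le> e" using S0[of s] S s by (simp add: ashk_def)
          then have "exp (- a * s) * ashk s \<le> exp (- a * s) * e" by (intro mult_left_mono) auto
          then show ?thesis using s False by simp
        qed
      qed (simp add: ashk_def)
    qed
    also have "\<dots> = S + e / a"
      using iS integrable_power_exp[OF a, of 0] integral_power_exp[OF a, of 0] S by simp
    finally show ?thesis .
  qed
  then show ?thesis using S by blast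
qed

text \<open>Integration by parts against the quadratic minorant \<open>L\<close>. At
  \<open>a = 2/5\<close> the elementary integrals and the boundary term give
  \<open>2 * lapI a \<ge> 3.5 - 0.575 - 0.6\<close>, which is twice 93/80; the overlap at this point
  is therefore at least \<open>2 * (2/5) * (93/80) = 93/100\<close>.\<close>

lemma lapI_lower: "lapI (2/5) \<ge> 93/80"
proof -
  let ?a = "2/5 :: real"
  let ?e = "\<lambda>s. exp (- ?a * s)"
  define L where "L s = 7/5 * s - 3/5 - 23/500 * s\<^sup>2" for s :: real
  define F where "F s = ?e s * ((arsinh s)\<^sup>2 - L s)" for s
  \<comment> \<open>On the half-line \<open>g\<close> is the derivative of \<open>F\<close> plus
    \<open>2/5\<close> times \<open>F\<close>. Since \<open>F\<close> is nonnegative, the integral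
    of \<open>g\<close> is at least \<open>- F 0\<close>.\<close>
  define g where "g s = (2 * (?e s * ashk s) - 7/5 * (s ^ 0 * ?e s * indicator {0<..} s) + 23/250 * (s ^ 1 * ?e s * indicator {0<..} s))" for s
  have F_nn: "F s \<ge> 0" if "s \<ge> 0" for s
    using sinh_quadratic_bound[OF arsinh_nonneg[OF that]] by (simp add: F_def L_def)
  have ig: "integrable lborel g"
    unfolding g_def
    by (intro Bochner_Integration.integrable_add Bochner_Integration.integrable_diff integrable_mult_right
        integrable_ashk integrable_power_exp) auto
  have val: "(\<integral>s. g s \<partial>lborel) = 2 * lapI ?a - 7/5 * (1 / ?a) + 23/250 * (1 / ?a\<^sup>2)"
  proof -
    have "(\<integral>s. g s \<partial>lborel) = 2 * lapI ?a - 7/5 * (\<integral>s. s ^ 0 * ?e s * indicator {0<..} s \<partial>lborel) + 23/250 * (\<integral>s. s ^ 1 * ?e s * indicator {0<..} s \<partial>lborel)"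
      unfolding g_def lapI_def using integrable_ashk[of ?a] integrable_power_exp[of ?a 0] integrable_power_exp[of ?a 1]
      by simp
    then show ?thesis using integral_power_exp[of ?a 0] integral_power_exp[of ?a 1] by (simp add: power2_eq_square)
  qed
  have lower: "(\<integral>s. indicator {..R} s *\<^sub>R g s \<partial>lborel) \<ge> - F 0" if R: "R > 0" for R
  proof -
    define G where "G s = ?e s * (2 * arsinh s / sqrt (1 + s\<^sup>2) - 7/5 + 23/250 * s)" for s
    have F': "(F has_real_derivative G s - ?a * F s) (at s)" for s
    proof -
      have "((\<lambda>s. (arsinh s)\<^sup>2) has_real_derivative 2 * arsinh s * (1 / sqrt (1 + s\<^sup>2))) (at s)"
        using DERIV_power[OF arsinh_deriv, of 2 s] by (simp add: mult_ac)
      moreover have "(L has_real_derivative 7/5 - 23/250 * s) (at s)"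
        unfolding L_def[abs_def] by (auto intro!: derivative_eq_intros)
      moreover have "(?e has_real_derivative - ?a * ?e s) (at s)"
        by (auto intro!: derivative_eq_intros)
      ultimately have "(F has_real_derivative (- ?a * ?e s) * ((arsinh s)\<^sup>2 - L s) + (2 * arsinh s * (1 / sqrt (1 + s\<^sup>2)) - (7/5 - 23/250 * s)) * ?e s) (at s)"
        unfolding F_def[abs_def] by (intro DERIV_mult DERIV_diff)
      then show ?thesis by (rule DERIV_cong) (simp add: G_def F_def field_simps)
    qed
    have cont: "isCont (\<lambda>s. G s - ?a * F s) s" for s
    proof -
      have "isCont arsinh s" by (rule DERIV_isCont[OF arsinh_deriv])
      moreover have "isCont F s" by (rule DERIV_isCont[OF F'])
      moreover have "sqrt (1 + s\<^sup>2) \<noteq> 0" by (simp add: add_nonneg_eq_0_iff)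
      ultimately show ?thesis unfolding G_def by (intro continuous_intros) auto
    qed
    have fi: "integrable lborel (\<lambda>s. (G s - ?a * F s) * indicator {0..R} s)"
      by (rule integrable.intros[OF has_bochner_integral_FTC_Icc_real[where F=F]]) (use R F' cont in auto)
    have fe: "(\<integral>s. (G s - ?a * F s) * indicator {0..R} s \<partial>lborel) = F R - F 0"
      by (rule integral_FTC_Icc_real) (use R F' cont in auto)
    have ig2: "integrable lborel (\<lambda>s. indicator {..R} s *\<^sub>R g s)"
      using integrable_mult_indicator[OF _ ig, of "{..R}"] by simp
    have "F R - F 0 \<le> (\<integral>s. indicator {..R} s *\<^sub>R g s \<partial>lborel)"
      unfolding fe[symmetric]
    proof (rule integral_mono_AE[OF fi ig2], rule AE_I[where N="{0}"], rule subsetI)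
      fix s :: real
      have "(G s - ?a * F s) * indicator {0..R} s \<le> indicator {..R} s *\<^sub>R g s" if "s \<noteq> 0"
        using F_nn[of s] that by (auto simp: g_def G_def ashk_def algebra_simps split: split_indicator)
      moreover assume "s \<in> {x \<in> space lborel. \<not> (G x - ?a * F x) * indicator {0..R} x \<le> indicator {..R} x *\<^sub>R g x}"
      ultimately show "s \<in> {0}" by auto
    qed auto
    then show ?thesis using F_nn[of R] R by simp
  qed
  have "(\<integral>s. g s \<partial>lborel) \<ge> - F 0"
  proof (rule tendsto_lowerbound[OF tendsto_integral_at_top[OF _ ig]])
    show "\<forall>\<^sub>F R in at_top. - F 0 \<le> (\<integral>s. indicator {..R} s *\<^sub>R g s \<partial>lborel)"
      using eventually_gt_at_top[of 0] by eventually_elim (rule lower)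
  qed auto
  moreover have "F 0 = 3/5" by (simp add: F_def L_def arsinh_0)
  ultimately show ?thesis unfolding val by (simp add: power2_eq_square)
qed

text \<open>
  The overlap of the normalized \<open>exp (- a p)\<close> with its image under the kernel \<open>yuk\<close> is \<open>2 * a * lapI a\<close>.
  It is maximal near \<open>a = 2 / 5\<close>; a stationary value above about \<open>0.926\<close> is what the block
  argument needs.
\<close>

lemma exists_stationary:
  "\<exists>a>0. 2 * a * lapI a \<ge> 93/100 \<and> lapI a = a * lapJ a"
proof -
  define al where "al a = 2 * a * lapI a" for a
  have d: "(al has_real_derivative 2 * lapI a - 2 * a * lapJ a) (at a)" if "a > 0" for a
    unfolding al_def[abs_def]
    by (rule derivative_eq_intros lapI_deriv[OF that] refl | simp add: algebra_simps)+
  have al0: "al (2/5) \<ge> 93/100" using lapI_lower by (simp add: al_def)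
  obtain S where S: "S > 0" "\<And>a. a > 0 \<Longrightarrow> lapI a \<le> S + (1/10) / a" using lapI_small[of "1/10"] by auto
  \<comment> \<open>Up to \<open>l\<close> the bound from \<open>lapI_small\<close> gives at most
    2/5, well below 93/100, while \<open>{l..3}\<close> still contains the point 2/5.\<close>
  define l where "l = min (1/5) (1 / (10 * S))"
  have l: "l > 0" "l \<le> 1/5" "l * S \<le> 1/10" using S(1) by (auto simp: l_def min_def field_simps)
  have small: "al a < 93/100" if "0 < a" "a \<le> l" for a
  proof -
    have "al a \<le> 2 * a * (S + (1/10) / a)" unfolding al_def using S(2)[of a] that by (intro mult_left_mono) auto
    also have "\<dots> = 2 * (a * S) + 1/5" using that by (simp add: field_simps)
    also have "\<dots> \<le> 2 * (l * S) + 1/5" using that S(1) by simp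
    finally show ?thesis using l by simp
  qed
  have large: "al a < 93/100" if "a \<ge> 3" for a
  proof -
    have "al a \<le> 2 * a * (1 / a\<^sup>2)" unfolding al_def using lapI_le_inverse[of a] that by (intro mult_left_mono) auto
    also have "\<dots> = 2 / a" using that by (simp add: power2_eq_square)
    also have "\<dots> \<le> 2 / 3" using that by (intro divide_left_mono) auto
    finally show ?thesis by simp
  qed
  have "continuous_on {l..3} al"
    using l by (intro continuous_at_imp_continuous_on ballI DERIV_isCont[OF d]) auto
  \<comment> \<open>The value at 2/5 exceeds all values outside the interval, so the maximum over it
    is global on the positive axis and the derivative vanishes there. The maximizer is used in place
    of 2/5 because the stationarity equation has to hold exactly.\<close>
  from continuous_attains_sup[OF compact_Icc _ this] obtain a where a: "a \<in> {l..3}" "\<And>b. b \<in> {l..3} \<Longrightarrow> al b \<le> al a"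
    using l by auto
  have a0: "a > 0" using a l by auto
  have ge: "al a \<ge> 93/100" using a(2)[of "2/5"] al0 l by auto
  have gmax: "al b \<le> al a" if "b > 0" for b
    using a(2)[of b] small[of b] large[of b] ge that by (cases "b \<in> {l..3}") auto
  have "2 * lapI a - 2 * a * lapJ a = 0"
    by (rule DERIV_local_max[OF d[OF a0] a0]) (use gmax in auto)
  then show ?thesis using a0 ge by (intro exI[of _ a]) (simp add: al_def)
qed

text \<open>\<open>Q'_le\<close> is integrated over growing compact intervals, and the work is to
  show that \<open>Q\<close> vanishes at both ends. At 0 the antiderivatives are of order
  \<open>p\<close> and \<open>p\<^sup>2\<close>. At infinity the two orthogonality relations turn
  them into tail integrals, so that \<open>H\<close> and \<open>S\<close> times
  \<open>exp (a * p)\<close> decay as fast as the bound on \<open>z\<close>.\<close>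

lemma laguerre_gap_estimate:
  fixes z z' :: "real \<Rightarrow> real"
  assumes a: "a > 0"
    and z': "\<And>p. p > 0 \<Longrightarrow> (z has_real_derivative z' p) (at p)"
    and zc: "continuous_on {0..} z" and [measurable]: "z' \<in> borel_measurable borel" "z \<in> borel_measurable borel"
    and decay: "\<And>p. p \<ge> 0 \<Longrightarrow> \<bar>z p\<bar> \<le> C\<^sub>0 / (1 + p)"
    and orth0: "(\<integral>s. exp (- a * s) * z s * indicator {0<..} s \<partial>lborel) = 0"
    and orth1: "(\<integral>s. s * exp (- a * s) * z s * indicator {0<..} s \<partial>lborel) = 0"
    and i1: "integrable lborel (\<lambda>p. p * (z' p)\<^sup>2 * indicator {0<..} p)"
    and i2: "integrable lborel (\<lambda>p. p * (z p)\<^sup>2 * indicator {0<..} p)"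
    and i3: "integrable lborel (\<lambda>p. (z p)\<^sup>2 * indicator {0<..} p)"
  shows "5 * a * (\<integral>p. (z p)\<^sup>2 * indicator {0<..} p \<partial>lborel)
    \<le> (\<integral>p. p * (z' p)\<^sup>2 * indicator {0<..} p \<partial>lborel) + a\<^sup>2 * (\<integral>p. p * (z p)\<^sup>2 * indicator {0<..} p \<partial>lborel)"
proof -
  define g where "g k s = s ^ k * exp (- a * s) * z s" for k :: nat and s
  define P where "P k p = integral {0..p} (g k)" for k p
  define H where "H = P 0"
  \<comment> \<open>This is the integral of \<open>(p - s) * exp (- a * s) * z s\<close> over
    \<open>0 < s < p\<close>, the antiderivative of \<open>H\<close> that vanishes at 0.\<close>
  define S where "S p = p * P 0 p - P 1 p" for p
  \<comment> \<open>The decay bound at 0 only yields \<open>C\<^sub>0 \<ge> 0\<close>; adding 1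
    gives the strict sign used in the asymptotic estimates.\<close>
  define C where "C = C\<^sub>0 + 1"
  have C: "\<bar>z p\<bar> \<le> C / (1 + p)" if "p \<ge> 0" for p
    using decay[OF that] that by (simp add: C_def add_divide_distrib add_increasing2)
  have Cpos: "C > 0" using decay[of 0] by (simp add: C_def)
  then have C0: "C \<ge> 0" by simp
  have zC: "\<bar>z p\<bar> \<le> C" if "p \<ge> 0" for p
    using C[OF that] that C0 divide_left_mono[of 1 "1 + p" C] by simp
  have gc: "continuous_on {0..} (g k)" for k
    unfolding g_def by (intro continuous_intros zc)
  have P': "(P k has_real_derivative g k p) (at p)" if "p > 0" for k p
  proof -
    have "continuous_on {0..p + 1} (g k)" by (rule continuous_on_subset[OF gc]) auto
    from integral_has_real_derivative[OF this, of p] that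
    have "((\<lambda>x. integral {0..x} (g k)) has_real_derivative g k p) (at p within {0..p + 1})" by simp
    moreover have "at p within {0..p + 1} = at p" using that by (intro at_within_interior) simp
    ultimately show ?thesis unfolding P_def[abs_def] by simp
  qed
  have ig: "integrable lborel (\<lambda>s. g k s * indicator {0<..} s)" for k
  proof (rule Bochner_Integration.integrable_bound)
    show "integrable lborel (\<lambda>s. C * (s ^ k * exp (- a * s) * indicator {0<..} s))"
      by (intro integrable_mult_right integrable_power_exp a)
    have "\<bar>g k s * indicator {0<..} s\<bar> \<le> \<bar>C * (s ^ k * exp (- a * s) * indicator {0<..} s)\<bar>" for s
    proof (cases "s > 0")
      case True
      then have "(s ^ k * exp (- a * s)) * \<bar>z s\<bar> \<le> (s ^ k * exp (- a * s)) * C" by (intro mult_left_mono zC) auto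
      then show ?thesis using True C0 by (simp add: g_def abs_mult mult_ac)
    qed simp
    then show "AE s in lborel. norm (g k s * indicator {0<..} s) \<le> norm (C * (s ^ k * exp (- a * s) * indicator {0<..} s))"
      by simp
  qed (simp add: g_def)
  have tot: "(\<integral>s. g k s * indicator {0<..} s \<partial>lborel) = 0" if "k < 2" for k
  proof -
    have "k = 0 \<or> k = 1" using that by auto
    then show ?thesis using orth0 orth1 by (auto simp: g_def)
  qed
  have P_int: "P k p = (\<integral>s. g k s * indicator {0<..p} s \<partial>lborel)" if "p \<ge> 0" for k p
  proof -
    have "set_integrable lborel {0..p} (g k)"
      by (rule borel_integrable_atLeastAtMost') (rule continuous_on_subset[OF gc], auto)
    from set_borel_integral_eq_integral(2)[OF this]
    have "P k p = (\<integral>s. indicator {0..p} s *\<^sub>R g k s \<partial>lborel)"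
      unfolding P_def set_lebesgue_integral_def by simp
    also have "\<dots> = (\<integral>s. g k s * indicator {0<..p} s \<partial>lborel)"
      by (rule integral_cong_AE, simp_all add: g_def, rule AE_I[where N="{0}"]) (auto split: split_indicator)
    finally show ?thesis .
  qed
  \<comment> \<open>By orthogonality the integral over the whole half-line vanishes for
    \<open>k < 2\<close>, so the integral up to \<open>p\<close> is minus the tail.\<close>
  have P_tail: "P k p = - (\<integral>s. g k s * indicator {p<..} s \<partial>lborel)"
    and i_tail: "integrable lborel (\<lambda>s. g k s * indicator {p<..} s)" if "p \<ge> 0" "k < 2" for k p
  proof -
    have i: "integrable lborel (\<lambda>s. g k s * indicator {0<..p} s)" 
      by (rule Bochner_Integration.integrable_bound[OF ig[of k]]) (auto simp: g_def split: split_indicator)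
    show i': "integrable lborel (\<lambda>s. g k s * indicator {p<..} s)" 
      by (rule Bochner_Integration.integrable_bound[OF ig[of k]]) (use that in \<open>auto simp: g_def split: split_indicator\<close>)
    have "(\<integral>s. g k s * indicator {0<..} s \<partial>lborel) = (\<integral>s. g k s * indicator {0<..p} s + g k s * indicator {p<..} s \<partial>lborel)"
      by (rule Bochner_Integration.integral_cong) (use that in \<open>auto split: split_indicator\<close>)
    then show "P k p = - (\<integral>s. g k s * indicator {p<..} s \<partial>lborel)"
      using i i' tot[OF \<open>k < 2\<close>] P_int[OF \<open>p \<ge> 0\<close>, of k] by simp
  qed
  have tail: "\<bar>H p * exp (a * p)\<bar> \<le> C / (1 + p) * (1 / a)"
    and tail': "\<bar>S p * exp (a * p)\<bar> \<le> C / (1 + p) * (1 / a\<^sup>2)" if p: "p \<ge> 0" for p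
  proof -
    \<comment> \<open>Both tails at once: freezing the decay of \<open>z\<close> at \<open>p\<close>
      and shifting by \<open>p\<close> leaves a Gamma integral.\<close>
    have main: "\<bar>\<integral>s. (s - p) ^ k * exp (- a * s) * z s * indicator {p<..} s \<partial>lborel\<bar> * exp (a * p) \<le> C / (1 + p) * (fact k / a ^ Suc k)" for k
    proof -
      let ?f = "\<lambda>s. (s - p) ^ k * exp (- a * s) * z s * indicator {p<..} s"
      let ?h = "\<lambda>s. C / (1 + p) * exp (- a * p) * (s ^ k * exp (- a * s) * indicator {0<..} s)"
      have ih: "integrable lborel ?h" by (intro integrable_mult_right integrable_power_exp a)
      have ih2: "integrable lborel (\<lambda>s. ?h (s + - p))" by (rule integrable_shift[OF ih])
      have le: "\<bar>?f s\<bar> \<le> ?h (s + - p)" for s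
      proof (cases "s > p")
        case True
        have "\<bar>z s\<bar> \<le> C / (1 + s)" using True p by (intro C) simp
        also have "\<dots> \<le> C / (1 + p)" using True p C0 by (intro divide_left_mono) auto
        finally have "((s - p) ^ k * exp (- a * s)) * \<bar>z s\<bar> \<le> ((s - p) ^ k * exp (- a * s)) * (C / (1 + p))"
          using True by (intro mult_left_mono) auto
        moreover have "exp (- a * s) = exp (- a * p) * exp (- a * (s - p))" by (simp add: exp_add[symmetric] algebra_simps)
        ultimately show ?thesis using True by (simp add: abs_mult mult_ac)
      qed simp
      have "\<bar>\<integral>s. ?f s \<partial>lborel\<bar> \<le> (\<integral>s. ?h (s + - p) \<partial>lborel)"
      proof (rule order_trans[OF integral_abs_bound], rule integral_mono[OF _ ih2 le])
        show "integrable lborel (\<lambda>s. \<bar>?f s\<bar>)"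
          by (rule Bochner_Integration.integrable_bound[OF ih2])
             (measurable, intro AE_I2, simp only: real_norm_def abs_abs, rule order_trans[OF le abs_ge_self])
      qed
      also have "\<dots> = (\<integral>s. ?h s \<partial>lborel)" by (rule integral_shift) measurable
      also have "\<dots> = C / (1 + p) * exp (- a * p) * (fact k / a ^ Suc k)"
        by (simp only: integral_mult_right_zero integral_power_exp[OF a])
      finally have "\<bar>\<integral>s. ?f s \<partial>lborel\<bar> * exp (a * p) \<le> C / (1 + p) * exp (- a * p) * (fact k / a ^ Suc k) * exp (a * p)"
        by (intro mult_right_mono) auto
      also have "\<dots> = C / (1 + p) * (fact k / a ^ Suc k) * (exp (- a * p) * exp (a * p))" by (simp only: mult_ac)
      also have "exp (- a * p) * exp (a * p) = 1" by (simp add: exp_minus)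
      finally show ?thesis by simp
    qed
    have "H p = - (\<integral>s. (s - p) ^ 0 * exp (- a * s) * z s * indicator {p<..} s \<partial>lborel)"
      unfolding H_def using P_tail[OF p, of 0] by (simp add: g_def)
    then show "\<bar>H p * exp (a * p)\<bar> \<le> C / (1 + p) * (1 / a)" using main[of 0] by (simp add: abs_mult)
    have "S p = (\<integral>s. g 1 s * indicator {p<..} s \<partial>lborel) - p * (\<integral>s. g 0 s * indicator {p<..} s \<partial>lborel)"
      unfolding S_def using P_tail[OF p] by simp
    also have "\<dots> = (\<integral>s. g 1 s * indicator {p<..} s - p * (g 0 s * indicator {p<..} s) \<partial>lborel)"
      using i_tail[OF p] by simp
    also have "\<dots> = (\<integral>s. (s - p) ^ 1 * exp (- a * s) * z s * indicator {p<..} s \<partial>lborel)"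
      by (rule Bochner_Integration.integral_cong) (auto simp: g_def algebra_simps)
    finally show "\<bar>S p * exp (a * p)\<bar> \<le> C / (1 + p) * (1 / a\<^sup>2)"
      using main[of 1] by (simp add: abs_mult power2_eq_square)
  qed
  have head: "\<bar>P k p\<bar> \<le> C * p ^ Suc k" if p: "p \<ge> 0" for k p
  proof -
    have "norm (integral {0..p} (g k)) \<le> integral {0..p} (\<lambda>s. C * p ^ k)"
    proof (rule integral_norm_bound_integral)
      show "g k integrable_on {0..p}" by (intro integrable_continuous_interval continuous_on_subset[OF gc]) auto
      fix s assume s: "s \<in> {0..p}"
      have "\<bar>g k s\<bar> = (s ^ k * exp (- a * s)) * \<bar>z s\<bar>" using s by (simp add: g_def abs_mult)
      also have "\<dots> \<le> (p ^ k * 1) * C"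
        using s a zC[of s] by (intro mult_mono power_mono) auto
      finally show "norm (g k s) \<le> C * p ^ k" by (simp add: mult_ac)
    qed (rule integrable_const_ivl)
    then show ?thesis using p by (simp add: P_def mult_ac)
  qed
  interpret G: laguerre_gap a z z' H S
  proof
    show "a > 0" by (rule a)
    fix p :: real assume p: "p > 0"
    show "(z has_real_derivative z' p) (at p)" by (rule z'[OF p])
    show "(H has_real_derivative exp (- a * p) * z p) (at p)" using P'[OF p, of 0] by (simp add: H_def g_def)
    show "(S has_real_derivative H p) (at p)"
      unfolding S_def[abs_def]
      by (rule DERIV_cong[OF DERIV_diff[OF DERIV_mult[OF DERIV_ident P'[OF p]] P'[OF p]]])
         (simp add: H_def g_def)
  qed
  have abs5: "\<bar>- t1 + t2 - t3 + t4 - t5\<bar> \<le> \<bar>t1\<bar> + \<bar>t2\<bar> + \<bar>t3\<bar> + \<bar>t4\<bar> + \<bar>t5\<bar>" for t1 t2 t3 t4 t5 :: real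
    by linarith
  define W where "W p = p * (z' p)\<^sup>2 + a\<^sup>2 * p * (z p)\<^sup>2 - 5 * a * (z p)\<^sup>2" for p
  have iW: "integrable lborel (\<lambda>p. W p * indicator {0<..} p)"
  proof -
    have "(\<lambda>p. W p * indicator {0<..} p) = (\<lambda>p. p * (z' p)\<^sup>2 * indicator {0<..} p + a\<^sup>2 * (p * (z p)\<^sup>2 * indicator {0<..} p) - 5 * a * ((z p)\<^sup>2 * indicator {0<..} p))"
      by (auto simp: W_def algebra_simps split: split_indicator)
    then show ?thesis using i1 i2 i3 by simp
  qed
  have W_val: "(\<integral>p. W p * indicator {0<..} p \<partial>lborel) = (\<integral>p. p * (z' p)\<^sup>2 * indicator {0<..} p \<partial>lborel) + a\<^sup>2 * (\<integral>p. p * (z p)\<^sup>2 * indicator {0<..} p \<partial>lborel)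
     - 5 * a * (\<integral>p. (z p)\<^sup>2 * indicator {0<..} p \<partial>lborel)"
  proof -
    have "(\<integral>p. W p * indicator {0<..} p \<partial>lborel) = (\<integral>p. p * (z' p)\<^sup>2 * indicator {0<..} p + a\<^sup>2 * (p * (z p)\<^sup>2 * indicator {0<..} p) - 5 * a * ((z p)\<^sup>2 * indicator {0<..} p) \<partial>lborel)"
      by (rule Bochner_Integration.integral_cong) (auto simp: W_def algebra_simps split: split_indicator)
    then show ?thesis using i1 i2 i3 by simp
  qed
  define A where "A n = {1 / real (Suc n)..real (Suc n)}" for n
  have lower: "(\<integral>p. W p * indicator (A n) p \<partial>lborel) \<ge> G.Q (real (Suc n)) - G.Q (1 / real (Suc n))" for n
  proof -
    have le: "1 / real (Suc n) \<le> real (Suc n)" by (simp add: divide_le_eq) (metis le_add1 mult_le_mono nat_mult_1 of_nat_Suc of_nat_le_iff of_nat_mult of_nat_1 plus_1_eq_Suc)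
    have pos: "p > 0" if "p \<in> A n" for p using that unfolding A_def by (auto intro: less_le_trans[of 0 "1 / real (Suc n)"])
    have "(G.Q' has_integral G.Q (real (Suc n)) - G.Q (1 / real (Suc n))) (A n)"
      unfolding A_def
    proof (rule fundamental_theorem_of_calculus[OF le])
      fix p assume "p \<in> {1 / real (Suc n)..real (Suc n)}"
      then have "p > 0" using pos by (simp add: A_def)
      then show "(G.Q has_vector_derivative G.Q' p) (at p within {1 / real (Suc n)..real (Suc n)})"
        using G.Q_deriv has_real_derivative_iff_has_vector_derivative has_vector_derivative_at_within by blast
    qed
    moreover have iA: "set_integrable lborel (A n) W"
      unfolding set_integrable_def
      by (rule Bochner_Integration.integrable_bound[OF iW])
         (measurable, simp add: A_def, use pos in \<open>auto simp: W_def split: split_indicator\<close>)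
    then have "(W has_integral (LINT p:A n|lborel. W p)) (A n)"
      using set_borel_integral_eq_integral[OF iA] by (simp add: has_integral_integrable_integral)
    ultimately have "G.Q (real (Suc n)) - G.Q (1 / real (Suc n)) \<le> (LINT p:A n|lborel. W p)"
      by (rule has_integral_le) (use G.Q'_le pos in \<open>auto simp: W_def\<close>)
    then show ?thesis by (simp add: set_lebesgue_integral_def mult.commute)
  qed
  have lim: "(\<lambda>n. \<integral>p. W p * indicator (A n) p \<partial>lborel) \<longlonglongrightarrow> (\<integral>p. W p * indicator {0<..} p \<partial>lborel)"
  proof (rule integral_dominated_convergence[where w="\<lambda>p. \<bar>W p * indicator {0<..} p\<bar>"])
    show "AE p in lborel. (\<lambda>n. W p * indicator (A n) p) \<longlonglongrightarrow> W p * indicator {0<..} p"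
    proof (rule AE_I2)
      fix p :: real
      show "(\<lambda>n. W p * indicator (A n) p) \<longlonglongrightarrow> W p * indicator {0<..} p"
      proof (cases "p > 0")
        case True
        obtain N :: nat where N: "max p (1 / p) \<le> real N" using real_arch_simple by blast
        have "p \<in> A n" if "n \<ge> N" for n
        proof -
          have "1 / p \<le> real (Suc n)" "p \<le> real (Suc n)" using N that by auto
          then show ?thesis using True by (simp add: A_def field_simps)
        qed
        then show ?thesis using True by (intro tendsto_eventually eventually_sequentiallyI[of N]) simp
      next
        case False
        have "p \<notin> A n" for n
          using False less_le_trans[of 0 "1 / real (Suc n)" p] by (auto simp: A_def)
        then show ?thesis using False by simp
      qed
    qed
    show "AE p in lborel. norm (W p * indicator (A n) p) \<le> \<bar>W p * indicator {0<..} p\<bar>" for n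
      by (rule AE_I2) (auto simp: A_def split: split_indicator intro: less_le_trans[of 0 "1 / real (Suc n)"])
  qed (use iW in \<open>auto simp: W_def A_def\<close>)
  have Q_top: "(\<lambda>n. G.Q (real (Suc n))) \<longlonglongrightarrow> 0"
  proof (rule Lim_null_comparison)
    \<comment> \<open>\<open>Q\<close> with every factor replaced by its bound at infinity. The
      slowest term is the last one, of order \<open>1 / p\<close>.\<close>
    define B where "B p = 8 * a * ((C / (1 + p)) * (C / (1 + p) * (1 / a))) + 4 * a * (1 + 2 * a * p) / p * (C / (1 + p) * (1 / a))\<^sup>2
       + 16 * a\<^sup>2 / p * ((C / (1 + p) * (1 / a)) * (C / (1 + p) * (1 / a\<^sup>2)))
       + 16 * a\<^sup>2 * (1 + a * p) / p\<^sup>2 * (C / (1 + p) * (1 / a\<^sup>2))\<^sup>2 + a * p * (C / (1 + p))\<^sup>2" for p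
    have B: "\<bar>G.Q p\<bar> \<le> B p" if p: "p > 0" for p
    proof -
      define h where "h = H p * exp (a * p)"
      define s where "s = S p * exp (a * p)"
      define u where "u = C / (1 + p)"
      have hb: "\<bar>h\<bar> \<le> u * (1 / a)" and sb: "\<bar>s\<bar> \<le> u * (1 / a\<^sup>2)" and zb: "\<bar>z p\<bar> \<le> u"
        using tail[of p] tail'[of p] C[of p] p by (simp_all add: h_def s_def u_def)
      have u0: "u \<ge> 0" using C0 p by (simp add: u_def)
      have "\<bar>G.Q p\<bar> \<le> \<bar>8 * a * z p * h\<bar> + \<bar>4 * a * (1 - 2 * a * p) / p * h\<^sup>2\<bar> + \<bar>16 * a\<^sup>2 / p * (h * s)\<bar>
          + \<bar>16 * a\<^sup>2 * (1 - a * p) / p\<^sup>2 * s\<^sup>2\<bar> + \<bar>a * p * (z p)\<^sup>2\<bar>"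
      proof -
        have "G.Q p = - (8 * a * z p * h) + 4 * a * (1 - 2 * a * p) / p * h\<^sup>2 - 16 * a\<^sup>2 / p * (h * s)
            + 16 * a\<^sup>2 * (1 - a * p) / p\<^sup>2 * s\<^sup>2 - a * p * (z p)\<^sup>2"
          unfolding G.Q_def h_def[symmetric] s_def[symmetric] by simp
        then show ?thesis by (simp only: abs5)
      qed
      also have "\<dots> \<le> 8 * a * (u * (u * (1 / a))) + 4 * a * (1 + 2 * a * p) / p * (u * (1 / a))\<^sup>2
          + 16 * a\<^sup>2 / p * ((u * (1 / a)) * (u * (1 / a\<^sup>2))) + 16 * a\<^sup>2 * (1 + a * p) / p\<^sup>2 * (u * (1 / a\<^sup>2))\<^sup>2 + a * p * u\<^sup>2"
      proof (intro add_mono)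
        show "\<bar>8 * a * z p * h\<bar> \<le> 8 * a * (u * (u * (1 / a)))"
          unfolding mult.assoc abs_mult using a hb zb by (intro mult_mono) auto
        have m1: "\<bar>1 - 2 * a * p\<bar> \<le> 1 + 2 * a * p" "\<bar>1 - a * p\<bar> \<le> 1 + a * p" using a p by (auto simp: abs_le_iff)
        have h2: "h\<^sup>2 \<le> (u * (1 / a))\<^sup>2" "s\<^sup>2 \<le> (u * (1 / a\<^sup>2))\<^sup>2" "(z p)\<^sup>2 \<le> u\<^sup>2"
          using power_mono[OF hb, of 2] power_mono[OF sb, of 2] power_mono[OF zb, of 2] by simp_all
        have "\<bar>4 * a * (1 - 2 * a * p) / p * h\<^sup>2\<bar> = 4 * a * \<bar>1 - 2 * a * p\<bar> / p * h\<^sup>2" using a p by (simp add: abs_mult)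
        also have "\<dots> \<le> 4 * a * (1 + 2 * a * p) / p * (u * (1 / a))\<^sup>2"
          using a p m1 h2 by (intro mult_mono divide_right_mono mult_left_mono) auto
        finally show "\<bar>4 * a * (1 - 2 * a * p) / p * h\<^sup>2\<bar> \<le> 4 * a * (1 + 2 * a * p) / p * (u * (1 / a))\<^sup>2" .
        have "\<bar>16 * a\<^sup>2 / p * (h * s)\<bar> = 16 * a\<^sup>2 / p * (\<bar>h\<bar> * \<bar>s\<bar>)" using p by (simp add: abs_mult)
        also have "\<dots> \<le> 16 * a\<^sup>2 / p * ((u * (1 / a)) * (u * (1 / a\<^sup>2)))"
          using hb sb p u0 a by (intro mult_left_mono mult_mono) auto
        finally show "\<bar>16 * a\<^sup>2 / p * (h * s)\<bar> \<le> 16 * a\<^sup>2 / p * ((u * (1 / a)) * (u * (1 / a\<^sup>2)))" .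
        have "\<bar>16 * a\<^sup>2 * (1 - a * p) / p\<^sup>2 * s\<^sup>2\<bar> = 16 * a\<^sup>2 * \<bar>1 - a * p\<bar> / p\<^sup>2 * s\<^sup>2" by (simp add: abs_mult)
        also have "\<dots> \<le> 16 * a\<^sup>2 * (1 + a * p) / p\<^sup>2 * (u * (1 / a\<^sup>2))\<^sup>2"
          using a p m1 h2 by (intro mult_mono divide_right_mono mult_left_mono) auto
        finally show "\<bar>16 * a\<^sup>2 * (1 - a * p) / p\<^sup>2 * s\<^sup>2\<bar> \<le> 16 * a\<^sup>2 * (1 + a * p) / p\<^sup>2 * (u * (1 / a\<^sup>2))\<^sup>2" .
        show "\<bar>a * p * (z p)\<^sup>2\<bar> \<le> a * p * u\<^sup>2" using a p h2 by (simp add: abs_mult mult_left_mono)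
      qed
      finally show ?thesis unfolding B_def u_def .
    qed
    show "\<forall>\<^sub>F n in sequentially. norm (G.Q (real (Suc n))) \<le> B (real (Suc n))"
      using B by (intro always_eventually) simp
    have "(B \<longlongrightarrow> 0) at_top" unfolding B_def using a Cpos by real_asymp
    then have "(\<lambda>n. B (real n)) \<longlonglongrightarrow> 0" by (rule filterlim_compose[OF _ filterlim_real_sequentially])
    then show "(\<lambda>n. B (real (Suc n))) \<longlonglongrightarrow> 0" by (rule LIMSEQ_Suc)
  qed
  have Q_bot: "(\<lambda>n. G.Q (1 / real (Suc n))) \<longlonglongrightarrow> 0"
  proof (rule Lim_null_comparison)
    define E where "E = exp a"
    \<comment> \<open>\<open>Q\<close> with \<open>H\<close> and \<open>S\<close> replaced by their
      orders \<open>p\<close> and \<open>p\<^sup>2\<close> near 0. Every term is then at least of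
      first order in \<open>p\<close>, in spite of the poles of the coefficients.\<close>
    define B where "B p = 8 * a * (C * (C * p * E)) + 4 * a * (1 + 2 * a * p) / p * (C * p * E)\<^sup>2
       + 16 * a\<^sup>2 / p * ((C * p * E) * (2 * C * p\<^sup>2 * E))
       + 16 * a\<^sup>2 * (1 + a * p) / p\<^sup>2 * (2 * C * p\<^sup>2 * E)\<^sup>2 + a * p * C\<^sup>2" for p
    have E: "E > 0" by (simp add: E_def)
    have B: "\<bar>G.Q p\<bar> \<le> B p" if p: "p > 0" "p \<le> 1" for p
    proof -
      define h where "h = H p * exp (a * p)"
      define s where "s = S p * exp (a * p)"
      have e: "exp (a * p) \<le> E" unfolding E_def using p a by simp
      have "\<bar>H p\<bar> \<le> C * p" using head[of p 0] p by (simp add: H_def)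
      then have hb: "\<bar>h\<bar> \<le> C * p * E"
        unfolding h_def abs_mult using e C0 p by (intro mult_mono) auto
      have "\<bar>S p\<bar> \<le> \<bar>p * P 0 p\<bar> + \<bar>P 1 p\<bar>" unfolding S_def by linarith
      also have "\<bar>p * P 0 p\<bar> \<le> p * (C * p)" using head[of p 0] p by (simp add: abs_mult mult_left_mono)
      also have "\<bar>P 1 p\<bar> \<le> C * p\<^sup>2" using head[of p 1] p by (simp add: power2_eq_square)
      finally have "\<bar>S p\<bar> \<le> 2 * C * p\<^sup>2" by (simp add: power2_eq_square)
      then have sb: "\<bar>s\<bar> \<le> 2 * C * p\<^sup>2 * E"
        unfolding s_def abs_mult using e C0 p by (intro mult_mono) auto
      have zb: "\<bar>z p\<bar> \<le> C" using p by (intro zC) simp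
      have "\<bar>G.Q p\<bar> \<le> \<bar>8 * a * z p * h\<bar> + \<bar>4 * a * (1 - 2 * a * p) / p * h\<^sup>2\<bar> + \<bar>16 * a\<^sup>2 / p * (h * s)\<bar>
          + \<bar>16 * a\<^sup>2 * (1 - a * p) / p\<^sup>2 * s\<^sup>2\<bar> + \<bar>a * p * (z p)\<^sup>2\<bar>"
      proof -
        have "G.Q p = - (8 * a * z p * h) + 4 * a * (1 - 2 * a * p) / p * h\<^sup>2 - 16 * a\<^sup>2 / p * (h * s)
            + 16 * a\<^sup>2 * (1 - a * p) / p\<^sup>2 * s\<^sup>2 - a * p * (z p)\<^sup>2"
          unfolding G.Q_def h_def[symmetric] s_def[symmetric] by simp
        then show ?thesis by (simp only: abs5)
      qed
      also have "\<dots> \<le> 8 * a * (C * (C * p * E)) + 4 * a * (1 + 2 * a * p) / p * (C * p * E)\<^sup>2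
       + 16 * a\<^sup>2 / p * ((C * p * E) * (2 * C * p\<^sup>2 * E))
       + 16 * a\<^sup>2 * (1 + a * p) / p\<^sup>2 * (2 * C * p\<^sup>2 * E)\<^sup>2 + a * p * C\<^sup>2"
      proof (intro add_mono)
        show "\<bar>8 * a * z p * h\<bar> \<le> 8 * a * (C * (C * p * E))"
          unfolding mult.assoc abs_mult using a hb zb C0 by (intro mult_mono) (auto simp: mult.assoc)
        have m1: "\<bar>1 - 2 * a * p\<bar> \<le> 1 + 2 * a * p" "\<bar>1 - a * p\<bar> \<le> 1 + a * p" using a p by (auto simp: abs_le_iff)
        have h2: "h\<^sup>2 \<le> (C * p * E)\<^sup>2" "s\<^sup>2 \<le> (2 * C * p\<^sup>2 * E)\<^sup>2" "(z p)\<^sup>2 \<le> C\<^sup>2"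
          using power_mono[OF hb, of 2] power_mono[OF sb, of 2] power_mono[OF zb, of 2] by simp_all
        have "\<bar>4 * a * (1 - 2 * a * p) / p * h\<^sup>2\<bar> = 4 * a * \<bar>1 - 2 * a * p\<bar> / p * h\<^sup>2" using a p by (simp add: abs_mult)
        also have "\<dots> \<le> 4 * a * (1 + 2 * a * p) / p * (C * p * E)\<^sup>2"
          using a p m1 h2 by (intro mult_mono divide_right_mono mult_left_mono) auto
        finally show "\<bar>4 * a * (1 - 2 * a * p) / p * h\<^sup>2\<bar> \<le> 4 * a * (1 + 2 * a * p) / p * (C * p * E)\<^sup>2" .
        have "\<bar>16 * a\<^sup>2 / p * (h * s)\<bar> = 16 * a\<^sup>2 / p * (\<bar>h\<bar> * \<bar>s\<bar>)" using p by (simp add: abs_mult)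
        also have "\<dots> \<le> 16 * a\<^sup>2 / p * ((C * p * E) * (2 * C * p\<^sup>2 * E))"
          using hb sb p a C0 E by (intro mult_left_mono mult_mono) auto
        finally show "\<bar>16 * a\<^sup>2 / p * (h * s)\<bar> \<le> 16 * a\<^sup>2 / p * ((C * p * E) * (2 * C * p\<^sup>2 * E))" .
        have "\<bar>16 * a\<^sup>2 * (1 - a * p) / p\<^sup>2 * s\<^sup>2\<bar> = 16 * a\<^sup>2 * \<bar>1 - a * p\<bar> / p\<^sup>2 * s\<^sup>2" by (simp add: abs_mult)
        also have "\<dots> \<le> 16 * a\<^sup>2 * (1 + a * p) / p\<^sup>2 * (2 * C * p\<^sup>2 * E)\<^sup>2"
          using a p m1 h2 by (intro mult_mono divide_right_mono mult_left_mono) auto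
        finally show "\<bar>16 * a\<^sup>2 * (1 - a * p) / p\<^sup>2 * s\<^sup>2\<bar> \<le> 16 * a\<^sup>2 * (1 + a * p) / p\<^sup>2 * (2 * C * p\<^sup>2 * E)\<^sup>2" .
        show "\<bar>a * p * (z p)\<^sup>2\<bar> \<le> a * p * C\<^sup>2" using a p h2 by (simp add: abs_mult mult_left_mono)
      qed
      finally show ?thesis unfolding B_def .
    qed
    show "\<forall>\<^sub>F n in sequentially. norm (G.Q (1 / real (Suc n))) \<le> B (1 / real (Suc n))"
      using B by (intro always_eventually) simp
    have "(B \<longlongrightarrow> 0) (at_right 0)" unfolding B_def using a E Cpos by real_asymp
    moreover have "filterlim (\<lambda>n. 1 / real (Suc n)) (at_right 0) sequentially" by real_asymp
    ultimately show "(\<lambda>n. B (1 / real (Suc n))) \<longlonglongrightarrow> 0" by (rule filterlim_compose)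
  qed
  have "0 \<le> (\<integral>p. W p * indicator {0<..} p \<partial>lborel)"
  proof (rule LIMSEQ_le[OF _ lim])
    show "(\<lambda>n. G.Q (real (Suc n)) - G.Q (1 / real (Suc n))) \<longlonglongrightarrow> 0" using tendsto_diff[OF Q_top Q_bot] by simp
  qed (use lower in auto)
  then show ?thesis unfolding W_val by simp
qed

section \<open>The energy of the image of the trial function\<close>

lemma gauss_cos:
  assumes t: "t > 0"
  shows "integrable lborel (\<lambda>x. cos (p \<bullet> x) * exp (- t * (norm (x::real^2))\<^sup>2))"
    and "(\<integral>x. cos (p \<bullet> x) * exp (- t * (norm x)\<^sup>2) \<partial>lborel) = pi / t * exp (- (norm p)\<^sup>2 / (4 * t))"
proof -
  have eq: "cos (p \<bullet> x) * exp (- t * (norm x)\<^sup>2) = Re (exp (\<i> * of_real (p \<bullet> x)) * of_real (exp (- t * (norm x)\<^sup>2)))" for x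
    by (simp add: Re_exp)
  show "integrable lborel (\<lambda>x. cos (p \<bullet> x) * exp (- t * (norm (x::real^2))\<^sup>2))"
    unfolding eq by (rule integrable_Re[OF gauss_ft(1)[OF t]])
  show "(\<integral>x. cos (p \<bullet> x) * exp (- t * (norm x)\<^sup>2) \<partial>lborel) = pi / t * exp (- (norm p)\<^sup>2 / (4 * t))"
    unfolding eq integral_Re[OF gauss_ft(1)[OF t]] gauss_ft(2)[OF t] by simp
qed

text \<open>The integrand of \<open>heat_K0\<close> at \<open>r = norm x\<close>, now real valued,
  so that Fubini applies to products with cosines of either sign.\<close>

definition hk :: "real \<Rightarrow> real^2 \<Rightarrow> real" where
  "hk s x = exp (- s) / (2 * s) * exp (- (1 / (4 * s)) * (norm x)\<^sup>2) * indicator {0<..} s"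

text \<open>\<open>k0 x\<close> is \<open>K\<^sub>0 (norm x)\<close>, with value \<open>0\<close> at the origin.\<close>

definition k0 :: "real^2 \<Rightarrow> real" where "k0 x = (\<integral>s. hk s x \<partial>lborel)"

lemma hk_measurable [measurable]: "(\<lambda>(s, x). hk s x) \<in> borel_measurable (borel \<Otimes>\<^sub>M borel)"
  unfolding hk_def by measurable

lemma hk_nonneg: "0 \<le> hk s x"
  by (auto simp: hk_def split: split_indicator)

lemma k0_measurable [measurable]: "k0 \<in> borel_measurable borel"
  unfolding k0_def by measurable

lemma k0_nonneg: "0 \<le> k0 x"
  unfolding k0_def using hk_nonneg by (intro integral_nonneg_AE AE_I2)

lemma hk_integrable: "integrable (lborel \<Otimes>\<^sub>M lborel) (\<lambda>(s, x). hk s x)"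
proof (rule integrableI_nonneg)
  have "(\<integral>\<^sup>+z. ennreal (case z of (s, x) \<Rightarrow> hk s x) \<partial>(lborel \<Otimes>\<^sub>M lborel)) = (\<integral>\<^sup>+s. \<integral>\<^sup>+x. ennreal (hk s x) \<partial>lborel \<partial>lborel)"
    by (subst lborel.nn_integral_fst[symmetric]) auto
  also have "\<dots> = (\<integral>\<^sup>+s. ennreal (2 * pi) * (ennreal (s ^ 0 * exp (- 1 * s)) * indicator {0<..} s) \<partial>lborel)"
  proof (rule nn_integral_cong)
    fix s :: real
    show "(\<integral>\<^sup>+x. ennreal (hk s x) \<partial>lborel) = ennreal (2 * pi) * (ennreal (s ^ 0 * exp (- 1 * s)) * indicator {0<..} s)"
    proof (cases "s > 0")
      case True
      have "(\<integral>\<^sup>+x. ennreal (hk s x) \<partial>lborel) = (\<integral>\<^sup>+x. ennreal (exp (- s) / (2 * s)) * ennreal (exp (- (1 / (4 * s)) * (norm (x::real^2))\<^sup>2)) \<partial>lborel)"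
        using True by (intro nn_integral_cong) (simp add: hk_def ennreal_mult[symmetric])
      also have "\<dots> = ennreal (exp (- s) / (2 * s)) * ennreal (pi / (1 / (4 * s)))"
      proof -
        have g: "(\<integral>\<^sup>+x. ennreal (exp (- (1 / (4 * s)) * (norm (x::real^2))\<^sup>2)) \<partial>lborel) = ennreal (pi / (1 / (4 * s)))"
          by (rule nn_integral_gauss) (use True in simp)
        show ?thesis unfolding g[symmetric] by (rule nn_integral_cmult) measurable
      qed
      also have "\<dots> = ennreal (2 * pi) * ennreal (exp (- s))"
        using True by (simp add: ennreal_mult[symmetric])
      finally show ?thesis using True by simp
    qed (simp add: hk_def)
  qed
  also have "\<dots> = ennreal (2 * pi) * (\<integral>\<^sup>+s. ennreal (s ^ 0 * exp (- 1 * s)) * indicator {0<..} s \<partial>lborel)"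
    by (rule nn_integral_cmult) measurable
  also have "\<dots> < \<infinity>" unfolding nn_integral_power_exp[OF zero_less_one] by (simp add: ennreal_mult_less_top)
  finally show "(\<integral>\<^sup>+z. ennreal (case z of (s, x) \<Rightarrow> hk s x) \<partial>(lborel \<Otimes>\<^sub>M lborel)) < \<infinity>" .
qed (auto simp: hk_nonneg)

lemma k0_integrable: "integrable lborel k0"
  using lborel_pair.integrable_snd[OF hk_integrable] by (simp add: k0_def[abs_def])

text \<open>The transform of each Gaussian leaves
  \<open>2 * pi * exp (- (1 + (norm p)\<^sup>2) * s)\<close>, and integrating over \<open>s\<close>
  gives the propagator.\<close>

lemma k0_cos: "(\<integral>x. cos (p \<bullet> x) * k0 x \<partial>lborel) = 2 * pi / (1 + (norm p)\<^sup>2)"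
proof -
  have i: "integrable (lborel \<Otimes>\<^sub>M lborel) (\<lambda>(s, x). cos (p \<bullet> x) * hk s x)"
    by (rule Bochner_Integration.integrable_bound[OF hk_integrable])
       (auto intro!: AE_I2 mult_left_le_one_le simp: abs_mult)
  have "(\<integral>x. cos (p \<bullet> x) * k0 x \<partial>lborel) = (\<integral>x. \<integral>s. cos (p \<bullet> x) * hk s x \<partial>lborel \<partial>lborel)"
    by (simp add: k0_def)
  also have "\<dots> = (\<integral>s. \<integral>x. cos (p \<bullet> x) * hk s x \<partial>lborel \<partial>lborel)"
    using lborel_pair.Fubini_integral[OF i] by simp
  also have "\<dots> = (\<integral>s. 2 * pi * (s ^ 0 * exp (- (1 + (norm p)\<^sup>2) * s) * indicator {0<..} s) \<partial>lborel)"
  proof (rule Bochner_Integration.integral_cong[OF refl])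
    fix s :: real
    show "(\<integral>x. cos (p \<bullet> x) * hk s x \<partial>lborel) = 2 * pi * (s ^ 0 * exp (- (1 + (norm p)\<^sup>2) * s) * indicator {0<..} s)"
    proof (cases "s > 0")
      case s: True
      then have t: "1 / (4 * s) > 0" by simp
      have "(\<integral>x. cos (p \<bullet> x) * hk s x \<partial>lborel) = (\<integral>x. exp (- s) / (2 * s) * (cos (p \<bullet> x) * exp (- (1 / (4 * s)) * (norm x)\<^sup>2)) \<partial>lborel)"
        using s by (intro Bochner_Integration.integral_cong) (auto simp: hk_def)
      also have "\<dots> = exp (- s) / (2 * s) * (pi / (1 / (4 * s)) * exp (- (norm p)\<^sup>2 / (4 * (1 / (4 * s)))))"
        by (simp only: integral_mult_right_zero gauss_cos(2)[OF t])
      also have "\<dots> = 2 * pi * (exp (- s) * exp (- (norm p)\<^sup>2 * s))" using s by simp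
      also have "exp (- s) * exp (- (norm p)\<^sup>2 * s) = exp (- (1 + (norm p)\<^sup>2) * s)"
        by (simp add: exp_add[symmetric] algebra_simps)
      finally show ?thesis using s by simp
    qed (simp add: hk_def)
  qed
  also have "\<dots> = 2 * pi * (1 / (1 + (norm p)\<^sup>2))"
    unfolding integral_mult_right_zero
    by (subst integral_power_exp) (simp_all add: add_pos_nonneg)
  finally show ?thesis by simp
qed

text \<open>With the square written as a double integral over \<open>s\<close> and \<open>t\<close>,
  the Gaussian integral over \<open>x\<close> leaves \<open>pi * exp (- (s + t)) / (s + t)\<close>.
  This depends on the sum only, and the range of \<open>p\<close> at fixed sum has a length that
  cancels the denominator.\<close>

lemma k0_L2: "(\<integral>\<^sup>+x. ennreal ((k0 x)\<^sup>2) \<partial>lborel) \<le> ennreal pi"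
proof -
  define h where "h s x = ennreal (hk s x)" for s x
  have [measurable]: "(\<lambda>(s, x). h s x) \<in> borel_measurable (borel \<Otimes>\<^sub>M borel)" unfolding h_def by measurable
  have le: "ennreal (k0 x) \<le> (\<integral>\<^sup>+s. h s x \<partial>lborel)" for x
  proof -
    have "k0 x = enn2real (\<integral>\<^sup>+s. h s x \<partial>lborel)"
      unfolding k0_def h_def using hk_nonneg by (intro integral_eq_nn_integral) auto
    then show ?thesis by (cases "\<integral>\<^sup>+s. h s x \<partial>lborel") simp_all
  qed
  define F where "F u = ennreal (exp (- u) / u)" for u :: real
  have [measurable]: "F \<in> borel_measurable borel" unfolding F_def by measurable
  have inner: "(\<integral>\<^sup>+x. h s x * h t x \<partial>lborel) = ennreal pi * (F (s + t) * 1 * indicator {0<..} t * indicator {0<..} s)" for s t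
  proof (cases "s > 0 \<and> t > 0")
    case True
    define c where "c = 1 / (4 * s) + 1 / (4 * t)"
    have c: "c > 0" using True by (simp add: c_def add_pos_pos)
    have ex: "exp (- (1 / (4 * s)) * n) * exp (- (1 / (4 * t)) * n) = exp (- c * n)" for n
      by (simp add: c_def exp_add[symmetric] algebra_simps)
    have "(\<integral>\<^sup>+x. h s x * h t x \<partial>lborel) = (\<integral>\<^sup>+x. ennreal (exp (- s) / (2 * s) * (exp (- t) / (2 * t))) * ennreal (exp (- c * (norm (x::real^2))\<^sup>2)) \<partial>lborel)"
    proof (rule nn_integral_cong)
      fix x :: "real^2"
      have "hk s x * hk t x = exp (- s) / (2 * s) * (exp (- t) / (2 * t)) * exp (- c * (norm x)\<^sup>2)"
        using True unfolding ex[symmetric] by (simp add: hk_def)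
      then show "h s x * h t x = ennreal (exp (- s) / (2 * s) * (exp (- t) / (2 * t))) * ennreal (exp (- c * (norm x)\<^sup>2))"
        using True unfolding h_def by (simp add: ennreal_mult[symmetric] hk_nonneg)
    qed
    also have "\<dots> = ennreal (exp (- s) / (2 * s) * (exp (- t) / (2 * t))) * ennreal (pi / c)"
      unfolding nn_integral_gauss[OF c, symmetric] by (rule nn_integral_cmult) measurable
    also have "\<dots> = ennreal (exp (- s) / (2 * s) * (exp (- t) / (2 * t)) * (pi / c))"
      using True c by (subst ennreal_mult[symmetric]) auto
    also have "exp (- s) / (2 * s) * (exp (- t) / (2 * t)) * (pi / c) = pi * (exp (- (s + t)) / (s + t))"
    proof -
      have "c = (s + t) / (4 * s * t)" using True by (simp add: c_def field_simps)
      moreover have "exp (- s) * exp (- t) = exp (- (s + t))" by (simp add: exp_add[symmetric])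
      ultimately show ?thesis using True by (simp add: field_simps)
    qed
    also have "ennreal (pi * (exp (- (s + t)) / (s + t))) = ennreal pi * ennreal (exp (- (s + t)) / (s + t))"
      using True by (intro ennreal_mult) auto
    finally show ?thesis using True by (simp add: F_def)
  qed (auto simp: h_def hk_def split: split_indicator)
  have "(\<integral>\<^sup>+x. ennreal ((k0 x)\<^sup>2) \<partial>lborel) \<le> (\<integral>\<^sup>+x. (\<integral>\<^sup>+s. h s x \<partial>lborel) * (\<integral>\<^sup>+t. h t x \<partial>lborel) \<partial>lborel)"
    using le k0_nonneg by (intro nn_integral_mono) (auto simp: power2_eq_square ennreal_mult intro!: mult_mono)
  also have "\<dots> = (\<integral>\<^sup>+x. \<integral>\<^sup>+s. \<integral>\<^sup>+t. h s x * h t x \<partial>lborel \<partial>lborel \<partial>lborel)"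
    by (simp add: nn_integral_cmult nn_integral_multc)
  also have "\<dots> = (\<integral>\<^sup>+s. \<integral>\<^sup>+x. \<integral>\<^sup>+t. h s x * h t x \<partial>lborel \<partial>lborel \<partial>lborel)"
    by (rule lborel_pair.Fubini') measurable
  also have "\<dots> = (\<integral>\<^sup>+s. \<integral>\<^sup>+t. \<integral>\<^sup>+x. h s x * h t x \<partial>lborel \<partial>lborel \<partial>lborel)"
    by (rule nn_integral_cong, rule lborel_pair.Fubini') measurable
  also have "\<dots> = ennreal pi * (\<integral>\<^sup>+s. \<integral>\<^sup>+t. F (s + t) * 1 * indicator {0<..} t * indicator {0<..} s \<partial>lborel \<partial>lborel)"
    unfolding inner by (simp add: nn_integral_cmult)
  also have "(\<integral>\<^sup>+s. \<integral>\<^sup>+t. F (s + t) * 1 * indicator {0<..} t * indicator {0<..} s \<partial>lborel \<partial>lborel)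
    = (\<integral>\<^sup>+s. F s * (\<integral>\<^sup>+p. 1 * indicator {0..s} p \<partial>lborel) * indicator {0<..} s \<partial>lborel)"
    by (rule nn_integral_quadrant[of F "\<lambda>_. 1"]) measurable
  also have "\<dots> = (\<integral>\<^sup>+s. ennreal (s ^ 0 * exp (- 1 * s)) * indicator {0<..} s \<partial>lborel)"
    by (intro nn_integral_cong) (auto simp: F_def ennreal_mult[symmetric] split: split_indicator)
  also have "\<dots> = 1" unfolding nn_integral_power_exp[OF zero_less_one] by simp
  finally show ?thesis by simp
qed

lemma circ_const: "circ (\<lambda>_. 1) r = ennreal (2 * pi)"
proof -
  have "circ (\<lambda>_. 1) r = (\<integral>\<^sup>+t. 2 * ennreal (1 / (1 * t\<^sup>2 + 2 * 0 * t + 1)) \<partial>lborel)"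
    unfolding circ_def by (intro nn_integral_cong) (simp add: add.commute)
  also have "\<dots> = 2 * ennreal (pi / sqrt (1 * 1 - 0\<^sup>2))"
    using nn_integral_inverse_quadratic[of 1 1 0] by (subst nn_integral_cmult) auto
  finally show ?thesis by (simp add: ennreal_mult)
qed

lemma nn_integral_radial:
  assumes [measurable]: "h \<in> borel_measurable borel"
  shows "(\<integral>\<^sup>+p. h (norm (p::real^2)) \<partial>lborel) = ennreal (2 * pi) * (\<integral>\<^sup>+r. ennreal r * h r * indicator {0<..} r \<partial>lborel)"
proof -
  have c: "circ (\<lambda>p. h (norm p)) r = h r * ennreal (2 * pi)" if "r \<ge> 0" for r
    using circ_radial_mult[of "\<lambda>_. 1" r h] that by (simp add: circ_const)
  have "(\<integral>\<^sup>+p. h (norm (p::real^2)) \<partial>lborel) = (\<integral>\<^sup>+r. ennreal r * circ (\<lambda>p. h (norm p)) r * indicator {0<..} r \<partial>lborel)"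
    by (rule nn_integral_polar) measurable
  also have "\<dots> = (\<integral>\<^sup>+r. ennreal (2 * pi) * (ennreal r * h r * indicator {0<..} r) \<partial>lborel)"
    by (intro nn_integral_cong) (auto simp: c mult_ac split: split_indicator)
  also have "\<dots> = ennreal (2 * pi) * (\<integral>\<^sup>+r. ennreal r * h r * indicator {0<..} r \<partial>lborel)"
    by (rule nn_integral_cmult) measurable
  finally show ?thesis .
qed

text \<open>The trial function \<open>exp (- a * r)\<close> as a radial function in the plane.
  Profiles enter the radial form multiplied by \<open>r\<close>, hence the division by the
  norm.\<close>

definition yk :: "real^2 \<Rightarrow> real \<Rightarrow> real" where "yk q a = exp (- a * norm q) / norm q"

lemma yk_measurable [measurable]: "(\<lambda>q. yk q a) \<in> borel_measurable borel"
  unfolding yk_def by measurable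

lemma yk_nonneg: "0 \<le> yk q a" by (simp add: yk_def)

lemma yk_integrable:
  assumes a: "a > 0"
  shows "integrable lborel (\<lambda>q. yk q a)"
proof (rule integrableI_nonneg)
  have "(\<integral>\<^sup>+q. ennreal (yk q a) \<partial>lborel) = (\<integral>\<^sup>+q. (\<lambda>r. ennreal (exp (- a * r) / r)) (norm (q::real^2)) \<partial>lborel)"
    by (simp add: yk_def)
  also have "\<dots> = ennreal (2 * pi) * (\<integral>\<^sup>+r. ennreal r * ennreal (exp (- a * r) / r) * indicator {0<..} r \<partial>lborel)"
    by (rule nn_integral_radial) measurable
  also have "(\<integral>\<^sup>+r. ennreal r * ennreal (exp (- a * r) / r) * indicator {0<..} r \<partial>lborel) = (\<integral>\<^sup>+r. ennreal (r ^ 0 * exp (- a * r)) * indicator {0<..} r \<partial>lborel)"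
    by (intro nn_integral_cong) (auto simp: ennreal_mult[symmetric] split: split_indicator)
  also have "ennreal (2 * pi) * \<dots> < \<infinity>" unfolding nn_integral_power_exp[OF a] by (simp add: ennreal_mult_less_top)
  finally show "(\<integral>\<^sup>+q. ennreal (yk q a) \<partial>lborel) < \<infinity>" .
qed (auto simp: yk_nonneg)

text \<open>Adding 1 to the cosine keeps the integrand nonnegative, so that the fundamental theorem
  for nonnegative integrals applies; the extra contribution is subtracted again in
  \<open>yk_cos\<close>.\<close>

lemma nn_integral_exp_cos:
  assumes a: "a > 0"
  shows "(\<integral>\<^sup>+r. ennreal (exp (- a * r) * (1 + cos (r * w))) * indicator {0<..} r \<partial>lborel) = ennreal (1 / a + a / (a\<^sup>2 + w\<^sup>2))"
proof -
  define F where "F r = - exp (- a * r) / a + exp (- a * r) * (w * sin (r * w) - a * cos (r * w)) / (a\<^sup>2 + w\<^sup>2)" for r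
  have n: "a\<^sup>2 + w\<^sup>2 > 0" using a by (simp add: add_pos_nonneg)
  have c: "1 + cos u \<ge> 0" for u :: real using cos_ge_minus_one[of u] by linarith
  have "(\<integral>\<^sup>+r. ennreal (exp (- a * r) * (1 + cos (r * w))) * indicator {0<..} r \<partial>lborel) = (\<integral>\<^sup>+r. ennreal (exp (- a * r) * (1 + cos (r * w))) * indicator {0..} r \<partial>lborel)"
    by (intro nn_integral_cong_AE AE_I[where N="{0}"]) (auto split: split_indicator)
  also have "\<dots> = ennreal (0 - F 0)"
  proof (rule nn_integral_FTC_atLeast)
    fix r :: real
    have e: "((\<lambda>r. exp (- a * r)) has_real_derivative - a * exp (- a * r)) (at r)"
      by (auto intro!: derivative_eq_intros)
    have s: "((\<lambda>r. w * sin (r * w) - a * cos (r * w)) has_real_derivative w\<^sup>2 * cos (r * w) + a * w * sin (r * w)) (at r)"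
      by (auto intro!: derivative_eq_intros simp: power2_eq_square)
    have "(F has_real_derivative - (- a * exp (- a * r)) / a + ((- a * exp (- a * r)) * (w * sin (r * w) - a * cos (r * w)) + (w\<^sup>2 * cos (r * w) + a * w * sin (r * w)) * exp (- a * r)) / (a\<^sup>2 + w\<^sup>2)) (at r)"
      unfolding F_def[abs_def] by (intro DERIV_add DERIV_cdivide DERIV_minus DERIV_mult e s)
    also have "- (- a * exp (- a * r)) / a + ((- a * exp (- a * r)) * (w * sin (r * w) - a * cos (r * w)) + (w\<^sup>2 * cos (r * w) + a * w * sin (r * w)) * exp (- a * r)) / (a\<^sup>2 + w\<^sup>2)
       = exp (- a * r) * (1 + cos (r * w))"
    proof -
      have e1: "(- a * exp (- a * r)) * (w * sin (r * w) - a * cos (r * w)) + (w\<^sup>2 * cos (r * w) + a * w * sin (r * w)) * exp (- a * r)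
        = exp (- a * r) * cos (r * w) * (a\<^sup>2 + w\<^sup>2)" by (simp add: algebra_simps power2_eq_square)
      have e2: "- (- a * exp (- a * r)) / a = exp (- a * r)" using a by simp
      have e3: "exp (- a * r) * cos (r * w) * (a\<^sup>2 + w\<^sup>2) / (a\<^sup>2 + w\<^sup>2) = exp (- a * r) * cos (r * w)"
        using n a by simp
      show ?thesis unfolding e1 e2 e3 by (simp add: distrib_left)
    qed
    finally show "(F has_real_derivative exp (- a * r) * (1 + cos (r * w))) (at r)" .
  next
    have e0: "((\<lambda>r. exp (- a * r)) \<longlongrightarrow> 0) at_top" using a by real_asymp
    have "((\<lambda>r. exp (- a * r) * (w * sin (r * w) - a * cos (r * w))) \<longlongrightarrow> 0) at_top"
    proof (rule Lim_null_comparison)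
      show "\<forall>\<^sub>F r in at_top. norm (exp (- a * r) * (w * sin (r * w) - a * cos (r * w))) \<le> exp (- a * r) * (\<bar>w\<bar> + a)"
      proof (intro always_eventually allI)
        fix r :: real
        have "\<bar>w * sin (r * w)\<bar> \<le> \<bar>w\<bar> * 1" "\<bar>a * cos (r * w)\<bar> \<le> a * 1"
          using mult_left_mono[OF abs_sin_le_one[of "r * w"], of "\<bar>w\<bar>"]
            mult_left_mono[OF abs_cos_le_one[of "r * w"], of a] a by (simp_all add: abs_mult)
        then have "\<bar>w * sin (r * w) - a * cos (r * w)\<bar> \<le> \<bar>w\<bar> + a" by linarith
        then show "norm (exp (- a * r) * (w * sin (r * w) - a * cos (r * w))) \<le> exp (- a * r) * (\<bar>w\<bar> + a)"
          by (simp add: abs_mult)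
      qed
      show "((\<lambda>r. exp (- a * r) * (\<bar>w\<bar> + a)) \<longlongrightarrow> 0) at_top" using tendsto_mult_left_zero[OF e0] .
    qed
    from tendsto_add[OF tendsto_divide[OF tendsto_minus[OF e0] tendsto_const, of a] tendsto_divide[OF this tendsto_const, of "a\<^sup>2 + w\<^sup>2"]]
    show "(F \<longlongrightarrow> 0) at_top" unfolding F_def[abs_def] using a n by simp
  qed (use c in auto)
  finally show ?thesis by (simp add: F_def add.commute)
qed

text \<open>In polar coordinates the singularity at the origin cancels against \<open>r\<close>, the
  radial integral is elementary, and the angular one is rational in the slope.\<close>

lemma yk_cos:
  assumes a: "a > 0"
  shows "(\<integral>q. cos (x \<bullet> q) * yk q a \<partial>lborel) = 2 * pi / sqrt (a\<^sup>2 + (norm x)\<^sup>2)"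
proof -
  \<comment> \<open>\<open>A\<close>, \<open>2 * B\<close> and \<open>C\<close> are the coefficients
    of \<open>(a\<^sup>2 + w\<^sup>2) * (1 + t\<^sup>2)\<close> as a polynomial in the slope
    \<open>t\<close>, where \<open>w\<close> is the inner product of \<open>x\<close> and
    \<open>dir t\<close>.\<close>
  define A where "A = a\<^sup>2 + (x $ 2)\<^sup>2"
  define B where "B = x $ 1 * x $ 2"
  define C where "C = a\<^sup>2 + (x $ 1)\<^sup>2"
  have A: "A > 0" using a by (simp add: A_def add_pos_nonneg)
  have D: "A * C - B\<^sup>2 = a\<^sup>2 * (a\<^sup>2 + (norm x)\<^sup>2)"
    unfolding A_def B_def C_def norm_vec2_sq by (simp add: power2_eq_square algebra_simps)
  have nx: "a\<^sup>2 + (norm x)\<^sup>2 > 0" using a by (simp add: add_pos_nonneg)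
  then have D_pos: "A * C - B\<^sup>2 > 0" unfolding D using a by simp
  have c: "1 + cos u \<ge> 0" for u :: real using cos_ge_minus_one[of u] by linarith
  have i1: "integrable lborel (\<lambda>q. yk q a)" by (rule yk_integrable[OF a])
  have i2: "integrable lborel (\<lambda>q. cos (x \<bullet> q) * yk q a)"
    by (rule Bochner_Integration.integrable_bound[OF i1])
       (auto intro!: AE_I2 mult_left_le_one_le simp: abs_mult yk_nonneg)
  have I0: "(\<integral>\<^sup>+q. ennreal (yk q a) \<partial>lborel) = ennreal (2 * pi / a)"
  proof -
    have "(\<integral>\<^sup>+q. ennreal (yk q a) \<partial>lborel) = (\<integral>\<^sup>+q. (\<lambda>r. ennreal (exp (- a * r) / r)) (norm (q::real^2)) \<partial>lborel)"
      by (simp add: yk_def)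
    also have "\<dots> = ennreal (2 * pi) * (\<integral>\<^sup>+r. ennreal r * ennreal (exp (- a * r) / r) * indicator {0<..} r \<partial>lborel)"
      by (rule nn_integral_radial) measurable
    also have "(\<integral>\<^sup>+r. ennreal r * ennreal (exp (- a * r) / r) * indicator {0<..} r \<partial>lborel) = (\<integral>\<^sup>+r. ennreal (r ^ 0 * exp (- a * r)) * indicator {0<..} r \<partial>lborel)"
      by (intro nn_integral_cong) (auto simp: ennreal_mult[symmetric] split: split_indicator)
    finally show ?thesis unfolding nn_integral_power_exp[OF a] using a by (simp add: ennreal_mult[symmetric])
  qed
  have I1: "(\<integral>\<^sup>+q. ennreal ((1 + cos (x \<bullet> q)) * yk q a) \<partial>lborel) = ennreal (2 * pi / a + 2 * pi / sqrt (a\<^sup>2 + (norm x)\<^sup>2))"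
  proof -
    have "(\<integral>\<^sup>+q. ennreal ((1 + cos (x \<bullet> q)) * yk q a) \<partial>lborel) = (\<integral>\<^sup>+r. ennreal r * circ (\<lambda>q. ennreal ((1 + cos (x \<bullet> q)) * yk q a)) r * indicator {0<..} r \<partial>lborel)"
      by (rule nn_integral_polar) measurable
    also have "\<dots> = (\<integral>\<^sup>+r. \<integral>\<^sup>+t. ennreal (2 / (1 + t\<^sup>2)) * (ennreal (exp (- a * r) * (1 + cos (r * (x \<bullet> dir t)))) * indicator {0<..} r) \<partial>lborel \<partial>lborel)"
    proof (rule nn_integral_cong)
      fix r :: real
      show "ennreal r * circ (\<lambda>q. ennreal ((1 + cos (x \<bullet> q)) * yk q a)) r * indicator {0<..} r
        = (\<integral>\<^sup>+t. ennreal (2 / (1 + t\<^sup>2)) * (ennreal (exp (- a * r) * (1 + cos (r * (x \<bullet> dir t)))) * indicator {0<..} r) \<partial>lborel)"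
      proof (cases "r > 0")
        case r: True
        have "ennreal r * circ (\<lambda>q. ennreal ((1 + cos (x \<bullet> q)) * yk q a)) r
          = (\<integral>\<^sup>+t. ennreal r * ((ennreal ((1 + cos (r * (x \<bullet> dir t))) * (exp (- a * r) / r)) + ennreal ((1 + cos (r * (x \<bullet> dir t))) * (exp (- a * r) / r))) * ennreal (1 / (1 + t\<^sup>2))) \<partial>lborel)"
          unfolding circ_def yk_def using r by (subst nn_integral_cmult[symmetric]) (auto simp: abs_of_pos)
        also have "\<dots> = (\<integral>\<^sup>+t. ennreal (2 / (1 + t\<^sup>2)) * ennreal (exp (- a * r) * (1 + cos (r * (x \<bullet> dir t)))) \<partial>lborel)"
        proof (rule nn_integral_cong)
          fix t :: real
          define m where "m = 1 + cos (r * (x \<bullet> dir t))"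
          have m: "m \<ge> 0" unfolding m_def by (rule c)
          have t: "1 + t\<^sup>2 > 0" by (simp add: add_pos_nonneg)
          have "ennreal r * ((ennreal (m * (exp (- a * r) / r)) + ennreal (m * (exp (- a * r) / r))) * ennreal (1 / (1 + t\<^sup>2)))
            = ennreal (r * ((m * (exp (- a * r) / r) + m * (exp (- a * r) / r)) * (1 / (1 + t\<^sup>2))))"
          proof -
            have "ennreal r * ((ennreal u + ennreal u) * ennreal v) = ennreal (r * ((u + u) * v))"
              if "u \<ge> 0" "v \<ge> 0" for u v
              using that r by (simp only: ennreal_plus[symmetric] ennreal_mult[symmetric] add_nonneg_nonneg
                  mult_nonneg_nonneg less_imp_le)
            then show ?thesis using m r t by simp
          qed
          also have "r * ((m * (exp (- a * r) / r) + m * (exp (- a * r) / r)) * (1 / (1 + t\<^sup>2))) = 2 / (1 + t\<^sup>2) * (exp (- a * r) * m)"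
            using r by simp
          also have "ennreal \<dots> = ennreal (2 / (1 + t\<^sup>2)) * ennreal (exp (- a * r) * m)"
            using m t by (intro ennreal_mult) auto
          finally show "ennreal r * ((ennreal ((1 + cos (r * (x \<bullet> dir t))) * (exp (- a * r) / r)) + ennreal ((1 + cos (r * (x \<bullet> dir t))) * (exp (- a * r) / r))) * ennreal (1 / (1 + t\<^sup>2)))
            = ennreal (2 / (1 + t\<^sup>2)) * ennreal (exp (- a * r) * (1 + cos (r * (x \<bullet> dir t))))" unfolding m_def .
        qed
        finally show ?thesis using r by simp
      qed simp
    qed
    also have "\<dots> = (\<integral>\<^sup>+t. \<integral>\<^sup>+r. ennreal (2 / (1 + t\<^sup>2)) * (ennreal (exp (- a * r) * (1 + cos (r * (x \<bullet> dir t)))) * indicator {0<..} r) \<partial>lborel \<partial>lborel)"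
      by (rule lborel_pair.Fubini') measurable
    also have "\<dots> = (\<integral>\<^sup>+t. ennreal (2 / a) * ennreal (1 / (1 * t\<^sup>2 + 2 * 0 * t + 1)) + ennreal (2 * a) * ennreal (1 / (A * t\<^sup>2 + 2 * B * t + C)) \<partial>lborel)"
    proof (rule nn_integral_cong)
      fix t :: real
      have t: "1 + t\<^sup>2 > 0" by (simp add: add_pos_nonneg)
      define w where "w = x \<bullet> dir t"
      have n: "a\<^sup>2 + w\<^sup>2 > 0" using a by (simp add: add_pos_nonneg)
      have w: "w = (x $ 1 + x $ 2 * t) / sqrt (1 + t\<^sup>2)" by (simp add: w_def dir_def inner_vec2 add_divide_distrib)
      have eq: "(a\<^sup>2 + w\<^sup>2) * (1 + t\<^sup>2) = A * t\<^sup>2 + 2 * B * t + C"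
        unfolding w A_def B_def C_def using t by (simp add: power_divide field_simps power2_eq_square)
      have "(\<integral>\<^sup>+r. ennreal (2 / (1 + t\<^sup>2)) * (ennreal (exp (- a * r) * (1 + cos (r * w))) * indicator {0<..} r) \<partial>lborel)
        = ennreal (2 / (1 + t\<^sup>2)) * ennreal (1 / a + a / (a\<^sup>2 + w\<^sup>2))"
        unfolding nn_integral_exp_cos[OF a, symmetric] by (rule nn_integral_cmult) measurable
      also have "\<dots> = ennreal (2 / (1 + t\<^sup>2) * (1 / a + a / (a\<^sup>2 + w\<^sup>2)))"
        using a n t by (intro ennreal_mult[symmetric]) auto
      also have "2 / (1 + t\<^sup>2) * (1 / a + a / (a\<^sup>2 + w\<^sup>2)) = 2 / a * (1 / (1 * t\<^sup>2 + 2 * 0 * t + 1)) + 2 * a * (1 / (A * t\<^sup>2 + 2 * B * t + C))"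
        unfolding eq[symmetric] using a n t by (simp add: distrib_left add.commute mult.commute)
      also have "ennreal \<dots> = ennreal (2 / a * (1 / (1 * t\<^sup>2 + 2 * 0 * t + 1))) + ennreal (2 * a * (1 / (A * t\<^sup>2 + 2 * B * t + C)))"
        using a n t unfolding eq[symmetric] by (intro ennreal_plus) auto
      also have "\<dots> = ennreal (2 / a) * ennreal (1 / (1 * t\<^sup>2 + 2 * 0 * t + 1)) + ennreal (2 * a) * ennreal (1 / (A * t\<^sup>2 + 2 * B * t + C))"
        using a n t unfolding eq[symmetric] by (subst (1 2) ennreal_mult) auto
      finally show "(\<integral>\<^sup>+r. ennreal (2 / (1 + t\<^sup>2)) * (ennreal (exp (- a * r) * (1 + cos (r * (x \<bullet> dir t)))) * indicator {0<..} r) \<partial>lborel) = \<dots>"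
        unfolding w_def .
    qed
    also have "\<dots> = ennreal (2 / a) * ennreal (pi / sqrt (1 * 1 - 0\<^sup>2)) + ennreal (2 * a) * ennreal (pi / sqrt (A * C - B\<^sup>2))"
      using nn_integral_inverse_quadratic[of 1 1 0] nn_integral_inverse_quadratic[OF A D_pos]
      by (simp add: nn_integral_add nn_integral_cmult)
    also have "\<dots> = ennreal (2 * pi / a + 2 * pi / sqrt (a\<^sup>2 + (norm x)\<^sup>2))"
      unfolding D using a nx by (simp add: real_sqrt_mult ennreal_mult[symmetric] ennreal_plus[symmetric] mult.commute del: ennreal_plus)
    finally show ?thesis .
  qed
  have e0: "(\<integral>q. yk q a \<partial>lborel) = 2 * pi / a"
    using I0 a nn_integral_eq_integral[OF i1] by (simp add: yk_nonneg integral_nonneg_AE)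
  have i3: "integrable lborel (\<lambda>q. (1 + cos (x \<bullet> q)) * yk q a)" using i1 i2 by (simp add: distrib_right)
  have "ennreal (\<integral>q. (1 + cos (x \<bullet> q)) * yk q a \<partial>lborel) = ennreal (2 * pi / a + 2 * pi / sqrt (a\<^sup>2 + (norm x)\<^sup>2))"
    unfolding I1[symmetric] using c by (intro nn_integral_eq_integral[OF i3, symmetric]) (auto simp: yk_nonneg)
  then have "(\<integral>q. (1 + cos (x \<bullet> q)) * yk q a \<partial>lborel) = 2 * pi / a + 2 * pi / sqrt (a\<^sup>2 + (norm x)\<^sup>2)"
    using c a by (subst (asm) ennreal_inj) (auto intro!: integral_nonneg_AE simp: yk_nonneg)
  moreover have "(\<integral>q. (1 + cos (x \<bullet> q)) * yk q a \<partial>lborel) = 2 * pi / a + (\<integral>q. cos (x \<bullet> q) * yk q a \<partial>lborel)"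
    using i1 i2 e0 by (simp add: distrib_right)
  ultimately show ?thesis by simp
qed

lemma borel_measurable_vec_nth' [measurable (raw)]:
  fixes f :: "'a \<Rightarrow> real^'n"
  shows "f \<in> borel_measurable M \<Longrightarrow> (\<lambda>x. f x $ i) \<in> borel_measurable M"
  by (rule measurable_compose[of f M borel "\<lambda>v. v $ i"])
     (auto intro!: borel_measurable_continuous_onI continuous_intros)

text \<open>Differentiation under the integral: the cosine is 1-Lipschitz, so
  \<open>norm x * f x\<close> dominates the difference quotients. It serves along the first axis for
  \<open>y'\<close>, and along the ray through \<open>p\<close> for the radial derivative.\<close>

lemma cos_transform_deriv:
  fixes f :: "real^2 \<Rightarrow> real"
  assumes f: "integrable lborel f" and xf: "integrable lborel (\<lambda>x. norm x * f x)" and v: "norm v \<le> 1"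
  shows "((\<lambda>r. \<integral>x. cos ((p + r *\<^sub>R v) \<bullet> x) * f x \<partial>lborel) has_real_derivative
      - (\<integral>x. (v \<bullet> x) * sin ((p + r *\<^sub>R v) \<bullet> x) * f x \<partial>lborel)) (at r)"
proof -
  have [measurable]: "f \<in> borel_measurable borel" using borel_measurable_integrable[OF f] by simp
  let ?g = "\<lambda>r x. cos ((p + r *\<^sub>R v) \<bullet> x) * f x"
  let ?D = "\<lambda>x. - ((v \<bullet> x) * sin ((p + r *\<^sub>R v) \<bullet> x) * f x)"
  have ig: "integrable lborel (?g s)" for s
    by (rule Bochner_Integration.integrable_bound[OF f]) (auto intro!: AE_I2 mult_left_le_one_le simp: abs_mult)
  have "((\<lambda>h. ((\<integral>x. ?g (r + h) x \<partial>lborel) - (\<integral>x. ?g r x \<partial>lborel)) / h) \<longlongrightarrow> (\<integral>x. ?D x \<partial>lborel)) (at 0)"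
    unfolding tendsto_at_iff_sequentially comp_def
  proof (intro allI impI)
    fix X :: "nat \<Rightarrow> real" assume X: "\<forall>i. X i \<in> UNIV - {0}" "X \<longlonglongrightarrow> 0"
    have "(\<lambda>n. \<integral>x. (?g (r + X n) x - ?g r x) / X n \<partial>lborel) \<longlonglongrightarrow> (\<integral>x. ?D x \<partial>lborel)"
    proof (rule integral_dominated_convergence[where w="\<lambda>x. \<bar>norm x * f x\<bar>"])
      show "AE x in lborel. (\<lambda>n. (?g (r + X n) x - ?g r x) / X n) \<longlonglongrightarrow> ?D x"
      proof (rule AE_I2)
        fix x
        have "((\<lambda>r. ?g r x) has_real_derivative ?D x) (at r)"
          by (auto intro!: derivative_eq_intros simp: inner_add_left)
        then have "((\<lambda>h. (?g (r + h) x - ?g r x) / h) \<longlongrightarrow> ?D x) (at 0)" by (simp only: DERIV_def)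
        then show "(\<lambda>n. (?g (r + X n) x - ?g r x) / X n) \<longlonglongrightarrow> ?D x"
          using X unfolding tendsto_at_iff_sequentially comp_def by blast
      qed
      show "AE x in lborel. norm ((?g (r + X n) x - ?g r x) / X n) \<le> \<bar>norm x * f x\<bar>" for n
      proof (rule AE_I2)
        fix x
        have cl: "\<bar>cos \<alpha> - cos \<beta>\<bar> \<le> \<bar>\<alpha> - \<beta>\<bar>" for \<alpha> \<beta> :: real
        proof -
          have "\<bar>cos \<alpha> - cos \<beta>\<bar> = 2 * \<bar>sin ((\<alpha> + \<beta>) / 2)\<bar> * \<bar>sin ((\<beta> - \<alpha>) / 2)\<bar>"
            by (simp add: cos_diff_cos abs_mult)
          also have "\<dots> \<le> 2 * 1 * \<bar>(\<beta> - \<alpha>) / 2\<bar>"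
            by (intro mult_mono mult_left_mono abs_sin_le_one abs_sin_x_le_abs_x) auto
          finally show ?thesis by simp
        qed
        have "\<bar>cos ((p + (r + X n) *\<^sub>R v) \<bullet> x) - cos ((p + r *\<^sub>R v) \<bullet> x)\<bar> \<le> \<bar>X n * (v \<bullet> x)\<bar>"
          using cl[of "(p + (r + X n) *\<^sub>R v) \<bullet> x" "(p + r *\<^sub>R v) \<bullet> x"] by (simp add: inner_add_left distrib_right)
        also have "\<dots> \<le> \<bar>X n\<bar> * norm x"
          using order_trans[OF Cauchy_Schwarz_ineq2[of v x] mult_right_mono[OF v norm_ge_zero[of x]]]
          by (simp add: abs_mult mult_left_mono)
        finally have "\<bar>cos ((p + (r + X n) *\<^sub>R v) \<bullet> x) - cos ((p + r *\<^sub>R v) \<bullet> x)\<bar> * \<bar>f x\<bar> \<le> \<bar>X n\<bar> * norm x * \<bar>f x\<bar>"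
          by (rule mult_right_mono) simp
        moreover have "X n \<noteq> 0" using X by auto
        moreover have "norm ((?g (r + X n) x - ?g r x) / X n)
            = \<bar>cos ((p + (r + X n) *\<^sub>R v) \<bullet> x) - cos ((p + r *\<^sub>R v) \<bullet> x)\<bar> * \<bar>f x\<bar> / \<bar>X n\<bar>"
          by (simp only: left_diff_distrib[symmetric] real_norm_def abs_mult abs_divide)
        ultimately show "norm ((?g (r + X n) x - ?g r x) / X n) \<le> \<bar>norm x * f x\<bar>"
          by (simp only: abs_mult) (simp add: divide_le_eq mult_ac)
      qed
      show "integrable lborel (\<lambda>x. \<bar>norm x * f x\<bar>)" using xf by (rule integrable_abs)
    qed measurable
    moreover have "(\<integral>x. (?g (r + X n) x - ?g r x) / X n \<partial>lborel) = ((\<integral>x. ?g (r + X n) x \<partial>lborel) - (\<integral>x. ?g r x \<partial>lborel)) / X n" for n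
      by (simp only: integral_divide_zero Bochner_Integration.integral_diff[OF ig ig])
    ultimately show "(\<lambda>n. ((\<integral>x. ?g (r + X n) x \<partial>lborel) - (\<integral>x. ?g r x \<partial>lborel)) / X n) \<longlonglongrightarrow> (\<integral>x. ?D x \<partial>lborel)"
      by (simp only:)
  qed
  then show ?thesis by (simp only: DERIV_def Bochner_Integration.integral_minus)
qed

lemma Re_Im_fourier_real:
  fixes f :: "real^2 \<Rightarrow> real"
  assumes f: "integrable lborel f"
  shows "Re (fourier_integral 1 (\<lambda>x. of_real (f x)) p) = (\<integral>x. cos (p \<bullet> x) * f x \<partial>lborel)"
    and "Im (fourier_integral 1 (\<lambda>x. of_real (f x)) p) = (\<integral>x. sin (p \<bullet> x) * f x \<partial>lborel)"
proof -
  have cf: "integrable lborel (\<lambda>x. complex_of_real (f x))" using f by simp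
  note i = integrable_fourier_kernel[OF cf, of p]
  show "Re (fourier_integral 1 (\<lambda>x. of_real (f x)) p) = (\<integral>x. cos (p \<bullet> x) * f x \<partial>lborel)"
    unfolding fourier_integral_def using integral_Re[OF i] by (simp add: Re_exp)
  show "Im (fourier_integral 1 (\<lambda>x. of_real (f x)) p) = (\<integral>x. sin (p \<bullet> x) * f x \<partial>lborel)"
    unfolding fourier_integral_def using integral_Im[OF i] by (simp add: Im_exp)
qed

lemma yk_div_integrable:
  assumes a: "a > 0"
  shows "integrable lborel (\<lambda>q. yk q a / (1 + (norm (p - q))\<^sup>2))"
proof (rule Bochner_Integration.integrable_bound[OF yk_integrable[OF a]])
  have "yk q a / (1 + (norm (p - q))\<^sup>2) \<le> yk q a / 1" for q
    by (rule divide_left_mono) (auto simp: yk_nonneg add_pos_nonneg)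
  then show "AE q in lborel. norm (yk q a / (1 + (norm (p - q))\<^sup>2)) \<le> norm (yk q a)"
    by (intro AE_I2) (simp add: yk_nonneg add_nonneg_nonneg)
qed measurable

section \<open>The image of the trial function and its energy\<close>

locale trial =
  fixes a :: real
  assumes a: "a > 0"
begin

definition e0 :: "real \<Rightarrow> real" where "e0 q = sqrt (2 * a) * exp (- a * q)"

definition y :: "real \<Rightarrow> real" where "y p = (\<integral>q. yuk p q * e0 q * indicator {0<..} q \<partial>lborel)"

text \<open>
  Up to constants, the plane Fourier transforms of \<open>k0 x\<close> and \<open>1 / sqrt (a\<^sup>2 + (norm x)\<^sup>2)\<close> are
  \<open>1 / (1 + (norm p)\<^sup>2)\<close> and \<open>exp (- a * norm p) / norm p\<close>.  Their convolution is the image \<open>y\<close> of the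
  trial function, so that \<open>y (norm p)\<close> is the transform of the product \<open>Psi\<close>.
\<close>

definition Psi :: "real^2 \<Rightarrow> real" where "Psi x = sqrt (2 * a) * k0 x / sqrt (a\<^sup>2 + (norm x)\<^sup>2)"

text \<open>The derivative of \<open>y\<close>, read off from the cosine transform of
  \<open>Psi\<close> along the first axis. As the kernel is even in \<open>p\<close>, this is
  meaningful on the whole line.\<close>

definition y' :: "real \<Rightarrow> real" where
  "y' r = - (\<integral>x. x $ 1 * sin (r * x $ 1) * Psi x \<partial>lborel) / (2 * pi)"

lemma yuk_le: "p \<ge> 0 \<Longrightarrow> q \<ge> 0 \<Longrightarrow> yuk p q \<le> 1 / sqrt (1 + p\<^sup>2)"
proof -
  assume pq: "p \<ge> 0" "q \<ge> 0"
  have "1 + p\<^sup>2 \<le> (1 + (p - q)\<^sup>2) * (1 + (p + q)\<^sup>2)"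
  proof -
    have "1 + p\<^sup>2 \<le> 1 + (p + q)\<^sup>2" using pq by (simp add: power_mono)
    also have "\<dots> \<le> (1 + (p - q)\<^sup>2) * (1 + (p + q)\<^sup>2)"
      using mult_right_mono[of 1 "1 + (p - q)\<^sup>2" "1 + (p + q)\<^sup>2"] by simp
    finally show ?thesis .
  qed
  then show ?thesis unfolding yuk_def
    by (intro divide_left_mono) (auto simp: add_pos_nonneg intro!: mult_pos_pos)
qed

lemma yuk_minus: "yuk (- p) q = yuk p q"
proof -
  have "(- p - q)\<^sup>2 = (p + q)\<^sup>2" "(- p + q)\<^sup>2 = (p - q)\<^sup>2"
    by (simp_all add: power2_eq_square algebra_simps)
  then show ?thesis by (simp only: yuk_def mult.commute)
qed

lemma y_measurable [measurable]: "y \<in> borel_measurable borel"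
  unfolding y_def e0_def by measurable

lemma Psi_measurable [measurable]: "Psi \<in> borel_measurable borel"
  unfolding Psi_def by measurable

lemma y'_measurable [measurable]: "y' \<in> borel_measurable borel"
  unfolding y'_def by measurable

lemma Psi_nonneg: "Psi x \<ge> 0" unfolding Psi_def using k0_nonneg a by simp

lemma sq_pos: "a\<^sup>2 + (norm (x::real^2))\<^sup>2 > 0" using a by (simp add: add_pos_nonneg)

lemma Psi_le: "Psi x \<le> sqrt (2 * a) / a * k0 x" "norm x * Psi x \<le> sqrt (2 * a) * k0 x"
proof -
  have s: "a \<le> sqrt (a\<^sup>2 + (norm x)\<^sup>2)" "norm x \<le> sqrt (a\<^sup>2 + (norm x)\<^sup>2)" by (auto intro!: real_le_rsqrt)
  have k: "0 \<le> sqrt (2 * a) * k0 x" using k0_nonneg a by simp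
  have "Psi x \<le> sqrt (2 * a) * k0 x / a" unfolding Psi_def using s a k sq_pos[of x] by (intro divide_left_mono) auto
  then show "Psi x \<le> sqrt (2 * a) / a * k0 x" by simp
  have "norm x * Psi x = (sqrt (2 * a) * k0 x) * (norm x / sqrt (a\<^sup>2 + (norm x)\<^sup>2))" by (simp add: Psi_def)
  also have "\<dots> \<le> (sqrt (2 * a) * k0 x) * 1"
    using s k sq_pos[of x] by (intro mult_left_mono) (auto simp: divide_le_eq_1)
  finally show "norm x * Psi x \<le> sqrt (2 * a) * k0 x" by simp
qed

lemma Psi_integrable: "integrable lborel Psi"
  by (rule Bochner_Integration.integrable_bound[OF integrable_mult_right[OF k0_integrable, of "sqrt (2 * a) / a"]])
     (auto intro!: AE_I2 order_trans[OF Psi_le(1) abs_ge_self] simp: Psi_nonneg abs_of_nonneg simp del: abs_divide abs_mult times_divide_eq_left)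

lemma norm_Psi_integrable: "integrable lborel (\<lambda>x. norm x * Psi x)"
  by (rule Bochner_Integration.integrable_bound[OF integrable_mult_right[OF k0_integrable, of "sqrt (2 * a)"]])
     (auto intro!: AE_I2 order_trans[OF Psi_le(2) abs_ge_self] simp: Psi_nonneg abs_of_nonneg simp del: abs_divide abs_mult times_divide_eq_left)

lemma comp_Psi_integrable: "integrable lborel (\<lambda>x. x $ i * Psi x)"
proof (rule Bochner_Integration.integrable_bound[OF norm_Psi_integrable])
  show "AE x in lborel. norm (x $ i * Psi x) \<le> norm (norm x * Psi x)"
    by (intro AE_I2) (simp add: abs_mult mult_right_mono component_le_norm_cart)
qed measurable

lemma y_integrable:
  "integrable lborel (\<lambda>q. yuk p q * e0 q * indicator {0<..} q)"
proof (rule Bochner_Integration.integrable_bound)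
  show "integrable lborel (\<lambda>q. sqrt (2 * a) * (q ^ 0 * exp (- a * q) * indicator {0<..} q))"
    by (intro integrable_mult_right integrable_power_exp a)
  have "yuk p q \<le> 1" for q
  proof -
    have "1 * 1 \<le> (1 + (p - q)\<^sup>2) * (1 + (p + q)\<^sup>2)" by (intro mult_mono) auto
    then show ?thesis unfolding yuk_def by simp
  qed
  then have "yuk p q * (sqrt (2 * a) * exp (- a * q)) \<le> 1 * (sqrt (2 * a) * exp (- a * q))" for q
    using a by (intro mult_right_mono) auto
  then show "AE q in lborel. norm (yuk p q * e0 q * indicator {0<..} q) \<le> norm (sqrt (2 * a) * (q ^ 0 * exp (- a * q) * indicator {0<..} q))"
    using a yuk_pos[of p] by (intro AE_I2) (auto simp: e0_def abs_mult less_imp_le split: split_indicator)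
qed (simp add: e0_def)

text \<open>Polar coordinates: the factor \<open>r\<close> turns \<open>yk\<close> back into the
  exponential, and \<open>circ_yukawa\<close> integrates the propagator over circles.\<close>

lemma yuk_integral: "(\<integral>q. yk q a / (1 + (norm (p - q))\<^sup>2) \<partial>lborel) = 2 * pi * y (norm p) / sqrt (2 * a)"
proof -
  have i: "integrable lborel (\<lambda>q. yk q a / (1 + (norm (p - q))\<^sup>2))"
    by (rule yk_div_integrable[OF a])
  have "ennreal (\<integral>q. yk q a / (1 + (norm (p - q))\<^sup>2) \<partial>lborel) = (\<integral>\<^sup>+q. ennreal (yk q a / (1 + (norm (p - q))\<^sup>2)) \<partial>lborel)"
    by (rule nn_integral_eq_integral[OF i, symmetric]) (simp add: yk_nonneg add_nonneg_nonneg)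
  also have "\<dots> = (\<integral>\<^sup>+q. ennreal (exp (- a * norm q) / norm q) * ennreal (1 / (1 + (norm (p - q))\<^sup>2)) \<partial>lborel)"
    by (intro nn_integral_cong) (simp add: yk_def ennreal_mult[symmetric])
  also have "\<dots> = (\<integral>\<^sup>+r. ennreal r * circ (\<lambda>q. ennreal (exp (- a * norm q) / norm q) * ennreal (1 / (1 + (norm (p - q))\<^sup>2))) r * indicator {0<..} r \<partial>lborel)"
    by (rule nn_integral_polar) measurable
  also have "\<dots> = (\<integral>\<^sup>+r. ennreal (2 * pi / sqrt (2 * a)) * ennreal (yuk (norm p) r * e0 r * indicator {0<..} r) \<partial>lborel)"
  proof (rule nn_integral_cong)
    fix r :: real
    show "ennreal r * circ (\<lambda>q. ennreal (exp (- a * norm q) / norm q) * ennreal (1 / (1 + (norm (p - q))\<^sup>2))) r * indicator {0<..} r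
      = ennreal (2 * pi / sqrt (2 * a)) * ennreal (yuk (norm p) r * e0 r * indicator {0<..} r)"
    proof (cases "r > 0")
      case r: True
      have "circ (\<lambda>q. ennreal (exp (- a * norm q) / norm q) * ennreal (1 / (1 + (norm (p - q))\<^sup>2))) r
        = ennreal (exp (- a * r) / r) * circ (\<lambda>q. ennreal (1 / (1 + (norm (p - q))\<^sup>2))) r"
        by (rule circ_radial_mult[where h="\<lambda>r. ennreal (exp (- a * r) / r)"]) (use r in auto)
      also have "\<dots> = ennreal (exp (- a * r) / r) * ennreal (2 * pi * yuk (norm p) r)"
        using circ_yukawa[of r p] r by simp
      finally show ?thesis
        using r a yuk_pos[of "norm p" r] by (simp add: ennreal_mult[symmetric] e0_def less_imp_le)
    qed simp
  qed
  also have "\<dots> = ennreal (2 * pi / sqrt (2 * a)) * (\<integral>\<^sup>+r. ennreal (yuk (norm p) r * e0 r * indicator {0<..} r) \<partial>lborel)"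
    by (rule nn_integral_cmult) (simp add: e0_def)
  also have "(\<integral>\<^sup>+r. ennreal (yuk (norm p) r * e0 r * indicator {0<..} r) \<partial>lborel) = ennreal (y (norm p))"
    unfolding y_def using yuk_pos[of "norm p"] a
    by (intro nn_integral_eq_integral[OF y_integrable]) (auto simp: e0_def less_imp_le split: split_indicator)
  also have "ennreal (2 * pi / sqrt (2 * a)) * \<dots> = ennreal (2 * pi / sqrt (2 * a) * y (norm p))"
    using a yuk_pos[of "norm p"] by (intro ennreal_mult[symmetric])
      (auto simp: y_def e0_def less_imp_le intro!: integral_nonneg_AE split: split_indicator)
  finally show ?thesis
    using a yuk_pos[of "norm p"] by (subst (asm) ennreal_inj)
      (auto simp: y_def e0_def yk_nonneg add_nonneg_nonneg less_imp_le intro!: integral_nonneg_AE split: split_indicator)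
qed

text \<open>A convolution theorem in terms of cosines. The factor
  \<open>1 / sqrt (a\<^sup>2 + (norm x)\<^sup>2)\<close> is written as the transform of
  \<open>yk\<close>, and the product of cosines splits into transforms of \<open>k0\<close> at
  \<open>p - q\<close> and \<open>p + q\<close>. The two contributions agree because the result
  depends on \<open>norm p\<close> only.\<close>

lemma Psi_cos: "(\<integral>x. cos (p \<bullet> x) * Psi x \<partial>lborel) = 2 * pi * y (norm p)"
proof -
  let ?L = "lborel :: (real^2) measure"
  have ik: "integrable (?L \<Otimes>\<^sub>M ?L) (\<lambda>(x, q). cos (p \<bullet> x) * k0 x * (cos (x \<bullet> q) * yk q a))"
  proof (rule Bochner_Integration.integrable_bound)
    show "integrable (?L \<Otimes>\<^sub>M ?L) (\<lambda>(x, q). k0 x * yk q a)"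
      by (rule integrable_prod_mult[OF lborel.sigma_finite_measure_axioms lborel.sigma_finite_measure_axioms k0_integrable yk_integrable[OF a]])
    have "\<bar>cos u * k * (cos v * g)\<bar> \<le> \<bar>k * g\<bar>" for u v k g :: real
    proof -
      have "\<bar>cos u * k * (cos v * g)\<bar> = (\<bar>cos u\<bar> * \<bar>cos v\<bar>) * \<bar>k * g\<bar>" by (simp add: abs_mult)
      also have "\<dots> \<le> (1 * 1) * \<bar>k * g\<bar>" by (intro mult_right_mono mult_mono) auto
      finally show ?thesis by simp
    qed
    then show "AE z in ?L \<Otimes>\<^sub>M ?L. norm (case z of (x, q) \<Rightarrow> cos (p \<bullet> x) * k0 x * (cos (x \<bullet> q) * yk q a)) \<le> norm (case z of (x, q) \<Rightarrow> k0 x * yk q a)"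
      by (intro AE_I2) (auto split: prod.split)
  qed measurable
  have ic: "integrable lborel (\<lambda>x. cos (r \<bullet> x) * k0 x)" for r
    by (rule Bochner_Integration.integrable_bound[OF k0_integrable]) (auto intro!: AE_I2 mult_left_le_one_le simp: abs_mult)
  have iq: "integrable lborel (\<lambda>q. yk q a / (1 + (norm (r - q))\<^sup>2))" for r
    by (rule yk_div_integrable[OF a])
  have aux: "C * k * (D * g) = g / 2 * (A * k + B * k)" if "C * D = (A + B) / 2" for A B C D k g :: real
  proof -
    have "C * k * (D * g) = (C * D) * (k * g)" by simp
    then show ?thesis unfolding that by (simp add: field_simps)
  qed
  have inner: "(\<integral>x. cos (p \<bullet> x) * k0 x * (cos (x \<bullet> q) * yk q a) \<partial>lborel)
     = pi * (yk q a / (1 + (norm (p - q))\<^sup>2) + yk q a / (1 + (norm (- p - q))\<^sup>2))" for q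
  proof -
    have "(\<integral>x. cos (p \<bullet> x) * k0 x * (cos (x \<bullet> q) * yk q a) \<partial>lborel)
      = (\<integral>x. yk q a / 2 * (cos ((p - q) \<bullet> x) * k0 x + cos ((p + q) \<bullet> x) * k0 x) \<partial>lborel)"
    proof (rule Bochner_Integration.integral_cong[OF refl])
      fix x
      have "cos (p \<bullet> x) * cos (x \<bullet> q) = (cos ((p - q) \<bullet> x) + cos ((p + q) \<bullet> x)) / 2"
        using cos_times_cos[of "p \<bullet> x" "q \<bullet> x"] by (simp add: inner_diff_left inner_add_left inner_commute[of x q])
      then show "cos (p \<bullet> x) * k0 x * (cos (x \<bullet> q) * yk q a) = yk q a / 2 * (cos ((p - q) \<bullet> x) * k0 x + cos ((p + q) \<bullet> x) * k0 x)"
        by (rule aux)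
    qed
    also have "\<dots> = yk q a / 2 * (2 * pi / (1 + (norm (p - q))\<^sup>2) + 2 * pi / (1 + (norm (p + q))\<^sup>2))"
      using ic k0_cos by simp
    also have "norm (p + q) = norm (- p - q)" using norm_minus_cancel[of "p + q"] by simp
    finally show ?thesis by (simp add: algebra_simps add_divide_distrib)
  qed
  have "(\<integral>x. cos (p \<bullet> x) * Psi x \<partial>lborel) = (\<integral>x. sqrt (2 * a) / (2 * pi) * (\<integral>q. cos (p \<bullet> x) * k0 x * (cos (x \<bullet> q) * yk q a) \<partial>lborel) \<partial>lborel)"
    by (rule Bochner_Integration.integral_cong[OF refl]) (simp add: yk_cos[OF a] Psi_def)
  also have "\<dots> = sqrt (2 * a) / (2 * pi) * (\<integral>x. \<integral>q. cos (p \<bullet> x) * k0 x * (cos (x \<bullet> q) * yk q a) \<partial>lborel \<partial>lborel)"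
    by (rule integral_mult_right_zero)
  also have "(\<integral>x. \<integral>q. cos (p \<bullet> x) * k0 x * (cos (x \<bullet> q) * yk q a) \<partial>lborel \<partial>lborel)
     = (\<integral>q. \<integral>x. cos (p \<bullet> x) * k0 x * (cos (x \<bullet> q) * yk q a) \<partial>lborel \<partial>lborel)"
    using lborel_pair.Fubini_integral[OF ik] by simp
  also have "\<dots> = pi * (2 * pi * y (norm p) / sqrt (2 * a) + 2 * pi * y (norm (- p)) / sqrt (2 * a))"
    unfolding inner yuk_integral[symmetric] using iq[of p] iq[of "- p"] by simp
  also have "sqrt (2 * a) / (2 * pi) * \<dots> = 2 * pi * y (norm p)" using a by simp
  finally show ?thesis .
qed

lemma y_deriv: "(y has_real_derivative y' r) (at r)"
proof -
  define v where "v = vec2 1 0"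
  have nv: "norm v = 1"
  proof -
    have "(norm v)\<^sup>2 = 1" unfolding norm_vec2_sq by (simp add: v_def)
    then show ?thesis using norm_ge_zero[of v] by (auto simp: power2_eq_1_iff)
  qed
  have vx: "v \<bullet> x = x $ 1" for x by (simp add: v_def inner_vec2)
  have ya: "y \<bar>s\<bar> = y s" for s by (cases "s \<ge> 0") (simp_all add: y_def yuk_minus)
  have "(\<integral>x. cos ((0 + s *\<^sub>R v) \<bullet> x) * Psi x \<partial>lborel) = 2 * pi * y s" for s
    unfolding Psi_cos by (simp add: nv ya)
  moreover have "norm v \<le> 1" using nv by simp
  ultimately have "((\<lambda>s. 2 * pi * y s) has_real_derivative - (\<integral>x. (v \<bullet> x) * sin ((0 + r *\<^sub>R v) \<bullet> x) * Psi x \<partial>lborel)) (at r)"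
    using cos_transform_deriv[OF Psi_integrable norm_Psi_integrable, of v 0 r] by simp
  from DERIV_cdivide[OF this, of "2 * pi"] show ?thesis
    by (simp add: vx y'_def)
qed

text \<open>Up to sign, the left side is the square of the component along \<open>p\<close> of the
  vector formed by the two sine transforms, because \<open>2 * pi * y'\<close> is the radial
  derivative of the transform of \<open>Psi\<close>. Cauchy-Schwarz then replaces the component by
  the whole vector, to which Plancherel applies.\<close>

lemma y'_radial_le:
  assumes p: "p \<noteq> 0"
  shows "(2 * pi * y' (norm p))\<^sup>2 \<le> (\<integral>x. sin (p \<bullet> x) * (x $ 1 * Psi x) \<partial>lborel)\<^sup>2 + (\<integral>x. sin (p \<bullet> x) * (x $ 2 * Psi x) \<partial>lborel)\<^sup>2"
proof -
  define v where "v = (1 / norm p) *\<^sub>R p"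
  have nv: "norm v = 1" using p by (simp add: v_def)
  have v2: "(v $ 1)\<^sup>2 + (v $ 2)\<^sup>2 = 1" using norm_vec2_sq[of v] nv by simp
  let ?S = "\<lambda>i. \<integral>x. sin (p \<bullet> x) * (x $ i * Psi x) \<partial>lborel"
  have iS: "integrable lborel (\<lambda>x. sin (p \<bullet> x) * (x $ i * Psi x))" for i
    by (rule Bochner_Integration.integrable_bound[OF comp_Psi_integrable[of i]])
       (auto intro!: AE_I2 mult_left_le_one_le simp: abs_mult)
  have "((\<lambda>r. \<integral>x. cos ((p + r *\<^sub>R v) \<bullet> x) * Psi x \<partial>lborel) has_real_derivative - (\<integral>x. (v \<bullet> x) * sin ((p + 0 *\<^sub>R v) \<bullet> x) * Psi x \<partial>lborel)) (at 0)"
    by (rule cos_transform_deriv[OF Psi_integrable norm_Psi_integrable]) (simp add: nv)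
  moreover have "((\<lambda>r. \<integral>x. cos ((p + r *\<^sub>R v) \<bullet> x) * Psi x \<partial>lborel) has_real_derivative 2 * pi * y' (norm p)) (at 0)"
  proof -
    have "norm (p + r *\<^sub>R v) = \<bar>norm p + r\<bar>" for r
    proof -
      have "p = norm p *\<^sub>R v" using p by (simp add: v_def)
      then have "p + r *\<^sub>R v = (norm p + r) *\<^sub>R v" by (metis scaleR_add_left)
      then show ?thesis by (simp add: nv)
    qed
    moreover have "y \<bar>s\<bar> = y s" for s by (cases "s \<ge> 0") (simp_all add: y_def yuk_minus)
    ultimately have "(\<integral>x. cos ((p + r *\<^sub>R v) \<bullet> x) * Psi x \<partial>lborel) = 2 * pi * y (norm p + r)" for r
      unfolding Psi_cos by simp
    moreover have "((\<lambda>r. 2 * pi * y (norm p + r)) has_real_derivative 2 * pi * (y' (norm p + 0) * 1)) (at 0)"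
      by (intro DERIV_cmult DERIV_chain2[OF y_deriv]) (auto intro!: derivative_eq_intros)
    ultimately show ?thesis by simp
  qed
  ultimately have "2 * pi * y' (norm p) = - (\<integral>x. (v \<bullet> x) * sin ((p + 0 *\<^sub>R v) \<bullet> x) * Psi x \<partial>lborel)"
    by (rule DERIV_unique[symmetric])
  also have "(\<integral>x. (v \<bullet> x) * sin ((p + 0 *\<^sub>R v) \<bullet> x) * Psi x \<partial>lborel) = (\<integral>x. v $ 1 * (sin (p \<bullet> x) * (x $ 1 * Psi x)) + v $ 2 * (sin (p \<bullet> x) * (x $ 2 * Psi x)) \<partial>lborel)"
    by (rule Bochner_Integration.integral_cong) (simp_all add: inner_vec2 algebra_simps)
  also have "\<dots> = v $ 1 * ?S 1 + v $ 2 * ?S 2" using iS by simp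
  finally have "(2 * pi * y' (norm p))\<^sup>2 = (v $ 1 * ?S 1 + v $ 2 * ?S 2)\<^sup>2" by (simp only: power2_minus)
  also have "\<dots> = ((v $ 1)\<^sup>2 + (v $ 2)\<^sup>2) * ((?S 1)\<^sup>2 + (?S 2)\<^sup>2) - (v $ 1 * ?S 2 - v $ 2 * ?S 1)\<^sup>2"
    by (simp add: power2_eq_square algebra_simps)
  also have "\<dots> \<le> (?S 1)\<^sup>2 + (?S 2)\<^sup>2" unfolding v2 by simp
  finally show ?thesis .
qed

end

lemma plancherel_real:
  fixes f :: "real^2 \<Rightarrow> real"
  assumes f: "integrable lborel f" and f2: "integrable lborel (\<lambda>x. (f x)\<^sup>2)"
  shows "(\<integral>\<^sup>+p. ennreal ((\<integral>x. cos (p \<bullet> x) * f x \<partial>lborel)\<^sup>2 + (\<integral>x. sin (p \<bullet> x) * f x \<partial>lborel)\<^sup>2) \<partial>lborel)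
    = ennreal ((2 * pi)\<^sup>2) * (\<integral>\<^sup>+x. ennreal ((f x)\<^sup>2) \<partial>lborel)"
proof -
  have [measurable]: "f \<in> borel_measurable borel" using borel_measurable_integrable[OF f] by simp
  interpret L12 "\<lambda>x. complex_of_real (f x)"
    by unfold_locales (use f f2 in auto)
  have "(cmod (fourier_integral 1 (\<lambda>x. complex_of_real (f x)) p))\<^sup>2
      = (\<integral>x. cos (p \<bullet> x) * f x \<partial>lborel)\<^sup>2 + (\<integral>x. sin (p \<bullet> x) * f x \<partial>lborel)\<^sup>2" for p
    by (simp add: cmod_power2 Re_Im_fourier_real[OF f])
  then show ?thesis
    using plancherel nn_integral_eq_integral[OF f2] by (simp add: ennreal_mult)
qed

context trial begin

text \<open>The weight produced by the derivative and by the \<open>a\<^sup>2\<close> term is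
  exactly the square of the denominator of \<open>Psi\<close>. This cancellation is why the Laguerre
  operator has the same parameter as the trial function.\<close>

lemma weighted_Psi_sq: "((x $ 1)\<^sup>2 + (x $ 2)\<^sup>2 + a\<^sup>2) * (Psi x)\<^sup>2 = 2 * a * (k0 x)\<^sup>2"
proof -
  have "(Psi x)\<^sup>2 = 2 * a * (k0 x)\<^sup>2 / (a\<^sup>2 + (norm x)\<^sup>2)"
    using a sq_pos[of x] by (simp add: Psi_def power_mult_distrib power_divide)
  moreover have "(norm x)\<^sup>2 = (x $ 1)\<^sup>2 + (x $ 2)\<^sup>2" by (rule norm_vec2_sq)
  ultimately show ?thesis using sq_pos[of x] by (simp add: add.commute)
qed

lemma k0_sq_integrable: "integrable lborel (\<lambda>x. (k0 x)\<^sup>2)"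
  using k0_L2 by (intro integrableI_bounded) (auto simp: ennreal_lessI intro: le_less_trans)

lemma Psi_sq_integrable: "integrable lborel (\<lambda>x. (Psi x)\<^sup>2)"
  and comp_Psi_sq_integrable: "integrable lborel (\<lambda>x. (x $ i * Psi x)\<^sup>2)"
proof -
  have s: "(Psi x)\<^sup>2 \<le> 2 * a / a\<^sup>2 * (k0 x)\<^sup>2" "(x $ i * Psi x)\<^sup>2 \<le> 2 * a * (k0 x)\<^sup>2" for x i
  proof -
    have "a\<^sup>2 * (Psi x)\<^sup>2 \<le> 2 * a * (k0 x)\<^sup>2" unfolding weighted_Psi_sq[symmetric] by (rule mult_right_mono) auto
    then show "(Psi x)\<^sup>2 \<le> 2 * a / a\<^sup>2 * (k0 x)\<^sup>2" using a by (simp add: field_simps)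
    have "i = 1 \<or> i = 2" by (rule exhaust_2)
    then have "(x $ i)\<^sup>2 \<le> (x $ 1)\<^sup>2 + (x $ 2)\<^sup>2 + a\<^sup>2" by auto
    from mult_right_mono[OF this, of "(Psi x)\<^sup>2"]
    show "(x $ i * Psi x)\<^sup>2 \<le> 2 * a * (k0 x)\<^sup>2" by (simp only: weighted_Psi_sq power_mult_distrib zero_le_power2)
  qed
  have n: "\<bar>u\<^sup>2\<bar> \<le> \<bar>v\<bar>" if "u\<^sup>2 \<le> v" for u v :: real using that by simp
  show "integrable lborel (\<lambda>x. (Psi x)\<^sup>2)"
    by (rule Bochner_Integration.integrable_bound[OF integrable_mult_right[OF k0_sq_integrable, of "2 * a / a\<^sup>2"]], measurable)
       (rule AE_I2, unfold real_norm_def, rule n[OF s(1)])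
  show "integrable lborel (\<lambda>x. (x $ i * Psi x)\<^sup>2)"
    by (rule Bochner_Integration.integrable_bound[OF integrable_mult_right[OF k0_sq_integrable, of "2 * a"]], measurable)
       (rule AE_I2, unfold real_norm_def, rule n[OF s(2)])
qed

text \<open>The radial energy of \<open>y\<close> is dominated by plane integrals of the squared
  transforms of \<open>x $ 1 * Psi x\<close>, \<open>x $ 2 * Psi x\<close> and
  \<open>a * Psi x\<close>. Plancherel and \<open>weighted_Psi_sq\<close> reduce these to the norm
  of \<open>k0\<close>, leaving \<open>2 * pi\<close> times the energy at most
  \<open>2 * a * pi\<close>.\<close>

lemma energy: "(\<integral>\<^sup>+r. ennreal (r * ((y' r)\<^sup>2 + a\<^sup>2 * (y r)\<^sup>2)) * indicator {0<..} r \<partial>lborel) \<le> ennreal a"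
proof -
  let ?h = "\<lambda>r. ennreal ((2 * pi * y' r)\<^sup>2 + a\<^sup>2 * (2 * pi * y r)\<^sup>2)"
  let ?C = "\<lambda>f p. \<integral>x. cos (p \<bullet> x) * f x \<partial>lborel" and ?S = "\<lambda>f p. \<integral>x. sin (p \<bullet> x) * f x \<partial>lborel"
  let ?T = "\<lambda>f p. ennreal ((?C f p)\<^sup>2 + (?S f p)\<^sup>2)"
  let ?f = "\<lambda>i x. x $ i * Psi x"
  let ?J = "\<integral>\<^sup>+r. ennreal (r * ((y' r)\<^sup>2 + a\<^sup>2 * (y r)\<^sup>2)) * indicator {0<..} r \<partial>lborel"
  let ?P = "ennreal ((2 * pi)\<^sup>2)"
  have "(\<integral>\<^sup>+p. ?h (norm (p::real^2)) \<partial>lborel) = ennreal (2 * pi) * (\<integral>\<^sup>+r. ennreal r * ?h r * indicator {0<..} r \<partial>lborel)"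
    by (rule nn_integral_radial) measurable
  also have "(\<integral>\<^sup>+r. ennreal r * ?h r * indicator {0<..} r \<partial>lborel) = (\<integral>\<^sup>+r. ?P * (ennreal (r * ((y' r)\<^sup>2 + a\<^sup>2 * (y r)\<^sup>2)) * indicator {0<..} r) \<partial>lborel)"
    by (intro nn_integral_cong) (auto simp: ennreal_mult[symmetric] algebra_simps power_mult_distrib split: split_indicator)
  also have "\<dots> = ?P * ?J" by (rule nn_integral_cmult) measurable
  finally have 1: "(\<integral>\<^sup>+p. ?h (norm (p::real^2)) \<partial>lborel) = ennreal (2 * pi) * (?P * ?J)" .
  have [measurable]: "(\<lambda>p. ?C f p) \<in> borel_measurable borel" "(\<lambda>p. ?S f p) \<in> borel_measurable borel"
    if [measurable]: "f \<in> borel_measurable borel" for f :: "real^2 \<Rightarrow> real" by measurable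
  have add3: "(\<integral>\<^sup>+x. f x + g x + c * h x \<partial>lborel) = (\<integral>\<^sup>+x. f x \<partial>lborel) + (\<integral>\<^sup>+x. g x \<partial>lborel) + c * (\<integral>\<^sup>+x. h x \<partial>lborel)"
    if [measurable]: "f \<in> borel_measurable borel" "g \<in> borel_measurable borel" "h \<in> borel_measurable borel"
    for f g h :: "real^2 \<Rightarrow> ennreal" and c
    by (simp add: nn_integral_add nn_integral_cmult)
  have "(\<integral>\<^sup>+p. ?h (norm (p::real^2)) \<partial>lborel) \<le> (\<integral>\<^sup>+p. ?T (?f 1) p + ?T (?f 2) p + ennreal (a\<^sup>2) * ?T Psi p \<partial>lborel)"
  proof (rule nn_integral_mono_AE)
    have "AE p in lborel. p \<noteq> (0::real^2)" by (rule AE_lborel_singleton)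
    then show "AE p in lborel. ?h (norm (p::real^2)) \<le> ?T (?f 1) p + ?T (?f 2) p + ennreal (a\<^sup>2) * ?T Psi p"
    proof eventually_elim
      case (elim p)
      have "(2 * pi * y' (norm p))\<^sup>2 \<le> (?S (?f 1) p)\<^sup>2 + (?S (?f 2) p)\<^sup>2" by (rule y'_radial_le[OF elim])
      moreover have "a\<^sup>2 * (2 * pi * y (norm p))\<^sup>2 \<le> a\<^sup>2 * ((?C Psi p)\<^sup>2 + (?S Psi p)\<^sup>2)"
        by (rule mult_left_mono) (simp_all add: Psi_cos)
      moreover have "0 \<le> (?C (?f 1) p)\<^sup>2" "0 \<le> (?C (?f 2) p)\<^sup>2" by simp_all
      ultimately have "(2 * pi * y' (norm p))\<^sup>2 + a\<^sup>2 * (2 * pi * y (norm p))\<^sup>2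
         \<le> ((?C (?f 1) p)\<^sup>2 + (?S (?f 1) p)\<^sup>2) + ((?C (?f 2) p)\<^sup>2 + (?S (?f 2) p)\<^sup>2) + a\<^sup>2 * ((?C Psi p)\<^sup>2 + (?S Psi p)\<^sup>2)"
        by linarith
      from ennreal_leI[OF this] show ?case by (simp add: ennreal_plus ennreal_mult)
    qed
  qed
  also have "\<dots> = (\<integral>\<^sup>+p. ?T (?f 1) p \<partial>lborel) + (\<integral>\<^sup>+p. ?T (?f 2) p \<partial>lborel) + ennreal (a\<^sup>2) * (\<integral>\<^sup>+p. ?T Psi p \<partial>lborel)"
    by (rule add3; measurable)
  also have "\<dots> = ?P * (\<integral>\<^sup>+x. ennreal ((?f 1 x)\<^sup>2) \<partial>lborel) + ?P * (\<integral>\<^sup>+x. ennreal ((?f 2 x)\<^sup>2) \<partial>lborel) + ennreal (a\<^sup>2) * (?P * (\<integral>\<^sup>+x. ennreal ((Psi x)\<^sup>2) \<partial>lborel))"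
    by (simp only: plancherel_real comp_Psi_integrable comp_Psi_sq_integrable Psi_integrable Psi_sq_integrable)
  also have "\<dots> = ?P * ((\<integral>\<^sup>+x. ennreal ((?f 1 x)\<^sup>2) \<partial>lborel) + (\<integral>\<^sup>+x. ennreal ((?f 2 x)\<^sup>2) \<partial>lborel) + ennreal (a\<^sup>2) * (\<integral>\<^sup>+x. ennreal ((Psi x)\<^sup>2) \<partial>lborel))"
    by (simp only: distrib_left mult.left_commute)
  also have "(\<integral>\<^sup>+x. ennreal ((?f 1 x)\<^sup>2) \<partial>lborel) + (\<integral>\<^sup>+x. ennreal ((?f 2 x)\<^sup>2) \<partial>lborel) + ennreal (a\<^sup>2) * (\<integral>\<^sup>+x. ennreal ((Psi x)\<^sup>2) \<partial>lborel)
     = (\<integral>\<^sup>+x. ennreal ((?f 1 x)\<^sup>2) + ennreal ((?f 2 x)\<^sup>2) + ennreal (a\<^sup>2) * ennreal ((Psi x)\<^sup>2) \<partial>lborel)"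
    by (rule add3[symmetric]; measurable)
  also have "\<dots> = (\<integral>\<^sup>+x. ennreal (2 * a) * ennreal ((k0 x)\<^sup>2) \<partial>lborel)"
  proof (rule nn_integral_cong)
    fix x
    have "(?f 1 x)\<^sup>2 + (?f 2 x)\<^sup>2 + a\<^sup>2 * (Psi x)\<^sup>2 = 2 * a * (k0 x)\<^sup>2"
      unfolding weighted_Psi_sq[of x, symmetric] by (simp add: power_mult_distrib algebra_simps)
    then show "ennreal ((?f 1 x)\<^sup>2) + ennreal ((?f 2 x)\<^sup>2) + ennreal (a\<^sup>2) * ennreal ((Psi x)\<^sup>2) = ennreal (2 * a) * ennreal ((k0 x)\<^sup>2)"
      using a by (simp add: ennreal_plus[symmetric] ennreal_mult[symmetric] del: ennreal_plus)
  qed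
  also have "\<dots> = ennreal (2 * a) * (\<integral>\<^sup>+x. ennreal ((k0 x)\<^sup>2) \<partial>lborel)"
    by (rule nn_integral_cmult) measurable
  also have "\<dots> \<le> ennreal (2 * a) * ennreal pi" by (rule mult_left_mono[OF k0_L2]) simp
  finally have "ennreal (2 * pi) * (?P * ?J) \<le> ?P * (ennreal (2 * a) * ennreal pi)"
    unfolding 1 by (simp add: mult_left_mono)
  moreover have "ennreal (2 * pi) * (?P * ?J) = ennreal ((2 * pi) ^ 3) * ?J"
    by (simp add: mult.assoc[symmetric] ennreal_mult[symmetric] power3_eq_cube power2_eq_square)
  moreover have "?P * (ennreal (2 * a) * ennreal pi) = ennreal ((2 * pi) ^ 3) * ennreal a"
    using a by (simp add: ennreal_mult[symmetric] power3_eq_cube power2_eq_square mult_ac)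
  ultimately have "ennreal ((2 * pi) ^ 3) * ?J \<le> ennreal ((2 * pi) ^ 3) * ennreal a" by simp
  then show ?thesis by (subst (asm) ennreal_mult_le_mult_iff) auto
qed

end

section \<open>Moments of the trial function and the off-diagonal part\<close>

lemma integral_FTC_Ioi:
  fixes F f :: "real \<Rightarrow> real"
  assumes F: "\<And>x. x > 0 \<Longrightarrow> (F has_real_derivative f x) (at x)"
    and [measurable]: "f \<in> borel_measurable borel"
    and i: "integrable lborel (\<lambda>x. f x * indicator {0<..} x)"
    and A: "(\<lambda>n. F (1 / real (Suc n))) \<longlonglongrightarrow> A" and B: "(\<lambda>n. F (real (Suc n))) \<longlonglongrightarrow> B"
  shows "(\<integral>x. f x * indicator {0<..} x \<partial>lborel) = B - A"
proof -
  let ?I = "\<lambda>n. {1 / real (Suc n)..real (Suc n)}"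
  have eq: "(\<integral>x. f x * indicator (?I n) x \<partial>lborel) = F (real (Suc n)) - F (1 / real (Suc n))" for n
  proof -
    have le: "1 / real (Suc n) \<le> real (Suc n)" using mult_mono[of 1 "real (Suc n)" 1 "real (Suc n)"] by (simp add: divide_le_eq)
    have h: "(f has_integral (F (real (Suc n)) - F (1 / real (Suc n)))) (?I n)"
    proof (rule fundamental_theorem_of_calculus[OF le])
      fix x assume "x \<in> ?I n"
      then have "x > 0" by (auto intro: less_le_trans[of 0 "1 / real (Suc n)"])
      from has_field_derivative_at_within[OF F[OF this]]
      show "(F has_vector_derivative f x) (at x within ?I n)"
        by (simp add: has_real_derivative_iff_has_vector_derivative)
    qed
    have pos: "x \<in> ?I n \<Longrightarrow> x > 0" for x by (auto intro: less_le_trans[of 0 "1 / real (Suc n)"])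
    have iA: "set_integrable lborel (?I n) f"
      unfolding set_integrable_def
      by (rule Bochner_Integration.integrable_bound[OF i]) (use pos in \<open>auto split: split_indicator\<close>)
    from h integral_unique[OF h] set_borel_integral_eq_integral(2)[OF iA] show ?thesis
      by (simp add: set_lebesgue_integral_def mult.commute)
  qed
  have "(\<lambda>n. \<integral>x. f x * indicator (?I n) x \<partial>lborel) \<longlonglongrightarrow> (\<integral>x. f x * indicator {0<..} x \<partial>lborel)"
  proof (rule integral_dominated_convergence[where w="\<lambda>x. \<bar>f x * indicator {0<..} x\<bar>"])
    show "integrable lborel (\<lambda>x. \<bar>f x * indicator {0<..} x\<bar>)" using i by (rule integrable_abs)
    show "AE x in lborel. norm (f x * indicator (?I n) x) \<le> \<bar>f x * indicator {0<..} x\<bar>" for n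
    proof (rule AE_I2)
      fix x
      have "x \<in> ?I n \<Longrightarrow> x > 0" by (auto intro: less_le_trans[of 0 "1 / real (Suc n)"])
      then show "norm (f x * indicator (?I n) x) \<le> \<bar>f x * indicator {0<..} x\<bar>" by (auto split: split_indicator)
    qed
    show "AE x in lborel. (\<lambda>n. f x * indicator (?I n) x) \<longlonglongrightarrow> f x * indicator {0<..} x"
    proof (rule AE_I2)
      fix x :: real
      show "(\<lambda>n. f x * indicator (?I n) x) \<longlonglongrightarrow> f x * indicator {0<..} x"
      proof (cases "x > 0")
        case True
        obtain N where N: "real N \<ge> x" "real N \<ge> 1 / x" by (meson linear order_trans real_arch_simple)
        have "x \<in> ?I n" if "n \<ge> N" for n
        proof -
          have "1 / x \<le> real (Suc n)" "x \<le> real (Suc n)" using that N by linarith+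
          then show ?thesis using True by (simp add: field_simps)
        qed
        then have "\<forall>\<^sub>F n in sequentially. f x * indicator {0<..} x = f x * indicator (?I n) x"
          using True by (intro eventually_sequentiallyI[of N]) (auto simp: indicator_def)
        then show ?thesis by (rule Lim_transform_eventually[OF tendsto_const])
      next
        case False
        then have "x \<notin> ?I n" for n by (auto intro: less_le_trans[of 0 "1 / real (Suc n)"])
        then show ?thesis using False by simp
      qed
    qed
  qed measurable
  then show ?thesis unfolding eq using tendsto_diff[OF B A] by (rule LIMSEQ_unique)
qed

context trial begin

definition \<alpha> :: real where "\<alpha> = 2 * a * lapI a"

lemma e0_measurable [measurable]: "e0 \<in> borel_measurable borel"
  unfolding e0_def by measurable

lemma e0_pos: "e0 q > 0" using a by (simp add: e0_def)

lemma y_nonneg: "y p \<ge> 0"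
  unfolding y_def using yuk_pos[of p] e0_pos
  by (intro integral_nonneg_AE AE_I2) (auto simp: less_imp_le split: split_indicator)

lemma ennreal_y: "ennreal (y p) = (\<integral>\<^sup>+q. ennreal (yuk p q * e0 q) * indicator {0<..} q \<partial>lborel)"
proof -
  have "ennreal (y p) = (\<integral>\<^sup>+q. ennreal (yuk p q * e0 q * indicator {0<..} q) \<partial>lborel)"
    unfolding y_def using yuk_pos[of p] e0_pos
    by (intro nn_integral_eq_integral[symmetric, OF y_integrable]) (auto simp: less_imp_le split: split_indicator)
  then show ?thesis by (simp add: indicator_mult_ennreal[symmetric] ennreal_mult'' ennreal_indicator)
qed

lemma e0_integrals:
  "integrable lborel (\<lambda>s. e0 s * indicator {0<..} s)" "(\<integral>s. e0 s * indicator {0<..} s \<partial>lborel) = sqrt (2 * a) / a"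
  "integrable lborel (\<lambda>s. (e0 s)\<^sup>2 * indicator {0<..} s)" "(\<integral>s. (e0 s)\<^sup>2 * indicator {0<..} s \<partial>lborel) = 1"
  "integrable lborel (\<lambda>s. s * (e0 s)\<^sup>2 * indicator {0<..} s)" "(\<integral>s. s * (e0 s)\<^sup>2 * indicator {0<..} s \<partial>lborel) = 1 / (2 * a)"
proof -
  have e: "e0 s * indicator {0<..} s = sqrt (2 * a) * (s ^ 0 * exp (- a * s) * indicator {0<..} s)"
    "(e0 s)\<^sup>2 * indicator {0<..} s = 2 * a * (s ^ 0 * exp (- (2 * a) * s) * indicator {0<..} s)"
    "s * (e0 s)\<^sup>2 * indicator {0<..} s = 2 * a * (s ^ 1 * exp (- (2 * a) * s) * indicator {0<..} s)" for s
    using a by (simp_all add: e0_def power_mult_distrib exp_double[symmetric] mult_ac)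
  have a2: "2 * a > 0" using a by simp
  show "integrable lborel (\<lambda>s. e0 s * indicator {0<..} s)" "integrable lborel (\<lambda>s. (e0 s)\<^sup>2 * indicator {0<..} s)"
    "integrable lborel (\<lambda>s. s * (e0 s)\<^sup>2 * indicator {0<..} s)"
    unfolding e by (intro integrable_mult_right integrable_power_exp a a2)+
  show "(\<integral>s. e0 s * indicator {0<..} s \<partial>lborel) = sqrt (2 * a) / a" "(\<integral>s. (e0 s)\<^sup>2 * indicator {0<..} s \<partial>lborel) = 1"
    "(\<integral>s. s * (e0 s)\<^sup>2 * indicator {0<..} s \<partial>lborel) = 1 / (2 * a)"
    unfolding e integral_mult_right_zero integral_power_exp[OF a] integral_power_exp[OF a2] using a
    by (simp_all add: power2_eq_square)
qed

lemma y_le: "p \<ge> 0 \<Longrightarrow> y p \<le> 2 * sqrt (2 * a) / a / (1 + p)"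
proof -
  assume p: "p \<ge> 0"
  have "y p \<le> (\<integral>q. 1 / sqrt (1 + p\<^sup>2) * (e0 q * indicator {0<..} q) \<partial>lborel)"
    unfolding y_def using yuk_le[OF p] e0_pos
    by (intro integral_mono y_integrable integrable_mult_right e0_integrals)
       (auto simp: less_imp_le split: split_indicator intro!: mult_right_mono simp del: times_divide_eq_left)
  also have "\<dots> = 1 / sqrt (1 + p\<^sup>2) * (sqrt (2 * a) / a)"
    by (simp only: integral_mult_right_zero e0_integrals)
  also have "1 / sqrt (1 + p\<^sup>2) * (sqrt (2 * a) / a) \<le> 2 / (1 + p) * (sqrt (2 * a) / a)"
  proof (rule mult_right_mono)
    show "0 \<le> sqrt (2 * a) / a" using a by simp
    show "1 / sqrt (1 + p\<^sup>2) \<le> 2 / (1 + p)"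
    proof -
    have "(1 + p)\<^sup>2 \<le> 4 * (1 + p\<^sup>2)" using zero_le_power2[of "p - 1"] p by (simp add: power2_eq_square algebra_simps) 
    then have "(1 + p) / 2 \<le> sqrt (1 + p\<^sup>2)" by (intro real_le_rsqrt) (simp add: power_divide)
    then show ?thesis using p by (simp add: field_simps add_pos_nonneg)
    qed
  qed
  finally show ?thesis by (simp add: mult_ac)
qed

lemma e0_le: "p \<ge> 0 \<Longrightarrow> e0 p \<le> sqrt (2 * a) * (1 + 1 / a) / (1 + p)"
proof -
  assume p: "p \<ge> 0"
  have "(1 + p) * exp (- a * p) \<le> 1 + 1 / a"
  proof -
    have e: "1 + a * p \<le> exp (a * p)" by (rule exp_ge_add_one_self)
    then have "a * p \<le> exp (a * p)" by linarith
    then have "p \<le> exp (a * p) / a" using a by (simp add: field_simps)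
    from add_mono[OF order_trans[OF _ e] this, of 1]
    have "1 + p \<le> (1 + 1 / a) * exp (a * p)" using a p by (simp add: distrib_right)
    then show ?thesis by (simp add: exp_minus field_simps)
  qed
  then have "sqrt (2 * a) * ((1 + p) * exp (- a * p)) \<le> sqrt (2 * a) * (1 + 1 / a)" using a by (intro mult_left_mono) auto
  then show ?thesis using p by (simp add: e0_def le_divide_eq mult_ac)
qed

text \<open>\<open>e0 p * e0 q\<close> depends on \<open>p + q\<close> only, so
  \<open>nn_integral_yuk_sum\<close> applies. In the second integral the factor \<open>p\<close> is
  symmetrized to half of \<open>p + q\<close>, using the symmetry of \<open>yuk\<close>.\<close>

lemma y_e0:
  "(\<integral>\<^sup>+p. ennreal (e0 p * y p) * indicator {0<..} p \<partial>lborel) = ennreal \<alpha>"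
  "(\<integral>\<^sup>+p. ennreal (p * e0 p * y p) * indicator {0<..} p \<partial>lborel) = ennreal (a * lapJ a)"
proof -
  let ?g = "\<lambda>h p q. h p q * ennreal (2 * a * exp (- a * (p + q))) * ennreal (yuk p q) * indicator {0<..} q * indicator {0<..} p"
  have red: "(\<integral>\<^sup>+p. h p * ennreal (e0 p * y p) * indicator {0<..} p \<partial>lborel) = (\<integral>\<^sup>+p. \<integral>\<^sup>+q. ?g (\<lambda>p q. h p) p q \<partial>lborel \<partial>lborel)"
    if [measurable]: "h \<in> borel_measurable borel" for h :: "real \<Rightarrow> ennreal"
  proof (rule nn_integral_cong)
    fix p
    have "h p * ennreal (e0 p * y p) * indicator {0<..} p = h p * ennreal (e0 p) * indicator {0<..} p * (\<integral>\<^sup>+q. ennreal (yuk p q * e0 q) * indicator {0<..} q \<partial>lborel)"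
      unfolding ennreal_y[symmetric] using e0_pos[of p] y_nonneg[of p] by (simp add: ennreal_mult mult_ac)
    also have "\<dots> = (\<integral>\<^sup>+q. h p * ennreal (e0 p) * indicator {0<..} p * (ennreal (yuk p q * e0 q) * indicator {0<..} q) \<partial>lborel)"
      by (rule nn_integral_cmult[symmetric]) measurable
    also have "\<dots> = (\<integral>\<^sup>+q. ?g (\<lambda>p q. h p) p q \<partial>lborel)"
    proof (rule nn_integral_cong)
      fix q
      have "e0 p * (yuk p q * e0 q) = 2 * a * exp (- a * (p + q)) * yuk p q"
        using a by (simp add: e0_def exp_add[symmetric] algebra_simps)
      then have "ennreal (e0 p) * ennreal (yuk p q * e0 q) = ennreal (2 * a * exp (- a * (p + q))) * ennreal (yuk p q)"
        using e0_pos[of p] e0_pos[of q] yuk_pos[of p q] a by (simp add: ennreal_mult[symmetric] less_imp_le)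
      then show "h p * ennreal (e0 p) * indicator {0<..} p * (ennreal (yuk p q * e0 q) * indicator {0<..} q) = ?g (\<lambda>p q. h p) p q"
        by (simp add: mult_ac) (metis mult.left_commute)
    qed
    finally show "h p * ennreal (e0 p * y p) * indicator {0<..} p = (\<integral>\<^sup>+q. ?g (\<lambda>p q. h p) p q \<partial>lborel)" .
  qed
  have sum: "(\<integral>\<^sup>+p. \<integral>\<^sup>+q. ?g (\<lambda>p q. h (p + q)) p q \<partial>lborel \<partial>lborel) = (\<integral>\<^sup>+s. h s * ennreal (2 * a) * ennreal (exp (- a * s) * ashk s) \<partial>lborel)"
    if [measurable]: "h \<in> borel_measurable borel" for h :: "real \<Rightarrow> ennreal"
  proof -
    have "(\<integral>\<^sup>+p. \<integral>\<^sup>+q. ?g (\<lambda>p q. h (p + q)) p q \<partial>lborel \<partial>lborel) = (\<integral>\<^sup>+s. (h s * ennreal (2 * a * exp (- a * s))) * ennreal (arsinh s / sqrt (1 + s\<^sup>2)) * indicator {0<..} s \<partial>lborel)"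
      by (rule nn_integral_yuk_sum) measurable
    also have "\<dots> = (\<integral>\<^sup>+s. h s * ennreal (2 * a) * ennreal (exp (- a * s) * ashk s) \<partial>lborel)"
    proof (rule nn_integral_cong)
      fix s
      show "h s * ennreal (2 * a * exp (- a * s)) * ennreal (arsinh s / sqrt (1 + s\<^sup>2)) * indicator {0<..} s
          = h s * ennreal (2 * a) * ennreal (exp (- a * s) * ashk s)"
      proof (cases "s > 0")
        case True
        then have "ennreal (2 * a * exp (- a * s)) * ennreal (arsinh s / sqrt (1 + s\<^sup>2)) = ennreal (2 * a) * ennreal (exp (- a * s) * ashk s)"
          using a arsinh_nonneg[of s] by (simp add: ennreal_mult[symmetric] ashk_def)
        then show ?thesis using True by (simp add: mult.assoc)
      qed (simp add: ashk_def)
    qed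
    finally show ?thesis .
  qed
  have "(\<integral>\<^sup>+p. ennreal (e0 p * y p) * indicator {0<..} p \<partial>lborel) = (\<integral>\<^sup>+s. ennreal (2 * a) * ennreal (exp (- a * s) * ashk s) \<partial>lborel)"
    using red[of "\<lambda>_. 1"] sum[of "\<lambda>_. 1"] by simp
  also have "\<dots> = ennreal (2 * a) * (\<integral>\<^sup>+s. ennreal (exp (- a * s) * ashk s) \<partial>lborel)" by (rule nn_integral_cmult) measurable
  also have "(\<integral>\<^sup>+s. ennreal (exp (- a * s) * ashk s) \<partial>lborel) = ennreal (lapI a)"
    unfolding lapI_def by (rule nn_integral_eq_integral[OF integrable_ashk[OF a]]) (simp add: ashk_nonneg)
  also have "ennreal (2 * a) * ennreal (lapI a) = ennreal \<alpha>"
    using a by (simp add: \<alpha>_def ennreal_mult')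
  finally show "(\<integral>\<^sup>+p. ennreal (e0 p * y p) * indicator {0<..} p \<partial>lborel) = ennreal \<alpha>" .
  let ?P = "\<integral>\<^sup>+p. ennreal (p * e0 p * y p) * indicator {0<..} p \<partial>lborel"
  have P: "?P = (\<integral>\<^sup>+p. \<integral>\<^sup>+q. ?g (\<lambda>p q. ennreal p) p q \<partial>lborel \<partial>lborel)"
  proof -
    have "?P = (\<integral>\<^sup>+p. ennreal p * ennreal (e0 p * y p) * indicator {0<..} p \<partial>lborel)"
      using e0_pos y_nonneg by (intro nn_integral_cong) (auto simp: ennreal_mult less_imp_le mult.assoc split: split_indicator)
    then show ?thesis using red[of ennreal] by simp
  qed
  also have "\<dots> = (\<integral>\<^sup>+q. \<integral>\<^sup>+p. ?g (\<lambda>p q. ennreal p) p q \<partial>lborel \<partial>lborel)"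
    by (rule lborel_pair.Fubini'[symmetric]) measurable
  also have "\<dots> = (\<integral>\<^sup>+q. \<integral>\<^sup>+p. ?g (\<lambda>p q. ennreal q) q p \<partial>lborel \<partial>lborel)"
  proof (intro nn_integral_cong)
    fix p q
    have "yuk p q = yuk q p" unfolding yuk_def by (simp add: power2_commute add.commute)
    then show "?g (\<lambda>p q. ennreal p) p q = ?g (\<lambda>p q. ennreal q) q p" by (simp add: add.commute mult_ac)
  qed
  finally have P': "?P = (\<integral>\<^sup>+p. \<integral>\<^sup>+q. ?g (\<lambda>p q. ennreal q) p q \<partial>lborel \<partial>lborel)" .
  have "?P + ?P = (\<integral>\<^sup>+p. \<integral>\<^sup>+q. ?g (\<lambda>p q. ennreal p) p q + ?g (\<lambda>p q. ennreal q) p q \<partial>lborel \<partial>lborel)"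
    by (subst (1) P, subst P', subst nn_integral_add[symmetric], measurable, intro nn_integral_cong nn_integral_add[symmetric], measurable)
  also have "\<dots> = (\<integral>\<^sup>+p. \<integral>\<^sup>+q. ?g (\<lambda>p q. ennreal (p + q)) p q \<partial>lborel \<partial>lborel)"
    by (intro nn_integral_cong) (auto simp: distrib_right split: split_indicator)
  also have "\<dots> = (\<integral>\<^sup>+s. ennreal s * ennreal (2 * a) * ennreal (exp (- a * s) * ashk s) \<partial>lborel)"
    by (rule sum) measurable
  also have "\<dots> = (\<integral>\<^sup>+s. ennreal (2 * a) * ennreal (s * exp (- a * s) * ashk s) \<partial>lborel)"
  proof (rule nn_integral_cong)
    fix s
    show "ennreal s * ennreal (2 * a) * ennreal (exp (- a * s) * ashk s) = ennreal (2 * a) * ennreal (s * exp (- a * s) * ashk s)"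
      using a ashk_nonneg[of s] by (cases "s > 0") (simp_all add: ennreal_mult[symmetric] mult_ac, simp add: ashk_def)
  qed
  also have "\<dots> = ennreal (2 * a) * (\<integral>\<^sup>+s. ennreal (s * exp (- a * s) * ashk s) \<partial>lborel)" by (rule nn_integral_cmult) measurable
  also have "(\<integral>\<^sup>+s. ennreal (s * exp (- a * s) * ashk s) \<partial>lborel) = ennreal (lapJ a)"
    unfolding lapJ_def by (rule nn_integral_eq_integral[OF integrable_ashk1[OF a]]) (auto simp: ashk_def arsinh_nonneg split: split_indicator)
  also have "ennreal (2 * a) * ennreal (lapJ a) = 2 * ennreal (a * lapJ a)"
    using a by (simp add: ennreal_mult' mult.assoc)
  finally have "2 * ?P = 2 * ennreal (a * lapJ a)" by (simp add: mult_2)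
  then show "?P = ennreal (a * lapJ a)" by (simp add: ennreal_mult_cancel_left)
qed

end

lemma integrable_inverse_quadratic: "integrable lborel (\<lambda>p::real. 1 / (1 + p\<^sup>2))"
proof (rule integrableI_bounded)
  have "(\<integral>\<^sup>+p. ennreal (norm (1 / (1 + p\<^sup>2 :: real))) \<partial>lborel) = (\<integral>\<^sup>+p. ennreal (1 / (1 * p\<^sup>2 + 2 * 0 * p + 1)) \<partial>lborel)"
    by (intro nn_integral_cong) (simp add: add.commute)
  then show "(\<integral>\<^sup>+p. ennreal (norm (1 / (1 + p\<^sup>2 :: real))) \<partial>lborel) < \<infinity>"
    using nn_integral_inverse_quadratic[of 1 1 0] by simp
qed simp

lemma integrable_sq_decay:
  fixes f :: "real \<Rightarrow> real"
  assumes [measurable]: "f \<in> borel_measurable borel" and f: "\<And>p. p \<ge> 0 \<Longrightarrow> \<bar>f p\<bar> \<le> C / (1 + p)"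
  shows "integrable lborel (\<lambda>p. (f p)\<^sup>2 * indicator {0<..} p)"
proof (rule Bochner_Integration.integrable_bound[OF integrable_mult_right[OF integrable_inverse_quadratic, of "C\<^sup>2"]])
  have "(f p)\<^sup>2 \<le> C\<^sup>2 * (1 / (1 + p\<^sup>2))" if "p \<ge> 0" for p
  proof -
    have "\<bar>f p\<bar>\<^sup>2 \<le> (C / (1 + p))\<^sup>2" by (rule power_mono[OF f[OF that]]) simp
    also have "\<dots> = C\<^sup>2 / (1 + p)\<^sup>2" by (rule power_divide)
    also have "\<dots> \<le> C\<^sup>2 / (1 + p\<^sup>2)"
      using that by (intro divide_left_mono) (auto simp: power2_sum add_pos_nonneg)
    finally show ?thesis by simp
  qed
  then show "AE p in lborel. norm ((f p)\<^sup>2 * indicator {0<..} p) \<le> norm (C\<^sup>2 * (1 / (1 + p\<^sup>2)))"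
    by (intro AE_I2) (auto split: split_indicator simp: abs_of_nonneg add_nonneg_nonneg)
qed measurable

context trial begin

lemma energy_integrable: "integrable lborel (\<lambda>r. r * ((y' r)\<^sup>2 + a\<^sup>2 * (y r)\<^sup>2) * indicator {0<..} r)"
  and energy_le: "(\<integral>r. r * ((y' r)\<^sup>2 + a\<^sup>2 * (y r)\<^sup>2) * indicator {0<..} r \<partial>lborel) \<le> a"
proof -
  let ?f = "\<lambda>r. r * ((y' r)\<^sup>2 + a\<^sup>2 * (y r)\<^sup>2) * indicator {0<..} r"
  have nn: "?f r \<ge> 0" for r by (auto split: split_indicator)
  have e: "(\<integral>\<^sup>+r. ennreal (?f r) \<partial>lborel) \<le> ennreal a"
    using energy by (simp add: ennreal_mult'' ennreal_indicator)
  show i: "integrable lborel ?f"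
    by (rule integrableI_nonneg) (use nn e in \<open>auto intro: le_less_trans\<close>)
  show "(\<integral>r. ?f r \<partial>lborel) \<le> a"
    using e nn_integral_eq_integral[OF i] nn a by (simp add: ennreal_le_iff)
qed

lemma energy_parts_integrable:
  "integrable lborel (\<lambda>r. r * (y' r)\<^sup>2 * indicator {0<..} r)" "integrable lborel (\<lambda>r. r * (y r)\<^sup>2 * indicator {0<..} r)"
proof -
  show "integrable lborel (\<lambda>r. r * (y' r)\<^sup>2 * indicator {0<..} r)"
    by (rule Bochner_Integration.integrable_bound[OF energy_integrable])
       (auto intro!: AE_I2 mult_left_mono simp: abs_mult split: split_indicator)
  show "integrable lborel (\<lambda>r. r * (y r)\<^sup>2 * indicator {0<..} r)"
    by (rule Bochner_Integration.integrable_bound[OF integrable_mult_right[OF energy_integrable, of "1 / a\<^sup>2"]])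
       (use a in \<open>auto intro!: AE_I2 simp: abs_mult field_simps split: split_indicator\<close>)
qed

lemma overlap:
  "integrable lborel (\<lambda>p. e0 p * y p * indicator {0<..} p)" "(\<integral>p. e0 p * y p * indicator {0<..} p \<partial>lborel) = \<alpha>"
  "integrable lborel (\<lambda>p. p * e0 p * y p * indicator {0<..} p)" "(\<integral>p. p * e0 p * y p * indicator {0<..} p \<partial>lborel) = a * lapJ a"
proof -
  have nn: "lapI a \<ge> 0" "lapJ a \<ge> 0"
    unfolding lapI_def lapJ_def using ashk_nonneg
    by (auto intro!: integral_nonneg_AE AE_I2 simp: ashk_def arsinh_nonneg split: split_indicator)
  have 1: "0 \<le> e0 p * y p * indicator {0<..} p" "0 \<le> p * e0 p * y p * indicator {0<..} p" for p
    using e0_pos[of p] y_nonneg[of p] by (auto split: split_indicator simp: less_imp_le)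
  have e: "(\<integral>\<^sup>+p. ennreal (e0 p * y p * indicator {0<..} p) \<partial>lborel) = ennreal \<alpha>"
    "(\<integral>\<^sup>+p. ennreal (p * e0 p * y p * indicator {0<..} p) \<partial>lborel) = ennreal (a * lapJ a)"
    using y_e0 by (simp_all add: ennreal_mult'' ennreal_indicator)
  show "integrable lborel (\<lambda>p. e0 p * y p * indicator {0<..} p)" "integrable lborel (\<lambda>p. p * e0 p * y p * indicator {0<..} p)"
    by (rule integrableI_nonneg; use 1 e in \<open>auto\<close>)+
  show "(\<integral>p. e0 p * y p * indicator {0<..} p \<partial>lborel) = \<alpha>" "(\<integral>p. p * e0 p * y p * indicator {0<..} p \<partial>lborel) = a * lapJ a"
    using 1 e nn a by (auto intro!: integral_eq_nn_integral[THEN trans] simp: \<alpha>_def)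
qed

text \<open>The integrand plus \<open>e0 p * y p\<close> is the derivative of
  \<open>p * y p * e0 p\<close>, which vanishes at both ends. Up to the factor \<open>- a\<close>
  this is the eigenvalue equation of the Laguerre operator for \<open>e0\<close>, tested against
  \<open>y\<close>.\<close>

lemma mixed_energy:
  "integrable lborel (\<lambda>p. p * e0 p * (y' p - a * y p) * indicator {0<..} p)"
  "(\<integral>p. p * e0 p * (y' p - a * y p) * indicator {0<..} p \<partial>lborel) = - \<alpha>"
proof -
  let ?F = "\<lambda>p. p * y p * e0 p" and ?f = "\<lambda>p. e0 p * y p + p * e0 p * (y' p - a * y p)"
  have i': "integrable lborel (\<lambda>p. p * e0 p * y' p * indicator {0<..} p)"
  proof (rule Bochner_Integration.integrable_bound)
    show "integrable lborel (\<lambda>p. p * (e0 p)\<^sup>2 * indicator {0<..} p + p * (y' p)\<^sup>2 * indicator {0<..} p)"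
      by (intro Bochner_Integration.integrable_add e0_integrals energy_parts_integrable)
    have "\<bar>p * e0 p * y' p\<bar> \<le> p * (e0 p)\<^sup>2 + p * (y' p)\<^sup>2" if "p > 0" for p
    proof -
      have "\<bar>e0 p * y' p\<bar> \<le> (e0 p)\<^sup>2 + (y' p)\<^sup>2"
        using sum_squares_bound[of "\<bar>e0 p\<bar>" "\<bar>y' p\<bar>"] mult_nonneg_nonneg[OF abs_ge_zero abs_ge_zero, of "e0 p" "y' p"]
        unfolding abs_mult power2_abs by linarith
      from mult_left_mono[OF this, of p] that show ?thesis by (simp add: abs_mult distrib_left mult.assoc)
    qed
    then show "AE p in lborel. norm (p * e0 p * y' p * indicator {0<..} p) \<le> norm (p * (e0 p)\<^sup>2 * indicator {0<..} p + p * (y' p)\<^sup>2 * indicator {0<..} p)"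
      by (intro AE_I2) (auto split: split_indicator intro: order_trans[OF _ abs_ge_self])
  qed measurable
  have sp: "p * e0 p * (y' p - a * y p) * indicator {0<..} p = p * e0 p * y' p * indicator {0<..} p - a * (p * e0 p * y p * indicator {0<..} p)" for p
    by (simp add: algebra_simps)
  show i: "integrable lborel (\<lambda>p. p * e0 p * (y' p - a * y p) * indicator {0<..} p)"
    unfolding sp by (intro Bochner_Integration.integrable_diff integrable_mult_right i' overlap)
  have sf: "?f p * indicator {0<..} p = e0 p * y p * indicator {0<..} p + p * e0 p * (y' p - a * y p) * indicator {0<..} p" for p
    by (simp add: distrib_right)
  have "(\<integral>p. ?f p * indicator {0<..} p \<partial>lborel) = 0 - 0"
  proof (rule integral_FTC_Ioi[where F="?F"])
    show "(?F has_real_derivative ?f x) (at x)" for x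
      unfolding e0_def by (rule derivative_eq_intros y_deriv refl | simp add: algebra_simps)+
    show "integrable lborel (\<lambda>p. ?f p * indicator {0<..} p)"
      unfolding sf by (intro Bochner_Integration.integrable_add overlap i)
    have bd: "\<bar>?F p\<bar> \<le> 2 * sqrt (2 * a) / a * e0 p * p" if "p \<ge> 0" for p
    proof -
      have "y p \<le> 2 * sqrt (2 * a) / a" using y_le[OF that] divide_left_mono[of 1 "1 + p" "2 * sqrt (2 * a) / a"] that a by simp
      then have "e0 p * p * y p \<le> e0 p * p * (2 * sqrt (2 * a) / a)" using e0_pos[of p] that by (intro mult_left_mono) auto
      then show ?thesis using e0_pos[of p] y_nonneg[of p] that by (simp add: abs_mult mult_ac)
    qed
    have "((\<lambda>p. 2 * sqrt (2 * a) / a * e0 p * p) \<longlongrightarrow> 0) at_top" unfolding e0_def using a by real_asymp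
    then have "(\<lambda>n. 2 * sqrt (2 * a) / a * e0 (real n) * real n) \<longlonglongrightarrow> 0" by (rule filterlim_compose[OF _ filterlim_real_sequentially])
    from LIMSEQ_Suc[OF this] show "(\<lambda>n. ?F (real (Suc n))) \<longlonglongrightarrow> 0"
      by (rule Lim_null_comparison[rotated]) (intro always_eventually allI, unfold real_norm_def, rule bd, simp)
    have "((\<lambda>p. 2 * sqrt (2 * a) / a * e0 p * p) \<longlongrightarrow> 0) (at_right 0)" unfolding e0_def using a by real_asymp
    moreover have "filterlim (\<lambda>n. 1 / real (Suc n)) (at_right 0) sequentially" by real_asymp
    ultimately have "(\<lambda>n. 2 * sqrt (2 * a) / a * e0 (1 / real (Suc n)) * (1 / real (Suc n))) \<longlonglongrightarrow> 0"
      by (rule filterlim_compose)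
    then show "(\<lambda>n. ?F (1 / real (Suc n))) \<longlonglongrightarrow> 0"
      by (rule Lim_null_comparison[rotated]) (intro always_eventually allI, unfold real_norm_def, rule bd, simp)
  qed measurable
  then show "(\<integral>p. p * e0 p * (y' p - a * y p) * indicator {0<..} p \<partial>lborel) = - \<alpha>"
    unfolding sf using overlap i by simp
qed

definition z :: "real \<Rightarrow> real" where "z p = y p - \<alpha> * e0 p"

lemma z_measurable [measurable]: "z \<in> borel_measurable borel" unfolding z_def by measurable

lemma z_decay: "\<exists>C. \<forall>p\<ge>0. \<bar>z p\<bar> \<le> C / (1 + p)"
proof (intro exI allI impI)
  fix p :: real assume p: "p \<ge> 0"
  have "\<bar>z p\<bar> \<le> y p + \<bar>\<alpha>\<bar> * e0 p"
    unfolding z_def using y_nonneg[of p] e0_pos[of p] by (intro order_trans[OF abs_triangle_ineq4]) (simp add: abs_mult)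
  also have "\<dots> \<le> 2 * sqrt (2 * a) / a / (1 + p) + \<bar>\<alpha>\<bar> * (sqrt (2 * a) * (1 + 1 / a) / (1 + p))"
    by (intro add_mono mult_left_mono y_le e0_le p) simp
  also have "\<dots> = (2 * sqrt (2 * a) / a + \<bar>\<alpha>\<bar> * (sqrt (2 * a) * (1 + 1 / a))) / (1 + p)"
    by (simp add: add_divide_distrib)
  finally show "\<bar>z p\<bar> \<le> (2 * sqrt (2 * a) / a + \<bar>\<alpha>\<bar> * (sqrt (2 * a) * (1 + 1 / a))) / (1 + p)" .
qed

lemma z_sq_integrable: "integrable lborel (\<lambda>p. (z p)\<^sup>2 * indicator {0<..} p)"
  using z_decay integrable_sq_decay[OF z_measurable] by blast

lemma e0_z_integral:
  "integrable lborel (\<lambda>p. e0 p * z p * indicator {0<..} p)" "(\<integral>p. e0 p * z p * indicator {0<..} p \<partial>lborel) = 0"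
proof -
  have e: "e0 p * z p * indicator {0<..} p = e0 p * y p * indicator {0<..} p - \<alpha> * ((e0 p)\<^sup>2 * indicator {0<..} p)" for p
    by (simp add: z_def algebra_simps power2_eq_square)
  show "integrable lborel (\<lambda>p. e0 p * z p * indicator {0<..} p)" "(\<integral>p. e0 p * z p * indicator {0<..} p \<partial>lborel) = 0"
    unfolding e using overlap e0_integrals by simp_all
qed

text \<open>The mixed term and the energy of \<open>e0\<close> combine to lower the energy of
  \<open>y\<close> by \<open>a * \<alpha>\<^sup>2\<close>, so that of \<open>z\<close> is at most
  \<open>a * (1 - \<alpha>\<^sup>2)\<close>; the Laguerre gap turns this into a bound on the
  norm.\<close>

lemma z_norm_le:
  assumes stat: "lapI a = a * lapJ a"
  shows "5 * (\<integral>p. (z p)\<^sup>2 * indicator {0<..} p \<partial>lborel) \<le> 1 - \<alpha>\<^sup>2"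
proof -
  define z' where "z' p = y' p + a * \<alpha> * e0 p" for p
  have [measurable]: "z' \<in> borel_measurable borel" unfolding z'_def by measurable
  have d: "(z has_real_derivative z' p) (at p)" for p
    unfolding z_def[abs_def] z'_def e0_def by (rule derivative_eq_intros y_deriv refl | simp)+
  obtain C where C: "\<And>p. p \<ge> 0 \<Longrightarrow> \<bar>z p\<bar> \<le> C / (1 + p)" using z_decay by blast
  have s: "sqrt (2 * a) > 0" using a by simp
  have o0: "(\<integral>s. exp (- a * s) * z s * indicator {0<..} s \<partial>lborel) = 0"
  proof -
    have "(\<integral>s. e0 s * z s * indicator {0<..} s \<partial>lborel) = (\<integral>s. sqrt (2 * a) * (exp (- a * s) * z s * indicator {0<..} s) \<partial>lborel)"
      by (simp add: e0_def mult.assoc)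
    then show ?thesis using e0_z_integral(2) s by (simp only: integral_mult_right_zero) simp
  qed
  \<comment> \<open>Stationarity enters here: it makes the moments \<open>a * lapJ a\<close> and
    \<open>\<alpha> / (2 * a)\<close> of the two parts of \<open>z\<close> equal.\<close>
  have o1: "(\<integral>s. s * exp (- a * s) * z s * indicator {0<..} s \<partial>lborel) = 0"
  proof -
    have "(\<integral>s. sqrt (2 * a) * (s * exp (- a * s) * z s * indicator {0<..} s) \<partial>lborel)
      = (\<integral>s. s * e0 s * y s * indicator {0<..} s - \<alpha> * (s * (e0 s)\<^sup>2 * indicator {0<..} s) \<partial>lborel)"
      by (rule Bochner_Integration.integral_cong[OF refl]) (simp add: z_def e0_def[of s for s] power2_eq_square algebra_simps)
    also have "\<dots> = a * lapJ a - \<alpha> * (1 / (2 * a))" using overlap e0_integrals by simp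
    also have "\<dots> = 0" using a stat by (simp add: \<alpha>_def)
    finally show ?thesis using s by (simp only: integral_mult_right_zero) simp
  qed
  \<comment> \<open>Expansion of the energy density of \<open>z\<close> into that of
    \<open>y\<close>, the mixed term and that of \<open>e0\<close>.\<close>
  have ez: "p * (z' p)\<^sup>2 * indicator {0<..} p + a\<^sup>2 * (p * (z p)\<^sup>2 * indicator {0<..} p)
     = p * ((y' p)\<^sup>2 + a\<^sup>2 * (y p)\<^sup>2) * indicator {0<..} p + 2 * a * \<alpha> * (p * e0 p * (y' p - a * y p) * indicator {0<..} p)
       + 2 * a\<^sup>2 * \<alpha>\<^sup>2 * (p * (e0 p)\<^sup>2 * indicator {0<..} p)" for p
    by (simp add: z_def z'_def power2_eq_square algebra_simps)
  have it: "integrable lborel (\<lambda>p. p * (z' p)\<^sup>2 * indicator {0<..} p + a\<^sup>2 * (p * (z p)\<^sup>2 * indicator {0<..} p))"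
    unfolding ez by (intro Bochner_Integration.integrable_add integrable_mult_right energy_integrable mixed_energy e0_integrals)
  have i1: "integrable lborel (\<lambda>p. p * (z' p)\<^sup>2 * indicator {0<..} p)"
    by (rule Bochner_Integration.integrable_bound[OF it]) (auto intro!: AE_I2 simp: abs_mult split: split_indicator)
  have i2: "integrable lborel (\<lambda>p. p * (z p)\<^sup>2 * indicator {0<..} p)"
    by (rule Bochner_Integration.integrable_bound[OF integrable_mult_right[OF it, of "1 / a\<^sup>2"]])
       (use a in \<open>auto intro!: AE_I2 simp: abs_mult field_simps split: split_indicator\<close>)
  have "5 * a * (\<integral>p. (z p)\<^sup>2 * indicator {0<..} p \<partial>lborel)
    \<le> (\<integral>p. p * (z' p)\<^sup>2 * indicator {0<..} p \<partial>lborel) + a\<^sup>2 * (\<integral>p. p * (z p)\<^sup>2 * indicator {0<..} p \<partial>lborel)"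
    by (rule laguerre_gap_estimate[OF a d _ _ _ C o0 o1 i1 i2 z_sq_integrable])
       (auto intro!: continuous_at_imp_continuous_on DERIV_isCont[OF d])
  also have "\<dots> = (\<integral>p. p * (z' p)\<^sup>2 * indicator {0<..} p + a\<^sup>2 * (p * (z p)\<^sup>2 * indicator {0<..} p) \<partial>lborel)"
    using i1 i2 by simp
  also have "\<dots> = (\<integral>p. p * ((y' p)\<^sup>2 + a\<^sup>2 * (y p)\<^sup>2) * indicator {0<..} p \<partial>lborel) + 2 * a * \<alpha> * (- \<alpha>) + 2 * a\<^sup>2 * \<alpha>\<^sup>2 * (1 / (2 * a))"
    unfolding ez mixed_energy(2)[symmetric] e0_integrals(6)[symmetric] using energy_integrable mixed_energy(1) e0_integrals(5) by simp
  also have "\<dots> \<le> a + 2 * a * \<alpha> * (- \<alpha>) + 2 * a\<^sup>2 * \<alpha>\<^sup>2 * (1 / (2 * a))" using energy_le by simp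
  also have "\<dots> = a * (1 - \<alpha>\<^sup>2)" using a by (simp add: power2_eq_square algebra_simps)
  finally have "a * (5 * (\<integral>p. (z p)\<^sup>2 * indicator {0<..} p \<partial>lborel)) \<le> a * (1 - \<alpha>\<^sup>2)" by (simp add: mult_ac)
  then show ?thesis using a by (simp only: mult_le_cancel_left_pos)
qed

end

section \<open>The block argument\<close>

lemma integrable_mult_of_sq:
  fixes f g :: "'a \<Rightarrow> real"
  assumes [measurable]: "f \<in> borel_measurable M" "g \<in> borel_measurable M"
    and "integrable M (\<lambda>x. (f x)\<^sup>2)" "integrable M (\<lambda>x. (g x)\<^sup>2)"
  shows "integrable M (\<lambda>x. f x * g x)"
proof (rule Bochner_Integration.integrable_bound)
  show "integrable M (\<lambda>x. (f x)\<^sup>2 + (g x)\<^sup>2)" using assms by simp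
  have "\<bar>f x * g x\<bar> \<le> (f x)\<^sup>2 + (g x)\<^sup>2" for x
    using sum_squares_bound[of "\<bar>f x\<bar>" "\<bar>g x\<bar>"] mult_nonneg_nonneg[OF abs_ge_zero abs_ge_zero, of "f x" "g x"]
    unfolding abs_mult power2_abs by linarith
  then show "AE x in M. norm (f x * g x) \<le> norm ((f x)\<^sup>2 + (g x)\<^sup>2)"
    by (intro AE_I2) (simp add: abs_of_nonneg)
qed measurable

lemma Cauchy_Schwarz_integral:
  fixes f g :: "'a \<Rightarrow> real"
  assumes [measurable]: "f \<in> borel_measurable M" "g \<in> borel_measurable M"
    and f: "integrable M (\<lambda>x. (f x)\<^sup>2)" and g: "integrable M (\<lambda>x. (g x)\<^sup>2)"
  shows "(\<integral>x. f x * g x \<partial>M)\<^sup>2 \<le> (\<integral>x. (f x)\<^sup>2 \<partial>M) * (\<integral>x. (g x)\<^sup>2 \<partial>M)"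
proof -
  define A B C where "A = (\<integral>x. (f x)\<^sup>2 \<partial>M)" and "B = (\<integral>x. f x * g x \<partial>M)" and "C = (\<integral>x. (g x)\<^sup>2 \<partial>M)"
  have fg: "integrable M (\<lambda>x. f x * g x)" by (rule integrable_mult_of_sq) (use f g in auto)
  have q: "0 \<le> t\<^sup>2 * A + 2 * t * B + C" for t
  proof -
    have "0 \<le> (\<integral>x. (t * f x + g x)\<^sup>2 \<partial>M)" by (rule integral_nonneg_AE) simp
    also have "\<dots> = (\<integral>x. t\<^sup>2 * (f x)\<^sup>2 + 2 * t * (f x * g x) + (g x)\<^sup>2 \<partial>M)"
      by (rule Bochner_Integration.integral_cong) (auto simp: power2_eq_square algebra_simps)
    also have "\<dots> = t\<^sup>2 * A + 2 * t * B + C" unfolding A_def B_def C_def using f g fg by simp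
    finally show ?thesis .
  qed
  have A: "A \<ge> 0" unfolding A_def by (rule integral_nonneg_AE) simp
  have "B\<^sup>2 \<le> A * C"
  proof (cases "A = 0")
    case True
    have "B = 0"
    proof (rule ccontr)
      assume B: "B \<noteq> 0"
      have "2 * (- (C + 1) / (2 * B)) * B = - (C + 1)" using B by simp
      with q[of "- (C + 1) / (2 * B)"] True show False by simp
    qed
    then show ?thesis using True by simp
  next
    case False
    then have "A > 0" using A by simp
    have "(- B / A)\<^sup>2 * A + 2 * (- B / A) * B + C = (A * C - B\<^sup>2) / A"
      using False by (simp add: field_simps power2_eq_square)
    with q[of "- B / A"] have "0 \<le> (A * C - B\<^sup>2) / A" by simp
    then show ?thesis using \<open>A > 0\<close> by (simp add: zero_le_divide_iff)
  qed
  then show ?thesis by (simp add: A_def B_def C_def)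
qed

text \<open>
  Split \<open>f = c e + \<eta>\<close> with \<open>\<eta>\<close> orthogonal to \<open>e\<close>.  The form of \<open>K\<close> is at most \<open>\<alpha> c\<^sup>2\<close> plus the cross
  term with \<open>b\<close> plus \<open>d\<close> times the squared norm of \<open>\<eta>\<close>, where \<open>d\<close> bounds the Hilbert-Schmidt norm
  of \<open>K - \<alpha> e \<otimes> e\<close>; \<open>gap\<close> says that this 2 by 2 form is at most the identity.
\<close>

locale HS_block =
  fixes M :: "'a measure" and K :: "'a \<Rightarrow> 'a \<Rightarrow> real" and e b :: "'a \<Rightarrow> real" and \<alpha> d :: real
  assumes sf: "sigma_finite_measure M"
    and K_meas [measurable]: "(\<lambda>(p, q). K p q) \<in> borel_measurable (M \<Otimes>\<^sub>M M)"
    and sym: "K p q = K q p"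
    and HS: "integrable (M \<Otimes>\<^sub>M M) (\<lambda>(p, q). (K p q)\<^sup>2)"
    and e_meas [measurable]: "e \<in> borel_measurable M" and b_meas [measurable]: "b \<in> borel_measurable M"
    and e_sq: "integrable M (\<lambda>p. (e p)\<^sup>2)" and e1: "(\<integral>p. (e p)\<^sup>2 \<partial>M) = 1"
    and b_sq: "integrable M (\<lambda>p. (b p)\<^sup>2)" and eb: "(\<integral>p. e p * b p \<partial>M) = 0"
    and Ke: "p \<in> space M \<Longrightarrow> (\<integral>q. K p q * e q \<partial>M) = \<alpha> * e p + b p"
    and d: "(\<integral>(p, q). (K p q)\<^sup>2 \<partial>(M \<Otimes>\<^sub>M M)) - \<alpha>\<^sup>2 \<le> d\<^sup>2" "0 \<le> d" "d \<le> 1"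
    and al: "\<alpha> \<le> 1" and gap: "(\<integral>p. (b p)\<^sup>2 \<partial>M) \<le> (1 - \<alpha>) * (1 - d)"
begin

sublocale pair_sigma_finite M M by (simp add: pair_sigma_finite_def sf)

abbreviation "MM \<equiv> M \<Otimes>\<^sub>M M"

definition form :: "('a \<Rightarrow> real) \<Rightarrow> ('a \<Rightarrow> real) \<Rightarrow> real" where
  "form f g = (\<integral>z. K (fst z) (snd z) * (f (fst z) * g (snd z)) \<partial>MM)"

lemma tensor_integrable:
  fixes f g :: "'a \<Rightarrow> real"
  assumes [measurable]: "f \<in> borel_measurable M" "g \<in> borel_measurable M"
    and "integrable M (\<lambda>x. (f x)\<^sup>2)" "integrable M (\<lambda>x. (g x)\<^sup>2)"
  shows "integrable MM (\<lambda>z. (f (fst z) * g (snd z))\<^sup>2)"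
    and "(\<integral>z. (f (fst z) * g (snd z))\<^sup>2 \<partial>MM) = (\<integral>x. (f x)\<^sup>2 \<partial>M) * (\<integral>x. (g x)\<^sup>2 \<partial>M)"
proof -
  have i: "integrable MM (\<lambda>(x, y). (f x)\<^sup>2 * (g y)\<^sup>2)" by (rule integrable_prod_mult[OF sf sf assms(3,4)])
  then show "integrable MM (\<lambda>z. (f (fst z) * g (snd z))\<^sup>2)" by (simp add: power_mult_distrib split_beta')
  have "(\<integral>z. (f (fst z) * g (snd z))\<^sup>2 \<partial>MM) = (\<integral>(x, y). (f x)\<^sup>2 * (g y)\<^sup>2 \<partial>MM)" by (simp add: power_mult_distrib split_beta')
  also have "\<dots> = (\<integral>x. \<integral>y. (f x)\<^sup>2 * (g y)\<^sup>2 \<partial>M \<partial>M)" using integral_fst'[OF i] by simp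
  finally show "(\<integral>z. (f (fst z) * g (snd z))\<^sup>2 \<partial>MM) = (\<integral>x. (f x)\<^sup>2 \<partial>M) * (\<integral>x. (g x)\<^sup>2 \<partial>M)" by simp
qed

lemma form_integrable:
  assumes [measurable]: "f \<in> borel_measurable M" "g \<in> borel_measurable M"
    and "integrable M (\<lambda>x. (f x)\<^sup>2)" "integrable M (\<lambda>x. (g x)\<^sup>2)"
  shows "integrable MM (\<lambda>z. K (fst z) (snd z) * (f (fst z) * g (snd z)))"
  by (rule integrable_mult_of_sq, measurable) (use tensor_integrable[OF assms] HS in \<open>simp_all add: split_beta'\<close>)

lemma form_e:
  assumes [measurable]: "g \<in> borel_measurable M" and g: "integrable M (\<lambda>x. (g x)\<^sup>2)"
  shows "form g e = (\<integral>p. g p * (\<alpha> * e p + b p) \<partial>M)" and "form e g = form g e"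
proof -
  have i: "integrable MM (\<lambda>(p, q). K p q * (g p * e q))"
    using form_integrable[OF _ _ g e_sq] by (simp add: split_beta')
  have "form g e = (\<integral>p. \<integral>q. K p q * (g p * e q) \<partial>M \<partial>M)" using integral_fst'[OF i] by (simp add: form_def split_beta')
  also have "\<dots> = (\<integral>p. g p * (\<integral>q. K p q * e q \<partial>M) \<partial>M)"
    unfolding integral_mult_right_zero[symmetric] by (simp add: mult_ac)
  also have "\<dots> = (\<integral>p. g p * (\<alpha> * e p + b p) \<partial>M)" by (rule Bochner_Integration.integral_cong) (simp_all add: Ke)
  finally show "form g e = (\<integral>p. g p * (\<alpha> * e p + b p) \<partial>M)" .
  have "form e g = (\<integral>(p, q). K q p * (g q * e p) \<partial>MM)"
    unfolding form_def by (rule Bochner_Integration.integral_cong) (auto simp: sym mult_ac)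
  also have "\<dots> = form g e" using integral_product_swap[of "\<lambda>(p, q). K p q * (g p * e q)"] by (simp add: form_def split_beta')
  finally show "form e g = form g e" .
qed

lemma form_le:
  assumes [measurable]: "f \<in> borel_measurable M" and f: "integrable M (\<lambda>x. (f x)\<^sup>2)"
  shows "form f f \<le> (\<integral>x. (f x)\<^sup>2 \<partial>M)"
proof -
  define c where "c = (\<integral>x. e x * f x \<partial>M)"
  define \<eta> where "\<eta> x = f x - c * e x" for x
  define N where "N = (\<integral>x. (\<eta> x)\<^sup>2 \<partial>M)"
  define I where "I = (\<integral>x. \<eta> x * b x \<partial>M)"
  have [measurable]: "\<eta> \<in> borel_measurable M" unfolding \<eta>_def by measurable
  have ief: "integrable M (\<lambda>x. e x * f x)" by (rule integrable_mult_of_sq) (use f e_sq in auto)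
  have ieb: "integrable M (\<lambda>x. e x * b x)" by (rule integrable_mult_of_sq) (use b_sq e_sq in auto)
  have \<eta>sq: "(\<eta> x)\<^sup>2 = (f x)\<^sup>2 - 2 * c * (e x * f x) + c\<^sup>2 * (e x)\<^sup>2" for x
    by (simp add: \<eta>_def power2_eq_square algebra_simps)
  have i\<eta>: "integrable M (\<lambda>x. (\<eta> x)\<^sup>2)" unfolding \<eta>sq using f e_sq ief by simp
  have N: "N = (\<integral>x. (f x)\<^sup>2 \<partial>M) - c\<^sup>2"
    unfolding N_def \<eta>sq using f e_sq ief e1 by (simp add: c_def[symmetric] power2_eq_square)
  have N0: "N \<ge> 0" unfolding N_def by (rule integral_nonneg_AE) simp
  have i\<eta>e: "integrable M (\<lambda>x. \<eta> x * e x)" by (rule integrable_mult_of_sq) (use i\<eta> e_sq in auto)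
  have i\<eta>b: "integrable M (\<lambda>x. \<eta> x * b x)" by (rule integrable_mult_of_sq) (use i\<eta> b_sq in auto)
  have \<eta>e: "(\<integral>x. \<eta> x * e x \<partial>M) = 0"
  proof -
    have "(\<integral>x. \<eta> x * e x \<partial>M) = (\<integral>x. e x * f x - c * (e x)\<^sup>2 \<partial>M)"
      by (rule Bochner_Integration.integral_cong) (simp_all add: \<eta>_def power2_eq_square algebra_simps)
    then show ?thesis using ief e_sq e1 by (simp add: c_def)
  qed
  \<comment> \<open>The image of \<open>e\<close> is \<open>\<alpha> * e + b\<close>, and
    \<open>\<eta>\<close> is orthogonal to \<open>e\<close>, so only \<open>b\<close> couples the
    two blocks.\<close>
  have \<eta>_form: "form \<eta> e = I"
  proof -
    have "form \<eta> e = (\<integral>p. \<alpha> * (\<eta> p * e p) + \<eta> p * b p \<partial>M)"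
      unfolding form_e(1)[OF _ i\<eta>, simplified] by (rule Bochner_Integration.integral_cong) (simp_all add: algebra_simps)
    also have "\<dots> = \<alpha> * (\<integral>p. \<eta> p * e p \<partial>M) + I" unfolding I_def using i\<eta>e i\<eta>b by simp
    finally show ?thesis by (simp add: \<eta>e)
  qed
  have e_form: "form e e = \<alpha>"
  proof -
    have "form e e = (\<integral>p. \<alpha> * (e p)\<^sup>2 + e p * b p \<partial>M)"
      unfolding form_e(1)[OF _ e_sq, simplified] by (rule Bochner_Integration.integral_cong) (simp_all add: power2_eq_square algebra_simps)
    then show ?thesis using e_sq ieb e1 eb by simp
  qed
  note fi = form_integrable
  have "form f f = (\<integral>z. K (fst z) (snd z) * (\<eta> (fst z) * \<eta> (snd z)) + c * (K (fst z) (snd z) * (\<eta> (fst z) * e (snd z)))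
      + c * (K (fst z) (snd z) * (e (fst z) * \<eta> (snd z))) + c\<^sup>2 * (K (fst z) (snd z) * (e (fst z) * e (snd z))) \<partial>MM)"
    unfolding form_def by (rule Bochner_Integration.integral_cong) (simp_all add: \<eta>_def power2_eq_square algebra_simps)
  also have "\<dots> = form \<eta> \<eta> + c * form \<eta> e + c * form e \<eta> + c\<^sup>2 * form e e"
    unfolding form_def using fi[of \<eta> \<eta>] fi[of \<eta> e] fi[of e \<eta>] fi[of e e] i\<eta> e_sq by simp
  also have "\<dots> = form \<eta> \<eta> + 2 * (c * I) + \<alpha> * c\<^sup>2"
    using form_e(2)[OF _ i\<eta>] by (simp add: \<eta>_form e_form)
  finally have 1: "form f f = form \<eta> \<eta> + 2 * (c * I) + \<alpha> * c\<^sup>2" .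
  have "form \<eta> \<eta> \<le> d * N"
  proof -
    \<comment> \<open>Subtracting \<alpha> times the rank one kernel does not change the form on
      \<open>\<eta>\<close>, and it lowers the squared Hilbert-Schmidt norm by
      \<open>\<alpha>\<^sup>2\<close> because \<open>form e e = \<alpha>\<close>.\<close>
    let ?G = "\<lambda>z. K (fst z) (snd z) - \<alpha> * (e (fst z) * e (snd z))" and ?H = "\<lambda>z. \<eta> (fst z) * \<eta> (snd z)"
    have ee: "integrable MM (\<lambda>z. (e (fst z) * e (snd z))\<^sup>2)" "(\<integral>z. (e (fst z) * e (snd z))\<^sup>2 \<partial>MM) = 1"
      using tensor_integrable[OF e_meas e_meas e_sq e_sq] by (simp_all add: e1)
    have HH: "integrable MM (\<lambda>z. (?H z)\<^sup>2)" "(\<integral>z. (?H z)\<^sup>2 \<partial>MM) = N * N"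
      using tensor_integrable[OF _ _ i\<eta> i\<eta>] by (simp_all add: N_def)
    have Gsq: "(?G z)\<^sup>2 = (K (fst z) (snd z))\<^sup>2 - 2 * \<alpha> * (K (fst z) (snd z) * (e (fst z) * e (snd z))) + \<alpha>\<^sup>2 * (e (fst z) * e (snd z))\<^sup>2" for z
      by (simp add: power2_eq_square algebra_simps)
    have iK: "integrable MM (\<lambda>z. (K (fst z) (snd z))\<^sup>2)" using HS by (simp add: split_beta')
    have iG: "integrable MM (\<lambda>z. (?G z)\<^sup>2)" unfolding Gsq using iK fi[of e e] e_sq ee by simp
    have "(\<integral>z. (?G z)\<^sup>2 \<partial>MM) = (\<integral>z. (K (fst z) (snd z))\<^sup>2 \<partial>MM) - 2 * \<alpha> * form e e + \<alpha>\<^sup>2 * 1"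
      unfolding Gsq form_def ee(2)[symmetric] using iK fi[of e e] e_sq ee(1) by simp
    also have "\<dots> \<le> d\<^sup>2" using d(1) by (simp add: e_form split_beta' power2_eq_square)
    finally have G2: "(\<integral>z. (?G z)\<^sup>2 \<partial>MM) \<le> d\<^sup>2" .
    have i1: "integrable MM (\<lambda>z. K (fst z) (snd z) * ?H z)" using fi[of \<eta> \<eta>] i\<eta> by simp
    have i2: "integrable MM (\<lambda>(p, q). (e p * \<eta> p) * (e q * \<eta> q))"
      by (rule integrable_prod_mult[OF sf sf]) (use i\<eta>e in \<open>simp_all add: mult.commute\<close>)
    have z: "(\<integral>(p, q). (e p * \<eta> p) * (e q * \<eta> q) \<partial>MM) = 0"
      using integral_fst'[OF i2] \<eta>e by (simp add: mult.commute)
    have "(\<integral>z. ?G z * ?H z \<partial>MM) = (\<integral>z. K (fst z) (snd z) * ?H z - \<alpha> * (case z of (p, q) \<Rightarrow> (e p * \<eta> p) * (e q * \<eta> q)) \<partial>MM)"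
      by (rule Bochner_Integration.integral_cong) (auto simp: algebra_simps)
    also have "\<dots> = form \<eta> \<eta>" using i1 i2 z by (simp add: form_def)
    finally have GH: "(\<integral>z. ?G z * ?H z \<partial>MM) = form \<eta> \<eta>" .
    have "(\<integral>z. ?G z * ?H z \<partial>MM)\<^sup>2 \<le> (\<integral>z. (?G z)\<^sup>2 \<partial>MM) * (\<integral>z. (?H z)\<^sup>2 \<partial>MM)"
      by (rule Cauchy_Schwarz_integral[OF _ _ iG HH(1)]) measurable
    then have "(form \<eta> \<eta>)\<^sup>2 \<le> (\<integral>z. (?G z)\<^sup>2 \<partial>MM) * (N * N)"
      unfolding GH HH(2) .
    also have "\<dots> \<le> d\<^sup>2 * (N * N)" by (rule mult_right_mono[OF G2]) (simp add: N0)
    also have "\<dots> = (d * N)\<^sup>2" by (simp add: power2_eq_square)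
    finally show ?thesis by (rule power2_le_imp_le) (use d(2) N0 in simp)
  qed
  \<comment> \<open>The cross term is absorbed by the deficits \<open>1 - \<alpha>\<close> and
    \<open>1 - d\<close> of the diagonal; \<open>gap\<close> is the discriminant condition for
    this.\<close>
  moreover have "2 * (c * I) \<le> (1 - \<alpha>) * c\<^sup>2 + (1 - d) * N"
  proof (rule power2_le_imp_le)
    have "I\<^sup>2 \<le> N * (\<integral>p. (b p)\<^sup>2 \<partial>M)"
      unfolding I_def N_def by (rule Cauchy_Schwarz_integral) (use i\<eta> b_sq in auto)
    also have "\<dots> \<le> N * ((1 - \<alpha>) * (1 - d))" using gap N0 by (rule mult_left_mono)
    finally have "c\<^sup>2 * I\<^sup>2 \<le> c\<^sup>2 * (N * ((1 - \<alpha>) * (1 - d)))" by (rule mult_left_mono) simp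
    then have "(2 * (c * I))\<^sup>2 \<le> 4 * (((1 - \<alpha>) * c\<^sup>2) * ((1 - d) * N))" by (simp add: power_mult_distrib mult_ac)
    also have "\<dots> \<le> ((1 - \<alpha>) * c\<^sup>2 + (1 - d) * N)\<^sup>2"
      using zero_le_power2[of "(1 - \<alpha>) * c\<^sup>2 - (1 - d) * N"] by (simp add: power2_eq_square algebra_simps)
    finally show "(2 * (c * I))\<^sup>2 \<le> ((1 - \<alpha>) * c\<^sup>2 + (1 - d) * N)\<^sup>2" .
    show "0 \<le> (1 - \<alpha>) * c\<^sup>2 + (1 - d) * N" using al d N0 by simp
  qed
  ultimately have "form f f \<le> c\<^sup>2 + N" unfolding 1 by (simp add: algebra_simps)
  then show ?thesis by (simp add: N)
qed

end

text \<open>The bound 1 for the norm of the radial operator. An infinite right side is trivial;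
  otherwise all functions are extended by 0 to the whole line, where \<open>HS_block\<close> is
  instantiated with a stationary trial function.\<close>

lemma yuk_form_le:
  fixes f :: "real \<Rightarrow> real"
  assumes [measurable]: "f \<in> borel_measurable borel" and nn: "\<And>r. f r \<ge> 0"
  shows "(\<integral>\<^sup>+r. \<integral>\<^sup>+s. ennreal (yuk r s * f r * f s) * indicator {0<..} s * indicator {0<..} r \<partial>lborel \<partial>lborel)
    \<le> (\<integral>\<^sup>+r. ennreal ((f r)\<^sup>2) * indicator {0<..} r \<partial>lborel)"
proof (cases "(\<integral>\<^sup>+r. ennreal ((f r)\<^sup>2) * indicator {0<..} r \<partial>lborel) = \<infinity>")
  case False
  obtain a where a: "a > 0" and lo: "2 * a * lapI a \<ge> 93/100" and stat: "lapI a = a * lapJ a"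
    using exists_stationary by blast
  interpret trial a by unfold_locales (rule a)
  have lo: "\<alpha> \<ge> 93/100" using lo by (simp add: \<alpha>_def)
  have zn: "5 * (\<integral>p. (z p)\<^sup>2 * indicator {0<..} p \<partial>lborel) \<le> 1 - \<alpha>\<^sup>2" by (rule z_norm_le[OF stat])
  have "(\<integral>p. (z p)\<^sup>2 * indicator {0<..} p \<partial>lborel) \<ge> 0" by (intro integral_nonneg_AE) auto
  then have "\<alpha>\<^sup>2 \<le> 1" using zn by linarith
  then have al1: "\<alpha> \<le> 1" using lo by (simp add: abs_le_square_iff[of \<alpha> 1, simplified, symmetric])
  define K where "K p q = yuk p q * indicator {0<..} p * indicator {0<..} q" for p q
  define e where "e p = e0 p * indicator {0<..} p" for p
  define b where "b p = z p * indicator {0<..} p" for p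
  define g where "g p = f p * indicator {0<..} p" for p
  have ind: "(u * indicator {0<..} p)\<^sup>2 = u\<^sup>2 * indicator {0<..} p" for u p :: real by (auto split: split_indicator)
  have [measurable]: "(\<lambda>(p, q). K p q) \<in> borel_measurable (borel \<Otimes>\<^sub>M borel)" unfolding K_def by measurable
  have K_nn: "K p q \<ge> 0" for p q unfolding K_def using yuk_pos[of p q] by (auto split: split_indicator)
  have KK: "(\<integral>\<^sup>+z. ennreal ((K (fst z) (snd z))\<^sup>2) \<partial>(lborel \<Otimes>\<^sub>M lborel)) = ennreal (pi\<^sup>2 / 8)"
  proof -
    have "(\<integral>\<^sup>+z. ennreal ((K (fst z) (snd z))\<^sup>2) \<partial>(lborel \<Otimes>\<^sub>M lborel)) = (\<integral>\<^sup>+p. \<integral>\<^sup>+q. ennreal ((K p q)\<^sup>2) \<partial>lborel \<partial>lborel)"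
      by (subst lborel.nn_integral_fst[symmetric]) auto
    also have "\<dots> = (\<integral>\<^sup>+p. \<integral>\<^sup>+q. ennreal ((yuk p q)\<^sup>2) * indicator {0<..} q * indicator {0<..} p \<partial>lborel \<partial>lborel)"
      by (intro nn_integral_cong) (auto simp: K_def split: split_indicator)
    finally show ?thesis using nn_integral_yuk_sq by simp
  qed
  have iK: "integrable (lborel \<Otimes>\<^sub>M lborel) (\<lambda>z. (K (fst z) (snd z))\<^sup>2)"
    by (rule integrableI_nonneg) (auto simp: KK)
  have HS: "(\<integral>z. (K (fst z) (snd z))\<^sup>2 \<partial>(lborel \<Otimes>\<^sub>M lborel)) = pi\<^sup>2 / 8"
    by (rule integral_eq_nn_integral[THEN trans]) (auto simp: KK)
  text \<open>This \<open>d\<close> makes \<open>(1 - \<alpha>) * (1 - d)\<close> equal to the bound \<open>(1 - \<alpha>\<^sup>2) / 5\<close> from the Laguerre gap.\<close>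
  interpret HS_block lborel K e b \<alpha> "(4 - \<alpha>) / 5"
  proof (rule HS_block.intro)
    show "sigma_finite_measure (lborel :: real measure)" by (rule lborel.sigma_finite_measure_axioms)
    show "K p q = K q p" for p q unfolding K_def yuk_def by (simp add: power2_commute add.commute mult_ac)
    show "integrable (lborel \<Otimes>\<^sub>M lborel) (\<lambda>(p, q). (K p q)\<^sup>2)" using iK by (simp add: split_beta')
    show "(\<integral>q. K p q * e q \<partial>lborel) = \<alpha> * e p + b p" for p
    proof (cases "p > 0")
      case True
      have "(\<integral>q. K p q * e q \<partial>lborel) = y p"
        unfolding y_def by (rule Bochner_Integration.integral_cong) (use True in \<open>auto simp: K_def e_def split: split_indicator\<close>)
      then show ?thesis using True by (simp add: e_def b_def z_def)
    qed (simp add: K_def e_def b_def)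
    show "integrable lborel (\<lambda>p. (e p)\<^sup>2)" "(\<integral>p. (e p)\<^sup>2 \<partial>lborel) = 1" "integrable lborel (\<lambda>p. (b p)\<^sup>2)"
      unfolding e_def b_def ind using e0_integrals z_sq_integrable by simp_all
    have "e p * b p = e0 p * z p * indicator {0<..} p" for p by (simp add: e_def b_def split: split_indicator)
    then show "(\<integral>p. e p * b p \<partial>lborel) = 0" using e0_z_integral by simp
    \<comment> \<open>Together with \<open>93 / 100 * \<alpha> \<le> \<alpha>\<^sup>2\<close> this
      reduces the quadratic condition on \<alpha> to a linear one, which holds from 93/100
      on.\<close>
    have "pi\<^sup>2 \<le> (31416 / 10000)\<^sup>2" using pi_approx by (intro power_mono) auto
    moreover have "93 / 100 * \<alpha> \<le> \<alpha>\<^sup>2" using lo by (simp add: power2_eq_square mult_right_mono)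
    ultimately have "pi\<^sup>2 / 8 - \<alpha>\<^sup>2 \<le> ((4 - \<alpha>) / 5)\<^sup>2"
      using lo by (simp add: power2_diff power_divide) 
    then show "(\<integral>(p, q). (K p q)\<^sup>2 \<partial>(lborel \<Otimes>\<^sub>M lborel)) - \<alpha>\<^sup>2 \<le> ((4 - \<alpha>) / 5)\<^sup>2"
      using HS by (simp add: split_beta')
    show "0 \<le> (4 - \<alpha>) / 5" "(4 - \<alpha>) / 5 \<le> 1" "\<alpha> \<le> 1" using lo al1 by simp_all
    show "(\<integral>p. (b p)\<^sup>2 \<partial>lborel) \<le> (1 - \<alpha>) * (1 - (4 - \<alpha>) / 5)"
      unfolding b_def ind using zn by (simp add: power2_eq_square field_simps)
  qed (simp_all add: e_def[abs_def] b_def[abs_def])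
  have gn: "(\<integral>\<^sup>+r. ennreal ((g r)\<^sup>2) \<partial>lborel) = (\<integral>\<^sup>+r. ennreal ((f r)\<^sup>2) * indicator {0<..} r \<partial>lborel)"
    by (intro nn_integral_cong) (auto simp: g_def split: split_indicator)
  have [measurable]: "g \<in> borel_measurable borel" unfolding g_def by measurable
  have gi: "integrable lborel (\<lambda>r. (g r)\<^sup>2)"
    by (rule integrableI_nonneg) (use False in \<open>auto simp: gn less_top[symmetric]\<close>)
  have g0: "g r \<ge> 0" for r using nn by (simp add: g_def)
  have i: "integrable (lborel \<Otimes>\<^sub>M lborel) (\<lambda>z. K (fst z) (snd z) * (g (fst z) * g (snd z)))"
    by (rule form_integrable) (use gi in auto)
  have "(\<integral>\<^sup>+r. \<integral>\<^sup>+s. ennreal (yuk r s * f r * f s) * indicator {0<..} s * indicator {0<..} r \<partial>lborel \<partial>lborel)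
    = (\<integral>\<^sup>+r. \<integral>\<^sup>+s. ennreal (K r s * (g r * g s)) \<partial>lborel \<partial>lborel)"
    by (intro nn_integral_cong) (auto simp: K_def g_def mult_ac split: split_indicator)
  also have "\<dots> = (\<integral>\<^sup>+z. ennreal (K (fst z) (snd z) * (g (fst z) * g (snd z))) \<partial>(lborel \<Otimes>\<^sub>M lborel))"
    by (subst lborel.nn_integral_fst[symmetric]) auto
  also have "\<dots> = ennreal (form g g)"
    unfolding form_def by (rule nn_integral_eq_integral[OF i]) (simp add: K_nn g0)
  also have "\<dots> \<le> ennreal (\<integral>r. (g r)\<^sup>2 \<partial>lborel)"
    by (intro ennreal_leI form_le) (use gi in auto)
  also have "\<dots> = (\<integral>\<^sup>+r. ennreal ((g r)\<^sup>2) \<partial>lborel)"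
    by (rule nn_integral_eq_integral[symmetric, OF gi]) simp
  finally show ?thesis by (simp only: gn)
qed simp

section \<open>Rescaling and conclusion\<close>

text \<open>In the sense of forms, the Bessel potential is at most the square root of minus the
  Laplacian, divided by \<beta>. Dilation by \<beta> normalizes the kernel to
  \<open>1 / (1 + (norm (p - q))\<^sup>2)\<close>, and the weight \<open>norm p\<close> together
  with the area element makes the square of \<open>r * prof r\<close>.\<close>

lemma potential_le_kinetic:
  assumes ft: "has_fourier_transform 1 \<psi> \<phi>" and sq: "square_integrable \<psi>" and b: "\<beta> > 0"
  shows "(\<integral>\<^sup>+x. ennreal (potential_density \<beta> \<psi> x) \<partial>lborel)
    \<le> ennreal (1 / ((2 * pi)\<^sup>2 * \<beta>)) * (\<integral>\<^sup>+p. ennreal (norm p * (cmod (\<phi> p))\<^sup>2) \<partial>lborel)"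
proof -
  have [measurable]: "\<phi> \<in> borel_measurable borel" and L2: "integrable lborel (\<lambda>p. (cmod (\<phi> p))\<^sup>2)"
    using ft by (simp_all add: has_fourier_transform_def square_integrable_def)
  define u where "u p = cmod (\<phi> (\<beta> *\<^sub>R p))" for p
  have [measurable]: "u \<in> borel_measurable borel" unfolding u_def by measurable
  have D: "DIM(real^2) = 2" by simp
  note sc = nn_integral_scale[where 'a="real^2" and c=\<beta>, OF _ b, unfolded D]
  have "(\<integral>\<^sup>+p. ennreal ((cmod (\<phi> p))\<^sup>2) \<partial>lborel) = ennreal (\<beta>\<^sup>2) * (\<integral>\<^sup>+p. ennreal ((u p)\<^sup>2) \<partial>lborel)"
    unfolding u_def by (rule sc) measurable
  moreover have "(\<integral>\<^sup>+p. ennreal ((cmod (\<phi> p))\<^sup>2) \<partial>lborel) < \<infinity>"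
    using nn_integral_eq_integral[OF L2] by simp
  ultimately have "(\<integral>\<^sup>+p. ennreal ((u p)\<^sup>2) \<partial>lborel) < \<infinity>"
    using b by (auto simp: ennreal_mult_less_top)
  then interpret radial_reduction u by unfold_locales (simp_all add: u_def[abs_def])
  define W where "W = (\<integral>\<^sup>+p. ennreal (norm p * (u p)\<^sup>2) \<partial>lborel)"
  \<comment> \<open>Cutting off at 0 makes \<open>f\<close> nonnegative on the whole line, as
    \<open>yuk_form_le\<close> demands, and changes nothing on the positive axis.\<close>
  define f where "f r = max 0 r * prof r" for r
  have [measurable]: "f \<in> borel_measurable borel" unfolding f_def by measurable
  have "(\<integral>\<^sup>+p. \<integral>\<^sup>+q. ennreal (u p * u q / (1 + (norm (p - q))\<^sup>2)) \<partial>lborel \<partial>lborel)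
     \<le> ennreal (2 * pi) * (\<integral>\<^sup>+r. \<integral>\<^sup>+s. ennreal (yuk r s * (r * prof r) * (s * prof s)) * indicator {0<..} s * indicator {0<..} r \<partial>lborel \<partial>lborel)"
    by (rule form_le_radial_form)
  also have "(\<integral>\<^sup>+r. \<integral>\<^sup>+s. ennreal (yuk r s * (r * prof r) * (s * prof s)) * indicator {0<..} s * indicator {0<..} r \<partial>lborel \<partial>lborel)
     = (\<integral>\<^sup>+r. \<integral>\<^sup>+s. ennreal (yuk r s * f r * f s) * indicator {0<..} s * indicator {0<..} r \<partial>lborel \<partial>lborel)"
    by (intro nn_integral_cong) (simp add: f_def split: split_indicator)
  also have "ennreal (2 * pi) * \<dots> \<le> ennreal (2 * pi) * (\<integral>\<^sup>+r. ennreal ((f r)\<^sup>2) * indicator {0<..} r \<partial>lborel)"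
    by (intro mult_left_mono yuk_form_le) (simp_all add: f_def prof_nn)
  also have "(\<integral>\<^sup>+r. ennreal ((f r)\<^sup>2) * indicator {0<..} r \<partial>lborel) = (\<integral>\<^sup>+r. ennreal r * ennreal r * ennreal ((prof r)\<^sup>2) * indicator {0<..} r \<partial>lborel)"
    by (intro nn_integral_cong) (auto simp: f_def power_mult_distrib ennreal_mult[symmetric] power2_eq_square split: split_indicator)
  also have "\<dots> = W"
    unfolding W_def using nn_integral_radial_weight[of ennreal] by (simp add: ennreal_mult)
  finally have uW: "(\<integral>\<^sup>+p. \<integral>\<^sup>+q. ennreal (u p * u q / (1 + (norm (p - q))\<^sup>2)) \<partial>lborel \<partial>lborel) \<le> ennreal (2 * pi) * W" .
  have T: "(\<integral>\<^sup>+p. ennreal (norm p * (cmod (\<phi> p))\<^sup>2) \<partial>lborel) = ennreal (\<beta> ^ 3) * W"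
  proof -
    have "(\<integral>\<^sup>+p. ennreal (norm p * (cmod (\<phi> p))\<^sup>2) \<partial>lborel) = ennreal (\<beta>\<^sup>2) * (\<integral>\<^sup>+p. ennreal (norm (\<beta> *\<^sub>R p) * (cmod (\<phi> (\<beta> *\<^sub>R p)))\<^sup>2) \<partial>lborel)"
      by (rule sc) measurable
    also have "(\<integral>\<^sup>+p. ennreal (norm (\<beta> *\<^sub>R p) * (cmod (\<phi> (\<beta> *\<^sub>R p)))\<^sup>2) \<partial>lborel) = (\<integral>\<^sup>+p. ennreal \<beta> * ennreal (norm p * (u p)\<^sup>2) \<partial>lborel)"
      using b by (intro nn_integral_cong) (simp add: u_def ennreal_mult[symmetric] mult.assoc)
    also have "\<dots> = ennreal \<beta> * W" unfolding W_def by (rule nn_integral_cmult) measurable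
    finally show ?thesis using b by (simp add: mult.assoc[symmetric] ennreal_mult[symmetric] power3_eq_cube power2_eq_square)
  qed
  let ?F = "\<lambda>k p. ennreal (cmod (\<phi> (p + k)) * cmod (\<phi> p) / (\<beta>\<^sup>2 + (norm k)\<^sup>2))"
  \<comment> \<open>Both variables are dilated. The Jacobian of one of them cancels against the
    denominator, that of the other stays in front.\<close>
  have "(\<integral>\<^sup>+k. \<integral>\<^sup>+p. ?F k p \<partial>lborel \<partial>lborel) = ennreal (\<beta>\<^sup>2) * (\<integral>\<^sup>+k. \<integral>\<^sup>+p. ?F (\<beta> *\<^sub>R k) p \<partial>lborel \<partial>lborel)"
    by (rule sc) measurable
  also have "(\<integral>\<^sup>+k. \<integral>\<^sup>+p. ?F (\<beta> *\<^sub>R k) p \<partial>lborel \<partial>lborel) = (\<integral>\<^sup>+k. ennreal (\<beta>\<^sup>2) * (\<integral>\<^sup>+p. ?F (\<beta> *\<^sub>R k) (\<beta> *\<^sub>R p) \<partial>lborel) \<partial>lborel)"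
    by (rule nn_integral_cong, rule sc) measurable
  also have "\<dots> = (\<integral>\<^sup>+k. \<integral>\<^sup>+p. ennreal (u p * u (k + p) / (1 + (norm (p - (k + p)))\<^sup>2)) \<partial>lborel \<partial>lborel)"
  proof (rule nn_integral_cong)
    fix k :: "real^2"
    have "ennreal (\<beta>\<^sup>2) * (\<integral>\<^sup>+p. ?F (\<beta> *\<^sub>R k) (\<beta> *\<^sub>R p) \<partial>lborel) = (\<integral>\<^sup>+p. ennreal (\<beta>\<^sup>2) * ?F (\<beta> *\<^sub>R k) (\<beta> *\<^sub>R p) \<partial>lborel)"
      by (rule nn_integral_cmult[symmetric]) measurable
    also have "\<dots> = (\<integral>\<^sup>+p. ennreal (u p * u (k + p) / (1 + (norm (p - (k + p)))\<^sup>2)) \<partial>lborel)"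
    proof (rule nn_integral_cong)
      fix p :: "real^2"
      have "\<beta>\<^sup>2 + (norm (\<beta> *\<^sub>R k))\<^sup>2 = \<beta>\<^sup>2 * (1 + (norm k)\<^sup>2)" by (simp add: power_mult_distrib distrib_left)
      then have "\<beta>\<^sup>2 * (cmod (\<phi> (\<beta> *\<^sub>R p + \<beta> *\<^sub>R k)) * cmod (\<phi> (\<beta> *\<^sub>R p)) / (\<beta>\<^sup>2 + (norm (\<beta> *\<^sub>R k))\<^sup>2))
         = u p * u (k + p) / (1 + (norm (p - (k + p)))\<^sup>2)"
        using b by (simp add: u_def scaleR_add_right add.commute mult.commute)
      then show "ennreal (\<beta>\<^sup>2) * ?F (\<beta> *\<^sub>R k) (\<beta> *\<^sub>R p) = ennreal (u p * u (k + p) / (1 + (norm (p - (k + p)))\<^sup>2))"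
        by (subst ennreal_mult[symmetric]) auto
    qed
    finally show "ennreal (\<beta>\<^sup>2) * (\<integral>\<^sup>+p. ?F (\<beta> *\<^sub>R k) (\<beta> *\<^sub>R p) \<partial>lborel)
       = (\<integral>\<^sup>+p. ennreal (u p * u (k + p) / (1 + (norm (p - (k + p)))\<^sup>2)) \<partial>lborel)" .
  qed
  also have "\<dots> = (\<integral>\<^sup>+p. \<integral>\<^sup>+k. ennreal (u p * u (k + p) / (1 + (norm (p - (k + p)))\<^sup>2)) \<partial>lborel \<partial>lborel)"
    by (rule lborel_pair.Fubini') measurable
  also have "\<dots> = (\<integral>\<^sup>+p. \<integral>\<^sup>+q. ennreal (u p * u q / (1 + (norm (p - q))\<^sup>2)) \<partial>lborel \<partial>lborel)"
    by (rule nn_integral_cong, rule nn_integral_shift) measurable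
  also have "ennreal (\<beta>\<^sup>2) * \<dots> \<le> ennreal (\<beta>\<^sup>2) * (ennreal (2 * pi) * W)"
    by (rule mult_left_mono[OF uW]) simp
  finally have "(\<integral>\<^sup>+k. \<integral>\<^sup>+p. ?F k p \<partial>lborel \<partial>lborel) \<le> ennreal (\<beta>\<^sup>2) * (ennreal (2 * pi) * W)" .
  then have "ennreal (1 / (2 * pi) ^ 3) * (\<integral>\<^sup>+k. \<integral>\<^sup>+p. ?F k p \<partial>lborel \<partial>lborel) \<le> ennreal (1 / (2 * pi) ^ 3) * (ennreal (\<beta>\<^sup>2) * (ennreal (2 * pi) * W))"
    by (rule mult_left_mono) simp
  also have "\<dots> = ennreal (1 / ((2 * pi)\<^sup>2 * \<beta>)) * (ennreal (\<beta> ^ 3) * W)"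
  proof -
    have "1 / (2 * pi) ^ 3 * (\<beta>\<^sup>2 * (2 * pi)) = 1 / ((2 * pi)\<^sup>2 * \<beta>) * \<beta> ^ 3"
      using b by (simp add: power3_eq_cube power2_eq_square)
    then have "ennreal (1 / (2 * pi) ^ 3) * (ennreal (\<beta>\<^sup>2) * ennreal (2 * pi)) = ennreal (1 / ((2 * pi)\<^sup>2 * \<beta>)) * ennreal (\<beta> ^ 3)"
      using b by (simp only: ennreal_mult[symmetric] zero_le_power2 zero_le_power zero_le_divide_iff zero_le_mult_iff pi_ge_zero zero_le_one zero_le_numeral less_imp_le simp_thms)
    then show ?thesis by (simp only: mult.assoc[symmetric])
  qed
  finally show ?thesis
    using potential_le_momentum[OF ft sq b] unfolding T by (rule order_trans[rotated])
qed

section \<open>The transform for general \<open>hbar\<close>, and the conclusion\<close>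

lemma has_fourier_transform_rescale:
  assumes ft: "has_fourier_transform 1 \<psi> \<phi>" and sq: "square_integrable \<psi>" and h: "hbar > 0"
  shows "has_fourier_transform hbar \<psi> (\<lambda>p. \<phi> ((1 / hbar) *\<^sub>R p))"
proof -
  have [measurable]: "\<phi> \<in> borel_measurable borel" and L2: "integrable lborel (\<lambda>p. (cmod (\<phi> p))\<^sup>2)"
    using ft by (simp_all add: has_fourier_transform_def square_integrable_def)
  have [measurable]: "\<psi> \<in> borel_measurable borel" using sq by (simp add: square_integrable_def)
  have [measurable]: "cball (0::real^2) R \<in> sets borel" for R by simp
  have sc: "(\<integral>\<^sup>+p. f ((1 / hbar) *\<^sub>R p) \<partial>lborel) = ennreal (hbar\<^sup>2) * (\<integral>\<^sup>+p. f p \<partial>lborel)"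
    if [measurable]: "f \<in> borel_measurable borel" for f :: "real^2 \<Rightarrow> ennreal"
    using nn_integral_scale[of "\<lambda>p. f ((1 / hbar) *\<^sub>R p)" hbar] h by simp
  have fi: "fourier_integral hbar g p = fourier_integral 1 g ((1 / hbar) *\<^sub>R p)" for g p
    by (simp add: fourier_integral_def)
  have "integrable lborel (\<lambda>p. (cmod (\<phi> ((1 / hbar) *\<^sub>R p)))\<^sup>2)"
  proof (rule integrableI_nonneg)
    show "(\<integral>\<^sup>+p. ennreal ((cmod (\<phi> ((1 / hbar) *\<^sub>R p)))\<^sup>2) \<partial>lborel) < \<infinity>"
      using sc[of "\<lambda>p. ennreal ((cmod (\<phi> p))\<^sup>2)"] nn_integral_eq_integral[OF L2] by (simp add: ennreal_mult_less_top)
  qed auto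
  moreover have "((\<lambda>R. ennreal (hbar\<^sup>2) * (\<integral>\<^sup>+p. ennreal ((cmod (fourier_integral 1 (\<lambda>x. indicator (cball 0 R) x * \<psi> x) p - \<phi> p))\<^sup>2) \<partial>lborel)) \<longlongrightarrow> ennreal (hbar\<^sup>2) * 0) at_top"
    using ft by (intro ennreal_tendsto_cmult) (simp_all add: has_fourier_transform_def)
  moreover have "(\<integral>\<^sup>+p. ennreal ((cmod (fourier_integral hbar (\<lambda>x. indicator (cball 0 R) x * \<psi> x) p - \<phi> ((1 / hbar) *\<^sub>R p)))\<^sup>2) \<partial>lborel)
    = ennreal (hbar\<^sup>2) * (\<integral>\<^sup>+p. ennreal ((cmod (fourier_integral 1 (\<lambda>x. indicator (cball 0 R) x * \<psi> x) p - \<phi> p))\<^sup>2) \<partial>lborel)" for R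
    unfolding fi by (rule sc[of "\<lambda>p. ennreal ((cmod (fourier_integral 1 (\<lambda>x. indicator (cball 0 R) x * \<psi> x) p - \<phi> p))\<^sup>2)"]) measurable
  ultimately show ?thesis unfolding has_fourier_transform_def square_integrable_def by simp
qed

text \<open>\<open>fourier\<close> picks some representative of the transform. Uniqueness identifies
  it almost everywhere with the rescaled transform, so that its integrals can be computed.\<close>

lemma has_fourier_transform_unique:
  assumes sq: "square_integrable \<psi>" and f: "has_fourier_transform hbar \<psi> \<phi>" and g: "has_fourier_transform hbar \<psi> \<xi>"
  shows "AE p in lborel. \<phi> p = \<xi> p"
proof -
  have [measurable]: "\<phi> \<in> borel_measurable borel" "\<xi> \<in> borel_measurable borel" "\<psi> \<in> borel_measurable borel"
    using f g sq by (simp_all add: has_fourier_transform_def square_integrable_def)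
  have [measurable]: "cball (0::real^2) R \<in> sets borel" for R by simp
  define F where "F R = fourier_integral hbar (\<lambda>x. indicator (cball 0 R) x * \<psi> x)" for R
  have [measurable]: "F R \<in> borel_measurable borel" for R unfolding F_def by measurable
  let ?n = "\<lambda>R f. \<integral>\<^sup>+p. ennreal ((cmod (F R p - f p))\<^sup>2) \<partial>lborel"
  have le: "(\<integral>\<^sup>+p. ennreal ((cmod (\<phi> p - \<xi> p))\<^sup>2) \<partial>lborel) \<le> ennreal 2 * ?n R \<phi> + ennreal 2 * ?n R \<xi>" for R
  proof -
    have "ennreal ((cmod (\<phi> p - \<xi> p))\<^sup>2) \<le> ennreal 2 * ennreal ((cmod (F R p - \<phi> p))\<^sup>2) + ennreal 2 * ennreal ((cmod (F R p - \<xi> p))\<^sup>2)" for p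
      using ennreal_cmod_add_sq_le[of 1 "\<phi> p - F R p" "F R p - \<xi> p"] by (simp add: norm_minus_commute)
    then have "(\<integral>\<^sup>+p. ennreal ((cmod (\<phi> p - \<xi> p))\<^sup>2) \<partial>lborel)
      \<le> (\<integral>\<^sup>+p. ennreal 2 * ennreal ((cmod (F R p - \<phi> p))\<^sup>2) + ennreal 2 * ennreal ((cmod (F R p - \<xi> p))\<^sup>2) \<partial>lborel)"
      by (intro nn_integral_mono)
    also have "\<dots> = ennreal 2 * ?n R \<phi> + ennreal 2 * ?n R \<xi>"
      by (subst nn_integral_add, measurable, subst (1 2) nn_integral_cmult, measurable)
    finally show ?thesis .
  qed
  have "((\<lambda>R. ennreal 2 * ?n R \<phi> + ennreal 2 * ?n R \<xi>) \<longlongrightarrow> ennreal 2 * 0 + ennreal 2 * 0) at_top"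
    using f g by (intro tendsto_add ennreal_tendsto_cmult) (simp_all add: has_fourier_transform_def F_def)
  then have "(\<integral>\<^sup>+p. ennreal ((cmod (\<phi> p - \<xi> p))\<^sup>2) \<partial>lborel) \<le> ennreal 2 * 0 + ennreal 2 * 0"
    by (rule tendsto_lowerbound) (use le in \<open>auto intro!: always_eventually\<close>)
  then have "(\<integral>\<^sup>+p. ennreal ((cmod (\<phi> p - \<xi> p))\<^sup>2) \<partial>lborel) = 0" by simp
  then have "AE p in lborel. ennreal ((cmod (\<phi> p - \<xi> p))\<^sup>2) = 0"
    by (subst (asm) nn_integral_0_iff_AE) auto
  then show ?thesis by eventually_elim simp
qed

text \<open>Without the mass term the kinetic weight is at least \<open>c\<close> times the norm of
  \<open>p\<close>. This leaves \<open>c * hbar\<close> against \<open>\<gamma> / \<beta>\<close> as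
  factors of the same integral \<open>?T\<close>, which explains the threshold. Integrability is
  shown alongside because a divergent integral would count as 0 in the forms.\<close>

lemma B_FW_nonneg:
  assumes h: "hbar > 0" and c: "c > 0" and m: "m > 0" and b: "\<beta> > 0" and g: "\<gamma> \<ge> 0" "\<gamma> \<le> hbar * c * \<beta>"
    and psi: "\<psi> \<in> H_half"
  shows "has_fourier_transform hbar \<psi> (fourier hbar \<psi>)"
    and "integrable lborel (kinetic_density hbar c m \<psi>)"
    and "integrable lborel (potential_density \<beta> \<psi>)"
    and "B_FW hbar c m \<beta> \<gamma> \<psi> \<ge> 0"
proof -
  obtain \<phi> where sq: "square_integrable \<psi>" and ft: "has_fourier_transform 1 \<psi> \<phi>"
    and H: "integrable lborel (\<lambda>p. sqrt (1 + (norm p)\<^sup>2) * (cmod (\<phi> p))\<^sup>2)"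
    using psi unfolding H_half_def by blast
  have [measurable]: "\<phi> \<in> borel_measurable borel" using ft by (simp add: has_fourier_transform_def square_integrable_def)
  have [measurable]: "\<psi> \<in> borel_measurable borel" using sq by (simp add: square_integrable_def)
  have fth: "has_fourier_transform hbar \<psi> (\<lambda>p. \<phi> ((1 / hbar) *\<^sub>R p))"
    by (rule has_fourier_transform_rescale[OF ft sq h])
  then show ftf: "has_fourier_transform hbar \<psi> (fourier hbar \<psi>)" unfolding fourier_def by (rule someI[of "has_fourier_transform hbar \<psi>"])
  have [measurable]: "fourier hbar \<psi> \<in> borel_measurable borel"
    using ftf by (simp add: has_fourier_transform_def square_integrable_def)
  have ae: "AE p in lborel. fourier hbar \<psi> p = \<phi> ((1 / hbar) *\<^sub>R p)"
    by (rule has_fourier_transform_unique[OF sq ftf fth])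
  \<comment> \<open>The kinetic density after dilation by \<open>hbar\<close>, expressed by the
    transform with \<open>hbar = 1\<close>. The Jacobian \<open>hbar\<^sup>2\<close> cancels the one
    in the prefactor of \<open>kinetic_form\<close>.\<close>
  let ?k = "\<lambda>p. sqrt (c\<^sup>2 * (hbar\<^sup>2 * (norm p)\<^sup>2) + m\<^sup>2 * c ^ 4) * (cmod (\<phi> p))\<^sup>2"
  have k_meas [measurable]: "kinetic_density hbar c m \<psi> \<in> borel_measurable borel"
    unfolding kinetic_density_def[abs_def] by measurable
  have k_nn: "kinetic_density hbar c m \<psi> p \<ge> 0" for p unfolding kinetic_density_def by simp
  have kin: "(\<integral>\<^sup>+p. ennreal (kinetic_density hbar c m \<psi> p) \<partial>lborel) = ennreal (hbar\<^sup>2) * (\<integral>\<^sup>+p. ennreal (?k p) \<partial>lborel)"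
  proof -
    have "(\<integral>\<^sup>+p. ennreal (kinetic_density hbar c m \<psi> p) \<partial>lborel)
       = (\<integral>\<^sup>+p. ennreal (sqrt (c\<^sup>2 * (norm p)\<^sup>2 + m\<^sup>2 * c ^ 4) * (cmod (\<phi> ((1 / hbar) *\<^sub>R p)))\<^sup>2) \<partial>lborel)"
      by (rule nn_integral_cong_AE) (use ae in eventually_elim, simp add: kinetic_density_def)
    also have "\<dots> = ennreal (hbar ^ DIM(real^2)) * (\<integral>\<^sup>+p. ennreal (sqrt (c\<^sup>2 * (norm (hbar *\<^sub>R p))\<^sup>2 + m\<^sup>2 * c ^ 4) * (cmod (\<phi> ((1 / hbar) *\<^sub>R (hbar *\<^sub>R p))))\<^sup>2) \<partial>lborel)"
      by (rule nn_integral_scale[OF _ h]) measurable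
    finally show ?thesis using h by (simp add: power_mult_distrib)
  qed
  \<comment> \<open>The weight of \<open>H_half\<close> dominates the kinetic weight, which makes
    the kinetic form finite on all of the space.\<close>
  have kle: "?k p \<le> (c * hbar + m * c\<^sup>2) * (sqrt (1 + (norm p)\<^sup>2) * (cmod (\<phi> p))\<^sup>2)" for p
  proof -
    have "c\<^sup>2 * (hbar\<^sup>2 * (norm p)\<^sup>2) + m\<^sup>2 * c ^ 4 \<le> ((c * hbar + m * c\<^sup>2) * sqrt (1 + (norm p)\<^sup>2))\<^sup>2"
    proof -
      have "((c * hbar + m * c\<^sup>2) * sqrt (1 + (norm p)\<^sup>2))\<^sup>2 = (c * hbar + m * c\<^sup>2)\<^sup>2 * (1 + (norm p)\<^sup>2)"
        by (simp add: power_mult_distrib)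
      also have "\<dots> = c\<^sup>2 * (hbar\<^sup>2 * (norm p)\<^sup>2) + m\<^sup>2 * c ^ 4 + (c\<^sup>2 * hbar\<^sup>2 + m\<^sup>2 * c ^ 4 * (norm p)\<^sup>2 + 2 * (c * hbar) * (m * c\<^sup>2) * (1 + (norm p)\<^sup>2))"
        by algebra
      finally show ?thesis using h c m by simp
    qed
    then have "sqrt (c\<^sup>2 * (hbar\<^sup>2 * (norm p)\<^sup>2) + m\<^sup>2 * c ^ 4) \<le> (c * hbar + m * c\<^sup>2) * sqrt (1 + (norm p)\<^sup>2)"
      using h c m by (intro real_le_lsqrt) auto
    from mult_right_mono[OF this, of "(cmod (\<phi> p))\<^sup>2"] show ?thesis by (simp add: mult.assoc)
  qed
  have ik: "integrable lborel ?k"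
    by (rule Bochner_Integration.integrable_bound[OF integrable_mult_right[OF H, of "c * hbar + m * c\<^sup>2"]], measurable)
       (rule AE_I2, use order_trans[OF kle abs_ge_self] in simp)
  have fin: "(\<integral>\<^sup>+p. ennreal (kinetic_density hbar c m \<psi> p) \<partial>lborel) = ennreal (hbar\<^sup>2 * (\<integral>p. ?k p \<partial>lborel))"
    unfolding kin using nn_integral_eq_integral[OF ik] by (simp add: ennreal_mult')
  show ikin: "integrable lborel (kinetic_density hbar c m \<psi>)"
    by (rule integrableI_nonneg) (auto simp: fin k_nn)
  have "(\<integral>p. ?k p \<partial>lborel) \<ge> 0" by (rule integral_nonneg_AE) simp
  then have kin_val: "(\<integral>p. kinetic_density hbar c m \<psi> p \<partial>lborel) = hbar\<^sup>2 * (\<integral>p. ?k p \<partial>lborel)"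
    by (subst integral_eq_nn_integral) (auto simp: fin k_nn)
  let ?T = "\<integral>p. norm p * (cmod (\<phi> p))\<^sup>2 \<partial>lborel"
  have iT: "integrable lborel (\<lambda>p. norm p * (cmod (\<phi> p))\<^sup>2)"
    by (rule Bochner_Integration.integrable_bound[OF H])
       (auto intro!: AE_I2 mult_right_mono real_le_rsqrt simp: abs_mult)
  have "c * hbar * ?T = (\<integral>p. c * hbar * (norm p * (cmod (\<phi> p))\<^sup>2) \<partial>lborel)" by simp
  also have "\<dots> \<le> (\<integral>p. ?k p \<partial>lborel)"
  proof (rule integral_mono[OF integrable_mult_right[OF iT] ik])
    fix p :: "real^2"
    have "c * hbar * norm p \<le> sqrt (c\<^sup>2 * (hbar\<^sup>2 * (norm p)\<^sup>2) + m\<^sup>2 * c ^ 4)"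
      by (rule real_le_rsqrt) (simp add: power_mult_distrib)
    from mult_right_mono[OF this, of "(cmod (\<phi> p))\<^sup>2"]
    show "c * hbar * (norm p * (cmod (\<phi> p))\<^sup>2) \<le> ?k p" by (simp add: mult.assoc)
  qed
  finally have lower: "c * hbar * ?T \<le> (\<integral>p. ?k p \<partial>lborel)" .
  have T0: "?T \<ge> 0" by (rule integral_nonneg_AE) simp
  have p_meas [measurable]: "potential_density \<beta> \<psi> \<in> borel_measurable borel"
    unfolding potential_density_def[abs_def] by measurable
  have p_nn: "potential_density \<beta> \<psi> x \<ge> 0" for x unfolding potential_density_def by (simp add: bessel_K0_nonneg)
  have pT: "(\<integral>\<^sup>+x. ennreal (potential_density \<beta> \<psi> x) \<partial>lborel) \<le> ennreal (1 / ((2 * pi)\<^sup>2 * \<beta>) * ?T)"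
  proof -
    have "(\<integral>\<^sup>+p. ennreal (norm p * (cmod (\<phi> p))\<^sup>2) \<partial>lborel) = ennreal ?T"
      by (rule nn_integral_eq_integral[OF iT]) simp
    moreover have "ennreal (1 / ((2 * pi)\<^sup>2 * \<beta>) * ?T) = ennreal (1 / ((2 * pi)\<^sup>2 * \<beta>)) * ennreal ?T"
      using b T0 by (intro ennreal_mult) auto
    ultimately show ?thesis using potential_le_kinetic[OF ft sq b] by (simp only:)
  qed
  show ip: "integrable lborel (potential_density \<beta> \<psi>)"
    by (rule integrableI_nonneg) (use pT p_nn in \<open>auto intro: le_less_trans\<close>)
  have "(\<integral>x. potential_density \<beta> \<psi> x \<partial>lborel) \<le> 1 / ((2 * pi)\<^sup>2 * \<beta>) * ?T"
    using pT nn_integral_eq_integral[OF ip] p_nn T0 b by (subst (asm) nn_integral_eq_integral[OF ip]) (simp_all add: ennreal_le_iff)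
  then have "\<gamma> * potential_form \<beta> \<psi> \<le> \<gamma> * (1 / ((2 * pi)\<^sup>2 * \<beta>) * ?T)"
    unfolding potential_form_def using g(1) by (rule mult_left_mono)
  also have "\<dots> \<le> (hbar * c * \<beta>) * (1 / ((2 * pi)\<^sup>2 * \<beta>) * ?T)"
    using g(2) T0 b by (intro mult_right_mono) auto
  also have "\<dots> = 1 / (2 * pi * hbar)\<^sup>2 * (hbar\<^sup>2 * (c * hbar * ?T))"
    using b h by (simp add: power_mult_distrib)
  also have "\<dots> \<le> kinetic_form hbar c m \<psi>"
    unfolding kinetic_form_def kin_val using lower by (intro mult_left_mono) auto
  finally show "B_FW hbar c m \<beta> \<gamma> \<psi> \<ge> 0" by (simp add: B_FW_def)
qed

theorem mainTheorem1:
  fixes hbar c m \<beta> \<gamma> :: real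
  assumes "hbar > 0" and "c > 0" and "m > 0" and "\<beta> > 0" and "\<gamma> \<ge> 0"
    and "\<gamma> \<le> gamma_crit_S hbar c \<beta>"
  shows "(\<forall>\<psi>\<in>H_half. has_fourier_transform hbar \<psi> (fourier hbar \<psi>)
            \<and> integrable lborel (kinetic_density hbar c m \<psi>)
            \<and> integrable lborel (potential_density \<beta> \<psi>))
       \<and> (\<exists>C::real. \<forall>\<psi>\<in>H_half. B_FW hbar c m \<beta> \<gamma> \<psi> \<ge> - C * L2_norm_sq \<psi>)
       \<and> (\<forall>\<psi>\<in>H_half. B_FW hbar c m \<beta> \<gamma> \<psi> \<ge> 0)"
proof -
  have g: "\<gamma> \<le> hbar * c * \<beta>" using assms(6) by (simp add: gamma_crit_S_def)
  note B = B_FW_nonneg[OF assms(1-5) g]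
  show ?thesis
  \<comment> \<open>Nonnegativity is boundedness from below with the constant 0.\<close>
  proof (intro conjI ballI exI[of _ 0])
    show "- 0 * L2_norm_sq \<psi> \<le> B_FW hbar c m \<beta> \<gamma> \<psi>" if "\<psi> \<in> H_half" for \<psi>
      using B(4)[OF that] by simp
  qed (fact B)+
qed

end
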